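(* Let $q\in L^2(0,1)$ and $c=\cos a>0$. Then, for the edges $\lambda_n^\pm$ and effective masses $\mu_n^\pm$ associated with the modified Lyapunov function $\xi$ (see context), the following hold. (1) For both signs, $$\mu_n^\pm=\mu_n^{0,\pm}+\frac{(-1)^{n+1}F_0''(\lambda_n^{0,\pm})\,\varepsilon_n^\pm}{c}+\frac{O(1)}{n^3}\qquad\text{as } n\to\infty .$$ (2) $$k'(\lambda)^2=\frac12\sum_{n\ge 0,\ \nu=\pm}\frac{\mu_n^\nu}{\lambda-\lambda_n^\nu},\qquad \lambda\ne\lambda_n^\pm,\ n\ge 0,$$ where the series converges absolutely and uniformly on compact subsets of $\mathbb{C}\setminus\{\lambda_n^\pm,\ n\ge 0\}$. (3) $$\mu_0^++\sum_{n\ge 1}(\mu_n^++\mu_n^-)=2 .$$ (4) For all $n\ge 0$ and both signs, $$\mu_{2n}^\pm=2\sum_{m\ge 1,\ s=\pm}\frac{1}{\lambda_{2m-1}^s-\lambda_{2n}^\pm},\qquad \mu_{2n+1}^\pm=2\sum_{m\ge 0,\ s=\pm}\frac{1}{\lambda_{2m}^s-\lambda_{2n+1}^\pm}.$$ For index $0$ only the sign $+$ occurs (there is no $\lambda_0^-$ or $\mu_0^-$; the corresponding terms are omitted in all formulas).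
   Context: Fix $a\in\mathbb{R}$ with $c=\cos a>0$, put $s=\sin a$, and let $q\in L^2(0,1)$ be real-valued, $q_0=\int_0^1q(t)\,dt$. Let $\vartheta(x,\lambda),\varphi(x,\lambda)$ be the solutions of $-y''+q(x)y=\lambda y$ on $[0,1]$ with $\vartheta(0,\lambda)=\varphi'(0,\lambda)=1$, $\vartheta'(0,\lambda)=\varphi(0,\lambda)=0$. Put $$\Delta(\lambda)=\tfrac12(\varphi'(1,\lambda)+\vartheta(1,\lambda)),\quad \Delta_-(\lambda)=\tfrac12(\varphi'(1,\lambda)-\vartheta(1,\lambda)),\quad F=\frac{9\Delta^2-\Delta_-^2-5}{4},\quad \xi=\frac{F+s^2}{c}.$$ These are entire functions of $\lambda$; $\xi$ is the modified Lyapunov function. It is known that all zeros of $\xi^2-1$ are real; counted with multiplicity they are labelled $\lambda_0^+<\lambda_1^-\le\lambda_1^+<\lambda_2^-\le\lambda_2^+<\dots$, and $\xi(\lambda_n^\pm)=(-1)^n$. The gaps are $\gamma_n=(\lambda_n^-,\lambda_n^+)$, $n\ge1$. Quasimomentum: $k$ is the analytic function on $\mathbb{C}_+$ defined by $\xi(\lambda)=\cos k(\lambda)$. The function $k'(\lambda)^2=\xi'(\lambda)^2/(1-\xi(\lambda)^2)$ does not depend on the branch and is understood as a meromorphic function on $\mathbb{C}$. Effective masses: for $\lambda_0^+$, and for each $\lambda_n^\pm$ with $n\ge 1$ and $\gamma_n\neq\emptyset$, the effective mass $\mu_n^\pm$ is defined by $$\lambda=\lambda_n^\pm+\frac{(k(\lambda)-\pi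 n)^2}{2\mu_n^\pm}(1+o(1))\quad\text{as }\lambda\to\lambda_n^\pm,$$ where a branch of $k$ with $k(\lambda)\to\pi n$ as $\lambda\to\lambda_n^\pm$ is taken. If $|\gamma_n|=0$, then $\mu_n^\pm=0$. Unperturbed quantities: the superscript $0$ denotes the case $q=0$ (same $a$). Then $F=F_0$ with $F_0(\lambda)=\frac{9\cos 2\sqrt\lambda-1}{8}$, the edges are given by $$\sqrt{\lambda_0^{0,+}}=\phi_0,\quad \sqrt{\lambda_{2n}^{0,\pm}}=\pi n\pm\phi_0\ (n\ge1),\quad \cos2\phi_0=\tfrac89\left(c^2+c-\tfrac78\right),\ \phi_0\in[0,\tfrac{\pi}{2}],$$ $$\sqrt{\lambda_{2n+1}^{0,\pm}}=\pi(n+\tfrac12)\pm\phi_1\ (n\ge0),\quad -\cos2\phi_1=\tfrac89\left(c^2-c-\tfrac78\right),\ \phi_1\in[0,\tfrac{\pi}{2}],$$ and the effective masses are $\mu_0^{0,+}=\frac{9}{8c}\frac{\sin2\phi_0}{\phi_0}$ (interpreted as $\frac{9}{4c}$ if $\phi_0=0$), $\mu_{2n}^{0,\pm}=\pm\frac{9}{8c}\frac{\sin2\phi_0}{\sqrt{\lambda_{2n}^{0,\pm}}}$, $\mu_{2n-1}^{0,\pm}=\pm\frac{9}{8c}\frac{\sin2\phi_1}{\sqrt{\lambda_{2n-1}^{0,\pm}}}$ for $n\ge1$. The numbers $\varepsilon_n^\pm$ are defined by $\lambda_n^\pm=\lambda_n^{0,\pm}+q_0+\varepsilon_n^\pm$.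 *)

theory Defs
  imports
    "HOL-Complex_Analysis.Complex_Analysis"
    "HOL-Library.Landau_Symbols"
begin

definition L2_unit :: "(real \<Rightarrow> real) \<Rightarrow> bool" where
  "L2_unit q \<longleftrightarrow> q \<in> borel_measurable (lebesgue_on {0<..<1})
     \<and> integrable (lebesgue_on {0<..<1}) (\<lambda>t. (q t)\<^sup>2)"

definition mean :: "(real \<Rightarrow> real) \<Rightarrow> real" where
  "mean q = integral\<^sup>L (lebesgue_on {0<..<1}) q"

text \<open>Since \<open>q\<close> is only square integrable, \<open>-y'' + q y = \<lambda> y\<close> is meant in the sense of
  Caratheodory: \<open>y'\<close> exists everywhere, is absolutely continuous, and the equation holds almost
  everywhere. This is expressed by the integrated equation for \<open>dy = y'\<close>. (As \<open>y\<close> is continuous,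
  \<open>(q - \<lambda>) y\<close> is Lebesgue integrable, so the gauge integral below is the Lebesgue integral.)\<close>

definition schroedinger_solution ::
  "(real \<Rightarrow> real) \<Rightarrow> complex \<Rightarrow> (real \<Rightarrow> complex) \<Rightarrow> (real \<Rightarrow> complex) \<Rightarrow> bool" where
  "schroedinger_solution q l y dy \<longleftrightarrow>
     (\<forall>x\<in>{0..1}. (y has_vector_derivative dy x) (at x within {0..1})) \<and>
     (\<forall>x\<in>{0..1}. ((\<lambda>t. (of_real (q t) - l) * y t) has_integral (dy x - dy 0)) {0..x})"

text \<open>The pair \<open>(y x, y' x)\<close>, for \<open>x \<in> [0,1]\<close>, of the solution with \<open>y 0 = u\<close>, \<open>y' 0 = v\<close>.\<close>

definition cauchy_data ::
  "(real \<Rightarrow> real) \<Rightarrow> complex \<Rightarrow> complex \<Rightarrow> complex \<Rightarrow> real \<Rightarrow> complex \<times> complex" where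
  "cauchy_data q l u v x =
     (THE p. \<exists>y dy. schroedinger_solution q l y dy \<and> y 0 = u \<and> dy 0 = v \<and> p = (y x, dy x))"

definition vartheta :: "(real \<Rightarrow> real) \<Rightarrow> real \<Rightarrow> complex \<Rightarrow> complex" where
  "vartheta q x l = fst (cauchy_data q l 1 0 x)"

definition varphi' :: "(real \<Rightarrow> real) \<Rightarrow> real \<Rightarrow> complex \<Rightarrow> complex" where
  "varphi' q x l = snd (cauchy_data q l 0 1 x)"

definition Delta :: "(real \<Rightarrow> real) \<Rightarrow> complex \<Rightarrow> complex" where
  "Delta q l = (varphi' q 1 l + vartheta q 1 l) / 2"

definition Delta_minus :: "(real \<Rightarrow> real) \<Rightarrow> complex \<Rightarrow> complex" where
  "Delta_minus q l = (varphi' q 1 l - vartheta q 1 l) / 2"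

definition F :: "(real \<Rightarrow> real) \<Rightarrow> complex \<Rightarrow> complex" where
  "F q l = (9 * (Delta q l)\<^sup>2 - (Delta_minus q l)\<^sup>2 - 5) / 4"

definition xi :: "real \<Rightarrow> (real \<Rightarrow> real) \<Rightarrow> complex \<Rightarrow> complex" where
  "xi a q l = (F q l + of_real ((sin a)\<^sup>2)) / of_real (cos a)"

datatype edge_sign = Minus | Plus

text \<open>There is no edge \<open>\<lambda>\<^sub>0\<^sup>-\<close>; values of sequences at \<open>(0, Minus)\<close> are never used.\<close>

definition edge_index :: "(nat \<times> edge_sign) set" where
  "edge_index = {(n, \<nu>). n = 0 \<longrightarrow> \<nu> = Plus}"

text \<open>\<open>lam\<close> is the increasing labelling of all zeros of \<open>\<xi>\<^sup>2 - 1\<close>, each repeated according to its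
  multiplicity. By the third clause all these zeros are real.\<close>

definition edge_labelling ::
  "real \<Rightarrow> (real \<Rightarrow> real) \<Rightarrow> (nat \<Rightarrow> edge_sign \<Rightarrow> real) \<Rightarrow> bool" where
  "edge_labelling a q lam \<longleftrightarrow>
     (\<forall>n. lam n Plus < lam (Suc n) Minus \<and> lam (Suc n) Minus \<le> lam (Suc n) Plus) \<and>
     (\<forall>(n, \<nu>)\<in>edge_index. xi a q (of_real (lam n \<nu>)) = (-1) ^ n) \<and>
     (\<forall>z. (xi a q z)\<^sup>2 - 1 = 0 \<longrightarrow>
        (\<exists>(n, \<nu>)\<in>edge_index. z = of_real (lam n \<nu>)) \<and>
        zorder (\<lambda>w. (xi a q w)\<^sup>2 - 1) z =
          int (card {(n, \<nu>). (n, \<nu>) \<in> edge_index \<and> of_real (lam n \<nu>) = z}))"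

definition edge_set :: "(nat \<Rightarrow> edge_sign \<Rightarrow> real) \<Rightarrow> complex set" where
  "edge_set lam = {of_real (lam n \<nu>) | n \<nu>. (n, \<nu>) \<in> edge_index}"

abbreviation upper_half_plane :: "complex set" where
  "upper_half_plane \<equiv> {z. Im z > 0}"

text \<open>The branches of the quasimomentum; they differ by sign and by multiples of \<open>2\<pi>\<close>.\<close>

definition quasimomentum :: "real \<Rightarrow> (real \<Rightarrow> real) \<Rightarrow> (complex \<Rightarrow> complex) \<Rightarrow> bool" where
  "quasimomentum a q k \<longleftrightarrow>
     k holomorphic_on upper_half_plane \<and> (\<forall>z\<in>upper_half_plane. xi a q z = cos (k z))"

definition quasimomentum_deriv_sq :: "real \<Rightarrow> (real \<Rightarrow> real) \<Rightarrow> complex \<Rightarrow> complex" where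
  "quasimomentum_deriv_sq a q z = (deriv (xi a q) z)\<^sup>2 / (1 - (xi a q z)\<^sup>2)"

lemma quasimomentum_deriv_sq:
  assumes k: "quasimomentum a q k" and z: "Im z > 0" and nz: "(xi a q z)\<^sup>2 \<noteq> 1"
  shows "(deriv k z)\<^sup>2 = quasimomentum_deriv_sq a q z"
proof -
  have op: "open upper_half_plane"
    by (rule open_halfspace_Im_gt)
  have "(k has_field_derivative deriv k z) (at z)"
    using k z op unfolding quasimomentum_def by (auto intro: holomorphic_derivI)
  then have "((\<lambda>w. cos (k w)) has_field_derivative (- sin (k z) * deriv k z)) (at z)"
    by (auto intro!: derivative_eq_intros)
  then have "(xi a q has_field_derivative (- sin (k z) * deriv k z)) (at z)"
    by (rule has_field_derivative_transform_within_open[OF _ op]) (use k z in \<open>auto simp: quasimomentum_def\<close>)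
  then have d: "deriv (xi a q) z = - sin (k z) * deriv k z"
    by (rule DERIV_imp_deriv)
  have x: "xi a q z = cos (k z)"
    using k z by (auto simp: quasimomentum_def)
  have s: "1 - (cos (k z))\<^sup>2 = (sin (k z))\<^sup>2"
    using sin_cos_squared_add[of "k z"] by (simp add: algebra_simps)
  with nz x have "sin (k z) \<noteq> 0" by auto
  then show ?thesis
    unfolding quasimomentum_deriv_sq_def d x s by (simp add: power_mult_distrib)
qed

text \<open>\<open>\<lambda> = e + (k(\<lambda>) - \<pi>n)\<^sup>2 / (2\<mu>) (1 + o(1))\<close> as \<open>\<lambda> \<rightarrow> e\<close>, for a branch \<open>k\<close> of the quasimomentum
  with \<open>k(\<lambda>) \<rightarrow> \<pi>n\<close>. As \<open>k\<close> lives on the upper half-plane, the limits are taken from there.\<close>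

definition is_effective_mass ::
  "real \<Rightarrow> (real \<Rightarrow> real) \<Rightarrow> nat \<Rightarrow> real \<Rightarrow> real \<Rightarrow> bool" where
  "is_effective_mass a q n e \<mu> \<longleftrightarrow> \<mu> \<noteq> 0 \<and>
     (\<exists>k r. quasimomentum a q k \<and>
        (k \<longlongrightarrow> of_real (pi * n)) (at (of_real e) within upper_half_plane) \<and>
        (r \<longlongrightarrow> 0) (at (of_real e) within upper_half_plane) \<and>
        (\<forall>\<^sub>F z in at (of_real e) within upper_half_plane.
           z = of_real e + (k z - of_real (pi * n))\<^sup>2 / of_real (2 * \<mu>) * (1 + r z)))"

definition effective_mass ::
  "real \<Rightarrow> (real \<Rightarrow> real) \<Rightarrow> (nat \<Rightarrow> edge_sign \<Rightarrow> real) \<Rightarrow> nat \<Rightarrow> edge_sign \<Rightarrow> real" where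
  "effective_mass a q lam n \<nu> =
     (if n \<ge> 1 \<and> lam n Minus = lam n Plus then 0
      else (THE \<mu>. is_effective_mass a q n (lam n \<nu>) \<mu>))"

text \<open>The unperturbed \<open>F\<^sub>0\<close> is \<open>F\<close> for the zero potential.\<close>

abbreviation F0 :: "complex \<Rightarrow> complex" where
  "F0 \<equiv> F (\<lambda>_. 0)"

lemma cauchy_data_zero_potential:
  fixes w :: complex
  defines "S \<equiv> \<lambda>x. if w = 0 then of_real x else sin (w * of_real x) / w"
  defines "C \<equiv> \<lambda>x. cos (w * of_real x)"
  assumes x: "x \<in> {0..1}"
  shows "cauchy_data (\<lambda>_. 0) (w\<^sup>2) u v x = (u * C x + v * S x, v * C x - w\<^sup>2 * u * S x)"
proof -
  have S': "(S has_vector_derivative C t) (at t within X)" for t X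
    by (cases "w = 0") (auto simp: S_def C_def intro!: derivative_eq_intros
      has_vector_derivative_real_field[of "\<lambda>z. sin (w * z) / w"]
      has_vector_derivative_real_field[of "\<lambda>z. z"])
  have C': "(C has_vector_derivative (- w\<^sup>2 * S t)) (at t within X)" for t X
    by (cases "w = 0") (auto simp: S_def C_def power2_eq_square intro!: derivative_eq_intros
      has_vector_derivative_real_field[of "\<lambda>z. cos (w * z)"])
  have SC: "C t * C t + w\<^sup>2 * (S t * S t) = 1" for t
    unfolding S_def C_def using sin_cos_squared_add[of "w * of_real t"]
    by (auto simp: power2_eq_square field_simps)
  have C0: "C 0 = 1" and S0: "S 0 = 0" by (auto simp: S_def C_def)
  let ?y = "\<lambda>t. u * C t + v * S t" and ?dy = "\<lambda>t. v * C t - w\<^sup>2 * u * S t"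
  have y: "(?y has_vector_derivative ?dy t) (at t within X)" for t X
    by (rule has_vector_derivative_eq_rhs, rule derivative_intros,
        rule has_vector_derivative_mult_right, rule C',
        rule has_vector_derivative_mult_right, rule S') (simp add: algebra_simps)
  have dy: "(?dy has_vector_derivative (- w\<^sup>2) * ?y t) (at t within X)" for t X
    by (rule has_vector_derivative_eq_rhs, rule derivative_intros,
        rule has_vector_derivative_mult_right, rule C',
        rule has_vector_derivative_mult_right, rule S') (simp add: algebra_simps)
  have sol: "schroedinger_solution (\<lambda>_. 0) (w\<^sup>2) ?y ?dy"
    unfolding schroedinger_solution_def
    using y dy fundamental_theorem_of_calculus[of 0 _ ?dy "\<lambda>t. (- w\<^sup>2) * ?y t"] by auto
  have uniq: "y x = ?y x \<and> dy x = ?dy x"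
    if s: "schroedinger_solution (\<lambda>_. 0) (w\<^sup>2) y dy" and i: "y 0 = u" "dy 0 = v" for y dy
  proof -
    have dY: "(y has_vector_derivative dy t) (at t within {0..1})" if "t \<in> {0..1}" for t
      using s that unfolding schroedinger_solution_def by blast
    have int: "((\<lambda>t. - w\<^sup>2 * y t) has_integral dy t - dy 0) {0..t}" if "t \<in> {0..1}" for t
      using s that unfolding schroedinger_solution_def by auto
    have cont: "continuous_on {0..1} (\<lambda>t. - w\<^sup>2 * y t)"
      using dY by (intro continuous_intros)
        (meson continuous_on_eq_continuous_within has_vector_derivative_continuous)
    have dDY: "(dy has_vector_derivative - w\<^sup>2 * y t) (at t within {0..1})" if t: "t \<in> {0..1}" for t
    proof -
      have "((\<lambda>t. dy 0 + integral {0..t} (\<lambda>t. - w\<^sup>2 * y t)) has_vector_derivative - w\<^sup>2 * y t)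
              (at t within {0..1})"
        using has_vector_derivative_add[OF has_vector_derivative_const[of "dy 0"]
            integral_has_vector_derivative[OF cont t]]
        by simp
      moreover have eq: "dy t = dy 0 + integral {0..t} (\<lambda>t. - w\<^sup>2 * y t)" if "t \<in> {0..1}" for t
        by (subst integral_unique[OF int[OF that]]) algebra
      ultimately show ?thesis
        by - (rule has_vector_derivative_transform[OF t _ _], erule eq)
    qed
    have P: "y x * C x - dy x * S x = y 0 * C 0 - dy 0 * S 0"
    proof -
      have "((\<lambda>t. y t * C t - dy t * S t) has_vector_derivative 0) (at t within {0..1})"
        if t: "t \<in> {0..1}" for t
        by (rule has_vector_derivative_eq_rhs, rule has_vector_derivative_diff,
            rule has_vector_derivative_mult, rule dY[OF t], rule C',
            rule has_vector_derivative_mult, rule dDY[OF t], rule S')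
          (simp add: algebra_simps)
      then obtain c where "\<And>t. t \<in> {0..1} \<Longrightarrow> y t * C t - dy t * S t = c"
        using has_vector_derivative_zero_constant[of "{0..1::real}" "\<lambda>t. y t * C t - dy t * S t"]
        by auto
      then show ?thesis using x by simp
    qed
    have Q: "w\<^sup>2 * (y x * S x) + dy x * C x = w\<^sup>2 * (y 0 * S 0) + dy 0 * C 0"
    proof -
      have "((\<lambda>t. w\<^sup>2 * (y t * S t) + dy t * C t) has_vector_derivative 0) (at t within {0..1})"
        if t: "t \<in> {0..1}" for t
        by (rule has_vector_derivative_eq_rhs, rule has_vector_derivative_add,
            rule has_vector_derivative_mult_right,
            rule has_vector_derivative_mult, rule dY[OF t], rule S',
            rule has_vector_derivative_mult, rule dDY[OF t], rule C')
          (simp add: algebra_simps)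
      then obtain c where "\<And>t. t \<in> {0..1} \<Longrightarrow> w\<^sup>2 * (y t * S t) + dy t * C t = c"
        using has_vector_derivative_zero_constant
          [of "{0..1::real}" "\<lambda>t. w\<^sup>2 * (y t * S t) + dy t * C t"]
        by auto
      then show ?thesis using x by simp
    qed
    have "y x = y x * (C x * C x + w\<^sup>2 * (S x * S x))" and
         "dy x = dy x * (C x * C x + w\<^sup>2 * (S x * S x))"
      by (simp_all add: SC)
    moreover have "y x * (C x * C x + w\<^sup>2 * (S x * S x)) =
        (y x * C x - dy x * S x) * C x + (w\<^sup>2 * (y x * S x) + dy x * C x) * S x"
      "dy x * (C x * C x + w\<^sup>2 * (S x * S x)) =
        (w\<^sup>2 * (y x * S x) + dy x * C x) * C x - w\<^sup>2 * (y x * C x - dy x * S x) * S x"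
      by algebra+
    ultimately show ?thesis
      unfolding P Q using i C0 S0 by simp
  qed
  show ?thesis
    unfolding cauchy_data_def
  proof (rule the_equality)
    show "\<exists>y dy. schroedinger_solution (\<lambda>_. 0) (w\<^sup>2) y dy \<and> y 0 = u \<and> dy 0 = v \<and>
        (u * C x + v * S x, v * C x - w\<^sup>2 * u * S x) = (y x, dy x)"
      by (intro exI[of _ ?y] exI[of _ ?dy] conjI sol) (simp_all add: C0 S0)
    show "p = (u * C x + v * S x, v * C x - w\<^sup>2 * u * S x)"
      if "\<exists>y dy. schroedinger_solution (\<lambda>_. 0) (w\<^sup>2) y dy \<and> y 0 = u \<and> dy 0 = v \<and>
        p = (y x, dy x)" for p
      using that uniq by blast
  qed
qed

lemma F0_eq: "F0 l = (9 * cos (2 * csqrt l) - 1) / 8"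
proof -
  have "cauchy_data (\<lambda>_. 0) l u v 1 =
     (u * cos (csqrt l) + v * (if csqrt l = 0 then 1 else sin (csqrt l) / csqrt l),
      v * cos (csqrt l) - l * u * (if csqrt l = 0 then 1 else sin (csqrt l) / csqrt l))" for u v
    using cauchy_data_zero_potential[of 1 "csqrt l" u v] by simp
  then have "F0 l = (9 * (cos (csqrt l))\<^sup>2 - 5) / 4"
    by (simp add: F_def Delta_def Delta_minus_def vartheta_def varphi'_def)
  then show ?thesis
    by (simp only: cos_double_cos) (simp add: field_simps)
qed

end

theory Submission
  imports Defs
begin

text \<open>
  Write \<open>X\<close> for the function \<open>\<xi>\<close> shifted by the mean of \<open>q\<close>. The Volterra equation for the fundamental
  solutions shows that \<open>X\<close> is entire, real on the real axis, and differs from the unperturbed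
  \<open>X\<^sub>0 = A cos 2\<surd>z + B\<close> by \<open>O(exp (2 |Im \<surd>z|) / |z|)\<close>. On the circles \<open>|z| = (R N)\<^sup>2\<close>, chosen such that
  \<open>X\<^sub>0 ((R N)\<^sup>2) = 0\<close>, both \<open>X - 1\<close> and \<open>X + 1\<close> are bounded below by a multiple of \<open>exp (2 |Im \<surd>z|)\<close>,
  so Rouche's theorem locates the edges, and \<open>\<epsilon>\<^sub>n\<close> stays bounded.

  Near a simple edge \<open>e\<close>, \<open>1 - (-1)\<^sup>n \<xi> = 1 - cos (k - \<pi>n)\<close> is asymptotic both to \<open>(k - \<pi>n)\<^sup>2 / 2\<close> and
  to a multiple of \<open>z - e\<close>, so the effective mass is \<open>(-1)\<^sup>n\<^sup>+\<^sup>1 \<xi>'(e)\<close>; at a double edge both sides vanish.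
  Part (1) is then a Taylor expansion of \<open>X\<^sub>0'\<close> together with Cauchy estimates for \<open>X - X\<^sub>0\<close>. Parts (2)
  and (4) are residue expansions of \<open>X'\<^sup>2 / (1 - X\<^sup>2)\<close> and \<open>X' / (X \<plusminus> 1)\<close> over these circles, and (3) holds
  because \<open>z X'\<^sup>2 / (1 - X\<^sup>2)\<close> tends to \<open>1\<close> on the circles away from the positive real axis.
\<close>

section \<open>The fundamental solutions for a square integrable potential\<close>

text \<open>The bookkeeping is in powers of |sqrt z|. Subtracting the mean of \<open>q\<close>
  removes the term of order 1 / |sqrt z| from X - X_0; a Cauchy estimate on a disc of radius |sqrt
  z|, over which exp (2 |Im sqrt z|) changes by a constant factor only, then gains one power per
  derivative. So X' - X_0' and X_0''' are both O(n^(-3)) at the edges, and (1) requires only that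
  the shifts be bounded. The delicate case is a closed gap of the model, possible when 1 + |B| = A:
  an error of order n^(-2) in X_0 then locates the root of an edge only up to O(1/n), which is just
  enough. On the circles the exponentials cancel from X'^2 / (1 - X^2) and from X' / (X +- 1), so
  these are at most of order 1 / R N on the whole circle; only (3) has to treat the part near the
  positive axis separately. Multiplicities are never split into cases: residues are taken of H g'/g
  with g = X^2 - 1, where the order of a zero is the number of labels sitting there, and at a double
  edge X' vanishes.\<close>

lemma absolutely_integrable_continuous_mult:
  fixes f g :: "real \<Rightarrow> complex"
  assumes "continuous_on {0..1} f" and "g absolutely_integrable_on {0..1}"
  shows "(\<lambda>t. f t * g t) absolutely_integrable_on {0..1}"
  by (rule absolutely_integrable_bounded_measurable_product)
    (use assms in \<open>auto intro: bilinear_times continuous_imp_measurable_on_sets_lebesgue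
      compact_imp_bounded compact_continuous_image\<close>)

lemma integrable_on_initial:
  fixes g :: "real \<Rightarrow> 'a::euclidean_space"
  assumes "g absolutely_integrable_on {0..1}" "x \<in> {0..1}"
  shows "g absolutely_integrable_on {0..x}" "g integrable_on {0..x}"
    "(\<lambda>t. norm (g t)) integrable_on {0..x}"
proof -
  show "g absolutely_integrable_on {0..x}"
    using assms by (auto intro: absolutely_integrable_on_subinterval)
  then show "g integrable_on {0..x}" "(\<lambda>t. norm (g t)) integrable_on {0..x}"
    by (auto simp: absolutely_integrable_on_def)
qed

lemma integrable_on_interior:
  fixes g :: "real \<Rightarrow> 'a::euclidean_space"
  assumes "g absolutely_integrable_on {0..1}" "0 \<le> a" "b \<le> 1"
  shows "g integrable_on {a..b}" "(\<lambda>t. norm (g t)) integrable_on {a..b}"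
proof -
  have "g absolutely_integrable_on {a..b}"
    using assms by (auto intro: absolutely_integrable_on_subinterval)
  then show "g integrable_on {a..b}" "(\<lambda>t. norm (g t)) integrable_on {a..b}"
    by (auto simp: absolutely_integrable_on_def)
qed

lemma integral_norm_le:
  fixes g :: "real \<Rightarrow> complex"
  assumes "g absolutely_integrable_on {0..1}" "x \<in> {0..1}"
    and "h integrable_on {0..x}" "\<And>t. t \<in> {0..x} \<Longrightarrow> norm (g t) \<le> h t"
  shows "norm (integral {0..x} g) \<le> integral {0..x} h"
  by (rule Henstock_Kurzweil_Integration.integral_norm_bound_integral) (use assms
    integrable_on_initial[OF assms(1,2)] in auto)

lemma continuous_indefinite:
  fixes g :: "real \<Rightarrow> complex"
  assumes "g absolutely_integrable_on {0..1}"
  shows "continuous_on {0..1} (\<lambda>x. integral {0..x} g)"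
  using assms integrable_on_interior[of g 0 1] by (intro indefinite_integral_continuous_1) auto

text \<open>Integration by parts when one factor is only absolutely continuous. The difference of the two
  sides is shown to have derivative \<open>0\<close> everywhere: its increment over \<open>[a,b]\<close> is at most a multiple
  of \<open>(b - a) \<integral>\<^sub>a\<^sup>b |g|\<close>, up to a classically differentiable part.\<close>

lemma integral_by_parts_indefinite:
  fixes g K K' :: "real \<Rightarrow> complex"
  assumes g: "g absolutely_integrable_on {0..1}"
    and K: "\<And>t. t \<in> {0..1} \<Longrightarrow> (K has_vector_derivative K' t) (at t within {0..1})"
    and K': "continuous_on {0..1} K'"
    and x: "x \<in> {0..1}"
  shows "integral {0..x} (\<lambda>t. K t * g t) =
    K x * integral {0..x} g - integral {0..x} (\<lambda>t. K' t * integral {0..t} g)"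
proof -
  define G where "G = (\<lambda>t. integral {0..t} g)"
  define \<Phi> where "\<Phi> = (\<lambda>t. integral {0..t} (\<lambda>s. norm (g s)))"
  define J where "J = (\<lambda>t. integral {0..t} (\<lambda>t. K' t * G t))"
  define H where "H = (\<lambda>t. K t * G t - integral {0..t} (\<lambda>t. K t * g t) - J t)"
  have contK: "continuous_on {0..1} K"
    using K by (meson continuous_on_eq_continuous_within has_vector_derivative_continuous)
  have Kg: "(\<lambda>t. K t * g t) absolutely_integrable_on {0..1}"
    by (rule absolutely_integrable_continuous_mult[OF contK g])
  have contG: "continuous_on {0..1} G"
    unfolding G_def by (rule continuous_indefinite[OF g])
  have cont\<Phi>: "continuous_on {0..1} \<Phi>"
    unfolding \<Phi>_def using integrable_on_interior[OF g, of 0 1]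
    by (intro indefinite_integral_continuous_1) auto
  obtain L where L: "\<And>t. t \<in> {0..1} \<Longrightarrow> norm (K' t) \<le> L"
    using compact_imp_bounded[OF compact_continuous_image[OF K' compact_Icc]] unfolding bounded_iff by blast
  have L0: "L \<ge> 0" using L[of 0] norm_ge_zero[of "K' 0"] by (simp del: norm_ge_zero)
  have Lip: "norm (K b - K a) \<le> L * \<bar>b - a\<bar>" if "a \<in> {0..1}" "b \<in> {0..1}" for a b
    using differentiable_bound[of "{0..1}" K "\<lambda>t h. h *\<^sub>R K' t" L b a] K L that
    by (auto simp: has_vector_derivative_def onorm_scaleR_left onorm_id)
  \<comment> \<open>Both endpoints are allowed for \<open>c\<close>, because the point of
    differentiation is the left end of a right increment and the right end of a left one.\<close>
  have step: "norm ((K b * G b - integral {0..b} (\<lambda>t. K t * g t)) -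
       (K a * G a - integral {0..a} (\<lambda>t. K t * g t)) - (K b - K a) * G c)
      \<le> L * (b - a) * (\<Phi> b - \<Phi> a)" if ab: "0 \<le> a" "a \<le> b" "b \<le> 1" and c: "c = a \<or> c = b" for a b c
  proof -
    have e1: "G b = G a + integral {a..b} g"
      unfolding G_def using Henstock_Kurzweil_Integration.integral_combine[of 0 a b g] ab
        integrable_on_interior[OF g, of 0 b] by simp
    have e2: "integral {0..b} (\<lambda>t. K t * g t) = integral {0..a} (\<lambda>t. K t * g t)
      + integral {a..b} (\<lambda>t. K t * g t)"
      using Henstock_Kurzweil_Integration.integral_combine[of 0 a b "\<lambda>t. K t
        * g t"] ab integrable_on_interior[OF Kg, of 0 b] by simp
    have e3: "\<Phi> b = \<Phi> a + integral {a..b} (\<lambda>t. norm (g t))"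
      unfolding \<Phi>_def using Henstock_Kurzweil_Integration.integral_combine[of 0 a b "\<lambda>t. norm (g t)"] ab
        integrable_on_interior[OF g, of 0 b] by simp
    \<comment> \<open>With \<open>d\<close> the endpoint other than \<open>c\<close>, the boundary
      terms collapse to \<open>K d\<close> times the increment of \<open>G\<close>.\<close>
    define d where "d = (if c = a then b else a)"
    have ig: "g integrable_on {a..b}" "(\<lambda>t. norm (g t)) integrable_on {a..b}" "(\<lambda>t. K t
      * g t) integrable_on {a..b}"
      using integrable_on_interior[OF g, of a b] integrable_on_interior[OF Kg, of a b] ab by auto
    have "(K b * G b - integral {0..b} (\<lambda>t. K t * g t)) -
       (K a * G a - integral {0..a} (\<lambda>t. K t * g t)) - (K b - K a) * G c
      = K d * integral {a..b} g - integral {a..b} (\<lambda>t. K t * g t)"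
      using c unfolding e1 e2 d_def by (auto simp: algebra_simps e1)
    also have "\<dots> = integral {a..b} (\<lambda>t. (K d - K t) * g t)"
      unfolding left_diff_distrib
      by (subst Henstock_Kurzweil_Integration.integral_diff[OF integrable_on_mult_right[OF ig(1)] ig(3)]) simp
    also have "norm \<dots> \<le> integral {a..b} (\<lambda>t. L * (b - a) * norm (g t))"
    proof (rule Henstock_Kurzweil_Integration.integral_norm_bound_integral)
      show "(\<lambda>t. (K d - K t) * g t) integrable_on {a..b}"
        unfolding left_diff_distrib by (intro integrable_diff integrable_on_mult_right ig)
      show "(\<lambda>t. L * (b - a) * norm (g t)) integrable_on {a..b}" by (intro integrable_on_mult_right ig)
      show "norm ((K d - K t) * g t) \<le> L * (b - a) * norm (g t)" if t: "t \<in> {a..b}" for t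
      proof -
        have "norm (K d - K t) \<le> L * \<bar>d - t\<bar>" using Lip[of t d] ab c t by (auto simp: d_def)
        also have "\<dots> \<le> L * (b - a)" using L0 t ab c by (intro mult_left_mono) (auto simp: d_def)
        finally show ?thesis by (simp add: norm_mult mult_right_mono)
      qed
    qed
    also have "\<dots> = L * (b - a) * (\<Phi> b - \<Phi> a)" unfolding e3 by simp
    finally show ?thesis .
  qed
  have "(H has_vector_derivative 0) (at c within {0..1})" if c: "c \<in> {0..1}" for c
  proof -
    define M where "M = (\<lambda>t. (K t * G t - integral {0..t} (\<lambda>t. K t * g t)) - (K t - K c) * G c)"
    have "(M has_vector_derivative 0) (at c within {0..1})"
      unfolding has_vector_derivative_def has_derivative_within_alt2
    proof (intro conjI allI impI)
      fix e :: real assume e: "e > 0"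
      have "(\<Phi> \<longlongrightarrow> \<Phi> c) (at c within {0..1})" using cont\<Phi> c by (auto simp: continuous_on)
      then have "((\<lambda>t. L * \<bar>\<Phi> t - \<Phi> c\<bar>) \<longlongrightarrow> L * \<bar>\<Phi> c - \<Phi> c\<bar>) (at c within {0..1})"
        by (intro tendsto_intros)
      then have "\<forall>\<^sub>F t in at c within {0..1}. L * \<bar>\<Phi> t - \<Phi> c\<bar> < e"
        using e by (intro order_tendstoD(2)) auto
      moreover have "\<forall>\<^sub>F t in at c within {0..1}. t \<in> {0..1}"
        by (simp add: eventually_at_filter)
      ultimately show "\<forall>\<^sub>F y in at c within {0..1}. norm (M y - M c - (y - c) *\<^sub>R 0) \<le> e * norm (y - c)"
      proof eventually_elim
        case (elim y)
        have "norm (M y - M c) \<le> L * \<bar>y - c\<bar> * \<bar>\<Phi> y - \<Phi> c\<bar>"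
        proof (cases "c \<le> y")
          case True
          then have "norm (M y - M c) \<le> L * (y - c) * (\<Phi> y - \<Phi> c)"
            using step[of c y c] c elim by (auto simp: M_def algebra_simps)
          also have "\<dots> \<le> L * (y - c) * \<bar>\<Phi> y - \<Phi> c\<bar>" using True L0 by (intro mult_left_mono) auto
          finally show ?thesis using True by simp
        next
          case False
          then have "norm (M c - M y) \<le> L * (c - y) * (\<Phi> c - \<Phi> y)"
            using step[of y c c] c elim by (auto simp: M_def algebra_simps)
          also have "\<dots> \<le> L * (c - y) * \<bar>\<Phi> y - \<Phi> c\<bar>" using False L0 by (intro mult_left_mono) auto
          finally show ?thesis using False by (simp add: norm_minus_commute)
        qed
        also have "\<dots> = (L * \<bar>\<Phi> y - \<Phi> c\<bar>) * \<bar>y - c\<bar>" by simp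
        also have "\<dots> \<le> e * \<bar>y - c\<bar>" using elim by (intro mult_right_mono) auto
        finally show ?case by simp
      qed
    qed (auto intro: bounded_linear_zero)
    moreover have "((\<lambda>t. (K t - K c) * G c) has_vector_derivative K' c * G c) (at c within {0..1})"
      by (rule has_vector_derivative_eq_rhs, rule has_vector_derivative_mult_left,
          rule has_vector_derivative_diff, rule K[OF c], rule has_vector_derivative_const) auto
    moreover have "(J has_vector_derivative K' c * G c) (at c within {0..1})"
      unfolding J_def by (rule integral_has_vector_derivative) (use K' contG c in \<open>auto intro!:
        continuous_intros\<close>)
    ultimately have "((\<lambda>t. M t + (K t - K c) * G c - J t) has_vector_derivative 0 + K' c * G c - K' c
      * G c) (at c within {0..1})"
      by (intro has_vector_derivative_diff has_vector_derivative_add)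
    then show ?thesis by (simp add: M_def H_def)
  qed
  then obtain C where C: "\<And>t. t \<in> {0..1} \<Longrightarrow> H t = C"
    using has_vector_derivative_zero_constant[of "{0..1::real}" H] by auto
  have "H 0 = 0" by (simp add: H_def G_def J_def)
  with C[of 0] C[OF x] have "H x = 0" by simp
  then show ?thesis by (simp add: H_def G_def J_def algebra_simps)
qed

section \<open>Picard iteration in a weighted sup norm\<close>

locale potential =
  fixes p :: "real \<Rightarrow> real"
  assumes abs_int: "p absolutely_integrable_on {0..1}"
    and sq_int: "(\<lambda>t. (p t)\<^sup>2) integrable_on {0..1}"
begin

definition V :: "complex \<Rightarrow> real \<Rightarrow> complex" where
  "V l t = of_real (p t) - l"

lemma complex_potential: "(\<lambda>t. of_real (p t) :: complex) absolutely_integrable_on {0..1}"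
  using absolutely_integrable_linear[OF abs_int bounded_linear_of_real] by (simp add: o_def)

lemma V_absolutely_integrable: "V l absolutely_integrable_on {0..1}"
  unfolding V_def
  by (rule set_integral_diff(1)[OF complex_potential absolutely_integrable_continuous_real])
    (rule continuous_on_const)

lemma V_mult:
  assumes "continuous_on {0..1} f"
  shows "(\<lambda>t. V l t * f t) absolutely_integrable_on {0..1}"
  using absolutely_integrable_continuous_mult[OF assms V_absolutely_integrable[of l]]
  by (simp add: mult.commute)

lemma norm_V_le: "norm l \<le> R \<Longrightarrow> norm (V l t) \<le> \<bar>p t\<bar> + R"
  unfolding V_def by (rule order_trans[OF norm_triangle_ineq4]) simp

text \<open>The weight \<open>exp (\<kappa> x)\<close> makes the Volterra operator a contraction in the sup norm. It
  comes from \<open>ab \<le> \<eta> a\<^sup>2 + b\<^sup>2 / (4 \<eta>)\<close> with \<open>a = |p| + R\<close> and \<open>b = exp (\<kappa> (t - x))\<close>.\<close>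

lemma contraction_weight:
  assumes R: "R \<ge> 0"
  obtains \<kappa> where "\<kappa> \<ge> 1" and "\<And>x. x \<in> {0..1} \<Longrightarrow> (\<lambda>t. (\<bar>p t\<bar> + R) * exp (\<kappa> * t)) integrable_on {0..x}"
    and "\<And>x. x \<in> {0..1} \<Longrightarrow> integral {0..x} (\<lambda>t. (\<bar>p t\<bar> + R) * exp (\<kappa> * t)) \<le> exp (\<kappa> * x) / 2"
proof -
  define N where "N = integral {0..1} (\<lambda>t. (\<bar>p t\<bar> + R)\<^sup>2) + 1"
  have pR: "(\<lambda>t. \<bar>p t\<bar> + R) absolutely_integrable_on {0..1}"
    using set_integral_add(1)[OF set_integrable_abs[OF abs_int]
      absolutely_integrable_continuous_real[of 0 1 "\<lambda>_. R"]] by simp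
  have abs1: "(\<lambda>t. \<bar>p t\<bar>) integrable_on {0..1}"
    using abs_int by (auto simp: absolutely_integrable_on_def)
  have "(\<lambda>t. (p t)\<^sup>2 + (2 * R) * \<bar>p t\<bar> + R\<^sup>2) integrable_on {0..1}"
    by (intro integrable_add integrable_on_mult_right sq_int abs1 integrable_const_ivl)
  also have "(\<lambda>t. (p t)\<^sup>2 + (2 * R) * \<bar>p t\<bar> + R\<^sup>2) = (\<lambda>t. (\<bar>p t\<bar> + R)\<^sup>2)"
    by (auto simp: power2_sum algebra_simps)
  finally have sq: "(\<lambda>t. (\<bar>p t\<bar> + R)\<^sup>2) integrable_on {0..1}" .
  have N: "N \<ge> 1" unfolding N_def using integral_nonneg[OF sq] by auto
  \<comment> \<open>With \<eta> = 1 / (4 N) the square of |p| + R contributes at most 1/4, as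
    \<open>N\<close> exceeds its integral; the exponential contributes at most N / (2 \<kappa>),
    which is 1/4 for this choice. The summand 1 in \<open>N\<close> also yields \<kappa> \<ge>
    1.\<close>
  define \<kappa> where "\<kappa> = 2 * N"
  have int: "(\<lambda>t. (\<bar>p t\<bar> + R) * exp (\<kappa> * t)) integrable_on {0..x}" if x: "x \<in> {0..1}" for x
  proof -
    have "(\<lambda>t. exp (\<kappa> * t) * (\<bar>p t\<bar> + R)) absolutely_integrable_on {0..1}"
      by (rule absolutely_integrable_bounded_measurable_product_real)
        (use pR in \<open>auto intro!: continuous_imp_measurable_on_sets_lebesgue
          compact_imp_bounded compact_continuous_image continuous_intros\<close>)
    from integrable_on_initial(2)[OF this x] show ?thesis by (simp add: mult.commute)
  qed
  moreover have "integral {0..x} (\<lambda>t. (\<bar>p t\<bar> + R) * exp (\<kappa> * t)) \<le> exp (\<kappa> * x) / 2"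
    if x: "x \<in> {0..1}" for x
  proof -
    have E: "((\<lambda>t. exp (2 * \<kappa> * (t - x))) has_integral (1 - exp (- 2 * \<kappa> * x)) / (2 * \<kappa>)) {0..x}"
    proof -
      have "((\<lambda>t. exp (2 * \<kappa> * (t - x))) has_integral exp (2 * \<kappa> * (x - x)) / (2 * \<kappa>) - exp (2 * \<kappa> * (0
        - x)) / (2 * \<kappa>)) {0..x}"
        by (rule fundamental_theorem_of_calculus)
          (use x N in \<open>auto simp: \<kappa>_def has_real_derivative_iff_has_vector_derivative [symmetric] intro!:
            derivative_eq_intros\<close>)
      then show ?thesis by (simp add: diff_divide_distrib)
    qed
    have sqx: "(\<lambda>t. (\<bar>p t\<bar> + R)\<^sup>2) integrable_on {0..x}"
      using integrable_on_subinterval[OF sq, of 0 x] x by auto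
    have "integral {0..x} (\<lambda>t. (\<bar>p t\<bar> + R) * exp (\<kappa> * t))
        \<le> integral {0..x} (\<lambda>t. exp (\<kappa> * x) * ((\<bar>p t\<bar> + R)\<^sup>2 / (4 * N) + N * exp (2 * \<kappa> * (t - x))))"
    proof (rule integral_le[OF int[OF x]])
      show "(\<lambda>t. exp (\<kappa> * x) * ((\<bar>p t\<bar> + R)\<^sup>2 / (4 * N) + N * exp (2 * \<kappa> * (t - x)))) integrable_on {0..x}"
        by (intro integrable_on_mult_right integrable_add integrable_on_divide sqx
          has_integral_integrable[OF E])
      show "(\<bar>p t\<bar> + R) * exp (\<kappa> * t) \<le> exp (\<kappa> * x) * ((\<bar>p t\<bar> + R)\<^sup>2 / (4 * N) + N * exp (2 * \<kappa> * (t
        - x)))" for t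
      proof -
        define A where "A = \<bar>p t\<bar> + R"
        define B where "B = exp (\<kappa> * (t - x))"
        have "0 \<le> (A / (2 * N) - B)\<^sup>2 * N" using N by auto
        also have "\<dots> = A\<^sup>2 / (4 * N) + N * B\<^sup>2 - A * B"
          using N by (simp add: power2_eq_square field_simps)
        finally have "A * B \<le> A\<^sup>2 / (4 * N) + N * B\<^sup>2" by simp
        moreover have "B\<^sup>2 = exp (2 * \<kappa> * (t - x))"
          unfolding B_def power2_eq_square by (simp flip: exp_add)
        moreover have "exp (\<kappa> * t) = exp (\<kappa> * x) * B"
          unfolding B_def by (simp add: algebra_simps flip: exp_add)
        ultimately show ?thesis unfolding A_def by (simp add: mult_left_mono mult.left_commute)
      qed
    qed
    also have "\<dots> = exp (\<kappa> * x) * (integral {0..x} (\<lambda>t. (\<bar>p t\<bar> + R)\<^sup>2) / (4 * N) + N * ((1 - exp (- 2 * \<kappa>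
      * x)) / (2 * \<kappa>)))"
      by (intro integral_unique has_integral_mult_right has_integral_add has_integral_divide
          integrable_integral[OF sqx] E)
    also have "\<dots> \<le> exp (\<kappa> * x) * (1 / 4 + 1 / 4)"
    proof (intro mult_left_mono add_mono)
      have "integral {0..x} (\<lambda>t. (\<bar>p t\<bar> + R)\<^sup>2) \<le> integral {0..1} (\<lambda>t. (\<bar>p t\<bar> + R)\<^sup>2)"
        using x by (intro integral_subset_le sqx sq) auto
      then show "integral {0..x} (\<lambda>t. (\<bar>p t\<bar> + R)\<^sup>2) / (4 * N) \<le> 1 / 4"
        using N by (simp add: N_def field_simps)
      show "N * ((1 - exp (- 2 * \<kappa> * x)) / (2 * \<kappa>)) \<le> 1 / 4"
        using N by (simp add: \<kappa>_def)
    qed auto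
    finally show ?thesis by simp
  qed
  moreover have "\<kappa> \<ge> 1" using N by (simp add: \<kappa>_def)
  ultimately show ?thesis using that by blast
qed

text \<open>These are the successive terms of the Neumann series of the integrated equation, not its
  partial sums; the solution is their sum.\<close>

primrec picard :: "complex \<Rightarrow> complex \<Rightarrow> complex \<Rightarrow> nat \<Rightarrow> real \<Rightarrow> complex" where
  "picard l u v 0 = (\<lambda>x. u + v * of_real x)"
| "picard l u v (Suc n) = (\<lambda>x. integral {0..x} (\<lambda>s. integral {0..s} (\<lambda>t. V l t * picard l u v n t)))"

definition picard' :: "complex \<Rightarrow> complex \<Rightarrow> complex \<Rightarrow> nat \<Rightarrow> real \<Rightarrow> complex" where
  "picard' l u v n s = integral {0..s} (\<lambda>t. V l t * picard l u v n t)"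

lemma picard_continuous: "continuous_on {0..1} (picard l u v n)"
  and picard'_continuous: "continuous_on {0..1} (picard' l u v n)"
proof -
  have *: "continuous_on {0..1} (picard' l u v n)" if "continuous_on {0..1} (picard l u v n)" for n
    unfolding picard'_def by (rule continuous_indefinite[OF V_mult[OF that]])
  show **: "continuous_on {0..1} (picard l u v n)" for n
  proof (induction n)
    case 0 then show ?case by (auto intro!: continuous_intros)
  next
    case (Suc n)
    have "continuous_on {0..1} (\<lambda>x. integral {0..x} (picard' l u v n))"
      by (rule continuous_indefinite[OF absolutely_integrable_continuous_real[OF *[OF Suc]]])
    then show ?case unfolding picard'_def picard.simps .
  qed
  show "continuous_on {0..1} (picard' l u v n)" by (rule *[OF **])
qed

lemma exp_integral_le:
  fixes \<kappa> x :: real assumes "\<kappa> \<ge> 1" "x \<ge> 0"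
  shows "(\<lambda>t. exp (\<kappa> * t)) integrable_on {0..x}" "integral {0..x} (\<lambda>t. exp (\<kappa> * t)) \<le> exp (\<kappa> * x)"
proof -
  have "((\<lambda>t. exp (\<kappa> * t)) has_integral exp (\<kappa> * x) / \<kappa> - exp (\<kappa> * 0) / \<kappa>) {0..x}"
    by (rule fundamental_theorem_of_calculus)
       (use assms in \<open>auto simp: has_real_derivative_iff_has_vector_derivative [symmetric] intro!:
         derivative_eq_intros\<close>)
  moreover have "exp (\<kappa> * x) / \<kappa> - exp (\<kappa> * 0) / \<kappa> \<le> exp (\<kappa> * x)"
  proof -
    have "exp (\<kappa> * x) / \<kappa> \<le> exp (\<kappa> * x) / 1" using assms by (intro divide_left_mono) auto
    moreover have "exp (\<kappa> * 0) / \<kappa> \<ge> 0" using assms by simp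
    ultimately show ?thesis by linarith
  qed
  ultimately show "(\<lambda>t. exp (\<kappa> * t)) integrable_on {0..x}" "integral {0..x} (\<lambda>t. exp (\<kappa> * t)) \<le> exp (\<kappa> * x)"
    by (auto simp: integral_unique)
qed

text \<open>The inner integration halves the bound with respect to the weight exp (\<kappa> x). The
  outer one does not enlarge it again, because the integral of exp (\<kappa> s) is at most exp
  (\<kappa> x) for \<kappa> \<ge> 1.\<close>

lemma volterra_step:
  assumes \<kappa>: "\<kappa> \<ge> 1" "\<And>x. x \<in> {0..1} \<Longrightarrow> (\<lambda>t. (\<bar>p t\<bar> + R) * exp (\<kappa> * t)) integrable_on {0..x}"
      "\<And>x. x \<in> {0..1} \<Longrightarrow> integral {0..x} (\<lambda>t. (\<bar>p t\<bar> + R) * exp (\<kappa> * t)) \<le> exp (\<kappa> * x) / 2"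
    and l: "norm l \<le> R" and f: "continuous_on {0..1} f"
    and M: "\<And>t. t \<in> {0..1} \<Longrightarrow> norm (f t) \<le> M * exp (\<kappa> * t)" and x: "x \<in> {0..1}"
  shows "norm (integral {0..x} (\<lambda>t. V l t * f t)) \<le> M / 2 * exp (\<kappa> * x)"
    and "norm (integral {0..x} (\<lambda>s. integral {0..s} (\<lambda>t. V l t * f t))) \<le> M / 2 * exp (\<kappa> * x)"
proof -
  have M0: "M \<ge> 0" using M[of 0] norm_ge_zero[of "f 0"] by (simp del: norm_ge_zero)
  have R0: "R \<ge> 0" using l norm_ge_zero order_trans by blast
  have *: "norm (integral {0..x} (\<lambda>t. V l t * f t)) \<le> M / 2 * exp (\<kappa> * x)" if x: "x \<in> {0..1}" for x
  proof -
    have "norm (integral {0..x} (\<lambda>t. V l t * f t)) \<le> integral {0..x} (\<lambda>t. M * ((\<bar>p t\<bar> + R) * exp (\<kappa> * t)))"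
    proof (rule integral_norm_le[OF V_mult[OF f] x])
      show "norm (V l t * f t) \<le> M * ((\<bar>p t\<bar> + R) * exp (\<kappa> * t))" if t: "t \<in> {0..x}" for t
      proof -
        have "norm (V l t * f t) \<le> (\<bar>p t\<bar> + R) * (M * exp (\<kappa> * t))"
          unfolding norm_mult using M[of t] norm_V_le[OF l] t x R0 by (intro mult_mono) auto
        then show ?thesis by (simp add: mult_ac)
      qed
    qed (rule integrable_on_mult_right[OF \<kappa>(2)[OF x]])
    also have "\<dots> \<le> M * (exp (\<kappa> * x) / 2)"
      using mult_left_mono[OF \<kappa>(3)[OF x] M0] by simp
    finally show ?thesis by simp
  qed
  show "norm (integral {0..x} (\<lambda>t. V l t * f t)) \<le> M / 2 * exp (\<kappa> * x)" by (rule *[OF x])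
  let ?I = "\<lambda>s. integral {0..s} (\<lambda>t. V l t * f t)"
  have "norm (integral {0..x} ?I) \<le> integral {0..x} (\<lambda>s. M / 2 * exp (\<kappa> * s))"
  proof (rule integral_norm_le[OF _ x])
    show "?I absolutely_integrable_on {0..1}"
      by (intro absolutely_integrable_continuous_real continuous_indefinite V_mult f)
    show "(\<lambda>s. M / 2 * exp (\<kappa> * s)) integrable_on {0..x}"
      by (rule integrable_on_mult_right, rule exp_integral_le) (use x \<kappa>(1) in auto)
  qed (use * x in auto)
  also have "\<dots> \<le> M / 2 * exp (\<kappa> * x)"
    using M0 x \<kappa> exp_integral_le[of \<kappa> x] by (simp add: mult_left_mono)
  finally show "norm (integral {0..x} ?I) \<le> M / 2 * exp (\<kappa> * x)" .
qed

text \<open>\<open>C\<close> depends on \<open>R\<close> alone, so the geometric decay is uniform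
  for \<open>l\<close> in a disc; this is what the Weierstrass test needs for holomorphy in
  \<open>l\<close>.\<close>

lemma picard_bounds:
  assumes R: "R \<ge> 0"
  obtains C where "C \<ge> 0" and "\<And>l u v n x. norm l \<le> R \<Longrightarrow> x \<in> {0..1} \<Longrightarrow> norm (picard l u v n x) \<le> C
    * (norm u + norm v) * (1/2)^n"
    "\<And>l u v n x. norm l \<le> R \<Longrightarrow> x \<in> {0..1} \<Longrightarrow> norm (picard' l u v n x) \<le> C * (norm u + norm v) * (1/2)^n"
proof -
  obtain \<kappa> where \<kappa>: "\<kappa> \<ge> 1" "\<And>x. x \<in> {0..1} \<Longrightarrow> (\<lambda>t. (\<bar>p t\<bar> + R) * exp (\<kappa> * t)) integrable_on {0..x}"
      "\<And>x. x \<in> {0..1} \<Longrightarrow> integral {0..x} (\<lambda>t. (\<bar>p t\<bar> + R) * exp (\<kappa> * t)) \<le> exp (\<kappa> * x) / 2"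
    using contraction_weight[OF R] by blast
  have b1: "norm (picard l u v n x) \<le> (norm u + norm v) * (1/2)^n * exp (\<kappa> * x)"
    if l: "norm l \<le> R" and x: "x \<in> {0..1}" for l u v n x
    using x
  proof (induction n arbitrary: x)
    case 0
    have "norm (u + v * of_real x) \<le> norm u + norm v * 1"
      by (rule order_trans[OF norm_triangle_ineq]) (use 0 in \<open>auto simp: norm_mult intro!: mult_left_le\<close>)
    also have "\<dots> \<le> (norm u + norm v) * exp (\<kappa> * x)"
      using 0 \<kappa>(1) mult_left_mono[of 1 "exp (\<kappa> * x)" "norm u + norm v"] by auto
    finally show ?case by simp
  next
    case (Suc n)
    show ?case using volterra_step(2)[OF \<kappa> l picard_continuous Suc.IH Suc.prems] by simp
  qed
  have b2: "norm (picard' l u v n x) \<le> (norm u + norm v) * (1/2)^n * exp (\<kappa> * x)"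
    if l: "norm l \<le> R" and x: "x \<in> {0..1}" for l u v n x
  proof -
    have "norm (picard' l u v n x) \<le> (norm u + norm v) * (1/2)^n / 2 * exp (\<kappa> * x)"
      unfolding picard'_def by (rule volterra_step(1)[OF \<kappa> l picard_continuous b1[OF l] x])
    also have "\<dots> \<le> (norm u + norm v) * (1/2)^n * exp (\<kappa> * x)" by (intro mult_right_mono) auto
    finally show ?thesis .
  qed
  have e: "a * b * exp (\<kappa> * x) \<le> exp \<kappa> * a * b" if "x \<in> {0..1}" "a \<ge> 0" "b \<ge> 0" for a b x :: real
  proof -
    have "(a * b) * exp (\<kappa> * x) \<le> (a * b) * exp \<kappa>"
      using that \<kappa>(1) by (intro mult_left_mono) (auto simp: mult_left_le)
    then show ?thesis by (simp add: mult_ac)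
  qed
  show ?thesis
    by (rule that[of "exp \<kappa>"]) (auto intro: order_trans[OF b1 e] order_trans[OF b2 e])
qed

end

text \<open>Holomorphy in the spectral parameter is obtained without differentiating under the integral
  sign: the Picard iterates are polynomials in \<open>l\<close> with coefficients continuous in \<open>x\<close>.\<close>

definition poly_in :: "nat \<Rightarrow> (complex \<Rightarrow> real \<Rightarrow> complex) \<Rightarrow> bool" where
  "poly_in N f \<longleftrightarrow> (\<exists>a. (\<forall>k. continuous_on {0..1} (a k)) \<and> (\<forall>k\<ge>N. a k = (\<lambda>_. 0)) \<and>
     (\<forall>l. \<forall>x\<in>{0..1}. f l x = (\<Sum>k<N. a k x * l ^ k)))"

lemma poly_in_mono: "poly_in N f \<Longrightarrow> N \<le> M \<Longrightarrow> poly_in M f"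
proof -
  assume "poly_in N f" and NM: "N \<le> M"
  then obtain a where a: "\<forall>k. continuous_on {0..1} (a k)" "\<forall>k\<ge>N. a k = (\<lambda>_. 0)"
     "\<forall>l. \<forall>x\<in>{0..1}. f l x = (\<Sum>k<N. a k x * l ^ k)" unfolding poly_in_def by blast
  have "(\<Sum>k<N. a k x * l ^ k) = (\<Sum>k<M. a k x * l ^ k)" for l x
    using a(2) NM by (intro sum.mono_neutral_left) auto
  with a NM show ?thesis unfolding poly_in_def by (intro exI[of _ a]) auto
qed

lemma poly_in_diff:
  assumes "poly_in N f" "poly_in N g"
  shows "poly_in N (\<lambda>l x. f l x - g l x)"
proof -
  obtain a where a: "\<forall>k. continuous_on {0..1} (a k)" "\<forall>k\<ge>N. a k = (\<lambda>_. 0)"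
     "\<forall>l. \<forall>x\<in>{0..1}. f l x = (\<Sum>k<N. a k x * l ^ k)" using assms(1) unfolding poly_in_def by blast
  obtain b where b: "\<forall>k. continuous_on {0..1} (b k)" "\<forall>k\<ge>N. b k = (\<lambda>_. 0)"
     "\<forall>l. \<forall>x\<in>{0..1}. g l x = (\<Sum>k<N. b k x * l ^ k)" using assms(2) unfolding poly_in_def by blast
  show ?thesis unfolding poly_in_def
    using a b by (intro exI[of _ "\<lambda>k x. a k x - b k x"])
      (auto intro!: continuous_intros simp: sum_subtractf left_diff_distrib)
qed

lemma poly_in_mult:
  assumes "poly_in N f"
  shows "poly_in (Suc N) (\<lambda>l x. l * f l x)"
proof -
  obtain a where a: "\<forall>k. continuous_on {0..1} (a k)" "\<forall>k\<ge>N. a k = (\<lambda>_. 0)"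
     "\<forall>l. \<forall>x\<in>{0..1}. f l x = (\<Sum>k<N. a k x * l ^ k)" using assms(1) unfolding poly_in_def by blast
  show ?thesis unfolding poly_in_def
  proof (intro exI[of _ "\<lambda>k. if k = 0 then (\<lambda>_. 0) else a (k - 1)"] conjI allI ballI impI)
    fix k show "continuous_on {0..1} (if k = 0 then (\<lambda>_. 0) else a (k - 1))"
      using a(1) by (auto intro: continuous_intros)
  next
    fix k assume "Suc N \<le> k" then show "(if k = 0 then (\<lambda>_. 0) else a (k - 1)) = (\<lambda>_. 0)"
      using a(2) by auto
  next
    fix l :: complex and x :: real assume "x \<in> {0..1}"
    then show "l * f l x = (\<Sum>k<Suc N. (if k = 0 then \<lambda>_. 0 else a (k - 1)) x * l ^ k)"
      using a(3) by (subst sum.lessThan_Suc_shift) (simp add: sum_distrib_left mult_ac)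
  qed
qed

lemma poly_in_integral:
  assumes "poly_in N f" and w: "w absolutely_integrable_on {0..1}"
  shows "poly_in N (\<lambda>l x. integral {0..x} (\<lambda>t. w t * f l t))"
proof -
  obtain a where a: "\<forall>k. continuous_on {0..1} (a k)" "\<forall>k\<ge>N. a k = (\<lambda>_. 0)"
     "\<forall>l. \<forall>x\<in>{0..1}. f l x = (\<Sum>k<N. a k x * l ^ k)" using assms(1) unfolding poly_in_def by blast
  have wa: "(\<lambda>t. w t * a k t) absolutely_integrable_on {0..1}" for k
    using absolutely_integrable_continuous_mult[OF _ w, of "a k"] a(1) by (simp add: mult.commute)
  show ?thesis unfolding poly_in_def
  proof (intro exI[of _ "\<lambda>k x. integral {0..x} (\<lambda>t. w t * a k t)"] conjI allI ballI impI)
    fix l :: complex and x :: real assume x: "x \<in> {0..1}"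
    have "integral {0..x} (\<lambda>t. w t * f l t) = integral {0..x} (\<lambda>t. \<Sum>k<N. (w t * a k t) * l ^ k)"
      by (rule Henstock_Kurzweil_Integration.integral_cong)
         (use x a(3) in \<open>auto simp: sum_distrib_left mult_ac\<close>)
    also have "\<dots> = (\<Sum>k<N. integral {0..x} (\<lambda>t. (w t * a k t) * l ^ k))"
      by (rule Henstock_Kurzweil_Integration.integral_sum)
         (auto intro!: integrable_on_mult_left integrable_on_initial(2)[OF wa x])
    finally show "integral {0..x} (\<lambda>t. w t * f l t) = (\<Sum>k<N. integral {0..x} (\<lambda>t. w t * a k t) * l ^ k)"
      by simp
  qed (use a(2) in \<open>auto intro!: continuous_indefinite wa\<close>)
qed

lemma poly_in_cong:
  "poly_in N f \<Longrightarrow> (\<And>l x. x \<in> {0..1} \<Longrightarrow> f l x = g l x) \<Longrightarrow> poly_in N g"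
  unfolding poly_in_def by metis

lemma poly_in_holomorphic: "poly_in N f \<Longrightarrow> x \<in> {0..1} \<Longrightarrow> (\<lambda>l. f l x) holomorphic_on S"
  unfolding poly_in_def
  by (auto intro!: holomorphic_intros)

section \<open>Existence, uniqueness and holomorphy of the solutions\<close>

context potential
begin

text \<open>Multiplication by p - l raises the degree in \<open>l\<close> by one, and integration in
  \<open>x\<close> acts on the coefficients only.\<close>

lemma picard_poly_in: "poly_in (Suc n) (\<lambda>l. picard l u v n)"
  and picard'_poly_in: "poly_in (Suc (Suc n)) (\<lambda>l. picard' l u v n)"
proof -
  have step: "poly_in (Suc N) (\<lambda>l. picard' l u v n)" if "poly_in N (\<lambda>l. picard l u v n)" for n N
  proof (rule poly_in_cong)
    show "poly_in (Suc N) (\<lambda>l x. integral {0..x} (\<lambda>t. of_real (p t) * picard l u v n t) - l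
      * integral {0..x} (\<lambda>t. 1 * picard l u v n t))"
      by (rule poly_in_diff[OF poly_in_mono[OF poly_in_integral[OF that complex_potential]]
          poly_in_mult[OF poly_in_integral[OF that]]])
         (auto intro!: absolutely_integrable_continuous_real)
    fix l :: complex and x :: real assume x: "x \<in> {0..1}"
    have i1: "(\<lambda>t. of_real (p t) * picard l u v n t) integrable_on {0..x}"
      using integrable_on_initial(2)[OF absolutely_integrable_continuous_mult[OF picard_continuous
        complex_potential] x]
      by (simp add: mult.commute)
    have i2: "(\<lambda>t. l * picard l u v n t) integrable_on {0..x}"
      by (intro integrable_on_mult_right integrable_on_initial(2)[OF _ x]
        absolutely_integrable_continuous_real picard_continuous)
    show "integral {0..x} (\<lambda>t. of_real (p t) * picard l u v n t) - l * integral {0..x} (\<lambda>t. 1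
      * picard l u v n t)
       = picard' l u v n x"
      unfolding picard'_def V_def left_diff_distrib Henstock_Kurzweil_Integration.integral_diff[OF i1 i2]
        by simp
  qed
  show *: "poly_in (Suc n) (\<lambda>l. picard l u v n)" for n
  proof (induction n)
    case 0
    show ?case unfolding poly_in_def
      by (rule exI[of _ "\<lambda>k. if k = 0 then (\<lambda>x. u + v * of_real x) else (\<lambda>_. 0)"])
         (auto intro!: continuous_intros)
  next
    case (Suc n)
    have "poly_in (Suc (Suc n)) (\<lambda>l x. integral {0..x} (\<lambda>t. 1 * picard' l u v n t))"
      by (rule poly_in_integral[OF step[OF Suc]])
         (auto intro!: absolutely_integrable_continuous_real)
    then show ?case by (simp add: picard'_def)
  qed
  show "poly_in (Suc (Suc n)) (\<lambda>l. picard' l u v n)" by (rule step[OF *])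
qed

lemma picard_bound:
  assumes "R \<ge> 0"
  shows "\<exists>C. \<forall>l n. norm l \<le> R \<longrightarrow> (\<forall>x\<in>{0..1}. norm (picard l u v n x) \<le> C * (1/2)^n
    \<and> norm (picard' l u v n x) \<le> C * (1/2)^n)"
proof (rule picard_bounds[OF assms], goal_cases)
  case (1 C)
  show ?case by (rule exI[of _ "C * (norm u + norm v)"]) (use 1 in auto)
qed

definition sol :: "complex \<Rightarrow> complex \<Rightarrow> complex \<Rightarrow> real \<Rightarrow> complex" where
  "sol l u v x = (\<Sum>n. picard l u v n x)"

definition sol' :: "complex \<Rightarrow> complex \<Rightarrow> complex \<Rightarrow> real \<Rightarrow> complex" where
  "sol' l u v x = v + (\<Sum>n. picard' l u v n x)"

lemma sol_holomorphic:
  assumes x: "x \<in> {0..1}"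
  shows "(\<lambda>l. sol l u v x) holomorphic_on UNIV" "(\<lambda>l. sol' l u v x) holomorphic_on UNIV"
proof -
  have *: "(\<lambda>l. \<Sum>n. f l n) holomorphic_on UNIV"
    if hol: "\<And>n. (\<lambda>l. f l n) holomorphic_on UNIV"
    and C: "\<And>R. R \<ge> 0 \<Longrightarrow> \<exists>C. \<forall>l n. norm l \<le> R \<longrightarrow> norm (f l n) \<le> C * (1/2)^n"
    for f :: "complex \<Rightarrow> nat \<Rightarrow> complex"
  proof (rule holomorphic_uniform_sequence[where f = "\<lambda>N l. \<Sum>n<N. f l n"])
    fix z :: complex
    obtain C where C: "\<And>l n. norm l \<le> norm z + 1 \<Longrightarrow> norm (f l n) \<le> C * (1/2)^n"
      using C[of "norm z + 1"] by auto
    have "uniform_limit (cball z 1) (\<lambda>N l. \<Sum>n<N. f l n) (\<lambda>l. \<Sum>n. f l n) sequentially"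
    proof (rule Weierstrass_m_test)
      fix n l assume "l \<in> cball z 1"
      then have "norm l \<le> norm z + 1"
        using norm_triangle_ineq2[of l z] by (simp add: dist_norm norm_minus_commute)
      then show "norm (f l n) \<le> C * (1/2)^n" by (rule C)
    qed (auto intro!: summable_mult)
    then show "\<exists>d>0. cball z d \<subseteq> UNIV \<and>
        uniform_limit (cball z d) (\<lambda>N l. \<Sum>n<N. f l n) (\<lambda>l. \<Sum>n. f l n) sequentially"
      by (intro exI[of _ 1]) auto
  qed (auto intro!: holomorphic_intros hol)
  show "(\<lambda>l. sol l u v x) holomorphic_on UNIV"
    unfolding sol_def
  proof (rule *)
    show "(\<lambda>l. picard l u v n x) holomorphic_on UNIV" for n
      by (rule poly_in_holomorphic[OF picard_poly_in x])
    fix R :: real assume "R \<ge> 0"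
    from picard_bound[OF this, of u v]
    show "\<exists>C. \<forall>l n. norm l \<le> R \<longrightarrow> norm (picard l u v n x) \<le> C * (1/2)^n" using x by metis
  qed
  show "(\<lambda>l. sol' l u v x) holomorphic_on UNIV"
    unfolding sol'_def
  proof (intro holomorphic_on_add holomorphic_on_const *)
    show "(\<lambda>l. picard' l u v n x) holomorphic_on UNIV" for n
      by (rule poly_in_holomorphic[OF picard'_poly_in x])
    fix R :: real assume "R \<ge> 0"
    from picard_bound[OF this, of u v]
    show "\<exists>C. \<forall>l n. norm l \<le> R \<longrightarrow> norm (picard' l u v n x) \<le> C * (1/2)^n" using x by metis
  qed
qed

text \<open>Dominated convergence with majorant 2 C |w|. The weight \<open>w\<close> is the
  potential in the equation for \<open>sol'\<close> and 1 in the equation for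
  \<open>sol\<close>.\<close>

lemma integral_suminf:
  fixes f :: "nat \<Rightarrow> real \<Rightarrow> complex"
  assumes f: "\<And>n. continuous_on {0..1} (f n)" and C: "\<And>n t. t \<in> {0..1} \<Longrightarrow> norm (f n t) \<le> C * (1/2)^n"
    and x: "x \<in> {0..1}" and w: "w absolutely_integrable_on {0..1}"
  shows "integral {0..x} (\<lambda>t. w t * (\<Sum>n. f n t)) = (\<Sum>n. integral {0..x} (\<lambda>t. w t * f n t))"
    and "continuous_on {0..1} (\<lambda>t. \<Sum>n. f n t)"
proof -
  have sm: "summable (\<lambda>n. f n t)" if "t \<in> {0..1}" for t
    by (rule summable_comparison_test[of _ "\<lambda>n. C * (1/2)^n"])
       (use C that in \<open>auto intro!: summable_mult exI[of _ 0]\<close>)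
  have C0: "C \<ge> 0" using C[of 0 0] norm_ge_zero[of "f 0 0"] by (simp del: norm_ge_zero)
  have wf: "(\<lambda>t. w t * f n t) absolutely_integrable_on {0..1}" for n
    using absolutely_integrable_continuous_mult[OF f w] by (simp add: mult.commute)
  have "(\<lambda>N. integral {0..x} (\<lambda>t. \<Sum>n<N. w t * f n t)) \<longlonglongrightarrow> integral {0..x} (\<lambda>t. w t * (\<Sum>n. f n t))"
  proof (rule dominated_convergence(2))
    show "(\<lambda>t. \<Sum>n<N. w t * f n t) integrable_on {0..x}" for N
      by (intro integrable_sum integrable_on_initial(2)[OF wf x]) auto
    show "(\<lambda>t. norm (w t) * (C * 2)) integrable_on {0..x}"
      by (rule integrable_on_mult_left[OF integrable_on_initial(3)[OF w x]])
    fix t assume t: "t \<in> {0..x}"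
    show "(\<lambda>N. \<Sum>n<N. w t * f n t) \<longlonglongrightarrow> w t * (\<Sum>n. f n t)"
      unfolding sum_distrib_left[symmetric]
      using summable_LIMSEQ[OF sm[of t]] t x by (intro tendsto_intros) auto
    fix N
    have "norm (\<Sum>n<N. f n t) \<le> (\<Sum>n<N. C * (1/2)^n)"
      by (rule sum_norm_le) (use C t x in auto)
    then have "norm (\<Sum>n<N. w t * f n t) \<le> norm (w t) * (\<Sum>n<N. C * (1/2)^n)"
      by (simp add: norm_mult mult_left_mono flip: sum_distrib_left)
    also have "(\<Sum>n<N. C * (1/2)^n) \<le> C * 2"
      using C0 sum_le_suminf[of "\<lambda>n. (1/2::real)^n" "{..<N}"] suminf_geometric[of "1/2::real"]
      by (auto simp flip: sum_distrib_left intro!: mult_left_mono)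
    finally show "norm (\<Sum>n<N. w t * f n t) \<le> norm (w t) * (C * 2)" by (simp add: mult_left_mono)
  qed
  also have "(\<lambda>N. integral {0..x} (\<lambda>t. \<Sum>n<N. w t * f n t)) = (\<lambda>N. \<Sum>n<N. integral {0..x} (\<lambda>t. w t * f n t))"
    by (intro ext Henstock_Kurzweil_Integration.integral_sum integrable_on_initial(2)[OF wf x]) auto
  finally show "integral {0..x} (\<lambda>t. w t * (\<Sum>n. f n t)) = (\<Sum>n. integral {0..x} (\<lambda>t. w t * f n t))"
    by (intro sums_unique) (simp add: sums_def)
  have "uniform_limit {0..1} (\<lambda>N t. \<Sum>n<N. f n t) (\<lambda>t. \<Sum>n. f n t) sequentially"
    by (rule Weierstrass_m_test[of _ _ "\<lambda>n. C * (1/2)^n"]) (use C in \<open>auto intro!: summable_mult\<close>)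
  then show "continuous_on {0..1} (\<lambda>t. \<Sum>n. f n t)"
    by (rule uniform_limit_theorem[rotated]) (auto intro!: always_eventually continuous_intros f)
qed

lemma sol_solution: "schroedinger_solution p l (sol l u v) (sol' l u v)"
  and sol_init: "sol l u v 0 = u" "sol' l u v 0 = v"
proof -
  obtain C where bs: "\<And>n x. x \<in> {0..1} \<Longrightarrow> norm (picard l u v n x) \<le> C * (1/2)^n"
    "\<And>n x. x \<in> {0..1} \<Longrightarrow> norm (picard' l u v n x) \<le> C * (1/2)^n"
    using picard_bound[OF norm_ge_zero[of l], of u v] by (metis order_refl)
  \<comment> \<open>Only continuity of the sum is extracted here; the instances 1 and zero for the
    endpoint and the weight merely discharge the premises.\<close>
  note c = integral_suminf(2)[OF picard_continuous bs(1), of 1 "\<lambda>_. 0", simplified]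
  note c' = integral_suminf(2)[OF picard'_continuous bs(2), of 1 "\<lambda>_. 0", simplified]
  have w1: "(\<lambda>_. 1::complex) absolutely_integrable_on {0..1::real}"
    by (intro absolutely_integrable_continuous_real continuous_intros)
  have cs: "continuous_on {0..1} (sol l u v)" "continuous_on {0..1} (sol' l u v)"
    unfolding sol_def sol'_def by (auto intro!: continuous_intros c c')
  have e1: "integral {0..x} (\<lambda>t. V l t * sol l u v t) = sol' l u v x - v" if x: "x \<in> {0..1}" for x
    unfolding sol_def sol'_def
    by (subst integral_suminf(1)[OF picard_continuous bs(1) x V_absolutely_integrable])
       (auto simp: picard'_def)
  have sm: "summable (\<lambda>n. picard l u v n x)" if x: "x \<in> {0..1}" for x
    by (rule summable_comparison_test[of _ "\<lambda>n. C * (1/2)^n"])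
       (use bs x in \<open>auto intro!: summable_mult exI[of _ 0]\<close>)
  have e2: "sol l u v x = u + integral {0..x} (sol' l u v)" if x: "x \<in> {0..1}" for x
  proof -
    have "sol l u v x = picard l u v 0 x + (\<Sum>n. picard l u v (Suc n) x)"
      unfolding sol_def using suminf_split_head[OF sm[OF x]] by simp
    also have "(\<Sum>n. picard l u v (Suc n) x) = (\<Sum>n. integral {0..x} (\<lambda>t. 1 * picard' l u v n t))"
      by (simp add: picard'_def)
    also have "\<dots> = integral {0..x} (\<lambda>t. 1 * (\<Sum>n. picard' l u v n t))"
      by (rule integral_suminf(1)[OF picard'_continuous bs(2) x w1, symmetric])
    also have "\<dots> = integral {0..x} (\<lambda>t. sol' l u v t - v)" by (simp add: sol'_def)
    also have "\<dots> = integral {0..x} (sol' l u v) - integral {0..x} (\<lambda>_. v)"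
      by (rule Henstock_Kurzweil_Integration.integral_diff)
         (auto intro!: integrable_on_initial(2)[OF absolutely_integrable_continuous_real[OF cs(2)] x])
    finally show ?thesis using x by (simp add: scaleR_conv_of_real mult.commute)
  qed
  show i: "sol l u v 0 = u" "sol' l u v 0 = v" using e2[of 0] e1[of 0] by auto
  show "schroedinger_solution p l (sol l u v) (sol' l u v)"
    unfolding schroedinger_solution_def
  proof (intro conjI ballI)
    fix x :: real assume x: "x \<in> {0..1}"
    have "((\<lambda>x. u + integral {0..x} (sol' l u v)) has_vector_derivative 0
      + sol' l u v x) (at x within {0..1})"
      by (intro has_vector_derivative_add has_vector_derivative_const integral_has_vector_derivative cs(2) x)
    then show "(sol l u v has_vector_derivative sol' l u v x) (at x within {0..1})"
      by - (rule has_vector_derivative_transform[OF x], auto simp: e2)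
    have "((\<lambda>t. V l t * sol l u v t) has_integral integral {0..x} (\<lambda>t. V l t * sol l u v t)) {0..x}"
      by (intro integrable_integral integrable_on_initial(2)[OF _ x] V_mult cs)
    then show "((\<lambda>t. (of_real (p t) - l) * sol l u v t) has_integral sol' l u v x - sol' l u v 0) {0..x}"
      unfolding e1[OF x] i by (simp add: V_def)
  qed
qed

lemma solution_continuous:
  assumes "schroedinger_solution p l y dy"
  shows "continuous_on {0..1} y" "continuous_on {0..1} dy"
    "\<And>x. x \<in> {0..1} \<Longrightarrow> dy x = dy 0 + integral {0..x} (\<lambda>t. V l t * y t)"
proof -
  show y: "continuous_on {0..1} y"
    using assms unfolding schroedinger_solution_def
    by (meson continuous_on_eq_continuous_within has_vector_derivative_continuous)
  show *: "dy x = dy 0 + integral {0..x} (\<lambda>t. V l t * y t)" if x: "x \<in> {0..1}" for x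
  proof -
    have "((\<lambda>t. V l t * y t) has_integral (dy x - dy 0)) {0..x}"
      using assms x unfolding schroedinger_solution_def V_def by blast
    from integral_unique[OF this] show ?thesis by simp
  qed
  have "continuous_on {0..1} (\<lambda>x. dy 0 + integral {0..x} (\<lambda>t. V l t * y t))"
    by (intro continuous_intros continuous_indefinite V_mult y)
  then show "continuous_on {0..1} dy" by (rule continuous_on_eq) (rule *[symmetric])
qed

text \<open>Let \<open>M\<close> be the maximum of |y t| exp (-\<kappa> t), attained at
  \<open>t0\<close>. A solution with zero data is a fixed point of the Volterra operator, whose
  weighted norm is at most 1/2, so M \<le> M / 2.\<close>

lemma solution_unique_zero:
  assumes s: "schroedinger_solution p l y dy" and i: "y 0 = 0" "dy 0 = 0" and x: "x \<in> {0..1}"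
  shows "y x = 0" "dy x = 0"
proof -
  note c = solution_continuous[OF s]
  obtain \<kappa> where \<kappa>: "\<kappa> \<ge> 1" "\<And>x. x \<in> {0..1} \<Longrightarrow> (\<lambda>t. (\<bar>p t\<bar> + norm l) * exp (\<kappa> * t)) integrable_on {0..x}"
      "\<And>x. x \<in> {0..1} \<Longrightarrow> integral {0..x} (\<lambda>t. (\<bar>p t\<bar> + norm l) * exp (\<kappa> * t)) \<le> exp (\<kappa> * x) / 2"
    by (rule contraction_weight[OF norm_ge_zero[of l]]) (rule that)
  have "continuous_on {0..1} (\<lambda>t. norm (y t) * exp (- (\<kappa> * t)))"
    by (intro continuous_intros c)
  from continuous_attains_sup[OF compact_Icc _ this] obtain t0 where t0: "t0 \<in> {0..1}" "\<And>t. t \<in> {0..1}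
    \<Longrightarrow> norm (y t) * exp (- (\<kappa> * t)) \<le> norm (y t0) * exp (- (\<kappa> * t0))"
    by fastforce
  define M where "M = norm (y t0) * exp (- (\<kappa> * t0))"
  have M: "norm (y t) \<le> M * exp (\<kappa> * t)" if "t \<in> {0..1}" for t
    using t0(2)[OF that] unfolding M_def[symmetric] by (simp add: exp_minus field_simps)
  have dy: "dy t = integral {0..t} (\<lambda>t. V l t * y t)" if "t \<in> {0..1}" for t
    using c(3)[OF that] i by simp
  have y: "y t = integral {0..t} (\<lambda>s. integral {0..s} (\<lambda>t. V l t * y t))" if t: "t \<in> {0..1}" for t
  proof -
    have "(dy has_integral (y t - y 0)) {0..t}"
    proof (rule fundamental_theorem_of_calculus)
      fix s assume "s \<in> {0..t}"
      then have "(y has_vector_derivative dy s) (at s within {0..1})"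
        using s t unfolding schroedinger_solution_def by auto
      then show "(y has_vector_derivative dy s) (at s within {0..t})"
        by (rule has_vector_derivative_within_subset) (use t in auto)
    qed (use t in auto)
    then have "y t = integral {0..t} dy" using i by (simp add: integral_unique)
    also have "\<dots> = integral {0..t} (\<lambda>s. integral {0..s} (\<lambda>t. V l t * y t))"
      by (rule Henstock_Kurzweil_Integration.integral_cong) (use t in \<open>auto simp: dy\<close>)
    finally show ?thesis .
  qed
  have "M * exp (\<kappa> * t0) \<le> M / 2 * exp (\<kappa> * t0)"
    using volterra_step(2)[OF \<kappa> order_refl c(1) M t0(1)] unfolding y[OF t0(1), symmetric]
    by (simp add: M_def mult.assoc flip: exp_add)
  then have "M \<le> M / 2" by (rule mult_right_le_imp_le) auto
  then have "M \<le> 0" by simp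
  then have z: "y t = 0" if "t \<in> {0..1}" for t
  proof -
    have "norm (y t) \<le> M * exp (\<kappa> * t)" by (rule M[OF that])
    also have "\<dots> \<le> 0" using \<open>M \<le> 0\<close> by (simp add: mult_nonpos_nonneg)
    finally show ?thesis by simp
  qed
  show "y x = 0" by (rule z[OF x])
  have "integral {0..x} (\<lambda>t. V l t * y t) = integral {0..x} (\<lambda>_. 0)"
    by (rule Henstock_Kurzweil_Integration.integral_cong) (use x z in auto)
  then show "dy x = 0" using dy[OF x] by simp
qed

lemma solution_unique:
  assumes s: "schroedinger_solution p l y dy" and x: "x \<in> {0..1}"
  shows "y x = sol l (y 0) (dy 0) x" "dy x = sol' l (y 0) (dy 0) x"
proof -
  let ?y = "\<lambda>t. y t - sol l (y 0) (dy 0) t" and ?dy = "\<lambda>t. dy t - sol' l (y 0) (dy 0) t"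
  have "schroedinger_solution p l ?y ?dy"
    unfolding schroedinger_solution_def
  proof (intro conjI ballI)
    fix x :: real assume x: "x \<in> {0..1}"
    show "(?y has_vector_derivative ?dy x) (at x within {0..1})"
      using s sol_solution[of l "y 0" "dy 0"] x unfolding schroedinger_solution_def
      by (intro has_vector_derivative_diff) auto
    have "((\<lambda>t. (of_real (p t) - l) * y t - (of_real (p t) - l) * sol l (y 0) (dy 0) t) has_integral
       (dy x - dy 0) - (sol' l (y 0) (dy 0) x - sol' l (y 0) (dy 0) 0)) {0..x}"
      using s sol_solution[of l "y 0" "dy 0"] x unfolding schroedinger_solution_def
      by (intro has_integral_diff) auto
    then show "((\<lambda>t. (of_real (p t) - l) * ?y t) has_integral ?dy x - ?dy 0) {0..x}"
      by (simp add: algebra_simps)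
  qed
  from solution_unique_zero[OF this _ _ x] show "y x = sol l (y 0) (dy 0) x" "dy x = sol' l (y 0) (dy 0) x"
    by (auto simp: sol_init)
qed

lemma cauchy_data_eq: "x \<in> {0..1} \<Longrightarrow> cauchy_data p l u v x = (sol l u v x, sol' l u v x)"
  unfolding cauchy_data_def
  by (rule the_equality) (use sol_solution sol_init solution_unique in blast)+

text \<open>As \<open>p\<close> is real, conjugating a solution for \<open>l\<close> gives a
  solution for \<open>cnj l\<close>, and uniqueness identifies it. This makes the Lyapunov function
  real on the real axis.\<close>

lemma sol_cnj:
  assumes x: "x \<in> {0..1}"
  shows "sol (cnj l) (cnj u) (cnj v) x = cnj (sol l u v x)" "sol' (cnj l) (cnj u) (cnj v) x
    = cnj (sol' l u v x)"
proof -
  have s: "schroedinger_solution p (cnj l) (\<lambda>t. cnj (sol l u v t)) (\<lambda>t. cnj (sol' l u v t))"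
    unfolding schroedinger_solution_def
  proof (intro conjI ballI)
    fix x :: real assume x: "x \<in> {0..1}"
    show "((\<lambda>t. cnj (sol l u v t)) has_vector_derivative cnj (sol' l u v x)) (at x within {0..1})"
      using sol_solution[of l u v] x unfolding schroedinger_solution_def
      by (intro has_vector_derivative_cnj) auto
    have "((\<lambda>t. (of_real (p t) - l) * sol l u v t) has_integral (sol' l u v x - sol' l u v 0)) {0..x}"
      using sol_solution[of l u v] x unfolding schroedinger_solution_def by blast
    from has_integral_linear[OF this bounded_linear_cnj]
    show "((\<lambda>t. (of_real (p t) - cnj l) * cnj (sol l u v t)) has_integral cnj (sol' l u v x)
      - cnj (sol' l u v 0)) {0..x}"
      by (simp add: o_def)
  qed
  from solution_unique[OF this x] show "sol (cnj l) (cnj u) (cnj v) x = cnj (sol l u v x)"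
      "sol' (cnj l) (cnj u) (cnj v) x = cnj (sol' l u v x)"
    by (simp_all add: sol_init)
qed

end

section \<open>The Lyapunov function at large energies\<close>

lemma norm_cos_sin_le:
  fixes z :: complex
  shows "norm (cos z) \<le> exp \<bar>Im z\<bar>" "norm (sin z) \<le> exp \<bar>Im z\<bar>"
  using cmod_cos_le_exp[of 1 z] cmod_sin_le_exp[of 1 z] by simp_all

context potential
begin

lemma variation_of_constants:
  assumes s: "schroedinger_solution p (w\<^sup>2) y dy" and w: "w \<noteq> 0" and x: "x \<in> {0..1}"
  defines "S \<equiv> \<lambda>t. sin (w * of_real t) / w" and "C \<equiv> \<lambda>t. cos (w * of_real t)"
  shows "y x = y 0 * C x + dy 0 * S x + integral {0..x} (\<lambda>t. S (x - t) * (of_real (p t) * y t))"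
    and "dy x = dy 0 * C x - w\<^sup>2 * y 0 * S x + integral {0..x} (\<lambda>t. C (x - t) * (of_real (p t) * y t))"
proof -
  note c = solution_continuous[OF s]
  have S': "((\<lambda>t. S (x - t)) has_vector_derivative - C (x - t)) (at t within X)" for t X
    unfolding S_def C_def using w
    by (auto intro!: derivative_eq_intros has_vector_derivative_real_field[of "\<lambda>z. sin (w * (of_real x
      - z)) / w"])
  have C': "((\<lambda>t. C (x - t)) has_vector_derivative w\<^sup>2 * S (x - t)) (at t within X)" for t X
    unfolding S_def C_def using w
    by (auto intro!: derivative_eq_intros has_vector_derivative_real_field[of "\<lambda>z. cos (w * (of_real x - z))"]
       simp: power2_eq_square)
  have cS: "continuous_on X (\<lambda>t. S (x - t))" and cC: "continuous_on X (\<lambda>t. C (x - t))" for X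
    unfolding S_def C_def using w by (auto intro!: continuous_intros)
  have SC0: "S 0 = 0" "C 0 = 1" by (auto simp: S_def C_def)
  note g = V_mult[OF c(1), of "w\<^sup>2"]
  have cx: "continuous_on {0..x} y" "continuous_on {0..x} dy"
    using c(1,2) x by (auto intro: continuous_on_subset)
  have G: "integral {0..t} (\<lambda>t. V (w\<^sup>2) t * y t) = dy t - dy 0" if "t \<in> {0..1}" for t
    using c(3)[OF that] by simp
  have yd: "(y has_vector_derivative dy t) (at t within {0..x})" if "t \<in> {0..x}" for t
    by (rule has_vector_derivative_within_subset[of _ _ _ "{0..1}"])
       (use that x s in \<open>auto simp: schroedinger_solution_def\<close>)
  have int: "f integrable_on {0..x}" if "continuous_on {0..x} f" for f :: "real \<Rightarrow> complex"
    using that integrable_continuous_real by blast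
  have py: "(\<lambda>t. f t * (of_real (p t) * y t)) integrable_on {0..x}"
     "integral {0..x} (\<lambda>t. f t * (of_real (p t) * y t)) =
      integral {0..x} (\<lambda>t. f t * (V (w\<^sup>2) t * y t)) + w\<^sup>2 * integral {0..x} (\<lambda>t. f t * y t)"
    if f: "continuous_on {0..1} f" for f
  proof -
    have fx: "continuous_on {0..x} f" using f x by (auto intro: continuous_on_subset)
    have a: "(\<lambda>t. f t * (V (w\<^sup>2) t * y t)) integrable_on {0..x}"
      by (rule integrable_on_initial(2)[OF absolutely_integrable_continuous_mult[OF f g] x])
    have b: "(\<lambda>t. w\<^sup>2 * (f t * y t)) integrable_on {0..x}"
      by (intro int continuous_intros fx cx)
    have e: "(\<lambda>t. f t * (of_real (p t) * y t)) = (\<lambda>t. f t * (V (w\<^sup>2) t * y t) + w\<^sup>2 * (f t * y t))"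
      by (auto simp: V_def algebra_simps)
    show "(\<lambda>t. f t * (of_real (p t) * y t)) integrable_on {0..x}"
      unfolding e by (rule integrable_add[OF a b])
    show "integral {0..x} (\<lambda>t. f t * (of_real (p t) * y t)) =
      integral {0..x} (\<lambda>t. f t * (V (w\<^sup>2) t * y t)) + w\<^sup>2 * integral {0..x} (\<lambda>t. f t * y t)"
      unfolding e Henstock_Kurzweil_Integration.integral_add[OF a b] by simp
  qed
  have x0: "0 \<le> x" using x by simp
  have "integral {0..x} (\<lambda>t. S (x - t) * (V (w\<^sup>2) t * y t)) = - integral {0..x} (\<lambda>t. - C (x - t) * (dy t
    - dy 0))"
    by (subst integral_by_parts_indefinite[OF g S' _ x])
       (use x in \<open>auto simp: SC0 G intro!: Henstock_Kurzweil_Integration.integral_cong continuous_intros cC\<close>)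
  also have "\<dots> = integral {0..x} (\<lambda>t. C (x - t) * dy t) - integral {0..x} (\<lambda>t. C (x - t) * dy 0)"
    by (subst Henstock_Kurzweil_Integration.integral_diff [symmetric])
       (auto intro!: int continuous_intros cC cx simp: algebra_simps simp flip: integral_neg)
  finally have e1: "integral {0..x} (\<lambda>t. S (x - t) * (V (w\<^sup>2) t * y t)) =
     integral {0..x} (\<lambda>t. C (x - t) * dy t) - integral {0..x} (\<lambda>t. C (x - t) * dy 0)" .
  have e2: "integral {0..x} (\<lambda>t. C (x - t) * dy 0) = S x * dy 0"
  proof -
    have "((\<lambda>t. C (x - t) * dy 0) has_integral (- S (x - x) * dy 0) - (- S (x - 0) * dy 0)) {0..x}"
      by (rule fundamental_theorem_of_calculus[OF x0])
         (rule has_vector_derivative_eq_rhs, rule has_vector_derivative_mult_left,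
          rule has_vector_derivative_minus, rule S', simp)
    from integral_unique[OF this] show ?thesis by (simp add: SC0)
  qed
  have e3: "integral {0..x} (\<lambda>t. C (x - t) * dy t) + w\<^sup>2 * integral {0..x} (\<lambda>t. S (x - t) * y t) = y x
    - C x * y 0"
  proof -
    have "((\<lambda>t. C (x - t) * dy t + w\<^sup>2 * S (x - t) * y t) has_integral C (x - x) * y x - C (x - 0)
      * y 0) {0..x}"
      by (rule fundamental_theorem_of_calculus[OF x0])
         (rule has_vector_derivative_mult[OF C' yd])
    then have "integral {0..x} (\<lambda>t. C (x - t) * dy t + w\<^sup>2 * (S (x - t) * y t)) = y x - C x * y 0"
      by (simp add: SC0 integral_unique mult.assoc)
    then show ?thesis
      by (subst (asm) Henstock_Kurzweil_Integration.integral_add)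
         (auto intro!: int continuous_intros cC cS cx)
  qed
  show "y x = y 0 * C x + dy 0 * S x + integral {0..x} (\<lambda>t. S (x - t) * (of_real (p t) * y t))"
    unfolding py(2)[OF cS] e1 e2 using e3 by (simp add: algebra_simps)
  have "integral {0..x} (\<lambda>t. C (x - t) * (V (w\<^sup>2) t * y t)) = dy x - dy 0 - integral {0..x} (\<lambda>t. w\<^sup>2
    * S (x - t) * (dy t - dy 0))"
    by (subst integral_by_parts_indefinite[OF g C' _ x])
       (use x in \<open>auto simp: SC0 G intro!: Henstock_Kurzweil_Integration.integral_cong continuous_intros cS\<close>)
  also have "integral {0..x} (\<lambda>t. w\<^sup>2 * S (x - t) * (dy t - dy 0)) =
     integral {0..x} (\<lambda>t. w\<^sup>2 * (S (x - t) * dy t)) - integral {0..x} (\<lambda>t. w\<^sup>2 * S (x - t) * dy 0)"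
    by (subst Henstock_Kurzweil_Integration.integral_diff [symmetric])
       (auto intro!: int continuous_intros cS cx simp: algebra_simps)
  finally have f1: "integral {0..x} (\<lambda>t. C (x - t) * (V (w\<^sup>2) t * y t)) =
     dy x - dy 0 - w\<^sup>2 * integral {0..x} (\<lambda>t. S (x - t) * dy t) + integral {0..x} (\<lambda>t. w\<^sup>2 * S (x - t)
       * dy 0)" by simp
  have f2: "integral {0..x} (\<lambda>t. w\<^sup>2 * S (x - t) * dy 0) = dy 0 - C x * dy 0"
  proof -
    have "((\<lambda>t. w\<^sup>2 * S (x - t) * dy 0) has_integral (C (x - x) * dy 0) - (C (x - 0) * dy 0)) {0..x}"
      by (rule fundamental_theorem_of_calculus[OF x0])
         (rule has_vector_derivative_mult_left, rule C')
    from integral_unique[OF this] show ?thesis by (simp add: SC0)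
  qed
  have f3: "integral {0..x} (\<lambda>t. S (x - t) * dy t) - integral {0..x} (\<lambda>t. C (x - t) * y t) = - S x * y 0"
  proof -
    have "((\<lambda>t. S (x - t) * dy t + - C (x - t) * y t) has_integral S (x - x) * y x - S (x - 0) * y 0) {0..x}"
      by (rule fundamental_theorem_of_calculus[OF x0])
         (rule has_vector_derivative_mult[OF S' yd])
    then have "integral {0..x} (\<lambda>t. S (x - t) * dy t - C (x - t) * y t) = - S x * y 0"
      by (simp add: SC0 integral_unique)
    then show ?thesis
      by (subst (asm) Henstock_Kurzweil_Integration.integral_diff)
         (auto intro!: int continuous_intros cC cS cx)
  qed
  have f3': "integral {0..x} (\<lambda>t. S (x - t) * dy t) = integral {0..x} (\<lambda>t. C (x - t) * y t) - S x * y 0"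
    using f3 by (simp add: algebra_simps)
  show "dy x = dy 0 * C x - w\<^sup>2 * y 0 * S x + integral {0..x} (\<lambda>t. C (x - t) * (of_real (p t) * y t))"
    unfolding py(2)[OF cC] f1 f2 f3' by (simp add: algebra_simps)
qed

definition L1 :: real where "L1 = integral {0..1} (\<lambda>t. \<bar>p t\<bar>)"

lemma abs_p_integrable: "x \<in> {0..1} \<Longrightarrow> (\<lambda>t. \<bar>p t\<bar>) integrable_on {0..x}"
  using integrable_on_initial(3)[OF abs_int, of x] by simp

lemma L1_ge: "x \<in> {0..1} \<Longrightarrow> integral {0..x} (\<lambda>t. \<bar>p t\<bar>) \<le> L1" "L1 \<ge> 0"
  unfolding L1_def by (auto intro!: integral_subset_le abs_p_integrable integral_nonneg)

text \<open>Both \<open>cos (w t)\<close> and \<open>sin (w t)\<close> are at most \<open>exp (|Im w| t)\<close>; the exponentials of a convolution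
  combine to \<open>exp (|Im w| x)\<close>.\<close>

lemma convolution_bound:
  fixes K f :: "real \<Rightarrow> complex"
  assumes K: "continuous_on {0..1} K" "\<And>t. t \<in> {0..x} \<Longrightarrow> norm (K t) \<le> A * exp (s * (x - t))"
    and f: "continuous_on {0..1} f" "\<And>t. t \<in> {0..x} \<Longrightarrow> norm (f t) \<le> B * exp (s * t)"
    and x: "x \<in> {0..1}"
  shows "norm (integral {0..x} (\<lambda>t. K t * (of_real (p t) * f t))) \<le> A * B * L1 * exp (s * x)"
proof -
  have A: "A \<ge> 0" "B \<ge> 0"
    using K(2)[of x] norm_ge_zero[of "K x"] f(2)[of 0] norm_ge_zero[of "f 0"] x
      by (auto simp del: norm_ge_zero)
  have "(\<lambda>t. (K t * f t) * of_real (p t)) absolutely_integrable_on {0..1}"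
    by (intro absolutely_integrable_continuous_mult complex_potential continuous_intros K f)
  then have ai: "(\<lambda>t. K t * (of_real (p t) * f t)) absolutely_integrable_on {0..1}" by (simp add: mult_ac)
  have "norm (integral {0..x} (\<lambda>t. K t * (of_real (p t) * f t))) \<le> integral {0..x} (\<lambda>t. A * B * exp (s
    * x) * \<bar>p t\<bar>)"
  proof (rule integral_norm_le[OF ai x])
    fix t assume t: "t \<in> {0..x}"
    have "norm (K t) * norm (f t) \<le> (A * exp (s * (x - t))) * (B * exp (s * t))"
      using K(2)[OF t] f(2)[OF t] A by (intro mult_mono) auto
    also have "\<dots> = A * B * exp (s * x)" by (simp add: algebra_simps flip: exp_add)
    finally have "norm (K t) * norm (f t) * \<bar>p t\<bar> \<le> A * B * exp (s * x) * \<bar>p t\<bar>"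
      by (rule mult_right_mono) auto
    then show "norm (K t * (of_real (p t) * f t)) \<le> A * B * exp (s * x) * \<bar>p t\<bar>"
      by (simp add: norm_mult mult_ac)
  qed (intro integrable_on_mult_right abs_p_integrable x)
  also have "\<dots> = A * B * exp (s * x) * integral {0..x} (\<lambda>t. \<bar>p t\<bar>)" by simp
  also have "\<dots> \<le> A * B * exp (s * x) * L1" using A L1_ge x by (intro mult_left_mono) auto
  finally show ?thesis by (simp add: mult_ac)
qed

text \<open>A bootstrap: if |sol| is at most M exp (s t), with \<open>M\<close> optimal, the
  convolution term in Duhamel's formula is at most (M L1 / |w|) exp (s t). As |w| \<ge> 2 L1 + 1,
  this gives M \<le> N + M / 2, hence M \<le> 2 N, which is fed back into the error.\<close>

lemma sol_asymptotics:
  assumes w: "norm w \<ge> 2 * L1 + 1" and N: "norm u + norm v / norm w \<le> N" and x: "x \<in> {0..1}"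
  shows "norm (sol (w\<^sup>2) u v x - (u * cos (w * of_real x) + v * (sin (w * of_real x) / w)))
     \<le> 2 * N * L1 / norm w * exp (\<bar>Im w\<bar> * x)"
proof -
  define s where "s = \<bar>Im w\<bar>"
  have w0: "w \<noteq> 0" "norm w > 0" using w L1_ge(2) by auto
  note sl = sol_solution[of "w\<^sup>2" u v]
  have c: "continuous_on {0..1} (sol (w\<^sup>2) u v)" by (rule solution_continuous[OF sl])
  have trig: "norm (cos (w * of_real t)) \<le> exp (s * t)" "norm (sin (w * of_real t)) \<le> exp (s * t)"
    if "t \<ge> 0" for t
    using norm_cos_sin_le[of "w * of_real t"] that by (auto simp: s_def abs_mult)
  have "continuous_on {0..1} (\<lambda>t. norm (sol (w\<^sup>2) u v t) * exp (- (s * t)))"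
    by (intro continuous_intros c)
  from continuous_attains_sup[OF compact_Icc _ this] obtain t0 where t0: "t0 \<in> {0..1}"
    "\<And>t. t \<in> {0..1} \<Longrightarrow> norm (sol (w\<^sup>2) u v t) * exp (- (s * t)) \<le> norm (sol (w\<^sup>2) u v t0) * exp (- (s * t0))"
    by fastforce
  define M where "M = norm (sol (w\<^sup>2) u v t0) * exp (- (s * t0))"
  have M: "norm (sol (w\<^sup>2) u v t) \<le> M * exp (s * t)" if "t \<in> {0..1}" for t
    using t0(2)[OF that] unfolding M_def[symmetric] by (simp add: exp_minus field_simps)
  have err: "norm (sol (w\<^sup>2) u v x - (u * cos (w * of_real x) + v * (sin (w * of_real x) / w)))
     \<le> M * L1 / norm w * exp (s * x)" if x: "x \<in> {0..1}" for x
  proof -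
    have "norm (integral {0..x} (\<lambda>t. (sin (w * of_real (x - t)) / w) * (of_real (p t) * sol (w\<^sup>2) u v t)))
       \<le> (1 / norm w) * M * L1 * exp (s * x)"
    proof (rule convolution_bound[OF _ _ c _ x])
      show "norm (sin (w * of_real (x - t)) / w) \<le> 1 / norm w * exp (s * (x - t))" if "t \<in> {0..x}" for t
        using trig(2)[of "x - t"] that w0 by (simp add: norm_divide divide_right_mono)
    qed (use M x w0 in \<open>auto intro!: continuous_intros\<close>)
    then show ?thesis
      using variation_of_constants(1)[OF sl w0(1) x] by (simp add: sol_init)
  qed
  have "norm (sol (w\<^sup>2) u v t0) \<le> N * exp (s * t0) + M * L1 / norm w * exp (s * t0)"
  proof -
    have "norm (u * cos (w * of_real t0) + v * (sin (w * of_real t0) / w)) \<le> norm u * exp (s * t0)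
      + norm v * (exp (s * t0) / norm w)"
      by (rule order_trans[OF norm_triangle_ineq])
         (use trig[of t0] t0 w0 in \<open>auto simp: norm_mult norm_divide intro!: add_mono mult_left_mono
           divide_right_mono\<close>)
    also have "\<dots> = (norm u + norm v / norm w) * exp (s * t0)" by (simp add: algebra_simps)
    also have "\<dots> \<le> N * exp (s * t0)" using N by (intro mult_right_mono) auto
    finally show ?thesis
      using err[OF t0(1)] norm_triangle_ineq2[of "sol (w\<^sup>2) u v t0" "u * cos (w * of_real t0) + v
        * (sin (w * of_real t0) / w)"] by linarith
  qed
  then have "M \<le> N + M * L1 / norm w"
    unfolding M_def by (simp add: exp_minus field_simps)
  moreover have "M * L1 / norm w \<le> M * (1/2)"
  proof -
    have "M \<ge> 0" by (simp add: M_def)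
    moreover have "L1 / norm w \<le> 1/2" using w w0 by (simp add: field_simps)
    ultimately have "M * (L1 / norm w) \<le> M * (1/2)" by (rule mult_left_mono[rotated])
    then show ?thesis by simp
  qed
  ultimately have "M \<le> 2 * N" by linarith
  then have "M * L1 / norm w * exp (s * x) \<le> 2 * N * L1 / norm w * exp (s * x)"
    using L1_ge(2) by (intro mult_right_mono divide_right_mono) auto
  with err[OF x] show ?thesis unfolding s_def by linarith
qed

end

context potential
begin

lemma vartheta_eq: "vartheta p 1 l = sol l 1 0 1" and varphi'_eq: "varphi' p 1 l = sol' l 0 1 1"
  by (simp_all add: vartheta_def varphi'_def cauchy_data_eq)

lemma F_holomorphic: "F p holomorphic_on UNIV"
proof -
  have "(\<lambda>l. F p l) holomorphic_on UNIV"
    unfolding F_def Delta_def Delta_minus_def vartheta_eq varphi'_eq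
    by (intro holomorphic_intros sol_holomorphic) auto
  then show ?thesis by simp
qed

lemma F_cnj: "F p (cnj l) = cnj (F p l)"
  using sol_cnj(1)[of 1 l 1 0] sol_cnj(2)[of 1 l 0 1]
  by (simp add: F_def Delta_def Delta_minus_def vartheta_eq varphi'_eq)

text \<open>For a potential of mean zero, the first order terms of \<open>\<vartheta>(1)\<close> and \<open>\<phi>'(1)\<close> add up to
  \<open>sin w / w\<close> times the mean.\<close>

lemma F_asymptotics:
  assumes mean: "integral {0..1} p = 0" and w: "norm w \<ge> 2 * L1 + 1"
  shows "norm (F p (w\<^sup>2) - F0 (w\<^sup>2)) \<le> (20 * L1\<^sup>2) * exp (2 * \<bar>Im w\<bar>) / (norm w)\<^sup>2"
proof -
  define s where "s = \<bar>Im w\<bar>"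
  define E where "E = exp s"
  define S C where "S = (\<lambda>t. sin (w * of_real t) / w)" and "C = (\<lambda>t. cos (w * of_real t))"
  have w0: "w \<noteq> 0" "norm w > 0" using w L1_ge(2) by auto
  have trig: "norm (cos (w * of_real t)) \<le> exp (s * t)" "norm (sin (w * of_real t)) \<le> exp (s * t)"
    if "t \<ge> 0" for t
    using norm_cos_sin_le[of "w * of_real t"] that by (auto simp: s_def abs_mult)
  have bS: "norm (S t) \<le> 1 / norm w * exp (s * t)" and bC: "norm (C t) \<le> 1 * exp (s * t)" if "t \<ge> 0" for t
    using trig[OF that] w0 by (auto simp: S_def C_def norm_divide divide_right_mono)
  have cSC: "continuous_on X S" "continuous_on X C" "continuous_on X (\<lambda>t. S (1
    - t))" "continuous_on X (\<lambda>t. C (1 - t))" for X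
    unfolding S_def C_def using w0 by (auto intro!: continuous_intros)
  define \<theta> \<phi> where "\<theta> = sol (w\<^sup>2) 1 0" and "\<phi> = sol (w\<^sup>2) 0 1"
  have init: "\<theta> 0 = 1" "\<phi> 0 = 0" by (simp_all add: \<theta>_def \<phi>_def sol_init)
  have c: "continuous_on {0..1} \<theta>" "continuous_on {0..1} \<phi>"
    unfolding \<theta>_def \<phi>_def by (rule solution_continuous[OF sol_solution])+
  have a\<theta>: "norm (\<theta> t - C t) \<le> 2 * L1 / norm w * exp (s * t)" if "t \<in> {0..1}" for t
    using sol_asymptotics[OF w, of 1 0 1 t] that by (simp add: \<theta>_def C_def s_def)
  have a\<phi>: "norm (\<phi> t - S t) \<le> 2 * L1 / (norm w)\<^sup>2 * exp (s * t)" if "t \<in> {0..1}" for t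
    using sol_asymptotics[OF w, of 0 1 "1 / norm w" t] that by (simp add: \<phi>_def S_def s_def power2_eq_square)
  define IC where "IC = integral {0..1} (\<lambda>t. S (1 - t) * (of_real (p t) * C t))"
  define IS where "IS = integral {0..1} (\<lambda>t. C (1 - t) * (of_real (p t) * S t))"
  have int: "(\<lambda>t. K t * (of_real (p t) * f t)) integrable_on {0..1}"
    if "continuous_on {0..1} K" "continuous_on {0..1} f" for K f :: "real \<Rightarrow> complex"
  proof -
    have "(\<lambda>t. (K t * f t) * of_real (p t)) absolutely_integrable_on {0..1}"
      by (intro absolutely_integrable_continuous_mult complex_potential continuous_intros that)
    then have "(\<lambda>t. K t * (of_real (p t) * f t)) absolutely_integrable_on {0..1}" by (simp add: mult_ac)
    then show ?thesis using absolutely_integrable_on_def by blast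
  qed
  have e1: "norm (\<theta> 1 - cos w - IC) \<le> 2 * L1\<^sup>2 / (norm w)\<^sup>2 * E"
  proof -
    have "\<theta> 1 - cos w - IC = integral {0..1} (\<lambda>t. S (1 - t) * (of_real (p t) * (\<theta> t - C t)))"
      using variation_of_constants(1)[OF sol_solution[of "w\<^sup>2" 1 0] w0(1), of 1]
        Henstock_Kurzweil_Integration.integral_diff[OF int[OF cSC(3) c(1)] int[OF cSC(3,2)]]
      by (simp add: sol_init init IC_def \<theta>_def[symmetric] S_def C_def algebra_simps)
    also have "norm \<dots> \<le> 1 / norm w * (2 * L1 / norm w) * L1 * exp (s * 1)"
      by (rule convolution_bound) (use bS[of "1 - t" for t] a\<theta> in \<open>auto intro!: continuous_intros cSC c\<close>)
    finally show ?thesis by (simp add: E_def power2_eq_square)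
  qed
  have e2: "norm (sol' (w\<^sup>2) 0 1 1 - cos w - IS) \<le> 2 * L1\<^sup>2 / (norm w)\<^sup>2 * E"
  proof -
    have "sol' (w\<^sup>2) 0 1 1 - cos w - IS = integral {0..1} (\<lambda>t. C (1 - t) * (of_real (p t) * (\<phi> t - S t)))"
      using variation_of_constants(2)[OF sol_solution[of "w\<^sup>2" 0 1] w0(1), of 1]
        Henstock_Kurzweil_Integration.integral_diff[OF int[OF cSC(4) c(2)] int[OF cSC(4,1)]]
      by (simp add: sol_init init IS_def \<phi>_def[symmetric] S_def C_def algebra_simps)
    also have "norm \<dots> \<le> 1 * (2 * L1 / (norm w)\<^sup>2) * L1 * exp (s * 1)"
      by (rule convolution_bound) (use bC[of "1 - t" for t] a\<phi> in \<open>auto intro!: continuous_intros cSC c\<close>)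
    finally show ?thesis by (simp add: E_def power2_eq_square)
  qed
  have "IC + IS = integral {0..1} (\<lambda>t. sin w / w * of_real (p t))"
  proof -
    have "IC + IS = integral {0..1} (\<lambda>t. S (1 - t) * (of_real (p t) * C t) + C (1 - t) * (of_real (p t)
      * S t))"
      unfolding IC_def IS_def by (rule Henstock_Kurzweil_Integration.integral_add[symmetric]) (auto
        intro!: int cSC)
    also have "(\<lambda>t. S (1 - t) * (of_real (p t) * C t) + C (1 - t) * (of_real (p t) * S t))
      = (\<lambda>t. sin w / w * of_real (p t))"
    proof
      fix t
      have "sin w = sin (w * of_real (1 - t) + w * of_real t)" by (simp add: algebra_simps)
      also have "\<dots> = sin (w * of_real (1 - t)) * cos (w * of_real t) + cos (w * of_real (1 - t)) * sin (w
        * of_real t)"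
        by (rule sin_add)
      finally show "S (1 - t) * (of_real (p t) * C t) + C (1 - t) * (of_real (p t) * S t) = sin w / w
        * of_real (p t)"
        using w0 by (simp add: S_def C_def field_simps)
    qed
    finally show ?thesis .
  qed
  also have "\<dots> = sin w / w * of_real (integral {0..1} p)"
  proof -
    have "p integrable_on {0..1}" using abs_int absolutely_integrable_on_def by blast
    from integral_linear[where h = "of_real :: real \<Rightarrow> complex", OF this bounded_linear_of_real]
    show ?thesis by (simp add: o_def)
  qed
  finally have IZ: "IS = - IC" using mean by (simp add: eq_neg_iff_add_eq_0 add.commute)
  have bIC: "norm IC \<le> L1 / norm w * E"
  proof -
    have "norm IC \<le> 1 / norm w * 1 * L1 * exp (s * 1)" unfolding IC_def
      by (rule convolution_bound) (use bS[of "1 - t" for t] bC in \<open>auto intro!: continuous_intros cSC\<close>)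
    then show ?thesis by (simp add: E_def)
  qed
  define D Dm where "D = Delta p (w\<^sup>2)" and "Dm = Delta_minus p (w\<^sup>2)"
  define r where "r = L1 / norm w"
  have r: "0 \<le> r" "r \<le> 1/2" using w w0 L1_ge(2) by (auto simp: r_def field_simps)
  have E1: "E \<ge> 1" unfolding E_def s_def by simp
  have e1': "norm (\<theta> 1 - cos w - IC) \<le> 2 * r\<^sup>2 * E" and e2': "norm (sol' (w\<^sup>2) 0 1 1 - cos w + IC) \<le> 2
    * r\<^sup>2 * E"
    and bIC': "norm IC \<le> r * E"
    using e1 e2 bIC unfolding IZ r_def by (auto simp: power_divide)
  \<comment> \<open>The first order terms \<open>IC\<close> and \<open>IS\<close> cancel in the sum,
    so the error of \<open>D\<close> is quadratic in \<open>r\<close>. In the difference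
    \<open>Dm\<close> a term linear in \<open>r\<close> survives, but \<open>F\<close> contains
    \<open>Dm\<close> only through its square.\<close>
  have D: "norm (D - cos w) \<le> 2 * r\<^sup>2 * E"
  proof -
    have *: "D - cos w = ((\<theta> 1 - cos w - IC) + (sol' (w\<^sup>2) 0 1 1 - cos w + IC)) / 2"
      by (simp add: D_def Delta_def vartheta_eq varphi'_eq \<theta>_def field_simps)
    have "norm ((\<theta> 1 - cos w - IC) + (sol' (w\<^sup>2) 0 1 1 - cos w + IC)) \<le> 2 * (2 * r\<^sup>2 * E)"
      using norm_triangle_ineq[of "\<theta> 1 - cos w - IC" "sol' (w\<^sup>2) 0 1 1 - cos w + IC"] e1' e2' by linarith
    then show ?thesis unfolding * by (simp add: norm_divide)
  qed
  have Dm: "norm Dm \<le> 2 * r * E"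
  proof -
    have "Dm = ((sol' (w\<^sup>2) 0 1 1 - cos w + IC) - (\<theta> 1 - cos w - IC)) / 2 - IC"
      by (simp add: Dm_def Delta_minus_def vartheta_eq varphi'_eq \<theta>_def field_simps)
    moreover have "norm ((sol' (w\<^sup>2) 0 1 1 - cos w + IC) - (\<theta> 1 - cos w - IC)) \<le> 2 * (2 * r\<^sup>2 * E)"
      using norm_triangle_ineq4[of "sol' (w\<^sup>2) 0 1 1 - cos w + IC" "\<theta> 1 - cos w - IC"] e1' e2' by linarith
    ultimately have "norm Dm \<le> 2 * r\<^sup>2 * E + r * E"
      using bIC' norm_triangle_ineq4[of "((sol' (w\<^sup>2) 0 1 1 - cos w + IC) - (\<theta> 1 - cos w - IC)) / 2" IC]
      by (simp add: norm_divide)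
    also have "2 * r\<^sup>2 \<le> r" using r mult_left_mono[of r "1/2" r] by (simp add: power2_eq_square)
    then have "2 * r\<^sup>2 * E \<le> r * E" using E1 by (intro mult_right_mono) auto
    finally show ?thesis by (simp add: mult_ac)
  qed
  have cosE: "norm (cos w) \<le> E" using trig(1)[of 1] by (simp add: E_def)
  have F0w: "F0 (w\<^sup>2) = (9 * (cos w)\<^sup>2 - 5) / 4"
  proof -
    have "cos (csqrt (w\<^sup>2)) = cos w" using csqrt_unique[of w "w\<^sup>2"] csqrt_unique[of "-w" "w\<^sup>2"]
      power2_eq_iff[of "csqrt (w\<^sup>2)" w] by auto
    then show ?thesis unfolding F0_eq cos_double_cos by (simp add: field_simps)
  qed
  have "F p (w\<^sup>2) - F0 (w\<^sup>2) = (9 * ((D - cos w) * ((D - cos w) + 2 * cos w)) - Dm * Dm) / 4"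
    unfolding F0w F_def[of p] D_def[symmetric] Dm_def[symmetric] by (simp add: power2_eq_square field_simps)
  also have "norm \<dots> \<le> (9 * ((2 * r\<^sup>2 * E) * (E + 2 * E)) + (2 * r * E) * (2 * r * E)) / 4"
  proof -
    have "2 * r\<^sup>2 \<le> 1" using r power_mono[of r "1/2" 2] by (simp add: power2_eq_square)
    then have "2 * r\<^sup>2 * E \<le> E" using E1 mult_right_mono[of "2 * r\<^sup>2" 1 E] by simp
    then have "norm ((D - cos w) + 2 * cos w) \<le> E + 2 * E"
      using D cosE norm_triangle_ineq[of "D - cos w" "2 * cos w"] by simp
    then have "norm ((D - cos w) * ((D - cos w) + 2 * cos w)) \<le> (2 * r\<^sup>2 * E) * (E + 2 * E)"
      unfolding norm_mult using D E1 by (intro mult_mono) auto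
    moreover have "norm (Dm * Dm) \<le> (2 * r * E) * (2 * r * E)"
      unfolding norm_mult using Dm E1 r by (intro mult_mono) auto
    ultimately show ?thesis
      using norm_triangle_ineq4[of "9 * ((D - cos w) * ((D - cos w) + 2 * cos w))" "Dm * Dm"]
      by (simp add: norm_divide norm_mult)
  qed
  also have "\<dots> = 29 / 2 * r\<^sup>2 * E\<^sup>2" by (simp add: power2_eq_square)
  also have "\<dots> \<le> 20 * r\<^sup>2 * E\<^sup>2" by (intro mult_right_mono) auto
  also have "\<dots> = (20 * L1\<^sup>2) * exp (2 * \<bar>Im w\<bar>) / (norm w)\<^sup>2"
    by (simp add: r_def E_def s_def power_divide exp_double)
  finally show ?thesis .
qed

end

section \<open>Reduction to a potential of mean zero\<close>

lemma L2_unit_integrable: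
  assumes "L2_unit q"
  shows "q absolutely_integrable_on {0..1}" "(\<lambda>t. (q t)\<^sup>2) integrable_on {0..1}"
    "integral {0..1} q = mean q"
proof -
  let ?M = "lebesgue_on {0<..<1::real}"
  have m: "q \<in> borel_measurable ?M" and sq: "integrable ?M (\<lambda>t. (q t)\<^sup>2)"
    using assms by (auto simp: L2_unit_def)
  have one: "integrable ?M (\<lambda>_. 1::real)"
    by (intro finite_measure.integrable_const finite_measure_lebesgue_on) simp
  have q: "integrable ?M q"
  proof (rule Bochner_Integration.integrable_bound[OF _ m])
    show "integrable ?M (\<lambda>t. 1 + (q t)\<^sup>2)" using one sq by (rule Bochner_Integration.integrable_add)
    have "\<bar>x\<bar> \<le> 1 + x\<^sup>2" for x :: real
      using zero_le_power2[of "\<bar>x\<bar> - 1"] zero_le_power2[of x] by (simp add: power2_diff)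
    then show "AE t in ?M. norm (q t) \<le> norm (1 + (q t)\<^sup>2)" by (auto intro: order_trans[OF _ abs_ge_self])
  qed
  have *: "f absolutely_integrable_on {0..1}" "integral {0..1} f = integral\<^sup>L ?M f" if "integrable ?M f"
    for f :: "real \<Rightarrow> real"
  proof -
    have neg: "negligible ({0<..<1} - {0..1} \<union> ({0..1} - {0<..<1::real}))"
      by (rule negligible_subset[of "{0,1}"]) auto
    have a: "f absolutely_integrable_on {0<..<1}"
      using that by (simp add: integrable_restrict_space set_integrable_def)
    show "f absolutely_integrable_on {0..1}"
      by (rule absolutely_integrable_spike_set[OF a]) (auto intro!: negligible_subset[OF neg])
    have "integral {0..1} f = integral {0<..<1} f"
      by (rule integral_spike_set) (auto intro!: negligible_subset[OF neg])
    also have "\<dots> = integral\<^sup>L ?M f" using lebesgue_integral_eq_integral[OF that] by simp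
    finally show "integral {0..1} f = integral\<^sup>L ?M f" .
  qed
  show "q absolutely_integrable_on {0..1}" by (rule *[OF q])
  show "(\<lambda>t. (q t)\<^sup>2) integrable_on {0..1}" using *(1)[OF sq] absolutely_integrable_on_def by blast
  show "integral {0..1} q = mean q" unfolding mean_def by (rule *(2)[OF q])
qed

lemma F_shift: "F q (z + of_real m) = F (\<lambda>t. q t - m) z"
proof -
  have "schroedinger_solution q (z + of_real m) = schroedinger_solution (\<lambda>t. q t - m) z"
    by (intro ext) (simp add: schroedinger_solution_def algebra_simps)
  then show ?thesis
    by (simp add: F_def Delta_def Delta_minus_def vartheta_def varphi'_def cauchy_data_def)
qed

text \<open>Holomorphy and reality are taken from \<open>q\<close> itself, the asymptotics from
  \<open>q\<close> minus its mean: subtracting a constant from the potential only translates the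
  spectral parameter.\<close>

theorem F_properties:
  assumes q: "L2_unit q"
  shows "F q holomorphic_on UNIV" "F q (cnj z) = cnj (F q z)"
    "\<exists>C r. C \<ge> 0 \<and> r > 0 \<and> (\<forall>z. norm z \<ge> r \<longrightarrow> norm (F q (z + of_real (mean q)) - F0 z) \<le> C * exp (2
      * \<bar>Im (csqrt z)\<bar>) / norm z)"
proof -
  note i = L2_unit_integrable[OF q]
  interpret q: potential q by unfold_locales (rule i)+
  show "F q holomorphic_on UNIV" "F q (cnj z) = cnj (F q z)" by (rule q.F_holomorphic q.F_cnj)+
  define p where "p = (\<lambda>t. q t - mean q)"
  have c: "(\<lambda>_. mean q) absolutely_integrable_on {0..1::real}"
    by (intro absolutely_integrable_continuous_real continuous_intros)
  have qi: "q integrable_on {0..1}" using i(1) absolutely_integrable_on_def by blast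
  interpret p: potential p
  proof
    show "p absolutely_integrable_on {0..1}" unfolding p_def by (rule set_integral_diff(1)[OF i(1) c])
    have "(\<lambda>t. (q t)\<^sup>2 - (2 * mean q) * q t + (mean q)\<^sup>2) integrable_on {0..1}"
      by (intro integrable_add integrable_diff integrable_on_mult_right i qi integrable_const_ivl)
    then show "(\<lambda>t. (p t)\<^sup>2) integrable_on {0..1}" by (simp add: p_def power2_diff algebra_simps)
  qed
  have mean: "integral {0..1} p = 0"
    unfolding p_def using Henstock_Kurzweil_Integration.integral_diff[OF qi integrable_const_ivl, of
      "mean q"] i(3) by simp
  show "\<exists>C r. C \<ge> 0 \<and> r > 0 \<and> (\<forall>z. norm z \<ge> r \<longrightarrow> norm (F q (z + of_real (mean q)) - F0 z) \<le> C * exp (2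
    * \<bar>Im (csqrt z)\<bar>) / norm z)"
  proof (intro exI conjI allI impI)
    fix z :: complex assume z: "(2 * p.L1 + 1)\<^sup>2 \<le> norm z"
    have n: "(norm (csqrt z))\<^sup>2 = norm z" by (simp flip: norm_power)
    have "2 * p.L1 + 1 \<le> norm (csqrt z)"
      by (rule power2_le_imp_le) (use z n in auto)
    from p.F_asymptotics[OF mean this]
    show "norm (F q (z + of_real (mean q)) - F0 z) \<le> (20 * p.L1\<^sup>2) * exp (2 * \<bar>Im (csqrt z)\<bar>) / norm z"
      unfolding n F_shift p_def[symmetric] by simp
  qed (use p.L1_ge(2) in \<open>auto intro!: zero_less_power\<close>)
qed

section \<open>The trigonometric model and its edges\<close>

locale cosine_model =
  fixes A B :: real
  assumes AB: "1 + \<bar>B\<bar> \<le> A"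
begin

definition X0 :: "complex \<Rightarrow> complex" where
  "X0 z = of_real A * cos (2 * csqrt z) + of_real B"

lemma A_pos: "A \<ge> 1" "A > 0" using AB by auto

lemma cos_csqrt_power2: "cos (2 * csqrt (w\<^sup>2)) = cos (2 * w)"
proof -
  have "csqrt (w\<^sup>2) = w \<or> csqrt (w\<^sup>2) = - w" by (metis power2_csqrt power2_eq_iff)
  then show ?thesis by auto
qed

lemma X0_power2: "X0 (w\<^sup>2) = of_real A * cos (2 * w) + of_real B"
  by (simp add: X0_def cos_csqrt_power2)

text \<open>With \<open>\<surd>t = n\<pi>/2 + y\<close> and \<open>|y| \<le> \<tau> n\<close>, the model function \<open>(-1)\<^sup>n X0 t\<close> vanishes at \<open>|y| = \<tau> n\<close>
  and equals \<open>1\<close> at \<open>|y| = \<phi> n\<close>.\<close>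

definition \<phi> :: "nat \<Rightarrow> real" where "\<phi> n = arccos ((1 - (-1)^n * B) / A) / 2"
definition \<tau> :: "nat \<Rightarrow> real" where "\<tau> n = arccos (- ((-1)^n * B) / A) / 2"
definition R :: "nat \<Rightarrow> real" where "R n = real n * pi / 2 + \<tau> n"

lemma sgnB: "\<bar>(-1)^n * B\<bar> = \<bar>B\<bar>" by (simp add: abs_mult)

lemma phi_arg: "- 1 < (1 - (-1)^n * B) / A" "(1 - (-1)^n * B) / A \<le> 1"
  and tau_arg: "- 1 < - ((-1)^n * B) / A" "- ((-1)^n * B) / A < 1"
  and arg_less: "- ((-1)^n * B) / A < (1 - (-1)^n * B) / A"
  using AB A_pos sgnB[of n] by (auto simp: field_simps abs_if split: if_splits)

lemma cos_2phi: "cos (2 * \<phi> n) = (1 - (-1)^n * B) / A"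
  and cos_2tau: "cos (2 * \<tau> n) = - ((-1)^n * B) / A"
  using phi_arg[of n] tau_arg[of n] by (simp_all add: \<phi>_def \<tau>_def cos_arccos)

lemma phi_nonneg: "0 \<le> \<phi> n" and phi_less_tau: "\<phi> n < \<tau> n" and tau_less: "\<tau> n < pi / 2" and tau_pos: "0 < \<tau> n"
proof -
  show a: "0 \<le> \<phi> n" unfolding \<phi>_def using arccos_lbound[of "(1 - (-1)^n * B) / A"] phi_arg[of n] by simp
  show b: "\<phi> n < \<tau> n" unfolding \<phi>_def \<tau>_def
    using arccos_less_arccos[OF _ arg_less phi_arg(2), of n] tau_arg[of n] by simp
  show "\<tau> n < pi / 2" unfolding \<tau>_def using arccos_lt_bounded[OF tau_arg(1,2), of n] by simp
  show "0 < \<tau> n" using a b by simp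
qed

text \<open>Passing to the other parity changes the sign of the argument of \<open>arccos\<close>.
  Hence \<open>R n\<close> is the right end of band \<open>n\<close> and, at the same time, the left
  end of the next one.\<close>

lemma tau_Suc: "\<tau> (Suc n) = pi / 2 - \<tau> n"
  using arccos_minus[of "- ((-1)^n * B) / A"] tau_arg[of n] by (simp add: \<tau>_def)

lemma phi_parity: "even n \<Longrightarrow> \<phi> n = \<phi> 0" "odd n \<Longrightarrow> \<phi> n = \<phi> 1"
  and tau_parity: "even n \<Longrightarrow> \<tau> n = \<tau> 0" "odd n \<Longrightarrow> \<tau> n = \<tau> 1"
  by (auto simp: \<phi>_def \<tau>_def)

lemma R_eq: "R n = real (Suc n) * pi / 2 - \<tau> (Suc n)"
  by (simp add: R_def tau_Suc field_simps)

lemma R_less: "R n < R (Suc n)"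
  using tau_pos[of "Suc n"] by (simp add: R_eq[of n] R_def[of "Suc n"])

lemma R_mono: "m \<le> n \<Longrightarrow> R m \<le> R n"
  using lift_Suc_mono_le[of R m n] R_less less_imp_le by blast

lemma R_pos: "R n > 0" unfolding R_def using tau_pos[of n] by (simp add: add_nonneg_pos)

lemma R_ge: "real n \<le> R n" "R n \<le> 2 * real n + 2"
proof -
  have "real n * 2 \<le> real n * pi" using pi_ge_two by (intro mult_left_mono) auto
  then show "real n \<le> R n" using tau_pos[of n] by (simp add: R_def)
  have "real n * pi \<le> real n * 4" using pi_less_4 by (intro mult_left_mono) auto
  then show "R n \<le> 2 * real n + 2" using tau_less[of n] pi_less_4 by (simp add: R_def)
qed

text \<open>The value does not depend on \<open>n\<close>; this makes the lower bounds on the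
  circles uniform in their radius.\<close>

lemma cos_2R: "cos (2 * R n) = - B / A"
proof -
  have "cos (2 * R n) = cos (real n * pi + 2 * \<tau> n)" by (simp add: R_def algebra_simps)
  also have "\<dots> = (-1)^n * cos (2 * \<tau> n)" by (subst cos_add) simp
  also have "\<dots> = - ((-1)^n * (-1)^n) * B / A" by (simp add: cos_2tau)
  finally show ?thesis by (simp flip: power_add mult_2)
qed

lemma X0_real: "t \<ge> 0 \<Longrightarrow> X0 (of_real t) = of_real (A * cos (2 * sqrt t) + B)"
  using X0_power2[of "of_real (sqrt t)"] cos_of_real[of "2 * sqrt t", where 'a = complex]
  by (simp flip: of_real_power)

lemma X0_shift:
  assumes "t \<ge> 0"
  shows "X0 (of_real t) = of_real ((-1)^n * (A * cos (2 * (sqrt t - real n * pi / 2)) + (-1)^n * B))"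
proof -
  have "cos (2 * sqrt t) = cos (2 * (sqrt t - real n * pi / 2) + real n * pi)" by (simp add: algebra_simps)
  also have "\<dots> = (-1)^n * cos (2 * (sqrt t - real n * pi / 2))" by (subst cos_add) simp
  finally have "A * cos (2 * sqrt t) + B = (-1)^n * (A * cos (2 * (sqrt t - real n * pi / 2)) + (-1)^n * B)"
    by (cases "even n") auto
  then show ?thesis using X0_real[OF assms] by simp
qed

text \<open>In the variable \<open>sqrt t\<close>, the intervals between consecutive zeros of
  \<open>X0\<close> on the half-line. Unlike a spectral band, such an interval surrounds the n-th
  gap of the model and has its centre at n \<pi> / 2.\<close>

definition in_band :: "nat \<Rightarrow> real \<Rightarrow> bool" where
  "in_band n t \<longleftrightarrow> t \<ge> 0 \<and> \<bar>sqrt t - real n * pi / 2\<bar> < \<tau> n"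

lemma in_band_iff:
  assumes "t \<ge> 0"
  shows "in_band n t \<longleftrightarrow> (n = 0 \<or> R (n - 1) < sqrt t) \<and> sqrt t < R n"
proof (cases n)
  case 0
  then show ?thesis using assms tau_pos[of 0]
    by (auto simp: in_band_def R_def abs_less_iff intro: less_le_trans)
next
  case (Suc m)
  then show ?thesis using assms by (auto simp: in_band_def R_eq[of m] R_def[of "Suc m"] abs_less_iff)
qed

lemma in_band_nonneg: "in_band n t \<Longrightarrow> t \<ge> 0" by (simp add: in_band_def)

lemma in_band_less:
  assumes "in_band n s" "in_band m t" "n < m"
  shows "s < t"
proof -
  have "sqrt s < R n" using assms in_band_nonneg in_band_iff by blast
  also have "\<dots> \<le> R (m - 1)" using assms by (intro R_mono) auto
  also have "\<dots> < sqrt t" using assms in_band_nonneg[of m t] in_band_iff[of t m] by auto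
  finally show ?thesis by simp
qed

lemma in_band_le: "in_band n s \<Longrightarrow> in_band m t \<Longrightarrow> s \<le> t \<Longrightarrow> n \<le> m"
  by (meson in_band_less linorder_not_le order.strict_iff_not)

lemma cos_even_cases:
  fixes a b :: real
  assumes "\<bar>a\<bar> \<le> pi" "0 \<le> b" "b \<le> pi"
  shows "cos a = cos b \<longleftrightarrow> \<bar>a\<bar> = b" "cos a \<le> cos b \<longleftrightarrow> b \<le> \<bar>a\<bar>" "cos a < cos b \<longleftrightarrow> b < \<bar>a\<bar>"
proof -
  have e: "cos a = cos \<bar>a\<bar>" by simp
  show "cos a \<le> cos b \<longleftrightarrow> b \<le> \<bar>a\<bar>" unfolding e using assms by (intro cos_mono_le_eq) auto
  show "cos a < cos b \<longleftrightarrow> b < \<bar>a\<bar>" unfolding e using assms by (intro cos_mono_less_eq) auto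
  show "cos a = cos b \<longleftrightarrow> \<bar>a\<bar> = b" unfolding e using assms cos_inj_pi[of "\<bar>a\<bar>" b] by auto
qed

lemma band_sign:
  assumes "in_band n t"
  shows "(-1)^n * (A * cos (2 * sqrt t) + B) > 0"
    "X0 (of_real t) = (-1)^n \<longleftrightarrow> \<bar>sqrt t - real n * pi / 2\<bar> = \<phi> n"
proof -
  define y where "y = sqrt t - real n * pi / 2"
  have t: "t \<ge> 0" and y: "\<bar>y\<bar> < \<tau> n" using assms by (auto simp: in_band_def y_def)
  have X: "X0 (of_real t) = of_real ((-1)^n * (A * cos (2 * y) + (-1)^n * B))"
    unfolding y_def by (rule X0_shift[OF t])
  have y2: "\<bar>2 * y\<bar> \<le> pi" using y tau_less[of n] by linarith
  have "cos (2 * \<tau> n) < cos (2 * y)"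
    using y tau_less[of n] tau_pos[of n] cos_mono_less_eq[of "2 * \<tau> n" "\<bar>2 * y\<bar>"] by simp
  then have "A * cos (2 * y) + (-1)^n * B > 0" using A_pos by (simp add: cos_2tau field_simps)
  moreover have "complex_of_real (A * cos (2 * sqrt t) + B) = of_real ((-1)^n * (A * cos (2 * y) + (-1)^n
    * B))"
    using X X0_real[OF t] by metis
  then have "A * cos (2 * sqrt t) + B = (-1)^n * (A * cos (2 * y) + (-1)^n * B)"
    by (rule of_real_eq_iff[THEN iffD1])
  ultimately show "(-1)^n * (A * cos (2 * sqrt t) + B) > 0"
    by (simp add: mult.assoc[symmetric] flip: power_mult_distrib)
  have "X0 (of_real t) = (-1)^n \<longleftrightarrow> complex_of_real ((-1)^n * (A * cos (2 * y) + (-1)^n * B))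
    = of_real ((-1)^n)"
    unfolding X by simp
  also have "\<dots> \<longleftrightarrow> A * cos (2 * y) + (-1)^n * B = 1"
    unfolding of_real_eq_iff by simp
  also have "\<dots> \<longleftrightarrow> cos (2 * y) = cos (2 * \<phi> n)" using A_pos by (auto simp: cos_2phi field_simps)
  also have "\<dots> \<longleftrightarrow> \<bar>y\<bar> = \<phi> n"
    using cos_even_cases(1)[OF y2, of "2 * \<phi> n"] phi_nonneg[of n] phi_less_tau[of n] tau_less[of n]
    by (simp add: abs_mult)
  finally show "X0 (of_real t) = (-1)^n \<longleftrightarrow> \<bar>sqrt t - real n * pi / 2\<bar> = \<phi> n" unfolding y_def .
qed

text \<open>On the negative axis the cosine becomes a hyperbolic cosine larger than 1, so
  \<open>X0\<close> exceeds A - |B|, which is at least 1.\<close>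

lemma X0_neg: "t < 0 \<Longrightarrow> (X0 (of_real t))\<^sup>2 \<noteq> 1"
proof
  assume t: "t < 0" and X: "(X0 (of_real t))\<^sup>2 = 1"
  define s where "s = sqrt (- t)"
  have s: "s > 0" "(\<i> * of_real s)\<^sup>2 = complex_of_real t"
    using t by (auto simp: s_def power_mult_distrib simp flip: of_real_power)
  have "cos (2 * (\<i> * of_real s)) = complex_of_real (cosh (2 * s))"
    by (simp add: cos_exp_eq cosh_def scaleR_conv_of_real exp_of_real algebra_simps flip: exp_of_real)
  then have "X0 (of_real t) = of_real (A * cosh (2 * s) + B)"
    using X0_power2[of "\<i> * of_real s"] s by simp
  with X have "complex_of_real ((A * cosh (2 * s) + B)\<^sup>2) = of_real 1" by simp
  then have "(A * cosh (2 * s) + B)\<^sup>2 = 1" unfolding of_real_eq_iff .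
  moreover have "cosh (2 * s) > 1" using s cosh_real_strict_mono[of 0 "2 * s"] by simp
  then have "A * cosh (2 * s) + B > 1" using A_pos AB mult_strict_left_mono[of 1 "cosh (2 * s)" A] by linarith
  ultimately show False using one_less_power[of "A * cosh (2 * s) + B" 2] by simp
qed

lemma X0_R: "X0 (of_real ((R n)\<^sup>2)) = 0"
  using X0_real[of "(R n)\<^sup>2"] R_pos[of n] A_pos by (simp add: cos_2R)

text \<open>The points \<open>R n\<close> cut the half-line into bands and are excluded because
  \<open>X0\<close> vanishes there. In band \<open>n\<close> the sign of \<open>X0\<close> is that
  of (-1)^n, which decides between the values 1 and -1.\<close>

lemma band_exists:
  assumes "(X0 (of_real t))\<^sup>2 = 1"
  obtains n where "in_band n t" "X0 (of_real t) = (-1)^n"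
proof -
  have t: "t \<ge> 0" using X0_neg[of t] assms by force
  have neR: "sqrt t \<noteq> R n" for n
  proof
    assume "sqrt t = R n"
    then have "t = (R n)\<^sup>2" using t by (metis real_sqrt_pow2)
    with X0_R[of n] assms show False by simp
  qed
  obtain m where "sqrt t < R m"
    using reals_Archimedean2[of "sqrt t"] R_ge(1) by (metis less_le_trans)
  then have ex: "\<exists>m. sqrt t < R m" by blast
  define n where "n = (LEAST m. sqrt t < R m)"
  have n: "sqrt t < R n" unfolding n_def using ex by (rule LeastI_ex)
  have "n = 0 \<or> R (n - 1) < sqrt t"
  proof (cases n)
    case (Suc m)
    then have "\<not> sqrt t < R m" using not_less_Least[of m "\<lambda>m. sqrt t < R m"] by (simp add: n_def)
    then show ?thesis using Suc neR[of m] by auto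
  qed auto
  then have J: "in_band n t" using n t by (simp add: in_band_iff)
  define v where "v = A * cos (2 * sqrt t) + B"
  have Xv: "X0 (of_real t) = of_real v" unfolding v_def by (rule X0_real[OF t])
  with assms have "v\<^sup>2 = 1" by (simp flip: of_real_power add: of_real_eq_1_iff)
  then have "v = 1 \<or> v = -1" by (simp add: power2_eq_1_iff)
  moreover have "(-1)^n * v > 0" using band_sign(1)[OF J] by (simp add: v_def)
  ultimately have "v = (-1)^n" by (cases "even n") auto
  then show ?thesis using that[OF J] Xv by simp
qed

text \<open>The unperturbed edges in closed form: \<open>\<sigma>\<close> is 1 for
  \<open>Plus\<close> and -1 for \<open>Minus\<close>, and the even and odd edge families of the
  usual notation are merged into one index.\<close>

definition edge0 :: "nat \<Rightarrow> real \<Rightarrow> real" where "edge0 n \<sigma> = (real n * pi / 2 + \<sigma> * \<phi> n)\<^sup>2"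

lemma edge0_sqrt: "\<sigma> = 1 \<or> \<sigma> = -1 \<and> n \<ge> 1 \<Longrightarrow> sqrt (edge0 n \<sigma>) = real n * pi / 2 + \<sigma> * \<phi> n"
proof -
  assume a: "\<sigma> = 1 \<or> \<sigma> = -1 \<and> n \<ge> 1"
  have "real n * pi / 2 + \<sigma> * \<phi> n \<ge> 0"
  proof (cases "\<sigma> = 1")
    case False
    with a have "n \<ge> 1" "\<sigma> = -1" by auto
    then have "1 * pi \<le> real n * pi" "\<sigma> * \<phi> n = - \<phi> n" by (auto intro!: mult_right_mono)
    then show ?thesis using phi_less_tau[of n] tau_less[of n] by linarith
  qed (use phi_nonneg[of n] in auto)
  then show ?thesis by (simp add: edge0_def)
qed

lemma edge0_band:
  assumes "\<sigma> = 1 \<or> \<sigma> = -1 \<and> n \<ge> 1"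
  shows "in_band n (edge0 n \<sigma>)" "X0 (of_real (edge0 n \<sigma>)) = (-1)^n"
proof -
  have a: "\<bar>sqrt (edge0 n \<sigma>) - real n * pi / 2\<bar> = \<phi> n"
    using assms phi_nonneg[of n] by (auto simp: edge0_sqrt abs_mult)
  then show J: "in_band n (edge0 n \<sigma>)" using phi_less_tau[of n] by (simp add: in_band_def edge0_def)
  show "X0 (of_real (edge0 n \<sigma>)) = (-1)^n" using band_sign(2)[OF J] a by simp
qed

end

text \<open>\<open>edge_labelling\<close> for an arbitrary function in place of
  \<open>xi a q\<close>, so that it applies both to the translate of \<open>xi a q\<close> by the
  mean of \<open>q\<close> and to the explicit model \<open>X0\<close>.\<close>

definition labelling :: "(complex \<Rightarrow> complex) \<Rightarrow> (nat \<Rightarrow> edge_sign \<Rightarrow> real) \<Rightarrow> bool" where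
  "labelling X L \<longleftrightarrow>
     (\<forall>n. L n Plus < L (Suc n) Minus \<and> L (Suc n) Minus \<le> L (Suc n) Plus) \<and>
     (\<forall>(n, \<nu>)\<in>edge_index. X (of_real (L n \<nu>)) = (-1) ^ n) \<and>
     (\<forall>z. (X z)\<^sup>2 - 1 = 0 \<longrightarrow>
        (\<exists>(n, \<nu>)\<in>edge_index. z = of_real (L n \<nu>)) \<and>
        zorder (\<lambda>w. (X w)\<^sup>2 - 1) z =
          int (card {(n, \<nu>). (n, \<nu>) \<in> edge_index \<and> of_real (L n \<nu>) = z}))"

lemma edge_labelling_iff: "edge_labelling a q L \<longleftrightarrow> labelling (xi a q) L"
  by (simp add: edge_labelling_def labelling_def)

lemma edge_index_iff: "(n, \<nu>) \<in> edge_index \<longleftrightarrow> n \<ge> 1 \<or> \<nu> = Plus"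
  by (auto simp: edge_index_def)

lemma edge_sign_cases: "\<nu> = Minus \<or> \<nu> = Plus" by (cases \<nu>) auto

lemma finite_edge_sign [simp]: "finite (S :: edge_sign set)"
  by (rule finite_subset[of _ "{Minus, Plus}"]) (use edge_sign_cases in auto)

context
  fixes X L assumes lab: "labelling X L"
begin

lemma labelling_step: "L n Plus < L (Suc n) Minus" "L (Suc n) Minus \<le> L (Suc n) Plus"
  using lab by (auto simp: labelling_def)

lemma labelling_val: "(n, \<nu>) \<in> edge_index \<Longrightarrow> X (of_real (L n \<nu>)) = (-1) ^ n"
  using lab by (auto simp: labelling_def)

lemma labelling_zero: "(X z)\<^sup>2 = 1 \<Longrightarrow> \<exists>n \<nu>. (n, \<nu>) \<in> edge_index \<and> z = of_real (L n \<nu>)"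
  using lab by (fastforce simp: labelling_def)

lemma labelling_zorder: "(X z)\<^sup>2 = 1 \<Longrightarrow>
  zorder (\<lambda>w. (X w)\<^sup>2 - 1) z = int (card {e. e \<in> edge_index \<and> of_real (case_prod L e) = z})"
proof -
  assume "(X z)\<^sup>2 = 1"
  moreover have "{e. e \<in> edge_index \<and> of_real (case_prod L e) = z} = {(n, \<nu>). (n, \<nu>) \<in> edge_index
    \<and> of_real (L n \<nu>) = z}"
    by auto
  ultimately show ?thesis using lab unfolding labelling_def by auto
qed

lemma labelling_Plus_less: "n < m \<Longrightarrow> L n Plus < L m Plus"
proof (induction m)
  case (Suc m)
  have "L m Plus < L (Suc m) Plus" using labelling_step[of m] by linarith
  then show ?case using Suc by (cases "n = m") auto
qed auto

lemma labelling_less: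
  assumes "(n, \<nu>) \<in> edge_index" "n < m"
  shows "L n \<nu> < L m \<mu>"
proof -
  obtain k where k: "m = Suc k" using assms by (cases m) auto
  have "L n \<nu> \<le> L n Plus"
    using assms(1) labelling_step(2)[of "n - 1"] edge_sign_cases[of \<nu>]
      by (cases n) (auto simp: edge_index_iff)
  also have "\<dots> \<le> L k Plus" using labelling_Plus_less[of n k] assms(2) k by (cases "n = k") auto
  also have "\<dots> < L m Minus" using labelling_step(1) k by simp
  also have "L m Minus \<le> L m \<mu>" using labelling_step(2)[of k] k edge_sign_cases[of \<mu>] by auto
  finally show ?thesis .
qed

lemma labelling_first_le: "(n, \<nu>) \<in> edge_index \<Longrightarrow> L 0 Plus \<le> L n \<nu>"
  using labelling_less[of 0 Plus n \<nu>] by (cases n) (auto simp: edge_index_iff)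

lemma labelling_le_imp: "(m, \<mu>) \<in> edge_index \<Longrightarrow> L n \<nu> \<le> L m \<mu> \<Longrightarrow> n \<le> m"
  using labelling_less[of m \<mu> n \<nu>] by force

end

section \<open>Identification of the edges of the model\<close>

context cosine_model
begin

text \<open>Strong induction on \<open>n\<close>. The value (-1)^n fixes the parity of the band
  containing the edge, every band contains some labelled edge (\<open>hit\<close>), and labels and
  bands are ordered alike; so an edge can neither lag behind its band nor jump over it.\<close>

lemma model_band:
  assumes lab: "labelling X0 L" and e: "(n, \<nu>) \<in> edge_index"
  shows "in_band n (L n \<nu>)"
  using e
proof (induction n arbitrary: \<nu> rule: less_induct)
  case (less n)
  have par: "\<exists>j. in_band j (L m \<mu>) \<and> even j = even m" if "(m, \<mu>) \<in> edge_index" for m \<mu>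
  proof -
    have v: "X0 (of_real (L m \<mu>)) = (-1)^m" by (rule labelling_val[OF lab that])
    then have "(X0 (of_real (L m \<mu>)))\<^sup>2 = 1" by (simp flip: power_mult)
    then obtain j where "in_band j (L m \<mu>)" "X0 (of_real (L m \<mu>)) = (-1)^j" by (rule band_exists)
    with v show ?thesis by (intro exI[of _ j]) (cases "even j"; cases "even m"; simp)
  qed
  have hit: "\<exists>m \<mu>. (m, \<mu>) \<in> edge_index \<and> in_band k (L m \<mu>)" for k
  proof -
    have "(X0 (of_real (edge0 k 1)))\<^sup>2 = 1" using edge0_band(2)[of 1 k] by (simp flip: power_mult)
    then obtain m \<mu> where "(m, \<mu>) \<in> edge_index" "edge0 k 1 = L m \<mu>"
      using labelling_zero[OF lab] by (metis of_real_eq_iff)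
    with edge0_band(1)[of 1 k] show ?thesis by auto
  qed
  have uniq: "i = k" if "in_band i s" "in_band k s" for i k s
    using in_band_le[OF that] in_band_le[OF that(2,1)] by simp
  \<comment> \<open>The smallest edge of index \<open>n\<close>; for index 0 this is
    \<open>Plus\<close>.\<close>
  define \<nu>1 where "\<nu>1 = (if n = 0 then Plus else Minus)"
  have e1: "(n, \<nu>1) \<in> edge_index" by (auto simp: \<nu>1_def edge_index_iff)
  have first_le: "L n \<nu>1 \<le> L n \<mu>" if "(n, \<mu>) \<in> edge_index" for \<mu>
    using that labelling_step(2)[OF lab, of "n - 1"] edge_sign_cases[of \<mu>]
    by (cases n) (auto simp: \<nu>1_def edge_index_iff)
  have lower: "n \<le> j" if j: "in_band j (L n \<mu>)" "even j = even n" and "(n, \<mu>) \<in> edge_index" for j \<mu>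
  proof (cases n)
    case (Suc m)
    have "in_band m (L m Plus)" by (rule less.IH) (auto simp: Suc edge_index_iff)
    moreover have "L m Plus < L n \<mu>" using labelling_less[OF lab, of m Plus n] Suc
      by (simp add: edge_index_iff)
    ultimately have "m \<le> j" using j(1) in_band_le by (meson less_imp_le)
    then show ?thesis using j(2) Suc by (cases "j = m") auto
  qed auto
  have n1: "in_band n (L n \<nu>1)"
  proof -
    obtain j where j: "in_band j (L n \<nu>1)" "even j = even n" using par[OF e1] by blast
    obtain m \<mu> where m: "(m, \<mu>) \<in> edge_index" "in_band n (L m \<mu>)" using hit by blast
    have "n \<le> m"
    proof (rule ccontr)
      assume "\<not> n \<le> m"
      then have "in_band m (L m \<mu>)" using less.IH m by simp
      with uniq[OF m(2) this] \<open>\<not> n \<le> m\<close> show False by simp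
    qed
    then have "L n \<nu>1 \<le> L m \<mu>"
      using first_le m(1) labelling_less[OF lab e1, of m \<mu>] by (cases "n = m") auto
    then have "j \<le> n" using in_band_le[OF j(1) m(2)] by simp
    with lower[OF j e1] j(1) show ?thesis by simp
  qed
  show ?case
  proof (cases "\<nu> = \<nu>1")
    case False
    obtain j where j: "in_band j (L n \<nu>)" "even j = even n" using par[OF less.prems] by blast
    have "\<not> n < j"
    proof
      assume nj: "n < j"
      \<comment> \<open>By parity the edge would lie at least two bands too high. The labelled edge
        in the skipped band lies below it, so its index is at most \<open>n\<close>; parity excludes
        \<open>n\<close> itself and the induction hypothesis excludes anything smaller.\<close>
      with j(2) have nj2: "Suc n < j" by (cases "j = Suc n") auto
      obtain m \<mu> where m: "(m, \<mu>) \<in> edge_index" "in_band (Suc n) (L m \<mu>)" using hit by blast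
      have lt: "L m \<mu> < L n \<nu>" by (rule in_band_less[OF m(2) j(1) nj2])
      then have "m \<le> n" using labelling_le_imp[OF lab less.prems, of m \<mu>] by simp
      moreover have "m \<noteq> n"
      proof
        assume "m = n"
        obtain i where "in_band i (L m \<mu>)" "even i = even m" using par[OF m(1)] by blast
        moreover from this(1) have "Suc n = i" by (rule uniq[OF m(2)])
        ultimately show False using \<open>m = n\<close> by auto
      qed
      ultimately have "in_band m (L m \<mu>)" using less.IH[of m \<mu>] m(1) by simp
      with uniq[OF m(2) this] \<open>m \<le> n\<close> show False by simp
    qed
    with lower[OF j less.prems] j(1) show ?thesis by simp
  qed (use n1 in simp)
qed

text \<open>In band \<open>n\<close> the edge equation has only the two solutions at distance
  \<open>\<phi> n\<close> from the centre, for n = 0 only the one to the right. Each of them is hit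
  by a label, which must have index \<open>n\<close>, and the order of the two labels decides which
  is which.\<close>

lemma model_edges:
  assumes lab: "labelling X0 L"
  shows "L n Plus = edge0 n 1" "n \<ge> 1 \<Longrightarrow> L n Minus = edge0 n (-1)"
proof -
  have val: "L n \<nu> = edge0 n 1 \<or> n \<ge> 1 \<and> L n \<nu> = edge0 n (-1)" if e: "(n, \<nu>) \<in> edge_index" for \<nu>
  proof -
    note J = model_band[OF lab e]
    have t: "L n \<nu> = (sqrt (L n \<nu>))\<^sup>2" using in_band_nonneg[OF J] by simp
    have "\<bar>sqrt (L n \<nu>) - real n * pi / 2\<bar> = \<phi> n"
      using band_sign(2)[OF J] labelling_val[OF lab e] by simp
    then have s: "sqrt (L n \<nu>) = real n * pi / 2 + \<phi> n \<or> sqrt (L n \<nu>) = real n * pi / 2 - \<phi> n" by linarith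
    show ?thesis
    proof (cases "n = 0")
      case True
      have "0 \<le> sqrt (L n \<nu>)" using in_band_nonneg[OF J] by simp
      moreover have e: "real n * pi / 2 = 0" using True by simp
      ultimately have "sqrt (L n \<nu>) = \<phi> n" using s phi_nonneg[of n] unfolding e by linarith
      then show ?thesis using t True by (auto simp: edge0_def)
    next
      case False
      then show ?thesis using t s unfolding edge0_def
        by (metis One_nat_def Suc_leI add.right_neutral add_uminus_conv_diff mult_1 mult_minus_left not_gr0)
    qed
  qed
  have hit: "\<exists>\<mu>. (n, \<mu>) \<in> edge_index \<and> edge0 n \<sigma> = L n \<mu>" if \<sigma>: "\<sigma> = 1 \<or> \<sigma> = -1 \<and> n \<ge> 1" for \<sigma>
  proof -
    have "(X0 (of_real (edge0 n \<sigma>)))\<^sup>2 = 1" using edge0_band(2)[OF \<sigma>] by (simp flip: power_mult)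
    then obtain m \<mu> where m: "(m, \<mu>) \<in> edge_index" "edge0 n \<sigma> = L m \<mu>"
      using labelling_zero[OF lab] by (metis of_real_eq_iff)
    have "in_band n (L m \<mu>)" "in_band m (L m \<mu>)" using edge0_band(1)[OF \<sigma>] m model_band[OF lab m(1)] by auto
    then have "m = n" using in_band_le by (meson antisym order_refl)
    then show ?thesis using m by auto
  qed
  have le: "edge0 n (-1) \<le> edge0 n 1" if "n \<ge> 1"
    using edge0_sqrt[of 1 n] edge0_sqrt[of "-1" n] phi_nonneg[of n] that real_sqrt_le_iff[of "edge0 n
      (-1)" "edge0 n 1"] by simp
  show "L n Plus = edge0 n 1"
  proof (cases "n = 0")
    case True then show ?thesis using val[of Plus] by (simp add: edge_index_iff)
  next
    case False
    then have "L n Minus \<le> L n Plus" using labelling_step(2)[OF lab, of "n - 1"] by simp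
    moreover obtain \<mu> where "edge0 n 1 = L n \<mu>" using hit[of 1] by blast
    ultimately show ?thesis using val[of Plus] val[of Minus] le False edge_sign_cases[of \<mu>]
      by (auto simp: edge_index_iff)
  qed
  show "L n Minus = edge0 n (-1)" if n1: "n \<ge> 1"
  proof -
    have "L n Minus \<le> L n Plus" using labelling_step(2)[OF lab, of "n - 1"] n1 by simp
    moreover obtain \<mu> where "edge0 n (-1) = L n \<mu>" using hit[of "-1"] n1 by auto
    ultimately show ?thesis using val[of Plus] val[of Minus] le[OF n1] n1 edge_sign_cases[of \<mu>]
      by (auto simp: edge_index_iff)
  qed
qed

end

section \<open>Growth along parabolic envelopes\<close>

text \<open>The size of cos (2 sqrt z); it is the same for both square roots.\<close>

definition env :: "complex \<Rightarrow> real" where "env z = exp (2 * \<bar>Im (csqrt z)\<bar>)"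

text \<open>The exponent counts powers of |sqrt z|, not of |z|, since one differentiation gains
  exactly one of them.\<close>

definition growth :: "nat \<Rightarrow> (complex \<Rightarrow> complex) \<Rightarrow> bool" where
  "growth k f \<longleftrightarrow> (\<exists>C r. C \<ge> 0 \<and> r > 0 \<and> (\<forall>z. r \<le> norm z \<longrightarrow> norm (f z) \<le> C * env z / sqrt (norm z) ^ k))"

lemma env_ge: "env z \<ge> 1" "env z > 0" by (simp_all add: env_def)

lemma env_real: "t \<ge> 0 \<Longrightarrow> env (of_real t) = 1" by (simp add: env_def)

lemma norm_csqrt_sqrt: "norm (csqrt z) = sqrt (norm z)"
  by (metis abs_norm_cancel norm_power power2_csqrt real_sqrt_abs)

lemma growthE:
  assumes "growth k f"
  obtains C r where "C \<ge> 0" "r \<ge> 1" "\<And>z. r \<le> norm z \<Longrightarrow> norm (f z) \<le> C * env z / sqrt (norm z) ^ k"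
proof -
  obtain C r where C: "C \<ge> 0" "r > 0" "\<forall>z. r \<le> norm z \<longrightarrow> norm (f z) \<le> C * env z / sqrt (norm z) ^ k"
    using assms unfolding growth_def by blast
  show ?thesis by (rule that[of C "max r 1"]) (use C in auto)
qed

lemma growthI:
  assumes "\<And>z. r \<le> norm z \<Longrightarrow> norm (f z) \<le> C * env z / sqrt (norm z) ^ k"
  shows "growth k f"
proof -
  have "norm (f z) \<le> \<bar>C\<bar> * env z / sqrt (norm z) ^ k" if "max 1 r \<le> norm z" for z :: complex
  proof -
    have "C * env z / sqrt (norm z) ^ k \<le> \<bar>C\<bar> * env z / sqrt (norm z) ^ k"
      using env_ge[of z] by (intro divide_right_mono mult_right_mono) auto
    with assms[of z] that show ?thesis by auto
  qed
  then show ?thesis unfolding growth_def by (intro exI[of _ "\<bar>C\<bar>"] exI[of _ "max 1 r"]) auto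
qed

lemma growth_mono: "growth k f \<Longrightarrow> m \<le> k \<Longrightarrow> growth m f"
proof (erule growthE)
  fix C r assume km: "m \<le> k" and C: "C \<ge> 0" "r \<ge> 1" "\<And>z. r \<le> norm z \<Longrightarrow> norm (f z) \<le> C
    * env z / sqrt (norm z) ^ k"
  show ?thesis
  proof (rule growthI)
    fix z :: complex assume z: "r \<le> norm z"
    have "C * env z / sqrt (norm z) ^ k \<le> C * env z / sqrt (norm z) ^ m"
    proof (intro divide_left_mono power_increasing km)
      have "norm z > 0" using C(2) z by linarith
      then have "sqrt (norm z) > 0" by simp
      then show "0 < sqrt (norm z) ^ k * sqrt (norm z) ^ m" by simp
    qed (use C z env_ge[of z] in auto)
    with C(3)[OF z] show "norm (f z) \<le> C * env z / sqrt (norm z) ^ m" by linarith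
  qed
qed

lemma growth_add: "growth k f \<Longrightarrow> growth k g \<Longrightarrow> growth k (\<lambda>z. f z + g z)"
proof (elim growthE)
  fix C r C' r' assume C: "C \<ge> 0" "\<And>z. r \<le> norm z \<Longrightarrow> norm (f z) \<le> C * env z / sqrt (norm z) ^ k"
    and C': "C' \<ge> 0" "\<And>z. r' \<le> norm z \<Longrightarrow> norm (g z) \<le> C' * env z / sqrt (norm z) ^ k"
  show ?thesis
  proof (rule growthI)
    fix z :: complex assume "max r r' \<le> norm z"
    then show "norm (f z + g z) \<le> (C + C') * env z / sqrt (norm z) ^ k"
      using C(2)[of z] C'(2)[of z] norm_triangle_ineq[of "f z" "g z"]
      by (simp add: add_divide_distrib distrib_right)
  qed
qed

text \<open>The numbers |w' - w| and |w' + w| have product at most |w| and sum at least 2 |w|, so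
  one of them is at most 1. Which one it is does not matter, because |Im w'| ignores the sign of the
  root.\<close>

lemma Im_csqrt_near:
  assumes "norm (z' - z) \<le> norm (csqrt z)" "z \<noteq> 0"
  shows "\<bar>Im (csqrt z')\<bar> \<le> \<bar>Im (csqrt z)\<bar> + 1"
proof -
  define w w' where "w = csqrt z" and "w' = csqrt z'"
  have w0: "norm w > 0" using assms(2) by (simp add: w_def)
  have "(w' - w) * (w' + w) = z' - z" by (simp add: w_def w'_def algebra_simps flip: power2_eq_square)
  then have "norm (w' - w) * norm (w' + w) \<le> norm w" using assms(1) by (simp add: w_def flip: norm_mult)
  moreover have "2 * norm w \<le> norm (w' - w) + norm (w' + w)"
    using norm_triangle_ineq4[of "w' + w" "w' - w"] by (simp add: norm_mult flip: mult_2)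
  ultimately have "norm (w' - w) \<le> 1 \<or> norm (w' + w) \<le> 1"
  proof -
    have False if a: "norm (w' - w) > 1" "norm (w' + w) > 1"
    proof -
      have "0 < (norm (w' - w) - 1) * (norm (w' + w) - 1)" using a by (intro mult_pos_pos) auto
      then have "norm (w' - w) + norm (w' + w) < norm (w' - w) * norm (w' + w) + 1"
        by (simp add: algebra_simps)
      with \<open>norm (w' - w) * norm (w' + w) \<le> norm w\<close> \<open>2 * norm w \<le> norm (w' - w) + norm (w' + w)\<close> a
      show False by linarith
    qed
    then show ?thesis by force
  qed
  then show ?thesis
  proof
    assume "norm (w' - w) \<le> 1"
    then have "\<bar>Im w' - Im w\<bar> \<le> 1" using abs_Im_le_cmod[of "w' - w"] by simp
    then show ?thesis unfolding w_def w'_def by linarith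
  next
    assume "norm (w' + w) \<le> 1"
    then have "\<bar>Im w' + Im w\<bar> \<le> 1" using abs_Im_le_cmod[of "w' + w"] by simp
    then show ?thesis unfolding w_def w'_def by linarith
  qed
qed

text \<open>Each derivative gains a factor \<open>1 / |\<surd>z|\<close>, by Cauchy's estimate on the disc of radius \<open>|\<surd>z|\<close>.\<close>

lemma growth_deriv:
  assumes hol: "f holomorphic_on UNIV" and g: "growth k f"
  shows "growth (Suc k) (deriv f)"
  using g
proof (rule growthE)
  fix C r assume C: "C \<ge> 0" "r \<ge> 1" "\<And>z. r \<le> norm z \<Longrightarrow> norm (f z) \<le> C * env z / sqrt (norm z) ^ k"
  show ?thesis
  proof (rule growthI)
    \<comment> \<open>From |z| \<ge> 4 the radius \<open>\<rho>\<close> of the Cauchy disc is at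
      most |z| / 2, so the disc stays in |x| \<ge> |z| / 2 \<ge> r, where the bound on
      \<open>f\<close> is available.\<close>
    fix z :: complex assume z: "max 4 (2 * r) \<le> norm z"
    define \<rho> where "\<rho> = sqrt (norm z)"
    have \<rho>: "\<rho> \<ge> 2" "\<rho>\<^sup>2 = norm z" using z real_le_rsqrt[of 2 "norm z"] by (auto simp: \<rho>_def)
    then have h: "2 * \<rho> \<le> norm z" using mult_right_mono[of 2 \<rho> \<rho>] by (simp add: power2_eq_square)
    have "norm ((deriv ^^ 1) f z) \<le> fact 1 * (C * (exp 2 * env z) * 2 ^ k / \<rho> ^ k) / \<rho> ^ 1"
    proof (rule Cauchy_inequality)
      show "f holomorphic_on ball z \<rho>" "continuous_on (cball z \<rho>) f"
        using hol holomorphic_on_imp_continuous_on holomorphic_on_subset continuous_on_subset by blast+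
      fix x :: complex assume x: "norm (z - x) = \<rho>"
      have nx: "norm z / 2 \<le> norm x" using norm_triangle_ineq2[of z x] x h by linarith
      have "sqrt (norm z) / 2 \<le> sqrt (norm x)"
      proof -
        have "sqrt (norm z) / 2 = sqrt (norm z / 4)" by (simp add: real_sqrt_divide)
        also have "\<dots> \<le> sqrt (norm x)" using nx norm_ge_zero[of z] by (intro real_sqrt_le_mono) linarith
        finally show ?thesis .
      qed
      then have p: "(\<rho> / 2) ^ k \<le> sqrt (norm x) ^ k" unfolding \<rho>_def by (intro power_mono) auto
      have "\<bar>Im (csqrt x)\<bar> \<le> \<bar>Im (csqrt z)\<bar> + 1"
        by (rule Im_csqrt_near) (use x z in \<open>auto simp: norm_csqrt_sqrt norm_minus_commute \<rho>_def\<close>)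
      then have "env x \<le> exp 2 * env z" by (simp add: env_def flip: exp_add)
      then have "C * env x / sqrt (norm x) ^ k \<le> C * (exp 2 * env z) / (\<rho> / 2) ^ k"
        using C(1) p \<rho> env_ge[of x] by (intro frac_le mult_left_mono) (auto intro!: mult_nonneg_nonneg)
      also have "\<dots> = C * (exp 2 * env z) * 2 ^ k / \<rho> ^ k" by (simp add: power_divide)
      finally show "norm (f x) \<le> C * (exp 2 * env z) * 2 ^ k / \<rho> ^ k"
        using C(3)[of x] nx z by linarith
    qed (use \<rho> in auto)
    then show "norm (deriv f z) \<le> (C * exp 2 * 2 ^ k) * env z / sqrt (norm z) ^ Suc k"
      by (simp add: \<rho>_def mult_ac)
  qed
qed

lemma growth_at_real:
  assumes "growth k f"
  obtains C r where "C \<ge> 0" "r \<ge> 1" "\<And>t. r \<le> t \<Longrightarrow> norm (f (of_real t)) \<le> C / sqrt t ^ k"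
proof -
  obtain C r where C: "C \<ge> 0" "r \<ge> 1" "\<And>z. r \<le> norm z \<Longrightarrow> norm (f z) \<le> C * env z / sqrt (norm z) ^ k"
    using growthE[OF assms] by metis
  show ?thesis
  proof (rule that[OF C(1,2)])
    fix t assume "r \<le> t"
    then show "norm (f (of_real t)) \<le> C / sqrt t ^ k"
      using C(3)[of "of_real t"] C(2) env_real[of t] by simp
  qed
qed

context cosine_model
begin

lemma X0_growth: "growth 0 X0"
proof (rule growthI)
  fix z :: complex
  have "norm (cos (2 * csqrt z)) \<le> env z"
    using cmod_cos_le_exp[of 1 "2 * csqrt z"] by (simp add: env_def abs_mult)
  then have "\<bar>A\<bar> * norm (cos (2 * csqrt z)) \<le> \<bar>A\<bar> * env z" by (intro mult_left_mono) auto
  moreover have "\<bar>B\<bar> \<le> \<bar>B\<bar> * env z" using mult_left_mono[OF env_ge(1)[of z], of "\<bar>B\<bar>"] by simp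
  ultimately show "norm (X0 z) \<le> (\<bar>A\<bar> + \<bar>B\<bar>) * env z / sqrt (norm z) ^ 0"
    unfolding X0_def by (intro order_trans[OF norm_triangle_ineq]) (simp add: norm_mult distrib_right)
qed

lemma sin_2R_nz: "sin (2 * R n) \<noteq> 0" "\<bar>sin (2 * R n)\<bar> = sqrt (1 - (B / A)\<^sup>2)"
proof -
  have "(sin (2 * R n))\<^sup>2 = 1 - (B / A)\<^sup>2" using sin_squared_eq[of "2 * R n"] by (simp add: cos_2R)
  then show *: "\<bar>sin (2 * R n)\<bar> = sqrt (1 - (B / A)\<^sup>2)" by (metis real_sqrt_abs)
  have "\<bar>B / A\<bar> < 1" using AB A_pos by (simp add: abs_divide)
  then have "(B / A)\<^sup>2 < 1" by (simp add: abs_square_less_1)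
  with * show "sin (2 * R n) \<noteq> 0" by auto
qed

text \<open>On the vertical line \<open>Re w = R n\<close> the value of \<open>A cos 2w + B\<close> is real only at \<open>w = R n\<close>,
  where it is \<open>0\<close>; hence it stays away from \<open>\<plusminus>1\<close>.\<close>

lemma vertical_line_bound:
  obtains d where "d > 0" "\<And>n y \<eta>. \<bar>y\<bar> \<le> 1 \<Longrightarrow> \<bar>\<eta>\<bar> = 1 \<Longrightarrow>
    norm (of_real A * cos (2 * Complex (R n) y) + of_real B - of_real \<eta>) \<ge> d"
proof -
  define \<sigma> where "\<sigma> = sqrt (1 - (B / A)\<^sup>2)"
  have \<sigma>: "\<sigma> \<noteq> 0" using sin_2R_nz[of 0] by (auto simp: \<sigma>_def)
  \<comment> \<open>\<open>h\<close> does not involve \<open>n\<close>: cos (2 R n) is constant, and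
    sin (2 R n) has constant modulus, its sign being lost in the norm.\<close>
  define h where "h = (\<lambda>\<eta> y. norm (Complex (- B * cosh (2 * y) + B - \<eta>) (A * \<sigma> * sinh (2 * y))))"
  have hn: "norm (of_real A * cos (2 * Complex (R n) y) + of_real B - of_real \<eta>) = h \<eta> y" for n y \<eta>
  proof -
    have ch: "cosh u = (exp u + inverse (exp u)) / 2" and sh: "sinh u = (exp u - inverse (exp u)) / 2"
      for u :: real
      by (simp_all add: cosh_field_def sinh_field_def exp_minus)
    have "Re (of_real A * cos (2 * Complex (R n) y) + of_real B - of_real \<eta>) = A * (cos (2 * R n)
      * cosh (2 * y)) + B - \<eta>"
      by (simp add: Re_cos ch exp_minus)
    also have "\<dots> = - B * cosh (2 * y) + B - \<eta>" using A_pos by (simp add: cos_2R)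
    finally have re: "Re (of_real A * cos (2 * Complex (R n) y) + of_real B - of_real \<eta>) = - B * cosh (2
      * y) + B - \<eta>" .
    have im: "Im (of_real A * cos (2 * Complex (R n) y) + of_real B - of_real \<eta>) = - A * (sin (2 * R n)
      * sinh (2 * y))"
      by (simp add: Im_cos sh exp_minus field_simps)
    have "(Im (of_real A * cos (2 * Complex (R n) y) + of_real B - of_real \<eta>))\<^sup>2 = (A * \<sigma> * sinh (2 * y))\<^sup>2"
      unfolding im \<sigma>_def sin_2R_nz(2)[of n, symmetric] by (simp add: power_mult_distrib)
    then show ?thesis unfolding h_def cmod_def re by simp
  qed
  have "\<exists>d>0. \<forall>y\<in>{-1..1}. h \<eta> y \<ge> d" if \<eta>: "\<bar>\<eta>\<bar> = 1" for \<eta>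
  proof -
    have "continuous_on {-1..1} (h \<eta>)" unfolding h_def cmod_def
      by (auto intro!: continuous_intros)
    from continuous_attains_inf[OF compact_Icc _ this] obtain y0 where y0: "\<forall>y\<in>{-1..1}. h \<eta> y0 \<le> h \<eta> y"
      by auto
    have "h \<eta> y0 \<noteq> 0"
    proof
      assume "h \<eta> y0 = 0"
      then have e: "- B * cosh (2 * y0) + B - \<eta> = 0" "A * \<sigma> * sinh (2 * y0) = 0"
        by (auto simp: h_def complex_eq_iff)
      from e(2) have "y0 = 0" using A_pos \<sigma> by simp
      with e(1) \<eta> show False by simp
    qed
    then have "h \<eta> y0 > 0" by (simp add: h_def)
    with y0 show ?thesis by blast
  qed
  from this[of 1] this[of "-1"] obtain d1 d2 where d: "d1 > 0" "\<And>y. y \<in> {-1..1}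
    \<Longrightarrow> h 1 y \<ge> d1" "d2 > 0" "\<And>y. y \<in> {-1..1} \<Longrightarrow> h (-1) y \<ge> d2" by auto
  show ?thesis
  proof (rule that[of "min d1 d2"])
    fix n :: nat and y \<eta> :: real assume a: "\<bar>y\<bar> \<le> 1" "\<bar>\<eta>\<bar> = 1"
    then have "y \<in> {-1..1}" "\<eta> = 1 \<or> \<eta> = -1" by auto
    then show "norm (of_real A * cos (2 * Complex (R n) y) + of_real B - of_real \<eta>) \<ge> min d1 d2"
      unfolding hn using d by (auto intro: min.coboundedI1 min.coboundedI2)
  qed (use d in auto)
qed

text \<open>With w = sqrt z there are two regimes. For |Im w| \<ge> 1 the exponential growth of the
  cosine wins over |B| + 1. For |Im w| < 1 the arc |w| = R N is within 1 / R N of the line Re w = R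
  N, and the bound on that line is transferred.\<close>

lemma X0_lower_bound:
  obtains d N0 where "d > 0" "\<And>N z \<eta>. N \<ge> N0 \<Longrightarrow> norm z = (R N)\<^sup>2 \<Longrightarrow> \<bar>\<eta>\<bar> = 1 \<Longrightarrow> norm (X0 z - of_real \<eta>) \<ge> d
    * env z"
proof -
  obtain d where d: "d > 0" "\<And>n y \<eta>. \<bar>y\<bar> \<le> 1 \<Longrightarrow> \<bar>\<eta>\<bar> = 1 \<Longrightarrow>
    norm (of_real A * cos (2 * Complex (R n) y) + of_real B - of_real \<eta>) \<ge> d"
    using vertical_line_bound by metis
  define K where "K = 2 * A * exp 2"
  obtain N0 :: nat where N0: "2 * K / d < N0" using reals_Archimedean2 by blast
  \<comment> \<open>One entry for each regime; exp (-2) compensates for \<open>env z\<close>, which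
    is at most exp 2 when |Im w| \<le> 1.\<close>
  define \<delta> where "\<delta> = min (A / 4) (d / 2 * exp (-2))"
  show ?thesis
  proof (rule that[of \<delta> "max 1 N0"])
    show "\<delta> > 0" using d A_pos by (simp add: \<delta>_def)
    fix N and z :: complex and \<eta> assume N: "max 1 N0 \<le> N" and z: "norm z = (R N)\<^sup>2" and \<eta>: "\<bar>\<eta>\<bar> = (1::real)"
    define w where "w = csqrt z"
    define y where "y = Im w"
    have nw: "norm w = R N" using z R_pos[of N] by (simp add: w_def norm_csqrt_sqrt)
    have Xz: "X0 z = of_real A * cos (2 * w) + of_real B" by (simp add: X0_def w_def)
    have env: "env z = exp (2 * \<bar>y\<bar>)" by (simp add: env_def y_def w_def)
    show "norm (X0 z - of_real \<eta>) \<ge> \<delta> * env z"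
    proof (cases "\<bar>y\<bar> \<ge> 1")
      case True
      have c: "norm (cos (2 * w)) \<ge> (exp (2 * \<bar>y\<bar>) - exp (- (2 * \<bar>y\<bar>))) / 2"
      proof -
        have "norm (exp (\<i> * (2 * w)) + exp (- (\<i> * (2 * w)))) \<ge> exp (2 * \<bar>y\<bar>) - exp (- (2 * \<bar>y\<bar>))"
          using norm_triangle_ineq2[of "exp (\<i> * (2 * w))" "- exp (- (\<i> * (2 * w)))"]
            norm_triangle_ineq2[of "exp (- (\<i> * (2 * w)))" "- exp (\<i> * (2 * w))"]
          by (cases "y \<ge> 0") (auto simp: y_def add.commute)
        then show ?thesis by (simp add: cos_exp_eq norm_divide)
      qed
      \<comment> \<open>With E = exp (2 |y|), the bound 5 suffices for (E - 1/E) / 2 \<ge> E / 4 +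
        1; multiplied by \<open>A\<close>, the summand 1 absorbs the loss |B| + 1.\<close>
      have e2: "exp (2 * \<bar>y\<bar>) \<ge> 5"
      proof -
        have "(5::real) \<le> 1 + 2 + 2\<^sup>2 / 2" by simp
        also have "\<dots> \<le> exp 2" using exp_lower_Taylor_quadratic[of "2::real"] by simp
        also have "\<dots> \<le> exp (2 * \<bar>y\<bar>)" using True by simp
        finally show ?thesis .
      qed
      have em: "exp (- (2 * \<bar>y\<bar>)) \<le> 1 / 5" using e2 by (simp add: exp_minus field_simps)
      have "norm (X0 z - of_real \<eta>) \<ge> A * norm (cos (2 * w)) - \<bar>B\<bar> - 1"
      proof -
        have "norm (of_real A * cos (2 * w)) \<le> norm (X0 z - of_real \<eta>) + norm (of_real \<eta> - complex_of_real B)"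
          using norm_triangle_ineq[of "X0 z - of_real \<eta>" "of_real \<eta> - of_real B"] by (simp add: Xz)
        moreover have "norm (of_real \<eta> - complex_of_real B) \<le> 1 + \<bar>B\<bar>"
          using norm_triangle_ineq4[of "complex_of_real \<eta>" "of_real B"] \<eta> by simp
        ultimately show ?thesis using A_pos by (simp add: norm_mult)
      qed
      moreover have "A * norm (cos (2 * w)) \<ge> A * ((exp (2 * \<bar>y\<bar>) - exp (- (2 * \<bar>y\<bar>))) / 2)"
        using c A_pos by (intro mult_left_mono) auto
      moreover have "A * ((exp (2 * \<bar>y\<bar>) - exp (- (2 * \<bar>y\<bar>))) / 2) \<ge> A * (exp (2 * \<bar>y\<bar>) / 4 + 1)"
        using A_pos e2 em by (intro mult_left_mono) (auto simp: field_simps)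
      ultimately have "norm (X0 z - of_real \<eta>) \<ge> A * (exp (2 * \<bar>y\<bar>) / 4)"
        using AB by (simp add: distrib_left)
      moreover have "\<delta> * env z \<le> A / 4 * env z" using env_ge[of z]
        by (intro mult_right_mono) (auto simp: \<delta>_def)
      ultimately show ?thesis unfolding env by linarith
    next
      case False
      then have y1: "\<bar>y\<bar> \<le> 1" by simp
      define w1 where "w1 = Complex (R N) y"
      define u where "u = R N - Re w"
      have u0: "u \<ge> 0" using complex_Re_le_cmod[of w] nw by (simp add: u_def)
      have ww: "w1 = w + of_real u" by (simp add: w1_def u_def y_def complex_eq_iff)
      \<comment> \<open>From |w| = R N one has (R N - Re w) (R N + Re w) = y^2 \<le> 1, and Re w
        \<ge> 0 for the principal root.\<close>
      have u: "u * R N \<le> 1"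
      proof -
        have "Re w \<ge> 0" using csqrt_principal[of z] by (auto simp: w_def)
        have "(R N - Re w) * (R N + Re w) = y\<^sup>2" using nw cmod_power2[of w]
          by (simp add: y_def algebra_simps power2_eq_square)
        moreover have "(R N - Re w) * (R N + Re w) \<ge> (R N - Re w) * R N"
          using u0 \<open>Re w \<ge> 0\<close> by (intro mult_left_mono) (auto simp: u_def)
        moreover have "y\<^sup>2 \<le> 1" using y1 by (simp add: abs_square_le_1)
        ultimately show ?thesis by (simp add: u_def)
      qed
      have "cos (2 * w) - cos (2 * w1) = 2 * sin (w + w1) * sin (of_real u)"
      proof -
        have "(2 * w + 2 * w1) / 2 = w + w1" "(2 * w1 - 2 * w) / 2 = of_real u" by (simp_all add: ww)
        then show ?thesis using cos_diff_cos[of "2 * w" "2 * w1"] by (simp only:)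
      qed
      moreover have "norm (sin (w + w1)) \<le> exp 2"
        using cmod_sin_le_exp[of 1 "w + w1"] y1 by (auto simp: ww y_def intro: order_trans)
      moreover have "norm (sin (complex_of_real u)) \<le> u"
        using abs_sin_x_le_abs_x[of u] u0 by (simp add: sin_of_real)
      ultimately have cd: "norm (cos (2 * w) - cos (2 * w1)) \<le> 2 * exp 2 * u"
        using mult_mono[of "norm (sin (w + w1))" "exp 2" "norm (sin (complex_of_real u))" u]
          by (simp add: norm_mult)
      have "K * u \<le> d / 2"
      proof -
        have "2 * K / d < R N" using N0 N R_ge(1)[of N] by linarith
        then have "2 * K / d * u \<le> R N * u" using u0 by (intro mult_right_mono) auto
        also have "\<dots> \<le> 1" using u by (simp add: mult.commute)
        finally show ?thesis using d by (simp add: field_simps)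
      qed
      moreover have "norm (of_real A * (cos (2 * w) - cos (2 * w1))) \<le> K * u"
        using mult_left_mono[OF cd, of A] A_pos by (simp add: norm_mult K_def mult_ac)
      moreover have "norm (of_real A * cos (2 * w1) + of_real B - of_real \<eta>) \<le> norm (X0 z - of_real \<eta>)
        + norm (of_real A * (cos (2 * w) - cos (2 * w1)))"
      proof -
        have e: "of_real A * cos (2 * w1) + of_real B - of_real \<eta> = (X0 z - of_real \<eta>) - of_real A
          * (cos (2 * w) - cos (2 * w1))"
          by (simp add: Xz algebra_simps)
        show ?thesis unfolding e by (rule norm_triangle_ineq4)
      qed
      ultimately have "norm (X0 z - of_real \<eta>) \<ge> d / 2"
        using d(2)[OF y1 \<eta>, of N] unfolding w1_def[symmetric] by linarith
      moreover have "\<delta> * env z \<le> d / 2 * exp (-2) * exp 2"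
        unfolding env using y1 d by (intro mult_mono) (auto simp: \<delta>_def)
      moreover have "d / 2 * exp (-2) * exp 2 = d / 2" by (simp add: mult.assoc flip: exp_add)
      ultimately show ?thesis by linarith
    qed
  qed
qed

end

section \<open>Localisation of the edges\<close>

lemma winding_number_circlepath_origin:
  assumes "norm p \<noteq> \<rho>" "\<rho> > 0"
  shows "winding_number (circlepath 0 \<rho>) p = (if norm p < \<rho> then 1 else 0)"
proof (cases "norm p < \<rho>")
  case True
  then show ?thesis by (simp add: winding_number_circlepath)
next
  case False
  have "winding_number (circlepath 0 \<rho>) p = 0"
    by (rule winding_number_zero_outside[of _ "cball 0 \<rho>"]) (use False assms in auto)
  then show ?thesis using False by simp
qed

lemma entire_finite_zeros:
  assumes "g holomorphic_on UNIV" "g a \<noteq> (0::complex)"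
  shows "finite {p. norm p < \<rho> \<and> g p = 0}"
proof (cases "g constant_on UNIV")
  case True
  then obtain c where "\<And>p. g p = c" unfolding constant_on_def by blast
  then have "g p \<noteq> 0" for p using assms(2) by metis
  then show ?thesis by simp
next
  case False
  have "finite {p\<in>cball 0 \<rho>. g p = 0}"
    by (rule holomorphic_compact_finite_zeros[OF assms(1) _ _ _ _ False]) auto
  then show ?thesis by (rule finite_subset[rotated]) auto
qed

text \<open>The integral over one small circle is evaluated twice, through the residue and through
  the weighted argument principle; comparison gives the residue.\<close>

lemma residue_log_deriv:
  assumes g: "g holomorphic_on S" and K: "K holomorphic_on S" and S: "open S" "p \<in> S"
    and gp: "g p = 0" and nz: "\<And>w. w \<in> S - {p} \<Longrightarrow> g w \<noteq> 0"
  shows "residue (\<lambda>w. deriv g w * K w / g w) p = K p * of_int (zorder g p)"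
proof -
  obtain e where e: "e > 0" "ball p e \<subseteq> S" using S open_contains_ball by blast
  define r where "r = e / 2"
  have r: "r > 0" "cball p r \<subseteq> ball p e" using e by (auto simp: r_def)
  have gb: "g holomorphic_on ball p e" and Kb: "K holomorphic_on ball p e"
    using g K e holomorphic_on_subset by blast+
  have hol: "(\<lambda>w. deriv g w * K w / g w) holomorphic_on ball p e - {p}"
    by (intro holomorphic_intros holomorphic_on_subset[OF holomorphic_deriv[OF gb]]
      holomorphic_on_subset[OF gb]
       holomorphic_on_subset[OF Kb]) (use nz e in auto)
  have 1: "contour_integral (circlepath p r) (\<lambda>w. deriv g w * K w / g w) = 2 * pi * \<i>
    * residue (\<lambda>w. deriv g w * K w / g w) p"
    by (rule contour_integral_unique, rule base_residue[of "ball p e"]) (use hol r e in auto)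
  have pz: "{w \<in> ball p e. g w = 0 \<or> w \<in> {}} = {p}"
  proof -
    have "g w \<noteq> 0" if "w \<in> ball p e" "w \<noteq> p" for w using nz[of w] e that by blast
    then show ?thesis using e gp by auto
  qed
  have 2: "contour_integral (circlepath p r) (\<lambda>w. deriv g w * K w / g w) = 2 * pi * \<i> *
     (\<Sum>q\<in>{w \<in> ball p e. g w = 0 \<or> w \<in> {}}. winding_number (circlepath p r) q * K q * zorder g q)"
  proof (rule argument_principle)
    show "\<forall>z. z \<notin> ball p e \<longrightarrow> winding_number (circlepath p r) z = 0"
      using r by (intro allI impI winding_number_zero_outside[of _ "cball p r"]) auto
    show "path_image (circlepath p r) \<subseteq> ball p e - {w \<in> ball p e. g w = 0 \<or> w \<in> {}}"
      unfolding pz using r by (auto simp: path_image_circlepath)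
    show "finite {w \<in> ball p e. g w = 0 \<or> w \<in> {}}" unfolding pz by simp
  qed (use gb Kb in auto)
  have "winding_number (circlepath p r) p = 1" using r by (simp add: winding_number_circlepath)
  then show ?thesis using 1 2 unfolding pz by simp
qed

lemma log_deriv_partial_fractions:
  assumes g: "g holomorphic_on UNIV" and H: "H holomorphic_on UNIV" and \<rho>: "\<rho> > 0"
    and nz: "\<And>w. norm w = \<rho> \<Longrightarrow> g w \<noteq> 0" and z: "norm z < \<rho>" "g z \<noteq> 0"
  shows "contour_integral (circlepath 0 \<rho>) (\<lambda>w. deriv g w * H w / g w / (w - z)) = 2 * pi * \<i> *
    (deriv g z * H z / g z + (\<Sum>p\<in>{p. norm p < \<rho> \<and> g p = 0}. of_int (zorder g p) * (H p / (p - z))))"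
proof -
  define f where "f = (\<lambda>w. deriv g w * H w / g w / (w - z))"
  \<comment> \<open>The residue theorem is applied in an open disc slightly larger than the circle.
    \<open>Z\<close> contains all zeros in that disc and \<open>Zi\<close> those enclosed; the
    others have winding number 0 and drop out.\<close>
  define Z where "Z = {p. norm p < \<rho> + 1 \<and> g p = 0}"
  define Zi where "Zi = {p. norm p < \<rho> \<and> g p = 0}"
  have fin: "finite Z" unfolding Z_def by (rule entire_finite_zeros[OF g z(2)])
  have sub: "Zi \<subseteq> Z" by (auto simp: Z_def Zi_def)
  have zZ: "z \<notin> Z" using z by (auto simp: Z_def)
  note w = winding_number_circlepath_origin[OF _ \<rho>]
  have hd: "deriv g holomorphic_on A" "g holomorphic_on A" "H holomorphic_on A" for A
    using g H holomorphic_deriv[OF g] holomorphic_on_subset by blast+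
  have "contour_integral (circlepath 0 \<rho>) f = 2 * pi * \<i>
    * (\<Sum>p\<in>insert z Z. winding_number (circlepath 0 \<rho>) p * residue f p)"
  proof (rule Residue_theorem[of "ball 0 (\<rho> + 1)"])
    show "f holomorphic_on ball 0 (\<rho> + 1) - insert z Z"
      unfolding f_def by (intro holomorphic_intros hd) (auto simp: Z_def)
    show "path_image (circlepath 0 \<rho>) \<subseteq> ball 0 (\<rho> + 1) - insert z Z"
      using \<rho> nz z by (auto simp: path_image_circlepath Z_def)
    show "\<forall>z. z \<notin> ball 0 (\<rho> + 1) \<longrightarrow> winding_number (circlepath 0 \<rho>) z = 0"
      using w by (auto simp: \<rho>)
  qed (use fin in auto)
  also have "(\<Sum>p\<in>insert z Z. winding_number (circlepath 0 \<rho>) p * residue f p) = residue f z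
    + (\<Sum>p\<in>Z. winding_number (circlepath 0 \<rho>) p * residue f p)"
    using fin zZ w[of z] z by simp
  also have "(\<Sum>p\<in>Z. winding_number (circlepath 0 \<rho>) p * residue f p)
    = (\<Sum>p\<in>Zi. winding_number (circlepath 0 \<rho>) p * residue f p)"
  proof (intro sum.mono_neutral_right fin sub ballI)
    fix p assume "p \<in> Z - Zi"
    then have "norm p \<noteq> \<rho>" "\<not> norm p < \<rho>" using nz[of p] by (auto simp: Z_def Zi_def)
    then show "winding_number (circlepath 0 \<rho>) p * residue f p = 0" using w[of p] by simp
  qed
  also have "\<dots> = (\<Sum>p\<in>Zi. of_int (zorder g p) * (H p / (p - z)))"
  proof (rule sum.cong)
    fix p assume p: "p \<in> Zi"
    define S where "S = ball 0 (\<rho> + 1) - (insert z Z - {p})"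
    have "residue (\<lambda>w. deriv g w * (H w / (w - z)) / g w) p = (H p / (p - z)) * of_int (zorder g p)"
    proof (rule residue_log_deriv)
      show "open S" unfolding S_def using fin by (intro open_Diff finite_imp_closed) auto
      show "p \<in> S" using p by (auto simp: S_def Zi_def)
      show "(\<lambda>w. H w / (w - z)) holomorphic_on S"
        using p z by (intro holomorphic_intros hd) (auto simp: S_def Zi_def)
      show "g p = 0" using p by (simp add: Zi_def)
      show "\<And>w. w \<in> S - {p} \<Longrightarrow> g w \<noteq> 0" by (auto simp: S_def Z_def)
    qed (rule hd)
    moreover have "(\<lambda>w. deriv g w * (H w / (w - z)) / g w) = f" by (auto simp: f_def)
    ultimately show "winding_number (circlepath 0 \<rho>) p * residue f p = of_int (zorder g p) * (H p / (p - z))"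
      using p w[of p] by (simp add: Zi_def)
  qed simp
  also have "residue f z = deriv g z * H z / g z"
    unfolding f_def
  proof (rule residue_simple)
    show "open (ball 0 (\<rho> + 1) - Z)" using fin by (intro open_Diff finite_imp_closed) auto
    show "(\<lambda>w. deriv g w * H w / g w) holomorphic_on ball 0 (\<rho> + 1) - Z"
      by (intro holomorphic_intros hd) (auto simp: Z_def)
  qed (use z zZ in auto)
  finally show ?thesis unfolding f_def Zi_def .
qed

lemma log_deriv_residue_sum:
  assumes g: "g holomorphic_on UNIV" and H: "H holomorphic_on UNIV" and \<rho>: "\<rho> > 0"
    and nz: "\<And>w. norm w = \<rho> \<Longrightarrow> g w \<noteq> 0"
  shows "contour_integral (circlepath 0 \<rho>) (\<lambda>w. deriv g w * H w / g w) = 2 * pi * \<i> *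
    (\<Sum>p\<in>{p. norm p < \<rho> \<and> g p = 0}. of_int (zorder g p) * H p)"
proof -
  define Z where "Z = {w \<in> ball 0 (\<rho> + 1). g w = 0 \<or> w \<in> {}}"
  define Zi where "Zi = {p. norm p < \<rho> \<and> g p = 0}"
  have nz1: "g (of_real \<rho>) \<noteq> 0" using nz[of "of_real \<rho>"] \<rho> by simp
  have "finite {p. norm p < \<rho> + 1 \<and> g p = 0}" by (rule entire_finite_zeros[OF g nz1])
  then have fin: "finite Z" by (rule finite_subset[rotated]) (auto simp: Z_def)
  note w = winding_number_circlepath_origin[OF _ \<rho>]
  have "contour_integral (circlepath 0 \<rho>) (\<lambda>w. deriv g w * H w / g w) = 2 * pi * \<i> *
     (\<Sum>q\<in>Z. winding_number (circlepath 0 \<rho>) q * H q * zorder g q)"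
    unfolding Z_def
  proof (rule argument_principle)
    show "\<forall>z. z \<notin> ball 0 (\<rho> + 1) \<longrightarrow> winding_number (circlepath 0 \<rho>) z = 0"
      using w by (auto simp: \<rho>)
    show "path_image (circlepath 0 \<rho>) \<subseteq> ball 0 (\<rho> + 1) - {w \<in> ball 0 (\<rho> + 1). g w = 0 \<or> w \<in> {}}"
      using \<rho> nz by (auto simp: path_image_circlepath)
    show "finite {w \<in> ball 0 (\<rho> + 1). g w = 0 \<or> w \<in> {}}" using fin by (simp add: Z_def)
  qed (use g H holomorphic_on_subset in auto)
  also have "(\<Sum>q\<in>Z. winding_number (circlepath 0 \<rho>) q * H q * zorder g q)
    = (\<Sum>q\<in>Zi. winding_number (circlepath 0 \<rho>) q * H q * zorder g q)"
  proof (intro sum.mono_neutral_right fin ballI)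
    fix p assume "p \<in> Z - Zi"
    then have "norm p \<noteq> \<rho>" "\<not> norm p < \<rho>" using nz[of p] by (auto simp: Z_def Zi_def)
    then show "winding_number (circlepath 0 \<rho>) p * H p * zorder g p = 0" using w[of p] by simp
  qed (auto simp: Z_def Zi_def)
  also have "\<dots> = (\<Sum>p\<in>Zi. of_int (zorder g p) * H p)"
    using w by (intro sum.cong) (auto simp: Zi_def)
  finally show ?thesis unfolding Zi_def .
qed

text \<open>Sets of labels rather than of points, so that a double edge counts twice. The absolute
  value accounts for edges on the negative axis.\<close>

definition edges_below :: "(nat \<Rightarrow> edge_sign \<Rightarrow> real) \<Rightarrow> real \<Rightarrow> (nat \<times> edge_sign) set" where
  "edges_below L \<rho> = {e \<in> edge_index. \<bar>case_prod L e\<bar> < \<rho>}"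

definition edges_upto :: "nat \<Rightarrow> (nat \<times> edge_sign) set" where
  "edges_upto N = {e \<in> edge_index. fst e \<le> N}"

lemma finite_edges_upto [simp]: "finite (edges_upto N)"
  by (rule finite_subset[of _ "{..N} \<times> UNIV"]) (auto simp: edges_upto_def)

context
  fixes X L assumes lab: "labelling X L"
begin

definition fibre :: "complex \<Rightarrow> (nat \<times> edge_sign) set" where
  "fibre z = {e. e \<in> edge_index \<and> of_real (case_prod L e) = z}"

lemma finite_fibre: "finite (fibre z)"
proof (cases "fibre z = {}")
  case False
  then obtain n \<nu> where e: "(n, \<nu>) \<in> edge_index" "of_real (L n \<nu>) = z" by (auto simp: fibre_def)
  have "fibre z \<subseteq> {n} \<times> UNIV"
  proof (rule subrelI)
    fix m \<mu> assume "(m, \<mu>) \<in> fibre z"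
    then have "(m, \<mu>) \<in> edge_index" "L m \<mu> = L n \<nu>" using e by (auto simp: fibre_def)
    then have "m \<le> n" "n \<le> m" using labelling_le_imp[OF lab, of n \<nu> m \<mu>] labelling_le_imp[OF lab, of m \<mu>
      n \<nu>] e(1) by auto
    then show "(m, \<mu>) \<in> {n} \<times> UNIV" by simp
  qed
  then show ?thesis by (rule finite_subset) auto
qed auto

lemma zeros_eq: "norm z < \<rho> \<and> (X z)\<^sup>2 - 1 = 0 \<longleftrightarrow> norm z < \<rho> \<and> fibre z \<noteq> {}"
proof -
  have "(X z)\<^sup>2 - 1 = 0 \<longleftrightarrow> fibre z \<noteq> {}"
  proof
    assume "(X z)\<^sup>2 - 1 = 0"
    then show "fibre z \<noteq> {}" using labelling_zero[OF lab, of z] by (auto simp: fibre_def)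
  next
    assume "fibre z \<noteq> {}"
    then obtain n \<nu> where "(n, \<nu>) \<in> edge_index" "of_real (L n \<nu>) = z" by (auto simp: fibre_def)
    then have "X z = (-1) ^ n" using labelling_val[OF lab] by blast
    then show "(X z)\<^sup>2 - 1 = 0" by (simp flip: power_mult)
  qed
  then show ?thesis by blast
qed

text \<open>The fibres of the labelling partition the labels, and the number of labels in a fibre is
  the order of the zero; hence sums weighted by multiplicity become plain sums over labels.\<close>

lemma edges_below_zeros:
  assumes fin: "finite {p. norm p < \<rho> \<and> (X p)\<^sup>2 - 1 = 0}"
  shows "finite (edges_below L \<rho>)"
    and "(\<Sum>p\<in>{p. norm p < \<rho> \<and> (X p)\<^sup>2 - 1 = 0}. of_int (zorder (\<lambda>w. (X w)\<^sup>2 - 1) p) * h p)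
      = (\<Sum>e\<in>edges_below L \<rho>. h (of_real (case_prod L e)) :: complex)"
proof -
  let ?Z = "{p. norm p < \<rho> \<and> (X p)\<^sup>2 - 1 = 0}"
  have eq: "edges_below L \<rho> = (\<Union>p\<in>?Z. fibre p)"
  proof (intro set_eqI iffI)
    fix e assume "e \<in> edges_below L \<rho>"
    then have "e \<in> fibre (of_real (case_prod L e))" "norm (complex_of_real (case_prod L e)) < \<rho>"
      by (simp_all add: edges_below_def fibre_def)
    then show "e \<in> (\<Union>p\<in>?Z. fibre p)" using zeros_eq[of "of_real (case_prod L e)" \<rho>] by blast
  qed (auto simp: edges_below_def fibre_def)
  show "finite (edges_below L \<rho>)" unfolding eq using fin finite_fibre by auto
  have "(\<Sum>e\<in>edges_below L \<rho>. h (of_real (case_prod L e))) = (\<Sum>p\<in>?Z. \<Sum>e\<in>fibre p. h (of_real (case_prod L e)))"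
    unfolding eq by (rule sum.UNION_disjoint) (use fin finite_fibre in \<open>auto simp: fibre_def\<close>)
  also have "\<dots> = (\<Sum>p\<in>?Z. of_int (zorder (\<lambda>w. (X w)\<^sup>2 - 1) p) * h p)"
  proof (rule sum.cong)
    fix p assume "p \<in> ?Z"
    then have "zorder (\<lambda>w. (X w)\<^sup>2 - 1) p = int (card (fibre p))"
      using labelling_zorder[OF lab, of p] by (simp add: fibre_def)
    moreover have "(\<Sum>e\<in>fibre p. h (of_real (case_prod L e))) = (\<Sum>e\<in>fibre p. h p)"
      by (rule sum.cong) (auto simp: fibre_def)
    ultimately show "(\<Sum>e\<in>fibre p. h (of_real (case_prod L e))) = of_int (zorder (\<lambda>w. (X w)\<^sup>2 - 1) p) * h p"
      by simp
  qed simp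
  finally show "(\<Sum>p\<in>?Z. of_int (zorder (\<lambda>w. (X w)\<^sup>2 - 1) p) * h p)
    = (\<Sum>e\<in>edges_below L \<rho>. h (of_real (case_prod L e)))" by simp
qed

end

lemma deriv_of_real:
  assumes hol: "f holomorphic_on UNIV" and cnj: "\<And>z. f (cnj z) = cnj (f z)"
  shows "deriv f (of_real t) = of_real (Re (deriv f (of_real t)))"
proof -
  have d: "(f has_field_derivative deriv f (of_real t)) (at (of_real t))"
    by (rule holomorphic_derivI[OF hol]) auto
  then have "((cnj \<circ> f \<circ> cnj) has_field_derivative cnj (deriv f (of_real t))) (at (of_real t))"
    by (intro has_field_derivative_cnj_cnj) (simp only: complex_cnj_complex_of_real)
  also have "cnj \<circ> f \<circ> cnj = f" by (rule ext) (simp add: cnj)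
  finally have "cnj (deriv f (of_real t)) = deriv f (of_real t)" by (rule DERIV_unique[OF _ d])
  then have "Im (deriv f (of_real t)) = 0" by (simp add: complex_eq_iff)
  then show ?thesis by (simp add: complex_eq_iff)
qed

text \<open>\<open>X\<close> stands for \<open>xi a q\<close> translated by the mean of
  \<open>q\<close> and \<open>L\<close> for the edges minus the mean, so that
  \<open>L n \<nu> - L0 n \<nu>\<close> is the number \<epsilon> of the theorem. Order 2 in
  \<open>close\<close> means O(1 / |z|) relative to \<open>env\<close>.\<close>

locale perturbation = cosine_model +
  fixes X :: "complex \<Rightarrow> complex" and L L0 :: "nat \<Rightarrow> edge_sign \<Rightarrow> real"
  assumes hol: "X holomorphic_on UNIV" and hol0: "X0 holomorphic_on UNIV"
    and cnj: "\<And>z. X (cnj z) = cnj (X z)"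
    and close: "growth 2 (\<lambda>z. X z - X0 z)"
    and lab: "labelling X L" and lab0: "labelling X0 L0"
begin

lemma X_growth: "growth 0 X"
  using growth_add[OF X0_growth growth_mono[OF close, of 0]] by simp

text \<open>\<open>d\<close> is a quarter of the constant for \<open>X0\<close>. The margin of 4
  between the perturbation and the distance of \<open>X0\<close> from 1 and -1 is what Rouche's
  theorem for X^2 - 1 consumes.\<close>

lemma X_lower_bound:
  obtains d N0 where "d > 0" "\<And>N z \<eta>. N \<ge> N0 \<Longrightarrow> norm z = (R N)\<^sup>2 \<Longrightarrow> \<bar>\<eta>\<bar> = 1 \<Longrightarrow> norm (X z - of_real \<eta>) \<ge> d
    * env z"
    "\<And>N z. N \<ge> N0 \<Longrightarrow> norm z = (R N)\<^sup>2 \<Longrightarrow> norm (X z - X0 z) < d * env z"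
    "\<And>N z \<eta>. N \<ge> N0 \<Longrightarrow> norm z = (R N)\<^sup>2 \<Longrightarrow> \<bar>\<eta>\<bar> = 1 \<Longrightarrow> norm (X0 z - of_real \<eta>) \<ge> 4 * d * env z"
proof -
  obtain d N0 where d: "d > 0" "\<And>N z \<eta>. N \<ge> N0 \<Longrightarrow> norm z = (R N)\<^sup>2 \<Longrightarrow> \<bar>\<eta>\<bar> = 1 \<Longrightarrow> norm (X0 z - of_real \<eta>) \<ge> d
    * env z"
    by (rule X0_lower_bound) (rule that)
  obtain C r where C: "C \<ge> 0" "r \<ge> 1" "\<And>z. r \<le> norm z \<Longrightarrow> norm (X z - X0 z) \<le> C * env z / sqrt (norm z) ^ 2"
    by (rule growthE[OF close]) (rule that)
  obtain N1 :: nat where N1: "max r (4 * C / d) < N1" using reals_Archimedean2 by blast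
  have small: "norm (X z - X0 z) < d / 4 * env z" if N: "N \<ge> max 1 N1" "norm z = (R N)\<^sup>2" for N :: nat and z
  proof -
    have "real N * 1 \<le> R N * R N" using R_ge(1)[of N] N by (intro mult_mono) auto
    then have nz: "real N \<le> norm z" using N by (simp add: power2_eq_square)
    have z: "r \<le> norm z" "4 * C / d < norm z" using N1 N nz by auto
    have pos: "norm z > 0" using z C by linarith
    have "C * env z / sqrt (norm z) ^ 2 = C / norm z * env z" by simp
    also have "C / norm z < d / 4" using z(2) pos d by (simp add: field_simps)
    then have "C / norm z * env z < d / 4 * env z" using env_ge by (intro mult_strict_right_mono) auto
    finally show ?thesis using C(3)[OF z(1)] by linarith
  qed
  show ?thesis
  proof (rule that[of "d / 4" "max N0 (max 1 N1)"])
    fix N and z :: complex assume N: "max N0 (max 1 N1) \<le> N" "norm z = (R N)\<^sup>2"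
    show s: "norm (X z - X0 z) < d / 4 * env z" by (rule small) (use N in auto)
    fix \<eta> :: real assume \<eta>: "\<bar>\<eta>\<bar> = 1"
    show "norm (X0 z - of_real \<eta>) \<ge> 4 * (d / 4) * env z" using d(2)[OF _ N(2) \<eta>] N by simp
    moreover have "norm (X0 z - of_real \<eta>) \<le> norm (X z - of_real \<eta>) + norm (X z - X0 z)"
      using norm_triangle_ineq4[of "X z - of_real \<eta>" "X z - X0 z"] by simp
    moreover have "d * env z > 0" using d(1) env_ge(2) by simp
    ultimately show "norm (X z - of_real \<eta>) \<ge> d / 4 * env z" using s by simp
  qed (use d in auto)
qed

lemma model_edges_below: "edges_below L0 ((R N)\<^sup>2) = edges_upto N"
proof -
  have "\<bar>L0 n \<nu>\<bar> < (R N)\<^sup>2 \<longleftrightarrow> n \<le> N" if e: "(n, \<nu>) \<in> edge_index" for n \<nu>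
  proof -
    note J = model_band[OF lab0 e]
    have nn: "L0 n \<nu> \<ge> 0" by (rule in_band_nonneg[OF J])
    have "L0 n \<nu> < (R N)\<^sup>2 \<longleftrightarrow> sqrt (L0 n \<nu>) < sqrt ((R N)\<^sup>2)" by (simp only: real_sqrt_less_iff)
    then have *: "\<bar>L0 n \<nu>\<bar> < (R N)\<^sup>2 \<longleftrightarrow> sqrt (L0 n \<nu>) < R N"
      using nn R_pos[of N] by simp
    show ?thesis
    proof (cases "n \<le> N")
      case True
      then show ?thesis using J[unfolded in_band_iff[OF nn]] R_mono[OF True] unfolding * by linarith
    next
      case False
      then have "R N \<le> R (n - 1)" by (intro R_mono) auto
      then show ?thesis using False J[unfolded in_band_iff[OF nn]] unfolding * by auto
    qed
  qed
  then show ?thesis by (auto simp: edges_below_def edges_upto_def)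
qed

text \<open>Rouche's theorem on \<open>|z| = (R N)\<^sup>2\<close> counts the edges of \<open>X\<close> in the disc; as the edges are
  ordered, those in the disc are the first ones.\<close>

lemma edges_below_R:
  obtains N0 where "\<And>N. N \<ge> N0 \<Longrightarrow> edges_below L ((R N)\<^sup>2) = edges_upto N"
proof -
  obtain d N0 where d: "d > 0" "\<And>N z \<eta>. N \<ge> N0 \<Longrightarrow> norm z = (R N)\<^sup>2 \<Longrightarrow> \<bar>\<eta>\<bar> = 1 \<Longrightarrow> norm (X z - of_real \<eta>) \<ge> d
    * env z"
    "\<And>N z. N \<ge> N0 \<Longrightarrow> norm z = (R N)\<^sup>2 \<Longrightarrow> norm (X z - X0 z) < d * env z"
    "\<And>N z \<eta>. N \<ge> N0 \<Longrightarrow> norm z = (R N)\<^sup>2 \<Longrightarrow> \<bar>\<eta>\<bar> = 1 \<Longrightarrow> norm (X0 z - of_real \<eta>) \<ge> 4 * d * env z"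
    by (rule X_lower_bound) (rule that)
  \<comment> \<open>The lowest edge may be negative. It must lie in the disc, so that an edge in the
    disc brings all edges with smaller labels with it.\<close>
  obtain N1 :: nat where N1: "\<bar>L 0 Plus\<bar> < N1" using reals_Archimedean2 by blast
  have "edges_below L ((R N)\<^sup>2) = edges_upto N" if N: "N \<ge> max 1 (max N0 N1)" for N
  proof -
    define \<rho> where "\<rho> = (R N)\<^sup>2"
    have \<rho>: "\<rho> > 0" using R_pos[of N] by (simp add: \<rho>_def)
    have N': "N \<ge> N0" using N by simp
    define g g0 where "g = (\<lambda>z. (X z)\<^sup>2 - 1)" and "g0 = (\<lambda>z. (X0 z)\<^sup>2 - 1)"
    have ghol: "g holomorphic_on A" "g0 holomorphic_on A" for A
      unfolding g_def g0_def by (intro holomorphic_intros holomorphic_on_subset[OF hol]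
        holomorphic_on_subset[OF hol0]; simp)+
    have dom: "norm (g z - g0 z) < norm (g0 z)" if z: "norm z = \<rho>" for z
    proof -
      note z' = z[unfolded \<rho>_def]
      have f: "g0 z = (X0 z - of_real 1) * (X0 z - of_real (-1))"
        by (simp add: g0_def algebra_simps power2_eq_square)
      define D where "D = X z - X0 z"
      \<comment> \<open>With \<open>l\<close> and \<open>u\<close> the smaller and larger distance
        of \<open>X0 z\<close> from 1 and -1, |g0 z| = l u and |2 X0 z| \<le> 2 u. So the difference
        is at most |D| (|D| + 2 u) \<le> 3 u |D|, which is less than l u as soon as |D| < l /
        3.\<close>
      define u where "u = max (norm (X0 z - of_real 1)) (norm (X0 z - of_real (-1)))"
      define l where "l = min (norm (X0 z - of_real 1)) (norm (X0 z - of_real (-1)))"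
      have D: "norm D < l / 4" using d(3)[OF N' z'] d(4)[OF N' z', of 1] d(4)[OF N' z', of "-1"]
        by (auto simp: D_def l_def)
      then have l0: "l > 0" using norm_ge_zero[of D] by linarith
      have lu: "l \<le> u" "l * u = norm (g0 z)" unfolding f norm_mult by (auto simp: l_def u_def min_def max_def)
      have x2: "norm (2 * X0 z) \<le> 2 * u"
      proof -
        have "2 * X0 z = (X0 z - of_real 1) + (X0 z - of_real (-1))" by simp
        then have "norm (2 * X0 z) \<le> norm (X0 z - of_real 1) + norm (X0 z - of_real (-1))"
          by (metis norm_triangle_ineq)
        then show ?thesis by (simp add: u_def)
      qed
      have "g z - g0 z = D * D + D * (2 * X0 z)"
        by (simp add: D_def g_def g0_def algebra_simps power2_eq_square)
      then have "norm (g z - g0 z) \<le> norm D * norm D + norm D * norm (2 * X0 z)"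
        by (metis norm_triangle_ineq norm_mult)
      also have "\<dots> \<le> norm D * u + norm D * (2 * u)"
        using D lu x2 l0 by (intro add_mono mult_left_mono) auto
      also have "\<dots> = norm D * (3 * u)" by (simp add: algebra_simps)
      also have "\<dots> < (l / 3) * (3 * u)" using D lu l0 by (intro mult_strict_right_mono) auto
      finally show ?thesis using lu by simp
    qed
    have gnz: "g z \<noteq> 0" "g0 z \<noteq> 0" if "norm z = \<rho>" for z
    proof -
      show "g0 z \<noteq> 0" using dom[OF that] norm_ge_zero[of "g z - g0 z"] by auto
      show "g z \<noteq> 0" using dom[OF that] by (auto simp: norm_minus_commute)
    qed
    have fin: "finite {p. norm p < r \<and> g p = 0}" "finite {p. norm p < r \<and> g0 p = 0}" for r
      by (rule entire_finite_zeros[OF ghol(1), of "of_real \<rho>"], use gnz[of "of_real \<rho>"] \<rho> in simp)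
         (rule entire_finite_zeros[OF ghol(2), of "of_real \<rho>"], use gnz[of "of_real \<rho>"] \<rho> in simp)
    have fb: "{p \<in> ball 0 (\<rho> + 1). f p = 0} = {p. norm p < \<rho> + 1 \<and> f p = 0}" for f :: "complex \<Rightarrow> complex"
      by auto
    note w = winding_number_circlepath_origin[OF _ \<rho>]
    have "(\<Sum>p\<in>{p\<in>ball 0 (\<rho> + 1). g0 p + (g p - g0 p) = 0}. winding_number (circlepath 0 \<rho>) p
      * zorder (\<lambda>p. g0 p + (g p - g0 p)) p)
        = (\<Sum>p\<in>{p\<in>ball 0 (\<rho> + 1). g0 p = 0}. winding_number (circlepath 0 \<rho>) p * zorder g0 p)"
    proof (rule Rouche_theorem)
      show "path_image (circlepath 0 \<rho>) \<subseteq> ball 0 (\<rho> + 1)" using \<rho> by (auto simp: path_image_circlepath)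
      show "\<forall>z\<in>path_image (circlepath 0 \<rho>). norm (g z - g0 z) < norm (g0 z)"
        using dom \<rho> by (auto simp: path_image_circlepath)
      show "\<forall>z. z \<notin> ball 0 (\<rho> + 1) \<longrightarrow> winding_number (circlepath 0 \<rho>) z = 0" using w by (auto simp: \<rho>)
      show "(\<lambda>z. g z - g0 z) holomorphic_on ball 0 (\<rho> + 1)" by (intro holomorphic_intros ghol)
    qed (use fin ghol in \<open>auto simp: fb\<close>)
    then have eq: "(\<Sum>p\<in>{p. norm p < \<rho> + 1 \<and> g p = 0}. winding_number (circlepath 0 \<rho>) p * zorder g p)
        = (\<Sum>p\<in>{p. norm p < \<rho> + 1 \<and> g0 p = 0}. winding_number (circlepath 0 \<rho>) p * zorder g0 p)"
      by (simp add: fb)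
    have conv: "(\<Sum>p\<in>{p. norm p < \<rho> + 1 \<and> f p = 0}. winding_number (circlepath 0 \<rho>) p * zorder f p)
       = (\<Sum>p\<in>{p. norm p < \<rho> \<and> f p = 0}. of_int (zorder f p) * 1)"
      if "finite {p. norm p < \<rho> + 1 \<and> f p = 0}" "\<And>z. norm z = \<rho> \<Longrightarrow> f z \<noteq> 0" for f :: "complex \<Rightarrow> complex"
    proof -
      have "(\<Sum>p\<in>{p. norm p < \<rho> + 1 \<and> f p = 0}. winding_number (circlepath 0 \<rho>) p * zorder f p)
        = (\<Sum>p\<in>{p. norm p < \<rho> \<and> f p = 0}. winding_number (circlepath 0 \<rho>) p * zorder f p)"
      proof (intro sum.mono_neutral_right that(1) ballI)
        fix p assume "p \<in> {p. norm p < \<rho> + 1 \<and> f p = 0} - {p. norm p < \<rho> \<and> f p = 0}"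
        then have "norm p \<noteq> \<rho>" "\<not> norm p < \<rho>" using that(2)[of p] by auto
        then show "winding_number (circlepath 0 \<rho>) p * zorder f p = 0" using w[of p] by simp
      qed auto
      also have "\<dots> = (\<Sum>p\<in>{p. norm p < \<rho> \<and> f p = 0}. of_int (zorder f p) * 1)"
        using w by (intro sum.cong) auto
      finally show ?thesis .
    qed
    have "(\<Sum>p\<in>{p. norm p < \<rho> \<and> g p = 0}. of_int (zorder g p) * 1) = (\<Sum>p\<in>{p. norm p < \<rho> \<and> g0 p
      = 0}. of_int (zorder g0 p) * (1::complex))"
      using eq conv[OF fin(1) gnz(1)] conv[OF fin(2) gnz(2)] by simp
    moreover note edges_below_zeros(2)[OF lab fin(1)[unfolded g_def], where h = "\<lambda>_. 1"]
      edges_below_zeros(2)[OF lab0 fin(2)[unfolded g0_def], where h = "\<lambda>_. 1"]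
    ultimately have "complex_of_nat (card (edges_below L \<rho>)) = of_nat (card (edges_below L0 \<rho>))"
      unfolding g_def g0_def by simp
    then have "card (edges_below L \<rho>) = card (edges_below L0 \<rho>)" by (rule of_nat_eq_iff[THEN iffD1])
    then have card: "card (edges_below L \<rho>) = card (edges_upto N)" by (simp add: model_edges_below \<rho>_def)
    have finE: "finite (edges_below L \<rho>)" by (rule edges_below_zeros(1)[OF lab fin(1)[unfolded g_def]])
    have "real N * 1 \<le> R N * R N" using R_ge(1)[of N] N by (intro mult_mono) auto
    then have "real N1 \<le> \<rho>" using N by (simp add: \<rho>_def power2_eq_square)
    then have big: "\<bar>L 0 Plus\<bar> < \<rho>" using N1 by linarith
    have "edges_below L \<rho> \<subseteq> edges_upto N"
    proof (rule ccontr)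
      assume "\<not> edges_below L \<rho> \<subseteq> edges_upto N"
      then obtain e where "e \<in> edges_below L \<rho>" "e \<notin> edges_upto N" by blast
      then obtain n \<nu> where n: "(n, \<nu>) \<in> edges_below L \<rho>" "N < n" "(n, \<nu>) \<in> edge_index"
        by (cases e) (auto simp: edges_upto_def edges_below_def)
      have "edges_upto N \<subseteq> edges_below L \<rho>"
      proof (rule subrelI)
        fix m \<mu> assume m: "(m, \<mu>) \<in> edges_upto N"
        then have "L m \<mu> < L n \<nu>" using n labelling_less[OF lab, of m \<mu> n \<nu>] by (auto simp: edges_upto_def)
        moreover have "L 0 Plus \<le> L m \<mu>" using m labelling_first_le[OF lab] by (auto simp: edges_upto_def)
        ultimately show "(m, \<mu>) \<in> edges_below L \<rho>" using n m big
          by (auto simp: edges_below_def edges_upto_def)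
      qed
      then have "insert (n, \<nu>) (edges_upto N) \<subseteq> edges_below L \<rho>" using n by auto
      then have "card (insert (n, \<nu>) (edges_upto N)) \<le> card (edges_below L \<rho>)" by (rule card_mono[OF finE])
      moreover have "(n, \<nu>) \<notin> edges_upto N" using n by (auto simp: edges_upto_def)
      ultimately show False using card by simp
    qed
    then show ?thesis using card by (simp add: card_subset_eq \<rho>_def)
  qed
  then show ?thesis using that by blast
qed

end

section \<open>Expansion of the derivative at the edges\<close>

lemma sin_diff_ge:
  fixes u v :: real
  assumes "0 \<le> u" "0 \<le> v" "u \<le> b" "v \<le> b" "b < pi / 2"
  shows "cos b * \<bar>u - v\<bar> \<le> \<bar>sin u - sin v\<bar>"
proof -
  have *: "cos b * (v - u) \<le> sin v - sin u" if uv: "0 \<le> u" "u < v" "v \<le> b" for u v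
  proof -
    have "\<exists>z>u. z < v \<and> sin v - sin u = (v - u) * cos z"
      by (rule MVT2[OF uv(2)]) (auto intro!: derivative_eq_intros)
    then obtain z where z: "u < z" "z < v" "sin v - sin u = (v - u) * cos z" by blast
    have "cos b \<le> cos z" using z uv assms(5) by (intro cos_monotone_0_pi_le) auto
    then have "(v - u) * cos b \<le> (v - u) * cos z" using uv by (intro mult_left_mono) auto
    then show ?thesis using z by (simp add: mult.commute)
  qed
  show ?thesis
    using *[of u v] *[of v u] assms by (cases u v rule: linorder_cases) (auto simp: abs_minus_commute)
qed

context perturbation
begin

lemma X_real: "X (of_real t) = of_real (Re (X (of_real t)))"
proof -
  have "cnj (X (of_real t)) = X (of_real t)" using cnj[of "of_real t"] by simp
  then have "Im (X (of_real t)) = 0" by (simp add: complex_eq_iff)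
  then show ?thesis by (simp add: complex_eq_iff)
qed

text \<open>Two consecutive discs differ by exactly the labels of index \<open>n\<close>. The lower
  bound holds for the edge and not just for its modulus, because the lowest edge lies in the smaller
  disc.\<close>

lemma edges_located:
  obtains N0 where "N0 \<ge> 2" "\<And>n \<nu>. n \<ge> N0 \<Longrightarrow> (R (n - 1))\<^sup>2 \<le> L n \<nu> \<and> L n \<nu> < (R n)\<^sup>2"
    "\<And>n t. n \<ge> N0 \<Longrightarrow> (R (n - 1))\<^sup>2 \<le> t \<Longrightarrow> t < (R n)\<^sup>2 \<Longrightarrow> (X (of_real t))\<^sup>2 = 1 \<Longrightarrow> \<exists>\<nu>. t = L n \<nu>"
proof -
  obtain N0 where N0: "\<And>N. N \<ge> N0 \<Longrightarrow> edges_below L ((R N)\<^sup>2) = edges_upto N"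
    by (rule edges_below_R) (rule that)
  show ?thesis
  proof (rule that[of "N0 + 2"])
    fix n assume n: "n \<ge> N0 + 2"
    have e: "edges_below L ((R n)\<^sup>2) = edges_upto n" "edges_below L ((R (n - 1))\<^sup>2) = edges_upto (n - 1)"
      using N0[of n] N0[of "n - 1"] n by auto
    show "(R (n - 1))\<^sup>2 \<le> L n \<nu> \<and> L n \<nu> < (R n)\<^sup>2" for \<nu>
    proof -
      have i: "(n, \<nu>) \<in> edge_index" using n by (simp add: edge_index_iff)
      have "(n, \<nu>) \<in> edges_below L ((R n)\<^sup>2)" using i unfolding e by (simp add: edges_upto_def)
      moreover have "\<not> n \<le> n - 1" using n by arith
      then have "(n, \<nu>) \<notin> edges_below L ((R (n - 1))\<^sup>2)" unfolding e by (simp add: edges_upto_def)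
      moreover have "(0, Plus) \<in> edges_below L ((R (n - 1))\<^sup>2)" unfolding e
        by (simp add: edges_upto_def edge_index_iff)
      ultimately show ?thesis using i labelling_first_le[OF lab i] by (auto simp: edges_below_def)
    qed
    fix t assume t: "(R (n - 1))\<^sup>2 \<le> t" "t < (R n)\<^sup>2" and X: "(X (of_real t))\<^sup>2 = 1"
    obtain m \<mu> where m: "(m, \<mu>) \<in> edge_index" "t = L m \<mu>"
      using labelling_zero[OF lab X] by (metis of_real_eq_iff)
    have t0: "t \<ge> 0" using t(1) zero_le_power2[of "R (n - 1)"] by linarith
    have "(m, \<mu>) \<in> edges_below L ((R n)\<^sup>2)" "(m, \<mu>) \<notin> edges_below L ((R (n - 1))\<^sup>2)"
      using m t t0 by (auto simp: edges_below_def)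
    then have "m = n" using m(1) unfolding e by (auto simp: edges_upto_def)
    then show "\<exists>\<nu>. t = L n \<nu>" using m by auto
  qed simp
qed

lemma R_pred_ge: "n \<ge> 2 \<Longrightarrow> real n / 2 \<le> R (n - 1)"
  using R_ge(1)[of "n - 1"] by (simp add: of_nat_diff)

lemma model_located: "n \<ge> 1 \<Longrightarrow> (R (n - 1))\<^sup>2 \<le> L0 n \<nu>"
proof -
  assume n: "n \<ge> 1"
  then have i: "(n, \<nu>) \<in> edge_index" by (simp add: edge_index_iff)
  note J = model_band[OF lab0 i]
  note nn = in_band_nonneg[OF J]
  have "R (n - 1) < sqrt (L0 n \<nu>)" using J[unfolded in_band_iff[OF nn]] n by auto
  then have "(R (n - 1))\<^sup>2 \<le> (sqrt (L0 n \<nu>))\<^sup>2" using R_pos[of "n - 1"] by (intro power_mono) auto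
  then show ?thesis using nn by simp
qed

text \<open>If the gap of the model is open, its midpoint separates the two edges of \<open>X\<close>, by the
  intermediate value theorem.\<close>

lemma edges_separated:
  obtains N0 where "\<And>n. n \<ge> N0 \<Longrightarrow> \<phi> n > 0 \<Longrightarrow> L n Minus \<le> (real n * pi / 2)\<^sup>2 \<and> (real n * pi / 2)\<^sup>2 \<le> L n Plus"
proof -
  obtain N0 where N0: "N0 \<ge> 2" "\<And>n \<nu>. n \<ge> N0 \<Longrightarrow> (R (n - 1))\<^sup>2 \<le> L n \<nu> \<and> L n \<nu> < (R n)\<^sup>2"
    "\<And>n t. n \<ge> N0 \<Longrightarrow> (R (n - 1))\<^sup>2 \<le> t \<Longrightarrow> t < (R n)\<^sup>2 \<Longrightarrow> (X (of_real t))\<^sup>2 = 1 \<Longrightarrow> \<exists>\<nu>. t = L n \<nu>"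
    by (rule edges_located) (rule that)
  obtain C r where C: "C \<ge> 0" "r \<ge> 1" "\<And>t. r \<le> t \<Longrightarrow> norm (X (of_real t) - X0 (of_real t)) \<le> C / sqrt t ^ 2"
    by (rule growth_at_real[OF close]) (rule that)
  \<comment> \<open>For an open gap, the excess of (-1)^n \<open>X0\<close> over 1 at the centre;
    for a closed one the value 1 only keeps the minimum positive. Parity reduces the minimum to n =
    0 and n = 1, and the cap 1/2 keeps \<open>f\<close> below 1 at the ends \<open>a\<close> and
    \<open>b\<close>, where \<open>X0\<close> vanishes.\<close>
  define \<kappa>0 where "\<kappa>0 = (\<lambda>n. if \<phi> n > 0 then A * (1 - cos (2 * \<phi> n)) else 1)"
  define \<kappa> where "\<kappa> = min (1/2) (min (\<kappa>0 0) (\<kappa>0 1))"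
  have k0: "\<kappa>0 n > 0" for n
  proof (cases "\<phi> n > 0")
    case True
    then have "cos (2 * \<phi> n) < cos 0" using phi_less_tau[of n] tau_less[of n]
      by (intro cos_monotone_0_pi) auto
    then show ?thesis using True A_pos by (simp add: \<kappa>0_def)
  qed (simp add: \<kappa>0_def)
  have k: "\<kappa> > 0" "\<kappa> \<le> 1/2" using k0 by (auto simp: \<kappa>_def)
  have kn: "\<kappa> \<le> A * (1 - cos (2 * \<phi> n))" if "\<phi> n > 0" for n
  proof -
    have "\<kappa> \<le> \<kappa>0 n" using phi_parity[of n] by (cases "even n") (auto simp: \<kappa>_def \<kappa>0_def)
    then show ?thesis using that by (simp add: \<kappa>0_def)
  qed
  obtain N1 :: nat where N1: "max r (C / \<kappa>) < N1" using reals_Archimedean2 by blast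
  show ?thesis
  proof (rule that[of "max N0 (2 * N1 + 2)"])
    fix n assume n: "n \<ge> max N0 (2 * N1 + 2)" and ph: "\<phi> n > 0"
    have n2: "n \<ge> 2" "n \<ge> N0" using n by auto
    define a b c where "a = (R (n - 1))\<^sup>2" and "b = (R n)\<^sup>2" and "c = (real n * pi / 2)\<^sup>2"
    have Rn: "R (n - 1) = real n * pi / 2 - \<tau> n" using R_eq[of "n - 1"] n2 by simp
    have ac: "a \<le> c" "c \<le> b" unfolding a_def b_def c_def
      using R_pos[of "n - 1"] tau_pos[of n] Rn by (auto intro!: power_mono simp: R_def)
    have a_ge: "real N1 \<le> a"
    proof -
      have "real N1 + 1 \<le> R (n - 1)" using R_pred_ge[OF n2(1)] n by linarith
      then have "(real N1 + 1) * 1 \<le> R (n - 1) * R (n - 1)" by (intro mult_mono) auto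
      then show ?thesis by (simp add: a_def power2_eq_square)
    qed
    define f where "f = (\<lambda>t. Re ((-1) ^ n * X (of_real t)))"
    have near: "\<bar>f t - Re ((-1) ^ n * X0 (of_real t))\<bar> \<le> \<kappa>" if t: "t \<ge> a" for t
    proof -
      have t1: "t \<ge> r" "t > C / \<kappa>" "t > 0" using t a_ge N1 C by auto
      have "\<bar>f t - Re ((-1) ^ n * X0 (of_real t))\<bar> = \<bar>Re ((-1) ^ n * (X (of_real t) - X0 (of_real t)))\<bar>"
        by (simp add: f_def right_diff_distrib)
      also have "\<dots> \<le> norm ((-1) ^ n * (X (of_real t) - X0 (of_real t)))" by (rule abs_Re_le_cmod)
      also have "\<dots> \<le> C / t" using C(3)[OF t1(1)] t1 by (simp add: norm_mult norm_power)
      also have "\<dots> \<le> \<kappa>" using t1 k by (simp add: field_simps)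
      finally show ?thesis .
    qed
    have Xval: "X (of_real t) = (-1) ^ n" if "f t = 1" for t
    proof -
      have "(-1) ^ n * X (of_real t) = of_real (f t)"
        unfolding f_def using X_real[of t] by (cases "even n") auto
      moreover have "X (of_real t) = (-1) ^ n * ((-1) ^ n * X (of_real t))" by (cases "even n") auto
      ultimately show ?thesis using that by simp
    qed
    have "f a \<le> 1" "f b \<le> 1"
      using near[of a] near[of b] ac k X0_R[of "n - 1"] X0_R[of n] by (auto simp: a_def b_def)
    moreover have "f c \<ge> 1"
    proof -
      have "sqrt c = real n * pi / 2" by (simp add: c_def)
      then have "X0 (of_real c) = of_real ((-1)^n * (A + (-1)^n * B))" using X0_shift[of c n]
        by (simp add: c_def)
      then have "Re ((-1) ^ n * X0 (of_real c)) = A + (-1)^n * B" by (cases "even n") auto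
      also have "\<dots> = 1 + A * (1 - cos (2 * \<phi> n))" using A_pos by (simp add: cos_2phi field_simps)
      finally show ?thesis using near[of c] ac kn[OF ph] by linarith
    qed
    moreover have "continuous_on S f" for S unfolding f_def
      by (intro continuous_intros continuous_on_compose2[OF holomorphic_on_imp_continuous_on[OF hol]]) auto
    ultimately obtain t1 t2 where t: "a \<le> t1" "t1 \<le> c" "f t1 = 1" "c \<le> t2" "t2 \<le> b" "f t2 = 1"
      using IVT'[of f a 1 c] IVT2'[of f b 1 c] ac by metis
    have "t2 \<noteq> b"
    proof
      assume "t2 = b"
      then show False using near[of b] ac k X0_R[of n] t by (simp add: b_def)
    qed
    then have "t2 < b" "t1 < b" using t \<open>t2 \<noteq> b\<close> by auto
    moreover have "(X (of_real t1))\<^sup>2 = 1" "(X (of_real t2))\<^sup>2 = 1" using Xval t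
      by (simp_all flip: power_mult)
    ultimately obtain \<nu>1 \<nu>2 where "t1 = L n \<nu>1" "t2 = L n \<nu>2"
      using N0(3)[OF n2(2), of t1] N0(3)[OF n2(2), of t2] t ac unfolding a_def b_def by auto
    moreover have "L n Minus \<le> L n Plus" using labelling_step(2)[OF lab, of "n - 1"] n2 by simp
    ultimately show "L n Minus \<le> (real n * pi / 2)\<^sup>2 \<and> (real n * pi / 2)\<^sup>2 \<le> L n Plus"
      using t edge_sign_cases[of \<nu>1] edge_sign_cases[of \<nu>2] unfolding c_def by auto
  qed
qed

text \<open>At an edge x^2 of \<open>X\<close> the model misses (-1)^n by O(x^(-2)), that is, sin^2
  |y| - sin^2 \<phi> = O(x^(-2)). Taking a square root, which is unavoidable when \<phi> = 0, leaves
  | |y| - \<phi> | = O(1/x). The sum of the roots of the two edges is O(x), so their difference of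
  squares is bounded.\<close>

lemma edge_shift_bounded:
  obtains K N0 where "K \<ge> 0" "\<And>n \<nu>. n \<ge> N0 \<Longrightarrow> \<bar>L n \<nu> - L0 n \<nu>\<bar> \<le> K"
proof -
  obtain N0 where N0: "N0 \<ge> 2" "\<And>n \<nu>. n \<ge> N0 \<Longrightarrow> (R (n - 1))\<^sup>2 \<le> L n \<nu> \<and> L n \<nu> < (R n)\<^sup>2"
    "\<And>n t. n \<ge> N0 \<Longrightarrow> (R (n - 1))\<^sup>2 \<le> t \<Longrightarrow> t < (R n)\<^sup>2 \<Longrightarrow> (X (of_real t))\<^sup>2 = 1 \<Longrightarrow> \<exists>\<nu>. t = L n \<nu>"
    by (rule edges_located) (rule that)
  obtain N2 where N2: "\<And>n. n \<ge> N2 \<Longrightarrow> \<phi> n > 0 \<Longrightarrow> L n Minus \<le> (real n * pi / 2)\<^sup>2 \<and> (real n * pi / 2)\<^sup>2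
    \<le> L n Plus"
    by (rule edges_separated) (rule that)
  obtain C r where C: "C \<ge> 0" "r \<ge> 1" "\<And>t. r \<le> t \<Longrightarrow> norm (X (of_real t) - X0 (of_real t)) \<le> C / sqrt t ^ 2"
    by (rule growth_at_real[OF close]) (rule that)
  define \<kappa> where "\<kappa> = min (cos (\<tau> 0)) (cos (\<tau> 1))"
  have "0 < cos (\<tau> n)" for n by (rule cos_gt_zero[OF tau_pos tau_less])
  then have k: "\<kappa> > 0" by (simp add: \<kappa>_def)
  have kn: "\<kappa> \<le> cos (\<tau> n)" for n using tau_parity[of n] by (cases "even n") (auto simp: \<kappa>_def)
  obtain N1 :: nat where N1: "r < N1" using reals_Archimedean2 by blast
  define K1 where "K1 = sqrt C / \<kappa>"
  have K1: "K1 \<ge> 0" using C k by (simp add: K1_def)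
  show ?thesis
  proof (rule that[of "2 * K1 + K1\<^sup>2" "max (max N0 N2) (2 * N1 + 2)"])
    fix n \<nu> assume n: "n \<ge> max (max N0 N2) (2 * N1 + 2)"
    have n2: "n \<ge> 2" "n \<ge> N0" "n \<ge> N2" using n by auto
    have i: "(n, \<nu>) \<in> edge_index" using n2 by (simp add: edge_index_iff)
    define t where "t = L n \<nu>"
    define x where "x = sqrt t"
    define y where "y = x - real n * pi / 2"
    have loc: "(R (n - 1))\<^sup>2 \<le> t" "t < (R n)\<^sup>2" using N0(2)[OF n2(2)] by (auto simp: t_def)
    have t0: "t \<ge> 0" using loc(1) zero_le_power2[of "R (n - 1)"] by linarith
    have x: "R (n - 1) \<le> x" "x < R n"
      using real_sqrt_le_mono[OF loc(1)] real_sqrt_less_mono[OF loc(2)] less_imp_le[OF R_pos[of n]]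
        less_imp_le[OF R_pos[of "n - 1"]]
      unfolding x_def by (simp_all only: real_sqrt_abs abs_of_nonneg)
    have Rn: "R (n - 1) = real n * pi / 2 - \<tau> n" using R_eq[of "n - 1"] n2 by simp
    have y: "\<bar>y\<bar> \<le> \<tau> n" using x(1)[unfolded Rn] x(2)[unfolded R_def] unfolding y_def by linarith
    have x1: "x \<ge> real N1 + 1" using R_pred_ge[OF n2(1)] n x(1) by linarith
    have xt: "x * x = t" unfolding x_def using t0 by (rule real_sqrt_mult_self[THEN trans, OF abs_of_nonneg])
    have tr: "t \<ge> r"
    proof -
      have "(real N1 + 1) * 1 \<le> x * x" by (rule mult_mono) (use x1 in linarith)+
      then have "real N1 + 1 \<le> t" unfolding xt by (simp only: mult_1_right)
      then show ?thesis using N1 by linarith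
    qed
    have Xt: "X (of_real t) = (-1) ^ n" unfolding t_def by (rule labelling_val[OF lab i])
    have X0t: "X0 (of_real t) = of_real ((-1)^n * (A * cos (2 * y) + (-1)^n * B))"
      unfolding y_def x_def by (rule X0_shift[OF t0])
    define s :: real where "s = (-1)^n"
    have ss: "s * s = 1" "\<bar>s\<bar> = 1" by (simp_all add: s_def flip: power_mult_distrib)
    have "A * cos (2 * \<phi> n) = 1 - s * B" using A_pos by (simp add: cos_2phi s_def)
    moreover have "s - s * (A * cos (2 * y) + s * B) = s * ((1 - s * B) - A * cos (2 * y))"
      by (simp add: algebra_simps)
    ultimately have "s - s * (A * cos (2 * y) + s * B) = s * (A * (cos (2 * \<phi> n) - cos (2 * y)))"
      by (simp only: right_diff_distrib)
    moreover have "X (of_real t) - X0 (of_real t) = of_real (s - s * (A * cos (2 * y) + s * B))"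
      unfolding Xt X0t of_real_diff s_def[symmetric] by (simp add: s_def)
    ultimately have dX: "X (of_real t) - X0 (of_real t) = of_real (s * (A * (cos (2 * \<phi> n) - cos (2
      * y))))" by simp
    have "norm (X (of_real t) - X0 (of_real t)) = A * \<bar>cos (2 * \<phi> n) - cos (2 * y)\<bar>"
      unfolding dX norm_of_real using ss A_pos by (simp add: abs_mult)
    then have f1: "A * \<bar>cos (2 * \<phi> n) - cos (2 * y)\<bar> \<le> C / x\<^sup>2"
      using C(3)[OF tr] by (simp add: x_def)
    have f2: "1 * \<bar>cos (2 * \<phi> n) - cos (2 * y)\<bar> \<le> A * \<bar>cos (2 * \<phi> n) - cos (2 * y)\<bar>"
      using A_pos by (intro mult_right_mono) auto
    have f3: "\<bar>cos (2 * \<phi> n) - cos (2 * y)\<bar> = 2 * \<bar>(sin \<bar>y\<bar>)\<^sup>2 - (sin (\<phi> n))\<^sup>2\<bar>"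
    proof -
      have "(sin \<bar>y\<bar>)\<^sup>2 = (sin y)\<^sup>2" by (simp add: abs_real_def)
      then have "cos (2 * \<phi> n) - cos (2 * y) = 2 * ((sin \<bar>y\<bar>)\<^sup>2 - (sin (\<phi> n))\<^sup>2)"
        unfolding cos_double_sin by (simp only: right_diff_distrib)
      then show ?thesis by (simp only: abs_mult)
    qed
    have half: "e \<le> b" if "A * d \<le> b" "1 * d \<le> A * d" "d = 2 * e" "0 \<le> e" for d e b
      using that by linarith
    have s2: "\<bar>(sin \<bar>y\<bar>)\<^sup>2 - (sin (\<phi> n))\<^sup>2\<bar> \<le> C / x\<^sup>2"
      by (rule half[OF f1 f2 f3 abs_ge_zero])
    define u v where "u = sin \<bar>y\<bar>" and "v = sin (\<phi> n)"
    have uv: "u \<ge> 0" "v \<ge> 0" unfolding u_def v_def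
      using y tau_less[of n] phi_nonneg[of n] phi_less_tau[of n] by (auto intro!: sin_ge_zero)
    have xge: "x \<ge> 1" using x1 by linarith
    have diff_squares: "\<bar>p\<^sup>2 - q\<^sup>2\<bar> = \<bar>p - q\<bar> * \<bar>p + q\<bar>" for p q :: real
    proof -
      have "p\<^sup>2 - q\<^sup>2 = (p - q) * (p + q)" by (simp add: power2_eq_square algebra_simps)
      then show ?thesis by (simp only: abs_mult)
    qed
    \<comment> \<open>For nonnegative \<open>u\<close> and \<open>v\<close> the square of u - v is
      at most |u^2 - v^2|; this treats open and closed gaps at once.\<close>
    have "\<bar>u - v\<bar> \<le> \<bar>u + v\<bar>" using uv by linarith
    then have "\<bar>u - v\<bar> * \<bar>u - v\<bar> \<le> \<bar>u\<^sup>2 - v\<^sup>2\<bar>" unfolding diff_squares by (rule mult_left_mono) simp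
    then have "\<bar>u - v\<bar>\<^sup>2 \<le> C / x\<^sup>2" using s2
      unfolding u_def[symmetric] v_def[symmetric] power2_eq_square[of "\<bar>u - v\<bar>"] by (rule order_trans)
    also have "C / x\<^sup>2 = (sqrt C / x)\<^sup>2" using C(1) by (simp add: power_divide)
    finally have h1: "\<bar>u - v\<bar> \<le> sqrt C / x"
      by (rule power2_le_imp_le) (use C(1) xge in simp)
    have h2: "cos (\<tau> n) * \<bar>\<bar>y\<bar> - \<phi> n\<bar> \<le> \<bar>u - v\<bar>" unfolding u_def v_def
      by (rule sin_diff_ge) (use y phi_nonneg[of n] less_imp_le[OF phi_less_tau[of n]] tau_less[of n] in
        \<open>simp_all\<close>)
    have h3: "\<kappa> * \<bar>\<bar>y\<bar> - \<phi> n\<bar> \<le> cos (\<tau> n) * \<bar>\<bar>y\<bar> - \<phi> n\<bar>" by (rule mult_right_mono[OF kn]) simp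
    have gen: "a \<le> s / \<kappa> / x" if "\<kappa> * a \<le> s / x" for a s
      using that k xge by (simp add: field_simps)
    have yp: "\<bar>\<bar>y\<bar> - \<phi> n\<bar> \<le> K1 / x" unfolding K1_def
      by (rule gen[OF order_trans[OF h3 order_trans[OF h2 h1]]])
    define \<sigma> :: real where "\<sigma> = (if \<nu> = Plus then 1 else -1)"
    have \<sigma>: "\<sigma> = 1 \<or> \<sigma> = -1 \<and> n \<ge> 1" using n2 by (auto simp: \<sigma>_def)
    have L0: "L0 n \<nu> = edge0 n \<sigma>"
      using model_edges[OF lab0, of n] n2 edge_sign_cases[of \<nu>] by (auto simp: \<sigma>_def)
    \<comment> \<open>So far only |y| is controlled. For an open gap the separation of the two edges
      by the centre gives \<open>y\<close> the sign \<open>\<sigma>\<close>; for a closed gap \<phi>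
      = 0 and the sign is irrelevant.\<close>
    have ys: "\<bar>y - \<sigma> * \<phi> n\<bar> = \<bar>\<bar>y\<bar> - \<phi> n\<bar>"
    proof (cases "\<phi> n > 0")
      case True
      have "0 \<le> \<sigma> * y"
      proof (cases "\<nu> = Plus")
        case True
        then have "(real n * pi / 2)\<^sup>2 \<le> t" using N2[OF n2(3) \<open>\<phi> n > 0\<close>] by (simp add: t_def)
        from real_sqrt_le_mono[OF this] show ?thesis using True by (simp add: y_def x_def \<sigma>_def)
      next
        case False
        then have "t \<le> (real n * pi / 2)\<^sup>2" using N2[OF n2(3) \<open>\<phi> n > 0\<close>] edge_sign_cases[of \<nu>]
          by (auto simp: t_def)
        from real_sqrt_le_mono[OF this] show ?thesis using False by (simp add: y_def x_def \<sigma>_def)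
      qed
      then show ?thesis by (auto simp: \<sigma>_def)
    next
      case False
      then show ?thesis using phi_nonneg[of n] by simp
    qed
    define r0 where "r0 = real n * pi / 2 + \<sigma> * \<phi> n"
    have dx: "\<bar>x - r0\<bar> \<le> K1 / x" using yp ys by (simp add: r0_def y_def algebra_simps)
    have "L n \<nu> - L0 n \<nu> = x\<^sup>2 - r0\<^sup>2" using t0 by (simp add: L0 edge0_def r0_def x_def t_def)
    also have "\<bar>\<dots>\<bar> = \<bar>x - r0\<bar> * \<bar>x + r0\<bar>" by (rule diff_squares)
    also have "\<dots> \<le> (K1 / x) * (2 * x + K1)"
    proof (rule mult_mono[OF dx])
      have "K1 / x \<le> K1 / 1" using K1 xge by (intro divide_left_mono) auto
      then show "\<bar>x + r0\<bar> \<le> 2 * x + K1" using dx xge by (auto simp: abs_le_iff)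
    qed (use K1 xge in auto)
    also have "\<dots> = 2 * K1 + K1\<^sup>2 / x" using xge by (simp add: field_simps power2_eq_square)
    also have "\<dots> \<le> 2 * K1 + K1\<^sup>2 / 1" using xge by (intro add_mono divide_left_mono) auto
    finally show "\<bar>L n \<nu> - L0 n \<nu>\<bar> \<le> 2 * K1 + K1\<^sup>2" by simp
  qed (use K1 in auto)
qed

text \<open>Insert X0' at the perturbed edge: X' - X0' is O(n^(-3)) there, and the second order
  Taylor remainder of X0' is at most O(n^(-3)) times the square of the bounded shift.\<close>

lemma deriv_expansion:
  obtains K N0 where "\<And>n \<nu>. n \<ge> N0 \<Longrightarrow> norm (deriv X (of_real (L n \<nu>)) - deriv X0 (of_real (L0 n \<nu>))
     - deriv (deriv X0) (of_real (L0 n \<nu>)) * of_real (L n \<nu> - L0 n \<nu>)) \<le> K / real n ^ 3" "K \<ge> 0" "N0 \<ge> 2"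
proof -
  obtain N0 where N0: "N0 \<ge> 2" "\<And>n \<nu>. n \<ge> N0 \<Longrightarrow> (R (n - 1))\<^sup>2 \<le> L n \<nu> \<and> L n \<nu> < (R n)\<^sup>2"
    "\<And>n t. n \<ge> N0 \<Longrightarrow> (R (n - 1))\<^sup>2 \<le> t \<Longrightarrow> t < (R n)\<^sup>2 \<Longrightarrow> (X (of_real t))\<^sup>2 = 1 \<Longrightarrow> \<exists>\<nu>. t = L n \<nu>"
    by (rule edges_located) (rule that)
  obtain K N2 where K: "K \<ge> 0" "\<And>n \<nu>. n \<ge> N2 \<Longrightarrow> \<bar>L n \<nu> - L0 n \<nu>\<bar> \<le> K"
    by (rule edge_shift_bounded) (rule that)
  have hd: "(\<lambda>z. X z - X0 z) holomorphic_on UNIV" by (intro holomorphic_intros hol hol0)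
  have fd: "X field_differentiable at z" "X0 field_differentiable at z" for z
    using hol hol0 by (auto simp: holomorphic_on_def)
  have h1: "deriv X0 holomorphic_on UNIV" by (rule holomorphic_deriv[OF hol0]) simp
  have h2: "deriv (deriv X0) holomorphic_on UNIV" by (rule holomorphic_deriv[OF h1]) simp
  have "growth 3 (deriv (\<lambda>z. X z - X0 z))"
    using growth_deriv[OF hd close] by (simp add: numeral_3_eq_3 numeral_2_eq_2)
  also have "deriv (\<lambda>z. X z - X0 z) = (\<lambda>z. deriv X z - deriv X0 z)" using fd by (intro ext deriv_diff) auto
  finally have g1: "growth 3 (\<lambda>z. deriv X z - deriv X0 z)" .
  have g2: "growth 3 (deriv (deriv (deriv X0)))"
    using growth_deriv[OF h2 growth_deriv[OF h1 growth_deriv[OF hol0 X0_growth]]]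
      by (simp add: numeral_3_eq_3)
  obtain C r where C: "C \<ge> 0" "r \<ge> 1" "\<And>t. r \<le> t \<Longrightarrow> norm (deriv X (of_real t) - deriv X0 (of_real t))
    \<le> C / sqrt t ^ 3"
    by (rule growth_at_real[OF g1]) (rule that)
  obtain C' r' where C': "C' \<ge> 0" "r' \<ge> 1" "\<And>t. r' \<le> t \<Longrightarrow> norm (deriv (deriv (deriv X0)) (of_real t))
    \<le> C' / sqrt t ^ 3"
    by (rule growth_at_real[OF g2]) (rule that)
  obtain N1 :: nat where N1: "max r r' < N1" using reals_Archimedean2 by blast
  show ?thesis
  proof (rule that[of "max (max N0 N2) (2 * N1 + 2)" "8 * C + 8 * C' * K\<^sup>2"])
    fix n \<nu> assume n: "n \<ge> max (max N0 N2) (2 * N1 + 2)"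
    have n2: "n \<ge> 2" "n \<ge> N0" "n \<ge> N2" using n by auto
    define m where "m = (R (n - 1))\<^sup>2"
    have mr: "r \<le> m" "r' \<le> m"
    proof -
      have "real N1 + 1 \<le> R (n - 1)" using R_pred_ge[OF n2(1)] n by linarith
      then have "(real N1 + 1) * 1 \<le> R (n - 1) * R (n - 1)" by (intro mult_mono) auto
      then show "r \<le> m" "r' \<le> m" using N1 by (auto simp: m_def power2_eq_square)
    qed
    \<comment> \<open>The factor 8 is 2^3: for t \<ge> m, \<open>sqrt t\<close> is at least R (n -
      1), hence at least n / 2.\<close>
    have inv: "B / sqrt t ^ 3 \<le> 8 * B / real n ^ 3" if "m \<le> t" "B \<ge> 0" for t B
    proof -
      have "real n / 2 \<le> sqrt t" using R_pred_ge[OF n2(1)] real_sqrt_le_mono[OF that(1)] R_pos[of "n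
        - 1"] by (simp add: m_def)
      then have "(real n / 2) ^ 3 \<le> sqrt t ^ 3" by (intro power_mono) auto
      moreover have "t > 0" using that(1) zero_less_power[OF R_pos, of "n - 1" 2] unfolding m_def by linarith
      ultimately have "B / sqrt t ^ 3 \<le> B / (real n / 2) ^ 3" using n2 that(2)
        by (intro divide_left_mono) (auto intro!: mult_pos_pos)
      then show ?thesis by (simp add: power_divide mult.commute)
    qed
    have loc: "m \<le> L n \<nu>" "m \<le> L0 n \<nu>" using N0(2)[OF n2(2)] model_located[of n \<nu>] n2 by (auto simp: m_def)
    \<comment> \<open>The real ray to the right of \<open>m\<close>, as a convex set of complex
      numbers: it contains both edges, and \<open>env\<close> is 1 on it.\<close>
    define S where "S = {z. Im z = 0 \<and> m \<le> Re z}"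
    have "S = {z. Im z \<le> 0} \<inter> {z. Im z \<ge> 0} \<inter> {z. Re z \<ge> m}" by (auto simp: S_def)
    then have "convex S"
      by (auto intro!: convex_Int convex_halfspace_Im_le convex_halfspace_Im_ge convex_halfspace_Re_ge)
    then have "norm ((\<lambda>i. (deriv ^^ i) (deriv X0)) 0 (of_real (L n \<nu>))
      - (\<Sum>i\<le>1. (\<lambda>i. (deriv ^^ i) (deriv X0)) i (of_real (L0 n \<nu>)) * (of_real (L n \<nu>)
      - of_real (L0 n \<nu>)) ^ i / fact i))
       \<le> (8 * C' / real n ^ 3) * norm (complex_of_real (L n \<nu>) - of_real (L0 n \<nu>)) ^ Suc 1 / fact 1"
    proof (rule complex_Taylor)
      fix i x
      have "(deriv ^^ i) (deriv X0) holomorphic_on UNIV" by (rule holomorphic_higher_deriv[OF h1]) simp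
      then have "((deriv ^^ i) (deriv X0) has_field_derivative deriv ((deriv ^^ i) (deriv X0)) x) (at x)"
        by (intro holomorphic_derivI[of _ UNIV]) auto
      then show "((deriv ^^ i) (deriv X0) has_field_derivative (deriv ^^ Suc i) (deriv X0) x) (at x within S)"
        by (simp add: has_field_derivative_at_within)
    next
      fix x assume "x \<in> S"
      then have x: "x = of_real (Re x)" "m \<le> Re x" by (auto simp: S_def complex_eq_iff)
      show "norm ((deriv ^^ Suc 1) (deriv X0) x) \<le> 8 * C' / real n ^ 3"
        using C'(3)[of "Re x"] inv[OF x(2) C'(1)] x mr by simp
    qed (use loc in \<open>auto simp: S_def\<close>)
    then have T: "norm (deriv X0 (of_real (L n \<nu>)) - deriv X0 (of_real (L0 n \<nu>))
      - deriv (deriv X0) (of_real (L0 n \<nu>)) * of_real (L n \<nu> - L0 n \<nu>))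
        \<le> 8 * C' / real n ^ 3 * \<bar>L n \<nu> - L0 n \<nu>\<bar>\<^sup>2"
      by (simp add: algebra_simps power2_eq_square flip: of_real_diff)
    have "8 * C' / real n ^ 3 * \<bar>L n \<nu> - L0 n \<nu>\<bar>\<^sup>2 \<le> 8 * C' / real n ^ 3 * K\<^sup>2"
      using K(2)[OF n2(3), of \<nu>] C' by (intro mult_left_mono power_mono) auto
    moreover have "norm (deriv X (of_real (L n \<nu>)) - deriv X0 (of_real (L n \<nu>))) \<le> 8 * C / real n ^ 3"
      using C(3)[of "L n \<nu>"] inv[OF loc(1) C(1)] loc mr by linarith
    moreover have "norm (x1 - x3 - x4) \<le> norm (x1 - x2) + norm (x2 - x3 - x4)" for x1 x2 x3 x4 :: complex
      using norm_triangle_ineq[of "x1 - x2" "x2 - x3 - x4"] by (simp add: algebra_simps)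
    note this[of "deriv X (of_real (L n \<nu>))" "deriv X0 (of_real (L0 n \<nu>))" "deriv (deriv X0) (of_real (L0
      n \<nu>)) * of_real (L n \<nu> - L0 n \<nu>)" "deriv X0 (of_real (L n \<nu>))"]
    ultimately show "norm (deriv X (of_real (L n \<nu>)) - deriv X0 (of_real (L0 n \<nu>))
      - deriv (deriv X0) (of_real (L0 n \<nu>)) * of_real (L n \<nu> - L0 n \<nu>))
       \<le> (8 * C + 8 * C' * K\<^sup>2) / real n ^ 3"
      using T by (simp add: add_divide_distrib)
  qed (use C C' in auto)
qed

end

section \<open>Partial fractions\<close>

lemma finite_edges_upto_Int [simp]: "finite (edges_upto N \<inter> S)" by simp

text \<open>Contour integrals yield limits along \<open>edges_upto N\<close>. Every finite set of
  labels is eventually contained in these, so for a summable family the limit is the unordered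
  sum.\<close>

lemma edges_upto_tendsto:
  fixes f :: "nat \<times> edge_sign \<Rightarrow> 'a::{comm_monoid_add,topological_space,t2_space}"
  assumes "f summable_on S" "S \<subseteq> edge_index"
  shows "(\<lambda>N. sum f (edges_upto N \<inter> S)) \<longlonglongrightarrow> infsum f S"
proof (rule filterlim_compose[OF infsum_tendsto[OF assms(1)]])
  show "filterlim (\<lambda>N. edges_upto N \<inter> S) (finite_subsets_at_top S) sequentially"
    unfolding filterlim_iff eventually_finite_subsets_at_top
  proof (intro allI impI)
    fix P assume "\<exists>X. finite X \<and> X \<subseteq> S \<and> (\<forall>Y. finite Y \<and> X \<subseteq> Y \<and> Y \<subseteq> S \<longrightarrow> P Y)"
    then obtain X where "finite X \<and> X \<subseteq> S \<and> (\<forall>Y. finite Y \<and> X \<subseteq> Y \<and> Y \<subseteq> S \<longrightarrow> P Y)" ..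
    then have X: "finite X" "X \<subseteq> S" "\<And>Y. finite Y \<Longrightarrow> X \<subseteq> Y \<Longrightarrow> Y \<subseteq> S \<Longrightarrow> P Y" by simp_all
    have "finite (fst ` X)" using X(1) by simp
    then obtain M where "\<forall>m\<in>fst ` X. m \<le> M" unfolding finite_nat_set_iff_bounded_le ..
    then have M: "\<And>x. x \<in> X \<Longrightarrow> fst x \<le> M" by blast
    show "\<forall>\<^sub>F N in sequentially. P (edges_upto N \<inter> S)"
    proof (rule eventually_sequentiallyI[of M])
      fix N assume "M \<le> N"
      have "X \<subseteq> edges_upto N \<inter> S"
      proof
        fix x assume "x \<in> X"
        then show "x \<in> edges_upto N \<inter> S"
          using X(2) assms(2) le_trans[OF M \<open>M \<le> N\<close>, of x] by (auto simp: edges_upto_def)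
      qed
      then show "P (edges_upto N \<inter> S)" by (rule X(3)[rotated]) auto
    qed
  qed
qed

lemma summable_on_edges:
  fixes f :: "nat \<times> edge_sign \<Rightarrow> real"
  assumes "\<And>e. f e \<ge> 0" "\<And>\<nu>. summable (\<lambda>n. f (n, \<nu>))"
  shows "f summable_on S"
proof -
  have *: "f summable_on range (\<lambda>n. (n, \<nu>))" for \<nu>
  proof (subst summable_on_reindex)
    show "inj (\<lambda>n. (n, \<nu>))" by (simp add: inj_on_def)
    show "(f \<circ> (\<lambda>n. (n, \<nu>))) summable_on UNIV"
      using summable_nonneg_imp_summable_on[OF assms(2)[of \<nu>]] assms(1) by (simp add: o_def)
  qed
  have "f summable_on (range (\<lambda>n. (n, Plus)) \<union> range (\<lambda>n. (n, Minus)))"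
    by (rule summable_on_Un_disjoint[OF * *]) auto
  also have "range (\<lambda>n. (n, Plus)) \<union> range (\<lambda>n. (n, Minus)) = (UNIV :: (nat \<times> edge_sign) set)"
  proof -
    have "e \<in> range (\<lambda>n. (n, Plus)) \<union> range (\<lambda>n. (n, Minus))" for e :: "nat \<times> edge_sign"
      using edge_sign_cases[of "snd e"] by (cases e) auto
    then show ?thesis by blast
  qed
  finally show ?thesis by (rule summable_on_subset_banach) auto
qed

lemma inverse_square_summable_on_edges:
  fixes f :: "nat \<times> edge_sign \<Rightarrow> real"
  assumes "\<And>e. f e \<ge> 0" "\<And>n \<nu>. n \<ge> N \<Longrightarrow> f (n, \<nu>) \<le> K / (real n)\<^sup>2"
  shows "f summable_on S"
proof (rule summable_on_edges[OF assms(1)])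
  fix \<nu>
  show "summable (\<lambda>n. f (n, \<nu>))"
  proof (rule summable_comparison_test)
    show "\<exists>N. \<forall>n\<ge>N. norm (f (n, \<nu>)) \<le> K * inverse ((real n)\<^sup>2)"
      using assms by (intro exI[of _ N]) (auto simp: divide_inverse)
    show "summable (\<lambda>n. K * inverse ((real n)\<^sup>2))"
      by (intro summable_mult inverse_power_summable) auto
  qed
qed

context perturbation
begin

lemma deriv_X_holomorphic: "deriv X holomorphic_on UNIV"
  by (rule holomorphic_deriv[OF hol]) simp

lemma X_holomorphic_on: "X holomorphic_on S" "deriv X holomorphic_on S"
  using hol deriv_X_holomorphic holomorphic_on_subset by blast+

lemma deriv_X: "(X has_field_derivative deriv X z) (at z)"
  by (rule holomorphic_derivI[OF hol]) auto

lemma deriv_X_real: "deriv X (of_real t) = of_real (Re (deriv X (of_real t)))"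
  by (rule deriv_of_real[OF hol cnj])

text \<open>Later shown to be the effective mass. Defined through the derivative, it needs no case
  distinction at closed gaps, where the derivative vanishes.\<close>

definition mass :: "nat \<Rightarrow> edge_sign \<Rightarrow> real" where
  "mass n \<nu> = Re ((-1) ^ (n + 1) * deriv X (of_real (L n \<nu>)))"

lemma of_real_mass: "of_real (mass n \<nu>) = (-1) ^ (n + 1) * deriv X (of_real (L n \<nu>))"
proof -
  obtain r where "deriv X (of_real (L n \<nu>)) = of_real r" using deriv_X_real[of "L n \<nu>"] ..
  then show ?thesis unfolding mass_def by (cases "even n") auto
qed

lemma edges_grow:
  obtains N0 where "N0 \<ge> 2" "\<And>n \<nu>. n \<ge> N0 \<Longrightarrow> (real n)\<^sup>2 / 4 \<le> L n \<nu>"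
proof -
  obtain N0 where N0: "N0 \<ge> 2" "\<And>n \<nu>. n \<ge> N0 \<Longrightarrow> (R (n - 1))\<^sup>2 \<le> L n \<nu> \<and> L n \<nu> < (R n)\<^sup>2"
    "\<And>n t. n \<ge> N0 \<Longrightarrow> (R (n - 1))\<^sup>2 \<le> t \<Longrightarrow> t < (R n)\<^sup>2 \<Longrightarrow> (X (of_real t))\<^sup>2 = 1 \<Longrightarrow> \<exists>\<nu>. t = L n \<nu>"
    by (rule edges_located) (rule that)
  show ?thesis
  proof (rule that[OF N0(1)])
    fix n \<nu> assume n: "n \<ge> N0"
    have "(real n / 2)\<^sup>2 \<le> (R (n - 1))\<^sup>2" using R_pred_ge[of n] n N0(1) by (intro power_mono) auto
    then show "(real n)\<^sup>2 / 4 \<le> L n \<nu>" using N0(2)[OF n, of \<nu>] by (simp add: power_divide)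
  qed
qed

text \<open>Eventually the edge is at least n^2 / 4 while |z| is at most n^2 / 8. Uniformity in
  bounded \<open>z\<close> serves the majorant on compact sets; the sums in (4) use it with
  \<open>z\<close> an edge.\<close>

lemma resolvent_bound:
  obtains N0 where "N0 \<ge> 1" "\<And>n \<nu> z. n \<ge> N0 \<Longrightarrow> norm (z :: complex) \<le> b \<Longrightarrow> norm (1 / (z - of_real (L n \<nu>)))
    \<le> 8 / (real n)\<^sup>2"
proof -
  obtain N0 where N0: "N0 \<ge> 2" "\<And>n \<nu>. n \<ge> N0 \<Longrightarrow> (real n)\<^sup>2 / 4 \<le> L n \<nu>"
    by (rule edges_grow) (rule that)
  obtain N1 :: nat where N1: "8 * b < N1" using reals_Archimedean2 by blast
  show ?thesis
  proof (rule that[of "max N0 N1"])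
    fix n \<nu> and z :: complex assume n: "n \<ge> max N0 N1" and z: "norm z \<le> b"
    have "real n * 1 \<le> real n * real n" using n N0(1) by (intro mult_left_mono) auto
    then have "8 * b \<le> (real n)\<^sup>2" using N1 n by (simp add: power2_eq_square)
    moreover have "L n \<nu> \<le> norm (complex_of_real (L n \<nu>))" by simp
    moreover have "norm (complex_of_real (L n \<nu>)) - norm z \<le> norm (z - of_real (L n \<nu>))"
      using norm_triangle_ineq2[of "of_real (L n \<nu>)" z] by (simp add: norm_minus_commute)
    ultimately have "(real n)\<^sup>2 / 8 \<le> norm (z - of_real (L n \<nu>))" using N0(2)[of n \<nu>] n z by linarith
    moreover have "(real n)\<^sup>2 / 8 > 0" using n N0(1) by simp
    ultimately have "1 / norm (z - of_real (L n \<nu>)) \<le> 1 / ((real n)\<^sup>2 / 8)"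
      by (intro divide_left_mono) (auto intro!: mult_pos_pos)
    then show "norm (1 / (z - of_real (L n \<nu>))) \<le> 8 / (real n)\<^sup>2" by (simp add: norm_divide)
  qed (use N0 in auto)
qed

lemma circle_bounds:
  obtains d C N0 where "d > 0" "C \<ge> 0"
    "\<And>N z \<eta>. N \<ge> N0 \<Longrightarrow> norm z = (R N)\<^sup>2 \<Longrightarrow> \<bar>\<eta>\<bar> = 1 \<Longrightarrow> norm (X z - of_real \<eta>) \<ge> d * env z"
    "\<And>N z. N \<ge> N0 \<Longrightarrow> norm z = (R N)\<^sup>2 \<Longrightarrow> norm (deriv X z) \<le> C * env z / R N"
    "\<And>N. N \<ge> N0 \<Longrightarrow> edges_below L ((R N)\<^sup>2) = edges_upto N"
proof -
  obtain d N0 where d: "d > 0" "\<And>N z \<eta>. N \<ge> N0 \<Longrightarrow> norm z = (R N)\<^sup>2 \<Longrightarrow> \<bar>\<eta>\<bar> = 1 \<Longrightarrow> norm (X z - of_real \<eta>) \<ge> d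
    * env z"
    "\<And>N z. N \<ge> N0 \<Longrightarrow> norm z = (R N)\<^sup>2 \<Longrightarrow> norm (X z - X0 z) < d * env z"
    "\<And>N z \<eta>. N \<ge> N0 \<Longrightarrow> norm z = (R N)\<^sup>2 \<Longrightarrow> \<bar>\<eta>\<bar> = 1 \<Longrightarrow> norm (X0 z - of_real \<eta>) \<ge> 4 * d * env z"
    by (rule X_lower_bound) (rule that)
  obtain C r where C: "C \<ge> 0" "r \<ge> 1" "\<And>z. r \<le> norm z \<Longrightarrow> norm (deriv X z) \<le> C * env z / sqrt (norm z) ^ Suc 0"
    by (rule growthE[OF growth_deriv[OF hol X_growth]]) (rule that)
  obtain N2 where N2: "\<And>N. N \<ge> N2 \<Longrightarrow> edges_below L ((R N)\<^sup>2) = edges_upto N"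
    by (rule edges_below_R) (rule that)
  obtain N1 :: nat where N1: "r < N1" using reals_Archimedean2 by blast
  show ?thesis
  proof (rule that[of d C "max (max N0 N2) (max 1 N1)"])
    fix N and z :: complex assume N: "N \<ge> max (max N0 N2) (max 1 N1)" and z: "norm z = (R N)\<^sup>2"
    have "real N * 1 \<le> R N * R N" using R_ge(1)[of N] N by (intro mult_mono) auto
    then have "r \<le> norm z" using N1 N z by (simp add: power2_eq_square)
    from C(3)[OF this] show "norm (deriv X z) \<le> C * env z / R N" using z R_pos[of N] by simp
  qed (use d C N2 in auto)
qed

definition g :: "complex \<Rightarrow> complex" where "g z = (X z)\<^sup>2 - 1"

lemma g_holomorphic: "g holomorphic_on S"
  unfolding g_def by (intro holomorphic_intros X_holomorphic_on)

lemma deriv_g: "deriv g z = 2 * X z * deriv X z"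
proof -
  have "(g has_field_derivative 2 * X z * deriv X z) (at z)" unfolding g_def
    by (auto intro!: derivative_eq_intros deriv_X)
  then show ?thesis by (rule DERIV_imp_deriv)
qed

lemma g_nz_circle:
  assumes "d > 0" "\<And>\<eta>. \<bar>\<eta>\<bar> = 1 \<Longrightarrow> norm (X z - of_real \<eta>) \<ge> d * env z"
  shows "g z \<noteq> 0"
proof -
  have "d * env z > 0" using assms(1) env_ge(2) by simp
  then have "norm (X z - of_real 1) > 0" "norm (X z - of_real (-1)) > 0"
    using assms(2)[of 1] assms(2)[of "-1"] by (simp_all only: abs_one abs_minus) linarith+
  then have "X z - of_real 1 \<noteq> 0" "X z - of_real (-1) \<noteq> 0" by auto
  moreover have "g z = (X z - of_real 1) * (X z - of_real (-1))"
    by (simp add: g_def power2_eq_square algebra_simps)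
  ultimately show ?thesis by simp
qed

lemma g_edge_sum:
  assumes nz: "\<And>w. norm w = (R N)\<^sup>2 \<Longrightarrow> g w \<noteq> 0" and e: "edges_below L ((R N)\<^sup>2) = edges_upto N"
  shows "(\<Sum>p\<in>{p. norm p < (R N)\<^sup>2 \<and> g p = 0}. of_int (zorder g p) * h p)
    = (\<Sum>e\<in>edges_upto N. h (of_real (case_prod L e)) :: complex)"
proof -
  have "g (of_real ((R N)\<^sup>2)) \<noteq> 0" by (rule nz) (simp add: norm_power)
  from entire_finite_zeros[OF g_holomorphic this]
  have "finite {p. norm p < (R N)\<^sup>2 \<and> (X p)\<^sup>2 - 1 = 0}" unfolding g_def .
  from edges_below_zeros(2)[OF lab this, of h]
  show ?thesis unfolding e g_def .
qed

text \<open>The residue theorem for \<open>H g'/g + E\<close>, with \<open>H\<close> and \<open>E\<close> entire; suitable choices of \<open>H\<close> and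
  \<open>E\<close> turn this function into \<open>X'\<^sup>2 / (1 - X\<^sup>2)\<close> and into \<open>X' / (X \<plusminus> 1)\<close>.\<close>

lemma circle_integrals:
  assumes H: "H holomorphic_on UNIV" and E: "E holomorphic_on UNIV"
    and nz: "\<And>w. norm w = (R N)\<^sup>2 \<Longrightarrow> g w \<noteq> 0" and e: "edges_below L ((R N)\<^sup>2) = edges_upto N"
  defines "f \<equiv> \<lambda>w. deriv g w * H w / g w + E w"
  shows "(f has_contour_integral 2 * pi * \<i> * (\<Sum>e\<in>edges_upto N. H (of_real (case_prod L e)))) (circlepath
    0 ((R N)\<^sup>2))"
    and "norm z < (R N)\<^sup>2 \<Longrightarrow> g z \<noteq> 0 \<Longrightarrow>
      ((\<lambda>w. f w / (w - z)) has_contour_integral 2 * pi * \<i> *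
        (f z + (\<Sum>e\<in>edges_upto N. H (of_real (case_prod L e)) / (of_real (case_prod L e)
          - z)))) (circlepath 0 ((R N)\<^sup>2))"
proof -
  have \<rho>: "(R N)\<^sup>2 > 0" by (rule zero_less_power[OF R_pos])
  have cont: "continuous_on (sphere 0 ((R N)\<^sup>2)) (\<lambda>w. deriv g w * H w / g w)"
    using nz H holomorphic_deriv[OF g_holomorphic, of UNIV] g_holomorphic
    by (intro continuous_intros holomorphic_on_imp_continuous_on) (auto intro: holomorphic_on_subset)
  have "(\<lambda>w. deriv g w * H w / g w) contour_integrable_on circlepath 0 ((R N)\<^sup>2)"
    by (rule contour_integrable_continuous_circlepath) (use cont \<rho> in simp)
  note int1 = has_contour_integral_integral[OF this]
  have 1: "((\<lambda>w. deriv g w * H w / g w) has_contour_integral 2 * pi * \<i>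
    * (\<Sum>e\<in>edges_upto N. H (of_real (case_prod L e)))) (circlepath 0 ((R N)\<^sup>2))"
    using int1 log_deriv_residue_sum[OF g_holomorphic H \<rho> nz] g_edge_sum[OF nz e, of H] by (simp only:)
  have 2: "(E has_contour_integral 0) (circlepath 0 ((R N)\<^sup>2))"
    by (rule Cauchy_theorem_convex_simple[of E UNIV]) (use E in auto)
  from has_contour_integral_add[OF 1 2]
  show "(f has_contour_integral 2 * pi * \<i> * (\<Sum>e\<in>edges_upto N. H (of_real (case_prod L e)))) (circlepath
    0 ((R N)\<^sup>2))"
    unfolding f_def by simp
  assume z: "norm z < (R N)\<^sup>2" "g z \<noteq> 0"
  have "continuous_on (sphere 0 ((R N)\<^sup>2)) (\<lambda>w. deriv g w * H w / g w / (w - z))"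
    using z by (intro continuous_on_divide cont continuous_intros) auto
  then have "(\<lambda>w. deriv g w * H w / g w / (w - z)) contour_integrable_on circlepath 0 ((R N)\<^sup>2)"
    by - (rule contour_integrable_continuous_circlepath, use \<rho> in simp)
  note int3 = has_contour_integral_integral[OF this]
  have 3: "((\<lambda>w. deriv g w * H w / g w / (w - z)) has_contour_integral 2 * pi * \<i> * (deriv g z * H z / g z +
      (\<Sum>e\<in>edges_upto N. H (of_real (case_prod L e)) / (of_real (case_prod L e)
        - z)))) (circlepath 0 ((R N)\<^sup>2))"
    using int3 log_deriv_partial_fractions[OF g_holomorphic H \<rho> nz z] g_edge_sum[OF nz e, of "\<lambda>p. H p /
      (p - z)"]
    by (simp only:)
  have 4: "((\<lambda>w. E w / (w - z)) has_contour_integral 2 * pi * \<i> * E z) (circlepath 0 ((R N)\<^sup>2))"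
    using Cauchy_integral_circlepath_simple[OF holomorphic_on_subset[OF E subset_UNIV], of z 0 "(R N)\<^sup>2"] z
    by (simp add: mult.assoc)
  from has_contour_integral_add[OF 3 4]
  show "((\<lambda>w. f w / (w - z)) has_contour_integral 2 * pi * \<i> *
        (f z + (\<Sum>e\<in>edges_upto N. H (of_real (case_prod L e)) / (of_real (case_prod L e)
          - z)))) (circlepath 0 ((R N)\<^sup>2))"
    unfolding f_def by (simp add: add_divide_distrib algebra_simps)
qed

text \<open>The length 2 \<pi> (R N)^2 of the circle is beaten by the decay K / R N of the function
  together with the distance (R N)^2 - |z| of \<open>z\<close> from the circle.\<close>

lemma partial_fractions_error:
  assumes H: "H holomorphic_on UNIV" and E: "E holomorphic_on UNIV"
    and nz: "\<And>w. norm w = (R N)\<^sup>2 \<Longrightarrow> g w \<noteq> 0" and e: "edges_below L ((R N)\<^sup>2) = edges_upto N"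
    and bd: "\<And>w. norm w = (R N)\<^sup>2 \<Longrightarrow> norm (deriv g w * H w / g w + E w) \<le> K / R N"
    and z: "norm z < (R N)\<^sup>2" "g z \<noteq> 0"
  shows "norm (deriv g z * H z / g z + E z + (\<Sum>e\<in>edges_upto N. H (of_real (case_prod L e)) / (of_real
    (case_prod L e) - z)))
     \<le> K * R N / ((R N)\<^sup>2 - norm z)"
proof -
  define S where "S = deriv g z * H z / g z + E z + (\<Sum>e\<in>edges_upto N. H (of_real (case_prod L e)) /
    (of_real (case_prod L e) - z))"
  have \<rho>: "(R N)\<^sup>2 > 0" by (rule zero_less_power[OF R_pos])
  have pos: "(R N)\<^sup>2 - norm z > 0" using z by simp
  have "norm (complex_of_real ((R N)\<^sup>2)) = (R N)\<^sup>2" by (simp add: norm_power)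
  from order_trans[OF norm_ge_zero bd[OF this]] have K: "K / R N \<ge> 0" .
  have "norm (2 * pi * \<i> * S) \<le> (K / R N / ((R N)\<^sup>2 - norm z)) * (2 * pi * (R N)\<^sup>2)"
  proof (rule has_contour_integral_bound_circlepath)
    show "((\<lambda>w. (deriv g w * H w / g w + E w) / (w - z)) has_contour_integral 2 * pi * \<i>
      * S) (circlepath 0 ((R N)\<^sup>2))"
      unfolding S_def by (rule circle_integrals(2)[OF H E nz e z])
    fix w :: complex assume "norm (w - 0) = (R N)\<^sup>2"
    then have w: "norm w = (R N)\<^sup>2" by simp
    have "(R N)\<^sup>2 - norm z \<le> norm (w - z)" using norm_triangle_ineq2[of w z] w by simp
    then show "norm ((deriv g w * H w / g w + E w) / (w - z)) \<le> K / R N / ((R N)\<^sup>2 - norm z)"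
      unfolding norm_divide[of _ "w - z"] using bd[OF w] pos K by (intro frac_le) auto
  qed (rule divide_nonneg_pos[OF K pos], rule \<rho>)
  also have "\<dots> = 2 * pi * (K * R N / ((R N)\<^sup>2 - norm z))"
  proof -
    have "K / r / D * (2 * pi * r\<^sup>2) = 2 * pi * (K * r / D)" if "r > 0" for r D
      using that by (cases "D = 0") (auto simp: field_simps power2_eq_square)
    then show ?thesis using R_pos[of N] .
  qed
  finally have "2 * pi * norm S \<le> 2 * pi * (K * R N / ((R N)\<^sup>2 - norm z))" unfolding norm_mult by simp
  then have "norm S \<le> K * R N / ((R N)\<^sup>2 - norm z)" by (rule mult_left_le_imp_le) simp
  then show ?thesis unfolding S_def .
qed

lemma R_tendsto: "filterlim R at_top sequentially"
  by (rule filterlim_at_top_mono[OF filterlim_real_sequentially]) (use R_ge(1) in auto)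

lemma error_tendsto: "(\<lambda>N. K * R N / ((R N)\<^sup>2 - b)) \<longlonglongrightarrow> 0"
proof -
  have i: "(\<lambda>N. inverse (R N)) \<longlonglongrightarrow> 0" by (rule tendsto_inverse_0_at_top[OF R_tendsto])
  have "(\<lambda>N. K * inverse (R N) / (1 - b * (inverse (R N) * inverse (R N)))) \<longlonglongrightarrow> K * 0 / (1 - b * (0 * 0))"
    by (intro tendsto_intros i) auto
  moreover have "K * inverse (R N) / (1 - b * (inverse (R N) * inverse (R N))) = K * R N / ((R N)\<^sup>2 - b)"
    for N
  proof -
    have "(R N)\<^sup>2 - b = (R N)\<^sup>2 * (1 - b * (inverse (R N) * inverse (R N)))"
      using R_pos[of N] by (simp add: field_simps power2_eq_square)
    then show ?thesis using R_pos[of N] by (simp add: power2_eq_square divide_inverse)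
  qed
  ultimately show ?thesis by simp
qed

end

context perturbation
begin

lemma edge_set_iff: "z \<in> edge_set L \<longleftrightarrow> g z = 0"
proof
  assume "z \<in> edge_set L"
  then obtain n \<nu> where "(n, \<nu>) \<in> edge_index" "z = of_real (L n \<nu>)" by (auto simp: edge_set_def)
  then have "X z = (-1) ^ n" using labelling_val[OF lab] by simp
  then show "g z = 0" by (simp add: g_def flip: power_mult)
next
  assume "g z = 0"
  then have "(X z)\<^sup>2 = 1" by (simp add: g_def)
  from labelling_zero[OF lab this] show "z \<in> edge_set L" unfolding edge_set_def by blast
qed

lemma mass_bounded:
  obtains C N0 where "C \<ge> 0" "\<And>n \<nu>. n \<ge> N0 \<Longrightarrow> \<bar>mass n \<nu>\<bar> \<le> C"
proof -
  obtain C r where C: "C \<ge> 0" "r \<ge> 1" "\<And>t. r \<le> t \<Longrightarrow> norm (deriv X (of_real t)) \<le> C / sqrt t ^ Suc 0"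
    by (rule growth_at_real[OF growth_deriv[OF hol X_growth]]) (rule that)
  obtain N0 where N0: "N0 \<ge> 2" "\<And>n \<nu>. n \<ge> N0 \<Longrightarrow> (real n)\<^sup>2 / 4 \<le> L n \<nu>"
    by (rule edges_grow) (rule that)
  obtain N1 :: nat where N1: "4 * r < N1" using reals_Archimedean2 by blast
  show ?thesis
  proof (rule that[OF C(1), of "max N0 N1"])
    fix n \<nu> assume n: "n \<ge> max N0 N1"
    have "real n * 1 \<le> real n * real n" using n N0(1) by (intro mult_left_mono) auto
    then have "4 * r \<le> (real n)\<^sup>2" using N1 n by (simp add: power2_eq_square)
    then have r: "r \<le> L n \<nu>" using N0(2)[of n \<nu>] n by simp
    have "\<bar>mass n \<nu>\<bar> = norm (complex_of_real (mass n \<nu>))" by simp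
    also have "\<dots> = norm (deriv X (of_real (L n \<nu>)))" unfolding of_real_mass
      by (simp add: norm_mult norm_power)
    also have "\<dots> \<le> C / sqrt (L n \<nu>) ^ Suc 0" by (rule C(3)[OF r])
    also have "\<dots> \<le> C / 1" using r C by (intro divide_left_mono) auto
    finally show "\<bar>mass n \<nu>\<bar> \<le> C" by simp
  qed
qed

text \<open>The tail is dominated by bounded masses times resolvents of order n^(-2); each of the
  finitely many remaining terms is continuous, hence bounded, on the compact set.\<close>

lemma uniform_majorant:
  assumes K: "compact K" "K \<inter> edge_set L = {}"
  obtains M where "M summable_on edge_index"
    "\<And>e z. e \<in> edge_index \<Longrightarrow> z \<in> K \<Longrightarrow> norm (of_real (case_prod mass e) / (z - of_real (case_prod L e))) \<le> M e"
proof -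
  obtain b where b: "\<And>z. z \<in> K \<Longrightarrow> norm z \<le> b"
    using compact_imp_bounded[OF K(1)] unfolding bounded_iff by metis
  obtain C N0 where C: "C \<ge> 0" "\<And>n \<nu>. n \<ge> N0 \<Longrightarrow> \<bar>mass n \<nu>\<bar> \<le> C"
    by (rule mass_bounded) (rule that)
  obtain N1 where N1: "N1 \<ge> 1" "\<And>n \<nu> z. n \<ge> N1 \<Longrightarrow> norm (z :: complex) \<le> b \<Longrightarrow> norm (1 / (z
    - of_real (L n \<nu>))) \<le> 8 / (real n)\<^sup>2"
    by (rule resolvent_bound) (rule that)
  define F where "F = (\<lambda>e z. norm (of_real (case_prod mass e) / (z - complex_of_real (case_prod L e))))"
  have "\<exists>B\<ge>0. \<forall>z\<in>K. F e z \<le> B" if "e \<in> edge_index" for e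
  proof -
    have "of_real (case_prod L e) \<in> edge_set L" using that by (cases e) (auto simp: edge_set_def)
    then have "continuous_on K (\<lambda>z. of_real (case_prod mass e) / (z - complex_of_real (case_prod L e)))"
      using K(2) by (intro continuous_intros) auto
    from compact_imp_bounded[OF compact_continuous_image[OF this K(1)]]
    obtain B where "\<forall>z\<in>K. F e z \<le> B" unfolding bounded_iff F_def by auto
    then show ?thesis by (intro exI[of _ "max 0 B"]) (auto intro: max.coboundedI2)
  qed
  then obtain B where B: "\<And>e. e \<in> edge_index \<Longrightarrow> B e \<ge> 0" "\<And>e z. e \<in> edge_index \<Longrightarrow> z \<in> K \<Longrightarrow> F e z \<le> B e" by metis
  define N where "N = max N0 N1"
  define M where "M = (\<lambda>e. if fst e \<ge> N then 8 * C / (real (fst e))\<^sup>2 else \<bar>B e\<bar>)"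
  show ?thesis
  proof (rule that[of M])
    show "M summable_on edge_index"
      by (rule inverse_square_summable_on_edges[where N = N and K = "8 * C"]) (use C in \<open>auto simp: M_def\<close>)
    fix e and z :: complex assume e: "e \<in> edge_index" and z: "z \<in> K"
    obtain n \<nu> where en: "e = (n, \<nu>)" by (cases e)
    show "norm (of_real (case_prod mass e) / (z - of_real (case_prod L e))) \<le> M e"
    proof (cases "n \<ge> N")
      case True
      have "norm (of_real (case_prod mass e) / (z - of_real (case_prod L e))) = \<bar>mass n \<nu>\<bar> * norm (1 / (z
        - of_real (L n \<nu>)))"
        by (simp add: en norm_divide)
      also have "\<dots> \<le> C * (8 / (real n)\<^sup>2)"
        using C(2)[of n \<nu>] N1(2)[of n z \<nu>] b[OF z] True C(1) by (intro mult_mono) (auto simp: N_def)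
      finally show ?thesis using True by (simp add: M_def en mult.commute)
    next
      case False
      then show ?thesis using B(2)[OF e z] by (auto simp: M_def F_def en intro: order_trans[OF _ abs_ge_self])
    qed
  qed
qed

text \<open>H = - X X' / 2 is half the mass at every edge, since X = (-1)^n there. It turns H g'/g
  into - X^2 X'^2 / (X^2 - 1), and adding the entire function X'^2 leaves the square of the
  derivative of the quasimomentum.\<close>

lemma quasimomentum_H:
  assumes "g z \<noteq> 0"
  shows "deriv g z * (- (X z * deriv X z) / 2) / g z + (deriv X z)\<^sup>2 = (deriv X z)\<^sup>2 / (1 - (X z)\<^sup>2)"
proof -
  have *: "2 * x * d * (- (x * d) / 2) / u + d\<^sup>2 = d\<^sup>2 / - u" if "u = x\<^sup>2 - 1" "u \<noteq> 0" for x d u :: complex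
  proof -
    have "2 * x * d * (- (x * d) / 2) = - (x\<^sup>2 * d\<^sup>2)" by (simp add: power2_eq_square)
    then show ?thesis using that(2) by (simp add: field_simps) (simp add: that(1) algebra_simps)
  qed
  have "- g z = 1 - (X z)\<^sup>2" by (simp add: g_def)
  with *[of "g z" "X z" "deriv X z"] assms show ?thesis by (simp add: deriv_g g_def)
qed

lemma H_edge:
  assumes "e \<in> edge_index"
  shows "- (X (of_real (case_prod L e)) * deriv X (of_real (case_prod L e))) / 2
    = of_real (case_prod mass e) / 2"
proof -
  obtain n \<nu> where e: "e = (n, \<nu>)" by (cases e)
  have "X (of_real (L n \<nu>)) = (-1) ^ n" using labelling_val[OF lab] assms by (simp add: e)
  then show ?thesis by (simp add: e of_real_mass)
qed

lemma hol_H: "(\<lambda>z. - (X z * deriv X z) / 2) holomorphic_on UNIV" "(\<lambda>z. (deriv X z)\<^sup>2) holomorphic_on UNIV"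
  by (intro holomorphic_intros X_holomorphic_on; simp)+

lemma abs_one_minus_square:
  assumes "d > 0" "\<And>\<eta>. \<bar>\<eta>\<bar> = 1 \<Longrightarrow> norm (X z - of_real \<eta>) \<ge> d * env z"
  shows "(d * env z)\<^sup>2 \<le> norm (1 - (X z)\<^sup>2)"
proof -
  have "1 - (X z)\<^sup>2 = - ((X z - of_real 1) * (X z - of_real (-1)))"
    by (simp add: power2_eq_square algebra_simps)
  then have "norm (1 - (X z)\<^sup>2) = norm (X z - of_real 1) * norm (X z - of_real (-1))"
    by (simp only: norm_minus_cancel norm_mult)
  moreover have "d * env z * (d * env z) \<le> norm (X z - of_real 1) * norm (X z - of_real (-1))"
    using assms(1) env_ge(2)[of z] by (intro mult_mono assms(2)) (auto intro: mult_nonneg_nonneg)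
  ultimately show ?thesis by (simp add: power2_eq_square)
qed

definition circle_const :: "real \<Rightarrow> real \<Rightarrow> nat \<Rightarrow> bool" where
  "circle_const d C N0 \<longleftrightarrow> d > 0 \<and> C \<ge> 0 \<and> N0 \<ge> 1 \<and>
    (\<forall>N\<ge>N0. edges_below L ((R N)\<^sup>2) = edges_upto N \<and>
       (\<forall>z. norm z = (R N)\<^sup>2 \<longrightarrow> norm (deriv X z) \<le> C * env z / R N \<and>
          (\<forall>\<eta>. \<bar>\<eta>\<bar> = 1 \<longrightarrow> norm (X z - of_real \<eta>) \<ge> d * env z)))"

lemma circle_const_exists: "\<exists>d C N0. circle_const d C N0"
proof -
  obtain d C N0 where D: "d > 0" "C \<ge> 0"
    "\<And>N z \<eta>. N \<ge> N0 \<Longrightarrow> norm z = (R N)\<^sup>2 \<Longrightarrow> \<bar>\<eta>\<bar> = 1 \<Longrightarrow> norm (X z - of_real \<eta>) \<ge> d * env z"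
    "\<And>N z. N \<ge> N0 \<Longrightarrow> norm z = (R N)\<^sup>2 \<Longrightarrow> norm (deriv X z) \<le> C * env z / R N"
    "\<And>N. N \<ge> N0 \<Longrightarrow> edges_below L ((R N)\<^sup>2) = edges_upto N"
    by (rule circle_bounds) (rule that)
  have "circle_const d C (max 1 N0)"
    unfolding circle_const_def by (intro conjI allI impI D) simp_all
  then show ?thesis by blast
qed

text \<open>In the last two estimates \<open>env\<close> cancels: X'^2 is compared with 1 - X^2,
  both of size \<open>env\<close> squared, and X' with X + \<eta>, both of size \<open>env\<close>.
  So they hold on the whole circle, including near the positive axis.\<close>

lemma circle_constD:
  assumes c: "circle_const d C N0"
  shows "d > 0" "C \<ge> 0" "N0 \<ge> 1"
    "\<And>N z \<eta>. N \<ge> N0 \<Longrightarrow> norm z = (R N)\<^sup>2 \<Longrightarrow> \<bar>\<eta>\<bar> = 1 \<Longrightarrow> norm (X z - of_real \<eta>) \<ge> d * env z"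
    "\<And>N z. N \<ge> N0 \<Longrightarrow> norm z = (R N)\<^sup>2 \<Longrightarrow> norm (deriv X z) \<le> C * env z / R N"
    "\<And>N. N \<ge> N0 \<Longrightarrow> edges_below L ((R N)\<^sup>2) = edges_upto N"
    "\<And>N z. N \<ge> N0 \<Longrightarrow> norm z = (R N)\<^sup>2 \<Longrightarrow> g z \<noteq> 0"
    "\<And>N z. N \<ge> N0 \<Longrightarrow> norm z = (R N)\<^sup>2 \<Longrightarrow> norm ((deriv X z)\<^sup>2 / (1 - (X z)\<^sup>2)) \<le> (C / d)\<^sup>2 / R N"
    "\<And>N z \<eta>. N \<ge> N0 \<Longrightarrow> norm z = (R N)\<^sup>2 \<Longrightarrow> \<bar>\<eta>\<bar> = 1 \<Longrightarrow> norm (deriv X z / (X z + of_real \<eta>)) \<le> (C / d) / R N"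
proof -
  show D: "d > 0" "C \<ge> 0" "N0 \<ge> 1"
    and lo': "\<And>N z \<eta>. N \<ge> N0 \<Longrightarrow> norm z = (R N)\<^sup>2 \<Longrightarrow> \<bar>\<eta>\<bar> = 1 \<Longrightarrow> norm (X z - of_real \<eta>) \<ge> d * env z"
    and up': "\<And>N z. N \<ge> N0 \<Longrightarrow> norm z = (R N)\<^sup>2 \<Longrightarrow> norm (deriv X z) \<le> C * env z / R N"
    and "\<And>N. N \<ge> N0 \<Longrightarrow> edges_below L ((R N)\<^sup>2) = edges_upto N"
    using c unfolding circle_const_def by simp_all
  fix N and z :: complex assume N: "N0 \<le> N" and z: "norm z = (R N)\<^sup>2"
  have R1: "R N \<ge> 1" using R_ge(1)[of N] N D(3) by simp
  note lo = lo'[OF N z] and up = up'[OF N z]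
  have de: "d * env z > 0" using D(1) env_ge(2)[of z] by simp
  show "g z \<noteq> 0" by (rule g_nz_circle[OF D(1) lo])
  have "norm ((deriv X z)\<^sup>2 / (1 - (X z)\<^sup>2)) \<le> (C * env z / R N)\<^sup>2 / (d * env z)\<^sup>2"
    unfolding norm_divide norm_power
    by (intro frac_le power_mono up abs_one_minus_square[OF D(1) lo]) (use de in auto)
  also have "\<dots> = (C / d)\<^sup>2 / (R N)\<^sup>2" using env_ge(2)[of z] D(1)
    by (simp add: power_divide power_mult_distrib)
  also have "\<dots> \<le> (C / d)\<^sup>2 / R N" using R1 self_le_power[of "R N" 2] by (intro divide_left_mono) auto
  finally show "norm ((deriv X z)\<^sup>2 / (1 - (X z)\<^sup>2)) \<le> (C / d)\<^sup>2 / R N" .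
  fix \<eta> :: real assume \<eta>: "\<bar>\<eta>\<bar> = 1"
  have "norm (deriv X z / (X z + of_real \<eta>)) \<le> (C * env z / R N) / (d * env z)"
    unfolding norm_divide using lo[of "-\<eta>"] \<eta> order_trans[OF norm_ge_zero up] up de by (intro frac_le) auto
  also have "\<dots> = (C / d) / R N" using env_ge(2)[of z] by simp
  finally show "norm (deriv X z / (X z + of_real \<eta>)) \<le> (C / d) / R N" .
qed

lemma sqrt_R_large: "eventually (\<lambda>N. b < (R N)\<^sup>2) sequentially"
proof -
  obtain M :: nat where M: "b < M" using reals_Archimedean2 by blast
  show ?thesis
  proof (rule eventually_sequentiallyI[of "max 1 M"])
    fix N assume N: "max 1 M \<le> N"
    have "real N * 1 \<le> R N * R N" using R_ge(1)[of N] N by (intro mult_mono) auto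
    then show "b < (R N)\<^sup>2" using M N by (simp add: power2_eq_square)
  qed
qed

lemma partial_fractions_limit:
  assumes z: "g z \<noteq> 0"
  shows "(\<lambda>N. \<Sum>e\<in>edges_upto N. of_real (case_prod mass e) / (z - of_real (case_prod L e)))
     \<longlonglongrightarrow> 2 * ((deriv X z)\<^sup>2 / (1 - (X z)\<^sup>2))"
proof -
  obtain d C N0 where "circle_const d C N0" using circle_const_exists by blast
  note D = circle_constD[OF this]
  define h where "h = (deriv X z)\<^sup>2 / (1 - (X z)\<^sup>2)"
  define S where "S = (\<lambda>N. \<Sum>e\<in>edges_upto N. of_real (case_prod mass e) / (z - of_real (case_prod L e)))"
  have ineq: "norm (S N - 2 * h) \<le> 2 * ((C / d)\<^sup>2 * R N / ((R N)\<^sup>2 - norm z))"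
    if N: "N \<ge> N0" "norm z < (R N)\<^sup>2" for N
  proof -
    have bd: "norm (deriv g w * (- (X w * deriv X w) / 2) / g w + (deriv X w)\<^sup>2) \<le> (C / d)\<^sup>2 / R N"
      if "norm w = (R N)\<^sup>2" for w
      unfolding quasimomentum_H[OF D(7)[OF N(1) that]] by (rule D(8)[OF N(1) that])
    have "norm (h + (\<Sum>e\<in>edges_upto N. (- (X (of_real (case_prod L e))
      * deriv X (of_real (case_prod L e))) / 2) / (of_real (case_prod L e) - z)))
      \<le> (C / d)\<^sup>2 * R N / ((R N)\<^sup>2 - norm z)"
      using partial_fractions_error[OF hol_H D(7)[OF N(1)] D(6)[OF N(1)] bd N(2) z]
      unfolding quasimomentum_H[OF z] h_def[symmetric] .
    also have "(\<Sum>e\<in>edges_upto N. (- (X (of_real (case_prod L e))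
      * deriv X (of_real (case_prod L e))) / 2) / (of_real (case_prod L e) - z)) = - S N / 2"
    proof -
      have summand: "(- (X (of_real (case_prod L e))
        * deriv X (of_real (case_prod L e))) / 2) / (of_real (case_prod L e) - z)
         = - (of_real (case_prod mass e) / (z - of_real (case_prod L e)) / 2)" if "e \<in> edges_upto N" for e
      proof -
        have "e \<in> edge_index" using that by (simp add: edges_upto_def)
        moreover have "a / 2 / (- y) = - (a / y / 2)" for a y :: complex by simp
        from this[of _ "z - of_real (case_prod L e)"]
        have "a / 2 / (of_real (case_prod L e) - z) = - (a / (z - of_real (case_prod L e)) / 2)" for a
          by (simp only: minus_diff_eq)
        ultimately show ?thesis by (simp only: H_edge)
      qed
      have "(\<Sum>e\<in>edges_upto N. (- (X (of_real (case_prod L e))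
        * deriv X (of_real (case_prod L e))) / 2) / (of_real (case_prod L e) - z))
        = (\<Sum>e\<in>edges_upto N. - (of_real (case_prod mass e) / (z - of_real (case_prod L e)) / 2))"
        by (rule sum.cong[OF refl]) (rule summand)
      also have "\<dots> = - S N / 2" unfolding S_def
        by (simp only: sum_negf sum_divide_distrib[symmetric] minus_divide_left[symmetric])
      finally show ?thesis .
    qed
    finally have "norm (h + - S N / 2) \<le> (C / d)\<^sup>2 * R N / ((R N)\<^sup>2 - norm z)" .
    moreover have "norm (v - 2 * u) = 2 * norm (u + - v / 2)" for u v :: complex
    proof -
      have "v - 2 * u = (- 2) * (u + - v / 2)" by simp
      then have "norm (v - 2 * u) = norm (- 2 :: complex) * norm (u + - v / 2)" by (simp only: norm_mult)
      then show ?thesis by simp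
    qed
    ultimately show ?thesis by simp
  qed
  have "eventually (\<lambda>N. norm (S N - 2 * h) \<le> 2 * ((C / d)\<^sup>2 * R N / ((R N)\<^sup>2 - norm z))) sequentially"
    using eventually_conj[OF eventually_ge_at_top[of N0] sqrt_R_large[of "norm z"]]
    by (rule eventually_mono) (simp only: ineq)
  moreover have "(\<lambda>N. 2 * ((C / d)\<^sup>2 * R N / ((R N)\<^sup>2 - norm z))) \<longlonglongrightarrow> 0"
    by (rule tendsto_mult_right_zero[OF error_tendsto])
  ultimately have "(\<lambda>N. S N - 2 * h) \<longlonglongrightarrow> 0" by (rule Lim_null_comparison)
  then show ?thesis unfolding S_def h_def by (rule Lim_null[THEN iffD2])
qed

theorem partial_fractions:
  assumes z: "z \<notin> edge_set L"
  shows "(\<lambda>(n, \<nu>). norm (of_real (mass n \<nu>) / (z - of_real (L n \<nu>)))) summable_on edge_index"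
    "(deriv X z)\<^sup>2 / (1 - (X z)\<^sup>2) = 1 / 2 * (\<Sum>\<^sub>\<infinity>(n, \<nu>)\<in>edge_index. of_real (mass n \<nu>) / (z
      - of_real (L n \<nu>)))"
proof -
  obtain M where M: "M summable_on edge_index"
    "\<And>e y. e \<in> edge_index \<Longrightarrow> y \<in> {z} \<Longrightarrow> norm (of_real (case_prod mass e) / (y - of_real (case_prod L e))) \<le> M e"
    by (rule uniform_majorant[of "{z}"]) (use z in auto)
  define f where "f = (\<lambda>e. of_real (case_prod mass e) / (z - complex_of_real (case_prod L e)))"
  have f: "f = (\<lambda>(n, \<nu>). of_real (mass n \<nu>) / (z - of_real (L n \<nu>)))" by (auto simp: f_def)
  have n: "(\<lambda>e. norm (f e)) summable_on edge_index"
    unfolding f_def by (rule Infinite_Sum.abs_summable_on_comparison_test'[OF M(1)]) (use M(2) in auto)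
  then show "(\<lambda>(n, \<nu>). norm (of_real (mass n \<nu>) / (z - of_real (L n \<nu>)))) summable_on edge_index"
    unfolding f by (simp add: case_prod_unfold)
  have s: "f summable_on edge_index" by (rule abs_summable_summable[OF n])
  have i: "edges_upto N \<inter> edge_index = edges_upto N" for N by (auto simp: edges_upto_def)
  have "(\<lambda>N. sum f (edges_upto N)) \<longlonglongrightarrow> infsum f edge_index"
    using edges_upto_tendsto[OF s order_refl] unfolding i .
  moreover have "(\<lambda>N. sum f (edges_upto N)) \<longlonglongrightarrow> 2 * ((deriv X z)\<^sup>2 / (1 - (X z)\<^sup>2))"
    unfolding f_def by (rule partial_fractions_limit) (use z edge_set_iff in auto)
  ultimately have "infsum f edge_index = 2 * ((deriv X z)\<^sup>2 / (1 - (X z)\<^sup>2))" by (rule LIMSEQ_unique)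
  then show "(deriv X z)\<^sup>2 / (1 - (X z)\<^sup>2) = 1 / 2 * (\<Sum>\<^sub>\<infinity>(n, \<nu>)\<in>edge_index. of_real (mass n \<nu>) / (z
    - of_real (L n \<nu>)))"
    unfolding f by simp
qed

theorem partial_fractions_uniform:
  assumes K: "compact K" "K \<inter> edge_set L = {}"
  shows "uniform_limit K (\<lambda>I z. 1 / 2 * (\<Sum>(n, \<nu>)\<in>I. of_real (mass n \<nu>) / (z - of_real (L n \<nu>))))
     (\<lambda>z. (deriv X z)\<^sup>2 / (1 - (X z)\<^sup>2)) (finite_subsets_at_top edge_index)"
proof -
  obtain M where M: "M summable_on edge_index"
    "\<And>e z. e \<in> edge_index \<Longrightarrow> z \<in> K \<Longrightarrow> norm (of_real (case_prod mass e) / (z - of_real (case_prod L e))) \<le> M e"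
    by (rule uniform_majorant[OF K]) (rule that)
  have "uniform_limit K (\<lambda>I z. \<Sum>e\<in>I. of_real (case_prod mass e) / (z - of_real (case_prod L e)))
     (\<lambda>z. \<Sum>\<^sub>\<infinity>e\<in>edge_index. of_real (case_prod mass e) / (z
       - of_real (case_prod L e))) (finite_subsets_at_top edge_index)"
    by (rule Weierstrass_m_test_general[OF M(2,1)])
  then have "uniform_limit K (\<lambda>I z. 1 / 2 * (\<Sum>e\<in>I. of_real (case_prod mass e) / (z
    - of_real (case_prod L e))))
     (\<lambda>z. 1 / 2 * (\<Sum>\<^sub>\<infinity>e\<in>edge_index. of_real (case_prod mass e) / (z
       - of_real (case_prod L e)))) (finite_subsets_at_top edge_index)"
    by (rule bounded_linear.uniform_limit[OF bounded_linear_mult_right])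
  moreover have "(deriv X z)\<^sup>2 / (1 - (X z)\<^sup>2) = 1 / 2
    * (\<Sum>\<^sub>\<infinity>e\<in>edge_index. of_real (case_prod mass e) / (z - of_real (case_prod L e)))" if "z \<in> K" for z
    using partial_fractions(2)[of z] K(2) that by (auto simp: case_prod_unfold)
  ultimately show ?thesis
    by (subst uniform_limit_cong'[where g = "\<lambda>I z. 1 / 2 * (\<Sum>e\<in>I. of_real (case_prod mass e) / (z
      - of_real (case_prod L e)))"
        and i = "\<lambda>z. 1 / 2 * (\<Sum>\<^sub>\<infinity>e\<in>edge_index. of_real (case_prod mass e) / (z - of_real (case_prod L e)))"])
      (auto simp: case_prod_unfold)
qed

end

section \<open>Sums over the edges of opposite parity\<close>

context perturbation
begin

text \<open>For \<open>\<sigma> = \<plusminus>1\<close>, the weight \<open>(1 - \<sigma> X) / 2\<close> is \<open>1\<close> at the zeros of \<open>X + \<sigma>\<close> and \<open>0\<close> at those of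
  \<open>X - \<sigma>\<close>.\<close>

lemma opposite_H:
  assumes "g z \<noteq> 0" "\<sigma> = 1 \<or> \<sigma> = -1"
  shows "deriv g z * ((1 - \<sigma> * X z) / 2) / g z + \<sigma> * deriv X z = deriv X z / (X z + \<sigma>)"
proof -
  have g: "g z = (X z - 1) * (X z + 1)" by (simp add: g_def power2_eq_square algebra_simps)
  with assms(1) have "X z \<noteq> 1" "X z \<noteq> -1" by (auto simp: add_eq_0_iff2)
  then have nz: "X z - 1 \<noteq> 0" "X z + 1 \<noteq> 0" by (auto simp: add_eq_0_iff2)
  show ?thesis using assms(2)
  proof
    assume "\<sigma> = 1"
    moreover have "2 * x * d * ((1 - x) / 2) / ((x - 1) * (x + 1)) + d = d / (x + 1)"
      if "x - 1 \<noteq> 0" "x + 1 \<noteq> 0" for x d :: complex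
    proof -
      have "2 * x * d * ((1 - x) / 2) = x * d * (1 - x)" by simp
      also have "\<dots> = (x - 1) * (- x * d)" by (simp add: algebra_simps)
      finally have "2 * x * d * ((1 - x) / 2) / ((x - 1) * (x + 1)) = - x * d / (x + 1)"
        by (simp only: nonzero_mult_divide_mult_cancel_left[OF that(1)])
      moreover have "- x * d / (x + 1) + d = d / (x + 1)" using that(2)
        by (simp add: divide_simps) (simp add: algebra_simps)
      ultimately show ?thesis by (simp only:)
    qed
    from this[OF nz] show ?thesis using \<open>\<sigma> = 1\<close> by (simp add: deriv_g g)
  next
    assume "\<sigma> = -1"
    moreover have "2 * x * d * ((1 + x) / 2) / ((x - 1) * (x + 1)) - d = d / (x - 1)"
      if "x - 1 \<noteq> 0" "x + 1 \<noteq> 0" for x d :: complex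
    proof -
      have "2 * x * d * ((1 + x) / 2) = x * d * (1 + x)" by simp
      also have "\<dots> = (x * d) * (x + 1)" by (simp add: algebra_simps)
      finally have "2 * x * d * ((1 + x) / 2) / ((x - 1) * (x + 1)) = x * d / (x - 1)"
        by (simp only: nonzero_mult_divide_mult_cancel_right[OF that(2)])
      moreover have "x * d / (x - 1) - d = d / (x - 1)" using that(1)
        by (simp add: divide_simps) (simp add: algebra_simps)
      ultimately show ?thesis by (simp only:)
    qed
    from this[OF nz] show ?thesis using \<open>\<sigma> = -1\<close> by (simp add: deriv_g g)
  qed
qed

definition opposite :: "complex \<Rightarrow> (nat \<times> edge_sign) set" where
  "opposite \<sigma> = {e \<in> edge_index. (-1) ^ fst e = - \<sigma>}"

lemma eventually_g_nz: "eventually (\<lambda>w. g w \<noteq> 0) (at z)"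
proof -
  obtain d C N0 where "circle_const d C N0" using circle_const_exists by blast
  note D = circle_constD[OF this]
  have "norm (complex_of_real ((R N0)\<^sup>2)) = (R N0)\<^sup>2" by (simp add: norm_power)
  from D(7)[OF order_refl this] have "g (of_real ((R N0)\<^sup>2)) \<noteq> 0" .
  from non_zero_neighbour_alt[OF g_holomorphic _ _ _ _ this, of UNIV z] show ?thesis
    by (auto elim: eventually_mono)
qed

lemma opposite_limit:
  assumes z: "X z = \<sigma>" and \<sigma>: "\<sigma> = 1 \<or> \<sigma> = -1"
  shows "(\<lambda>N. \<Sum>e\<in>edges_upto N \<inter> opposite \<sigma>. 1 / (of_real (case_prod L e) - z)) \<longlonglongrightarrow> - deriv X z / (2 * \<sigma>)"
proof -
  obtain d C N0 where "circle_const d C N0" using circle_const_exists by blast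
  note D = circle_constD[OF this]
  define S where "S = (\<lambda>N (y :: complex). \<Sum>e\<in>edges_upto N \<inter> opposite \<sigma>. 1 / (of_real (case_prod L e) - y))"
  define G where "G = (\<lambda>N y. deriv X y / (X y + \<sigma>) + S N y)"
  have \<sigma>0: "\<sigma> \<noteq> 0" "\<sigma> * \<sigma> = 1" using \<sigma> by auto
  define \<eta> :: real where "\<eta> = (if \<sigma> = 1 then 1 else -1)"
  have \<eta>: "\<sigma> = of_real \<eta>" "\<bar>\<eta>\<bar> = 1" using \<sigma> by (auto simp: \<eta>_def)
  have L_val: "X (of_real (case_prod L e)) = (-1) ^ fst e" if "e \<in> edge_index" for e
    using labelling_val[OF lab, of "fst e" "snd e"] that by (cases e) auto
  have away: "norm (G N y) \<le> (C / d) * R N / ((R N)\<^sup>2 - norm y)"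
    if N: "N \<ge> N0" and y: "norm y < (R N)\<^sup>2" "g y \<noteq> 0" for N y
  proof -
    have hol: "(\<lambda>y. (1 - \<sigma> * X y) / 2) holomorphic_on UNIV" "(\<lambda>y. \<sigma> * deriv X y) holomorphic_on UNIV"
      by (intro holomorphic_intros X_holomorphic_on; simp)+
    have bd: "norm (deriv g w * ((1 - \<sigma> * X w) / 2) / g w + \<sigma> * deriv X w) \<le> (C / d) / R N"
      if "norm w = (R N)\<^sup>2" for w
      unfolding opposite_H[OF D(7)[OF N that] \<sigma>] unfolding \<eta>(1) by (rule D(9)[OF N that \<eta>(2)])
    have Seq: "(\<Sum>e\<in>edges_upto N. (1 - \<sigma> * X (of_real (case_prod L e))) / 2 / (of_real (case_prod L e)
      - y)) = S N y"
      unfolding S_def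
    proof (rule sum.mono_neutral_cong_right)
      show "\<forall>e\<in>edges_upto N - edges_upto N \<inter> opposite \<sigma>. (1 - \<sigma>
        * X (of_real (case_prod L e))) / 2 / (of_real (case_prod L e) - y) = 0"
      proof
        fix e assume e: "e \<in> edges_upto N - edges_upto N \<inter> opposite \<sigma>"
        then have i: "e \<in> edge_index" "(-1) ^ fst e \<noteq> - \<sigma>" by (auto simp: opposite_def edges_upto_def)
        have "(-1) ^ fst e = (1::complex) \<or> (-1) ^ fst e = (-1::complex)" by (cases "even (fst e)") auto
        then have "(-1) ^ fst e = \<sigma>" using i(2) \<sigma> by auto
        then show "(1 - \<sigma> * X (of_real (case_prod L e))) / 2 / (of_real (case_prod L e) - y) = 0"
          using L_val[OF i(1)] \<sigma>0 by simp
      qed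
      fix e assume "e \<in> edges_upto N \<inter> opposite \<sigma>"
      then have i: "e \<in> edge_index" "(-1) ^ fst e = - \<sigma>" by (auto simp: opposite_def)
      then have two: "1 - \<sigma> * X (of_real (case_prod L e)) = 2" using L_val[OF i(1)] \<sigma>0 by simp
      show "(1 - \<sigma> * X (of_real (case_prod L e))) / 2 / (of_real (case_prod L e) - y)
        = 1 / (of_real (case_prod L e) - y)"
        unfolding two by simp
    qed auto
    from partial_fractions_error[OF hol D(7)[OF N] D(6)[OF N] bd y]
    show ?thesis unfolding opposite_H[OF y(2) \<sigma>] Seq G_def .
  qed
  \<comment> \<open>Limit of \<open>away\<close> as y tends to \<open>z\<close> through points where
    \<open>g\<close> does not vanish, for fixed \<open>N\<close>.\<close>
  have ineq: "norm (G N z) \<le> (C / d) * R N / ((R N)\<^sup>2 - norm z)" if N: "N \<ge> N0" "norm z < (R N)\<^sup>2" for N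
  proof (rule tendsto_le)
    have "of_real (case_prod L e) \<noteq> z" if "e \<in> opposite \<sigma>" for e
    proof
      assume "of_real (case_prod L e) = z"
      moreover have "e \<in> edge_index" "(-1) ^ fst e = - \<sigma>" using that by (auto simp: opposite_def)
      ultimately show False using L_val[of e] z \<sigma> by auto
    qed
    then have cS: "isCont (S N) z" unfolding S_def by (intro continuous_intros) auto
    have cX: "isCont X z" "isCont (deriv X) z"
      using holomorphic_on_imp_continuous_on[OF hol] holomorphic_on_imp_continuous_on[OF deriv_X_holomorphic]
      by (simp_all only: continuous_on_eq_continuous_at[OF open_UNIV] UNIV_I)
    have "isCont (G N) z" unfolding G_def using z \<sigma> by (intro continuous_intros cS cX) auto
    then show "((\<lambda>y. norm (G N y)) \<longlongrightarrow> norm (G N z)) (at z)" by (intro tendsto_norm) (simp add: isCont_def)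
    show "((\<lambda>y. (C / d) * R N / ((R N)\<^sup>2 - norm y)) \<longlongrightarrow> (C / d) * R N / ((R N)\<^sup>2 - norm z)) (at z)"
      by (intro tendsto_intros) (use N(2) in auto)
    have "eventually (\<lambda>y. norm y < (R N)\<^sup>2) (at z)"
      by (rule order_tendstoD(2)[of norm "norm z"]) (use N(2) in \<open>auto intro!: tendsto_intros\<close>)
    then show "eventually (\<lambda>y. norm (G N y) \<le> (C / d) * R N / ((R N)\<^sup>2 - norm y)) (at z)"
      using eventually_g_nz[of z] by eventually_elim (rule away[OF N(1)])
  qed simp
  have "eventually (\<lambda>N. norm (G N z) \<le> (C / d) * R N / ((R N)\<^sup>2 - norm z)) sequentially"
    using eventually_conj[OF eventually_ge_at_top[of N0] sqrt_R_large[of "norm z"]]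
    by (rule eventually_mono) (simp only: ineq)
  then have "(\<lambda>N. G N z) \<longlonglongrightarrow> 0" by (rule Lim_null_comparison[OF _ error_tendsto])
  then have "(\<lambda>N. G N z - deriv X z / (X z + \<sigma>)) \<longlonglongrightarrow> 0 - deriv X z / (X z + \<sigma>)"
    by (intro tendsto_diff tendsto_const)
  moreover have "(\<lambda>N. G N z - deriv X z / (X z + \<sigma>)) = (\<lambda>N. S N z)" by (simp add: G_def)
  moreover have "0 - deriv X z / (X z + \<sigma>) = - deriv X z / (2 * \<sigma>)" unfolding z mult_2 by simp
  ultimately show ?thesis unfolding S_def by (simp only:)
qed

text \<open>With \<sigma> = (-1)^n, its own inverse, the limit - X' / (2 \<sigma>) is half the mass.
  Summability is shown separately, so that the limit along \<open>edges_upto N\<close> is the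
  unordered sum.\<close>

lemma opposite_sum:
  assumes e: "(n, \<nu>) \<in> edge_index"
  shows "(\<lambda>e. 1 / (case_prod L e - L n \<nu>)) summable_on opposite ((-1) ^ n)"
    "mass n \<nu> = 2 * (\<Sum>\<^sub>\<infinity>e\<in>opposite ((-1) ^ n). 1 / (case_prod L e - L n \<nu>))"
proof -
  define f where "f = (\<lambda>e. 1 / (case_prod L e - L n \<nu>))"
  obtain N1 where N1: "N1 \<ge> 1" "\<And>m \<mu> z. m \<ge> N1 \<Longrightarrow> norm (z :: complex) \<le> \<bar>L n \<nu>\<bar> \<Longrightarrow> norm (1 / (z
    - of_real (L m \<mu>))) \<le> 8 / (real m)\<^sup>2"
    by (rule resolvent_bound) (rule that)
  have "\<bar>f (m, \<mu>)\<bar> \<le> 8 / (real m)\<^sup>2" if "m \<ge> N1" for m \<mu>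
    using N1(2)[OF that, of "of_real (L n \<nu>)" \<mu>]
    by (simp add: f_def norm_divide abs_minus_commute flip: of_real_diff)
  then have "(\<lambda>e. \<bar>f e\<bar>) summable_on opposite ((-1) ^ n)"
    by (intro inverse_square_summable_on_edges[where N = N1 and K = 8]) auto
  then have "(\<lambda>e. norm (f e)) summable_on opposite ((-1) ^ n)" unfolding real_norm_def .
  then show s: "f summable_on opposite ((-1) ^ n)" by (rule abs_summable_summable)
  have sub: "opposite ((-1) ^ n) \<subseteq> edge_index" by (auto simp: opposite_def)
  have v: "X (of_real (L n \<nu>)) = (-1) ^ n" by (rule labelling_val[OF lab e])
  have sg: "(-1) ^ n = (1::complex) \<or> (-1) ^ n = (-1::complex)" by (cases "even n") auto
  have m: "- deriv X (of_real (L n \<nu>)) / (2 * (-1) ^ n) = of_real (mass n \<nu> / 2)"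
    using of_real_mass[of n \<nu>] by (cases "even n") auto
  have fs: "(\<lambda>N. complex_of_real (sum f (edges_upto N \<inter> opposite ((-1) ^ n))))
      = (\<lambda>N. \<Sum>e\<in>edges_upto N \<inter> opposite ((-1) ^ n). 1 / (of_real (case_prod L e) - of_real (L n \<nu>)))"
    by (simp add: f_def)
  have "(\<lambda>N. complex_of_real (sum f (edges_upto N \<inter> opposite ((-1) ^ n)))) \<longlonglongrightarrow> of_real (mass n \<nu> / 2)"
    unfolding fs m[symmetric] by (rule opposite_limit[OF v sg])
  then have "(\<lambda>N. sum f (edges_upto N \<inter> opposite ((-1) ^ n))) \<longlonglongrightarrow> mass n \<nu> / 2"
    unfolding tendsto_of_real_iff .
  from LIMSEQ_unique[OF this edges_upto_tendsto[OF s sub]]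
  show "mass n \<nu> = 2 * (\<Sum>\<^sub>\<infinity>e\<in>opposite ((-1) ^ n). f e)" by simp
qed

theorem mass_even:
  assumes "(2 * n, \<nu>) \<in> edge_index"
  shows "(\<lambda>(m, s). 1 / (L (2 * m - 1) s - L (2 * n) \<nu>)) summable_on {(m, s). m \<ge> 1}"
    "mass (2 * n) \<nu> = 2 * (\<Sum>\<^sub>\<infinity>(m, s)\<in>{(m, s). m \<ge> 1}. 1 / (L (2 * m - 1) s - L (2 * n) \<nu>))"
proof -
  have p: "(-1) ^ (2 * n) = (1 :: complex)" by simp
  note os = opposite_sum[OF assms, unfolded p]
  define f where "f = (\<lambda>e. 1 / (case_prod L e - L (2 * n) \<nu>))"
  have mem: "(m, s) \<in> opposite 1 \<longleftrightarrow> odd m" for m s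
    by (cases "even m") (auto simp: opposite_def edge_index_iff Suc_le_eq odd_pos)
  have b: "bij_betw (\<lambda>(m, s). (2 * m - 1, s)) {(m, s). m \<ge> (1::nat)} (opposite 1)"
  proof (rule bij_betwI[where g = "\<lambda>(m, s). ((m + 1) div 2, s)"])
    show "(\<lambda>(m, s). (2 * m - 1, s)) \<in> {(m, s). m \<ge> (1::nat)} \<rightarrow> opposite 1"
      by (auto simp: mem)
    show "(\<lambda>(m, s). ((m + 1) div 2, s)) \<in> opposite 1 \<rightarrow> {(m, s). m \<ge> 1}"
    proof (rule funcsetI, clarify)
      fix m s assume "(m, s) \<in> opposite 1"
      then obtain k where "m = 2 * k + 1" unfolding mem by (rule oddE)
      then show "1 \<le> (m + 1) div 2" by simp
    qed
    show "(\<lambda>(m, s). (2 * m - 1, s)) ((\<lambda>(m, s). ((m + 1) div 2, s)) y) = y" if "y \<in> opposite 1" for y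
    proof (cases y)
      case (Pair m s)
      with that have "odd m" by (simp add: mem)
      then obtain k where "m = 2 * k + 1" by (rule oddE)
      then show ?thesis using Pair by simp
    qed
  qed (auto split: prod.splits)
  have e: "(\<lambda>(m, s). 1 / (L (2 * m - 1) s - L (2 * n) \<nu>)) = (\<lambda>x. f ((\<lambda>(m, s). (2 * m - 1, s)) x))"
    by (auto simp: f_def)
  show "(\<lambda>(m, s). 1 / (L (2 * m - 1) s - L (2 * n) \<nu>)) summable_on {(m, s). m \<ge> 1}"
    unfolding e summable_on_reindex_bij_betw[OF b] unfolding f_def by (rule os(1))
  show "mass (2 * n) \<nu> = 2 * (\<Sum>\<^sub>\<infinity>(m, s)\<in>{(m, s). m \<ge> 1}. 1 / (L (2 * m - 1) s - L (2 * n) \<nu>))"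
    unfolding e infsum_reindex_bij_betw[OF b] unfolding f_def by (rule os(2))
qed

theorem mass_odd:
  shows "(\<lambda>(m, s). 1 / (L (2 * m) s - L (2 * n + 1) \<nu>)) summable_on {(m, s). (2 * m, s) \<in> edge_index}"
    "mass (2 * n + 1) \<nu> = 2 * (\<Sum>\<^sub>\<infinity>(m, s)\<in>{(m, s). (2 * m, s) \<in> edge_index}. 1 / (L (2 * m) s - L (2 * n
      + 1) \<nu>))"
proof -
  have i: "(2 * n + 1, \<nu>) \<in> edge_index" by (simp add: edge_index_iff)
  have p: "(-1) ^ (2 * n + 1) = (-1 :: complex)" by simp
  note os = opposite_sum[OF i, unfolded p]
  define f where "f = (\<lambda>e. 1 / (case_prod L e - L (2 * n + 1) \<nu>))"
  have mem: "(m, s) \<in> opposite (-1) \<longleftrightarrow> even m \<and> (m, s) \<in> edge_index" for m s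
    by (cases "even m") (auto simp: opposite_def)
  have b: "bij_betw (\<lambda>(m, s). (2 * m, s)) {(m, s). (2 * m, s) \<in> edge_index} (opposite (-1))"
  proof (rule bij_betwI[where g = "\<lambda>(m, s). (m div 2, s)"])
    show "(\<lambda>(m, s). (2 * m, s)) \<in> {(m, s). (2 * m, s) \<in> edge_index} \<rightarrow> opposite (-1)"
      by (auto simp: mem)
    show "(\<lambda>(m, s). (m div 2, s)) \<in> opposite (-1) \<rightarrow> {(m, s). (2 * m, s) \<in> edge_index}"
    proof (rule funcsetI, clarify)
      fix m s assume "(m, s) \<in> opposite (-1)"
      then have "even m" "(m, s) \<in> edge_index" unfolding mem by auto
      then show "(2 * (m div 2), s) \<in> edge_index" by simp
    qed
    show "(\<lambda>(m, s). (2 * m, s)) ((\<lambda>(m, s). (m div 2, s)) y) = y" if "y \<in> opposite (-1)" for y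
      using that by (cases y) (simp add: mem)
  qed (auto split: prod.splits)
  have e: "(\<lambda>(m, s). 1 / (L (2 * m) s - L (2 * n + 1) \<nu>)) = (\<lambda>x. f ((\<lambda>(m, s). (2 * m, s)) x))"
    by (auto simp: f_def)
  show "(\<lambda>(m, s). 1 / (L (2 * m) s - L (2 * n + 1) \<nu>)) summable_on {(m, s). (2 * m, s) \<in> edge_index}"
    unfolding e summable_on_reindex_bij_betw[OF b] unfolding f_def by (rule os(1))
  show "mass (2 * n + 1) \<nu> = 2 * (\<Sum>\<^sub>\<infinity>(m, s)\<in>{(m, s). (2 * m, s) \<in> edge_index}. 1 / (L (2 * m) s - L (2
    * n + 1) \<nu>))"
    unfolding e infsum_reindex_bij_betw[OF b] unfolding f_def by (rule os(2))
qed

end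

section \<open>The total mass\<close>

text \<open>For any square root w of z, (Im w)^2 = (|z| - Re z) / 2; the double angle formula does
  the rest.\<close>

lemma Im_csqrt_circle:
  assumes "\<rho> \<ge> 0"
  shows "\<bar>Im (csqrt (of_real (\<rho>\<^sup>2) * exp (2 * of_real pi * \<i> * of_real x)))\<bar> = \<rho> * \<bar>sin (pi * x)\<bar>"
proof -
  define z where "z = of_real (\<rho>\<^sup>2) * exp (2 * of_real pi * \<i> * of_real x)"
  define w where "w = csqrt z"
  have wz: "w\<^sup>2 = z" by (simp add: w_def)
  have "norm z = \<rho>\<^sup>2" by (simp add: z_def norm_mult norm_power)
  then have n: "(Re w)\<^sup>2 + (Im w)\<^sup>2 = \<rho>\<^sup>2" unfolding wz[symmetric] norm_power cmod_power2 .
  have "Re z = \<rho>\<^sup>2 * cos (2 * (pi * x))" unfolding z_def by (simp add: Re_exp mult_ac del: of_real_power)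
  moreover have "Re (w\<^sup>2) = (Re w)\<^sup>2 - (Im w)\<^sup>2" by (simp add: power2_eq_square)
  ultimately have r: "(Re w)\<^sup>2 - (Im w)\<^sup>2 = \<rho>\<^sup>2 * (1 - 2 * (sin (pi * x))\<^sup>2)" unfolding wz cos_double_sin
    by simp
  have "(Im w)\<^sup>2 = \<rho>\<^sup>2 * (sin (pi * x))\<^sup>2" using n r by (simp add: algebra_simps)
  then have "\<bar>Im w\<bar>\<^sup>2 = (\<rho> * \<bar>sin (pi * x)\<bar>)\<^sup>2" by (simp add: power_mult_distrib)
  then have "\<bar>Im w\<bar> = \<rho> * \<bar>sin (pi * x)\<bar>" using assms
    by (simp only: power2_eq_iff_nonneg abs_ge_zero mult_nonneg_nonneg)
  then show ?thesis unfolding w_def z_def .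
qed

text \<open>The integrand tends to 0 except at the two parameters for which the point of the circle
  lies on the positive axis, so dominated convergence applies with bound 1.\<close>

lemma integral_exp_sin_tendsto:
  assumes r: "filterlim r at_top sequentially"
  shows "(\<lambda>N. integral {0..1} (\<lambda>x. exp (- (2 * (r N * \<bar>sin (pi * x)\<bar>))))) \<longlonglongrightarrow> 0"
proof -
  \<comment> \<open>Before the index \<open>M\<close> the number \<open>r N\<close> may be negative
    and the integrand larger than 1; these terms are cut off and restored at the end.\<close>
  obtain M where M: "\<And>N. N \<ge> M \<Longrightarrow> r N \<ge> 0"
    using filterlim_at_top[THEN iffD1, OF r, rule_format, of 0] unfolding eventually_sequentially by blast
  define f where "f = (\<lambda>N x. exp (- (2 * (r (N + M) * \<bar>sin (pi * x)\<bar>))))"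
  define l :: "real \<Rightarrow> real" where "l = (\<lambda>x. if x \<in> {0, 1} then 1 else 0)"
  have "(\<lambda>N. integral {0..1} (f N)) \<longlonglongrightarrow> integral {0..1} l"
  proof (rule dominated_convergence(2)[where h = "\<lambda>_. 1"])
    show "f N integrable_on {0..1}" for N unfolding f_def
      by (intro integrable_continuous_real continuous_intros)
    show "(\<lambda>_::real. 1::real) integrable_on {0..1}" by (intro integrable_continuous_real continuous_intros)
    show "norm (f N x) \<le> 1" for N x using M[of "N + M"] by (simp add: f_def)
    fix x :: real assume x: "x \<in> {0..1}"
    show "(\<lambda>N. f N x) \<longlonglongrightarrow> l x"
    proof (cases "x \<in> {0, 1}")
      case True
      then show ?thesis by (auto simp: f_def l_def)
    next
      case False
      then have "0 < pi * x" "pi * x < pi" using x by auto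
      then have s: "sin (pi * x) > 0" by (rule sin_gt_zero)
      have "filterlim (\<lambda>N. r (N + M)) at_top sequentially" using r
        by (rule filterlim_compose) (rule filterlim_add_const_nat_at_top)
      then have "filterlim (\<lambda>N. (2 * sin (pi * x)) * r (N + M)) at_top sequentially"
        by (rule filterlim_tendsto_pos_mult_at_top[OF tendsto_const, rotated]) (use s in simp)
      then have "filterlim (\<lambda>N. - ((2 * sin (pi * x)) * r (N + M))) at_bot sequentially"
        unfolding filterlim_uminus_at_bot by simp
      then have "(\<lambda>N. exp (- ((2 * sin (pi * x)) * r (N + M)))) \<longlonglongrightarrow> 0"
        by (rule filterlim_compose[OF exp_at_bot])
      moreover have "f N x = exp (- ((2 * sin (pi * x)) * r (N + M)))" for N
        using s by (simp add: f_def mult_ac)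
      ultimately show ?thesis using False by (simp add: l_def)
    qed
  qed
  moreover have "integral {0..1} l = integral {0..1} (\<lambda>_::real. 0)"
    by (rule integral_spike[of "{0, 1}"]) (auto simp: l_def)
  ultimately have "(\<lambda>N. integral {0..1} (\<lambda>x. exp (- (2 * (r (N + M) * \<bar>sin (pi * x)\<bar>))))) \<longlonglongrightarrow> 0"
    by (simp add: f_def)
  then show ?thesis by (rule LIMSEQ_offset)
qed

context perturbation
begin

text \<open>Differentiation of A cos 2w + B in w = sqrt z. Consequently z X0'^2 - (1 - X0^2) equals
  A^2 - 1 - B^2 + 2 B X0: the quadratic terms cancel and only growth of first order in
  \<open>env\<close> remains.\<close>

lemma X0_ode: "z * (deriv X0 z)\<^sup>2 = of_real (A\<^sup>2) - (X0 z - of_real B)\<^sup>2"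
proof -
  define w where "w = csqrt z"
  have wz: "w\<^sup>2 = z" by (simp add: w_def)
  have "(X0 has_field_derivative deriv X0 (w\<^sup>2)) (at (w\<^sup>2))"
    using hol0 by (rule holomorphic_derivI) auto
  moreover have "((\<lambda>w. w\<^sup>2) has_field_derivative 2 * w) (at w)"
    using DERIV_power[OF DERIV_ident, of 2 w UNIV] by simp
  ultimately have 1: "((\<lambda>w. X0 (w\<^sup>2)) has_field_derivative deriv X0 (w\<^sup>2) * (2 * w)) (at w)"
    by (rule DERIV_chain2)
  have "((\<lambda>w. of_real A * cos (2 * w) + of_real B) has_field_derivative - (2 * (of_real A * sin (2
    * w)))) (at w)"
    by (auto intro!: derivative_eq_intros)
  then have 2: "((\<lambda>w. X0 (w\<^sup>2)) has_field_derivative - (2 * (of_real A * sin (2 * w)))) (at w)"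
    unfolding X0_power2 .
  have "deriv X0 (w\<^sup>2) * (2 * w) = - (2 * (of_real A * sin (2 * w)))" by (rule DERIV_unique[OF 1 2])
  moreover have "deriv X0 (w\<^sup>2) * (2 * w) = 2 * (w * deriv X0 (w\<^sup>2))" by (simp only: mult_ac)
  ultimately have "2 * (w * deriv X0 (w\<^sup>2)) = 2 * (- (of_real A * sin (2 * w)))"
    by (simp only: mult_minus_right)
  then have wd: "w * deriv X0 (w\<^sup>2) = - (of_real A * sin (2 * w))" unfolding mult_cancel_left by simp
  have "z * (deriv X0 z)\<^sup>2 = (w * deriv X0 (w\<^sup>2))\<^sup>2" unfolding power_mult_distrib wz ..
  also have "\<dots> = of_real (A\<^sup>2) * (sin (2 * w))\<^sup>2"
    unfolding wd power2_minus power_mult_distrib of_real_power ..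
  also have "\<dots> = of_real (A\<^sup>2) - (of_real A * cos (2 * w))\<^sup>2"
    unfolding sin_squared_eq power_mult_distrib right_diff_distrib by simp
  also have "of_real A * cos (2 * w) = X0 z - of_real B" using X0_power2[of w] unfolding wz
    by (rule eq_diff_eq[THEN iffD2, OF sym])
  finally show ?thesis .
qed

lemma deriv_close: "growth 3 (\<lambda>z. deriv X z - deriv X0 z)"
proof -
  have hd: "(\<lambda>z. X z - X0 z) holomorphic_on UNIV" by (intro holomorphic_intros hol hol0)
  have fd: "X field_differentiable at z" "X0 field_differentiable at z" for z
    using hol hol0 by (auto simp: holomorphic_on_def)
  have "growth 3 (deriv (\<lambda>z. X z - X0 z))"
    using growth_deriv[OF hd close] by (simp add: numeral_3_eq_3 numeral_2_eq_2)
  also have "deriv (\<lambda>z. X z - X0 z) = (\<lambda>z. deriv X z - deriv X0 z)" using fd by (intro ext deriv_diff) auto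
  finally show ?thesis .
qed

text \<open>The numerator z X'^2 - (1 - X^2) is O(env) for the model, and the perturbation adds
  O(env^2 / R N). The denominator has size at least \<open>env\<close> squared, up to a
  constant.\<close>

lemma quasimomentum_near_one:
  "\<exists>K N0. K \<ge> 0 \<and> (\<forall>N\<ge>N0. \<forall>z. norm z = (R N)\<^sup>2 \<longrightarrow>
     norm (z * ((deriv X z)\<^sup>2 / (1 - (X z)\<^sup>2)) - 1) \<le> K * (1 / env z + 1 / R N))"
proof -
  obtain d C N0 where "circle_const d C N0" using circle_const_exists by blast
  note D = circle_constD[OF this]
  obtain C1 r1 where 1: "C1 \<ge> 0" "r1 \<ge> 1" "\<And>z. r1 \<le> norm z \<Longrightarrow> norm (X z - X0 z) \<le> C1
    * env z / sqrt (norm z) ^ 2"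
    by (rule growthE[OF close]) (rule that)
  obtain C2 r2 where 2: "C2 \<ge> 0" "r2 \<ge> 1" "\<And>z. r2 \<le> norm z \<Longrightarrow> norm (X z + X0 z) \<le> C2
    * env z / sqrt (norm z) ^ 0"
    by (rule growthE[OF growth_add[OF X_growth X0_growth]]) (rule that)
  obtain C3 r3 where 3: "C3 \<ge> 0" "r3 \<ge> 1" "\<And>z. r3 \<le> norm z \<Longrightarrow> norm (deriv X z - deriv X0 z) \<le> C3
    * env z / sqrt (norm z) ^ 3"
    by (rule growthE[OF deriv_close]) (rule that)
  obtain C4 r4 where 4: "C4 \<ge> 0" "r4 \<ge> 1" "\<And>z. r4 \<le> norm z \<Longrightarrow> norm (deriv X z + deriv X0 z) \<le> C4
    * env z / sqrt (norm z) ^ Suc 0"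
    by (rule growthE[OF growth_add[OF growth_deriv[OF hol X_growth] growth_deriv[OF hol0 X0_growth]]])
      (rule that)
  obtain C5 r5 where 5: "C5 \<ge> 0" "r5 \<ge> 1" "\<And>z. r5 \<le> norm z \<Longrightarrow> norm (X0 z) \<le> C5 * env z / sqrt (norm z) ^ 0"
    by (rule growthE[OF X0_growth]) (rule that)
  obtain N1 where N1: "\<And>N. N \<ge> N1 \<Longrightarrow> r1 + r2 + r3 + r4 + r5 < (R N)\<^sup>2"
    using sqrt_R_large[of "r1 + r2 + r3 + r4 + r5"] unfolding eventually_sequentially by blast
  define c1 where "c1 = \<bar>A\<^sup>2 - 1 - B\<^sup>2\<bar> + 2 * \<bar>B\<bar> * C5"
  define c2 where "c2 = C1 * C2 + C3 * C4"
  have c: "c1 \<ge> 0" "c2 \<ge> 0" using 1 2 3 4 5 by (auto simp: c1_def c2_def)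
  define K where "K = max c1 c2 / d\<^sup>2"
  have "norm (z * ((deriv X z)\<^sup>2 / (1 - (X z)\<^sup>2)) - 1) \<le> K * (1 / env z + 1 / R N)"
    if N: "N \<ge> max N0 N1" and z: "norm z = (R N)\<^sup>2" for N z
  proof -
    have N': "N \<ge> N0" using N by simp
    have R1: "R N \<ge> 1" using R_ge(1)[of N] D(3) N' by linarith
    have rs: "r1 \<le> norm z" "r2 \<le> norm z" "r3 \<le> norm z" "r4 \<le> norm z" "r5 \<le> norm z"
      using N1[of N] N z 1(2) 2(2) 3(2) 4(2) 5(2) by auto
    define E where "E = env z"
    have E: "E \<ge> 1" unfolding E_def by (rule env_ge)
    have sq: "sqrt (norm z) = R N" using z R1 by simp
    have den: "(d * E)\<^sup>2 \<le> norm (1 - (X z)\<^sup>2)"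
      unfolding E_def by (rule abs_one_minus_square[OF D(1) D(4)[OF N' z]])
    have den0: "(d * E)\<^sup>2 > 0" using D(1) E by simp
    then have nz: "1 - (X z)\<^sup>2 \<noteq> 0" using den by force
    \<comment> \<open>The first two summands are z X0'^2 - (1 - X0^2), rewritten by
      \<open>X0_ode\<close>; the other two are the changes from \<open>X0\<close> to
      \<open>X\<close> in each of its terms.\<close>
    define T where "T = of_real (A\<^sup>2 - 1 - B\<^sup>2) + of_real (2 * B) * X0 z + (X z - X0 z) * (X z + X0 z)
        + z * ((deriv X z - deriv X0 z) * (deriv X z + deriv X0 z))"
    have "z * (deriv X z)\<^sup>2 - (1 - (X z)\<^sup>2) = T"
    proof -
      have "z * (deriv X z)\<^sup>2 = z * (deriv X0 z)\<^sup>2 + z * ((deriv X z - deriv X0 z) * (deriv X z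
        + deriv X0 z))"
        by (simp add: power2_eq_square algebra_simps)
      then show ?thesis unfolding T_def X0_ode by (simp add: power2_eq_square algebra_simps)
    qed
    moreover have quot: "u \<noteq> 0 \<Longrightarrow> z * (b / u) - 1 = (z * b - u) / u" for b u :: complex
      by (simp add: diff_divide_distrib)
    ultimately have "z * ((deriv X z)\<^sup>2 / (1 - (X z)\<^sup>2)) - 1 = T / (1 - (X z)\<^sup>2)"
      using quot[OF nz] by simp
    then have "norm (z * ((deriv X z)\<^sup>2 / (1 - (X z)\<^sup>2)) - 1) = norm T / norm (1 - (X z)\<^sup>2)"
      by (simp only: norm_divide)
    also have "\<dots> \<le> (c1 * E + c2 * E\<^sup>2 / R N) / (d * E)\<^sup>2"
    proof (rule frac_le)
      have t1: "norm (complex_of_real (A\<^sup>2 - 1 - B\<^sup>2)) \<le> \<bar>A\<^sup>2 - 1 - B\<^sup>2\<bar> * E"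
        using mult_left_mono[OF E, of "\<bar>A\<^sup>2 - 1 - B\<^sup>2\<bar>"] unfolding norm_of_real by simp
      have t2: "norm (of_real (2 * B) * X0 z) \<le> 2 * \<bar>B\<bar> * C5 * E"
        using mult_left_mono[OF 5(3)[OF rs(5)], of "2 * \<bar>B\<bar>"] by (simp add: norm_mult E_def mult.assoc)
      have t3: "norm ((X z - X0 z) * (X z + X0 z)) \<le> C1 * C2 * E\<^sup>2 / R N"
      proof -
        have "norm ((X z - X0 z) * (X z + X0 z)) \<le> (C1 * E / (R N)\<^sup>2) * (C2 * E)"
          unfolding norm_mult E_def using 1(3)[OF rs(1)] 2(3)[OF rs(2)] 1(1) env_ge(1)[of z]
            by (intro mult_mono) (auto simp: sq)
        also have "\<dots> = C1 * C2 * E\<^sup>2 / (R N)\<^sup>2" by (simp add: power2_eq_square)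
        also have "\<dots> \<le> C1 * C2 * E\<^sup>2 / R N"
          using R1 self_le_power[of "R N" 2] 1(1) 2(1) by (intro divide_left_mono) auto
        finally show ?thesis .
      qed
      have t4: "norm (z * ((deriv X z - deriv X0 z) * (deriv X z + deriv X0 z))) \<le> C3 * C4 * E\<^sup>2 / R N"
      proof -
        have "norm (deriv X z - deriv X0 z) * norm (deriv X z + deriv X0 z) \<le> (C3 * E / R N ^ 3) * (C4
          * E / R N)"
          unfolding E_def using 3(3)[OF rs(3)] 4(3)[OF rs(4)] 3(1) env_ge(1)[of z] R1
            by (intro mult_mono) (auto simp: sq)
        then have "(R N)\<^sup>2 * (norm (deriv X z - deriv X0 z) * norm (deriv X z + deriv X0 z)) \<le> (R N)\<^sup>2
          * ((C3 * E / R N ^ 3) * (C4 * E / R N))"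
          by (rule mult_left_mono) simp
        also have "\<dots> = C3 * C4 * E\<^sup>2 / (R N)\<^sup>2" using R1 by (simp add: power2_eq_square power3_eq_cube)
        also have "\<dots> \<le> C3 * C4 * E\<^sup>2 / R N"
          using R1 self_le_power[of "R N" 2] 3(1) 4(1) by (intro divide_left_mono) auto
        finally show ?thesis unfolding norm_mult z .
      qed
      have "norm T \<le> norm (complex_of_real (A\<^sup>2 - 1 - B\<^sup>2)) + norm (of_real (2 * B) * X0 z) + norm ((X z
        - X0 z) * (X z + X0 z))
        + norm (z * ((deriv X z - deriv X0 z) * (deriv X z + deriv X0 z)))"
        unfolding T_def by (intro norm_triangle_le add_mono order_refl)
      also have "\<dots> \<le> \<bar>A\<^sup>2 - 1 - B\<^sup>2\<bar> * E + 2 * \<bar>B\<bar> * C5 * E + C1 * C2 * E\<^sup>2 / R N + C3 * C4 * E\<^sup>2 / R N"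
        by (intro add_mono t1 t2 t3 t4)
      also have "\<dots> = c1 * E + c2 * E\<^sup>2 / R N" unfolding c1_def c2_def
        by (simp only: distrib_right add_divide_distrib)
      finally show "norm T \<le> c1 * E + c2 * E\<^sup>2 / R N" .
      show "0 \<le> c1 * E + c2 * E\<^sup>2 / R N" using c E R1 by simp
    qed (use den den0 in auto)
    also have "\<dots> = (c1 / d\<^sup>2) * (1 / E) + (c2 / d\<^sup>2) * (1 / R N)"
      using E D(1) R1 by (simp add: add_divide_distrib power2_eq_square mult_ac)
    also have "\<dots> \<le> K * (1 / E) + K * (1 / R N)"
      using E D(1) R1 unfolding K_def by (intro add_mono mult_right_mono divide_right_mono) auto
    finally show ?thesis unfolding E_def by (simp only: distrib_left)
  qed
  moreover have "K \<ge> 0" using c by (simp add: K_def)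
  ultimately show ?thesis by blast
qed

text \<open>Half the sum of the masses is the contour integral of f over 2 \<pi> i, that is, the
  mean over the circle of \<zeta> f (\<zeta>). This product differs from 1 by at most K (1 / env + 1
  / R N). Near the positive axis 1 / env is not small, but its mean over the circle tends to
  0.\<close>

lemma mass_partial_sums: "(\<lambda>N. \<Sum>e\<in>edges_upto N. case_prod mass e) \<longlonglongrightarrow> 2"
proof -
  obtain d C N0 where "circle_const d C N0" using circle_const_exists by blast
  note D = circle_constD[OF this]
  obtain K N1 where K: "K \<ge> 0" "\<forall>N\<ge>N1. \<forall>z. norm z = (R N)\<^sup>2 \<longrightarrow>
     norm (z * ((deriv X z)\<^sup>2 / (1 - (X z)\<^sup>2)) - 1) \<le> K * (1 / env z + 1 / R N)"
    using quasimomentum_near_one by (elim exE conjE) (rule that)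
  define S where "S = (\<lambda>N. \<Sum>e\<in>edges_upto N. case_prod mass e)"
  define J where "J = (\<lambda>N. integral {0..1} (\<lambda>x. exp (- (2 * (R N * \<bar>sin (pi * x)\<bar>)))))"
  have "norm (S N - 2) \<le> 2 * (K * (J N + inverse (R N)))" if N: "N \<ge> max N0 N1" for N
  proof -
    have N': "N \<ge> N0" "N \<ge> N1" using N by auto
    define \<zeta> where "\<zeta> = (\<lambda>x::real. of_real ((R N)\<^sup>2) * exp (2 * of_real pi * \<i> * of_real x))"
    have n\<zeta>: "norm (\<zeta> x) = (R N)\<^sup>2" for x by (simp add: \<zeta>_def norm_mult norm_power)
    have env\<zeta>: "1 / env (\<zeta> x) = exp (- (2 * (R N * \<bar>sin (pi * x)\<bar>)))" for x
      unfolding env_def \<zeta>_def Im_csqrt_circle[OF less_imp_le[OF R_pos]]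
        by (simp add: exp_minus divide_inverse)
    define f where "f = (\<lambda>w. deriv g w * (- (X w * deriv X w) / 2) / g w + (deriv X w)\<^sup>2)"
    have f\<zeta>: "f (\<zeta> x) = (deriv X (\<zeta> x))\<^sup>2 / (1 - (X (\<zeta> x))\<^sup>2)" for x
      unfolding f_def by (rule quasimomentum_H[OF D(7)[OF N'(1) n\<zeta>]])
    have "(\<Sum>e\<in>edges_upto N. - (X (of_real (case_prod L e)) * deriv X (of_real (case_prod L e))) / 2)
      = (\<Sum>e\<in>edges_upto N. of_real (case_prod mass e) / 2)"
      by (rule sum.cong[OF refl], rule H_edge) (simp add: edges_upto_def)
    also have "\<dots> = of_real (S N / 2)" unfolding S_def by (simp add: sum_divide_distrib)
    finally have sumH: "(\<Sum>e\<in>edges_upto N. - (X (of_real (case_prod L e))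
      * deriv X (of_real (case_prod L e))) / 2) = complex_of_real (S N / 2)" .
    have "(f has_contour_integral 2 * pi * \<i> * of_real (S N / 2)) (circlepath 0 ((R N)\<^sup>2))"
      using circle_integrals(1)[OF hol_H D(7)[OF N'(1)] D(6)[OF N'(1)]] unfolding sumH f_def .
    then have int: "((\<lambda>x. f (circlepath 0 ((R N)\<^sup>2) x)
      * vector_derivative (circlepath 0 ((R N)\<^sup>2)) (at x within {0..1}))
        has_integral 2 * pi * \<i> * of_real (S N / 2)) {0..1}"
      unfolding has_contour_integral_def .
    have "((\<lambda>x. f (\<zeta> x) * (2 * pi * \<i> * \<zeta> x)) has_integral 2 * pi * \<i> * of_real (S N / 2)) {0..1}"
    proof (rule has_integral_eq[OF _ int])
      fix x :: real assume x: "x \<in> {0..1}"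
      then have v: "vector_derivative (circlepath 0 ((R N)\<^sup>2)) (at x within {0..1}) = 2 * pi * \<i>
        * of_real ((R N)\<^sup>2) * exp (2 * of_real pi * \<i> * of_real x)"
        by (intro vector_derivative_circlepath01) auto
      have p: "circlepath 0 ((R N)\<^sup>2) x = \<zeta> x" unfolding circlepath \<zeta>_def by simp
      show "f (circlepath 0 ((R N)\<^sup>2) x) * vector_derivative (circlepath 0 ((R N)\<^sup>2)) (at x within
        {0..1}) = f (\<zeta> x) * (2 * pi * \<i> * \<zeta> x)"
        unfolding v p by (simp only: \<zeta>_def mult.assoc)
    qed
    from has_integral_mult_right[OF this, of "1 / (2 * pi * \<i>)"]
    have int: "((\<lambda>x. 1 / (2 * pi * \<i>) * (f (\<zeta> x) * (2 * pi * \<i> * \<zeta> x))) has_integral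
        1 / (2 * pi * \<i>) * (2 * pi * \<i> * of_real (S N / 2))) {0..1}" .
    have cancel: "t \<noteq> 0 \<Longrightarrow> 1 / t * (u * (t * v)) = u * v" and cancel': "t \<noteq> 0 \<Longrightarrow> 1 / t * (t * u) = u"
      for t u v :: complex
      by simp_all
    have nz: "complex_of_real (2 * pi) * \<i> \<noteq> 0" by simp
    have "((\<lambda>x. f (\<zeta> x) * \<zeta> x) has_integral of_real (S N / 2)) {0..1}"
      using int unfolding cancel[OF nz] cancel'[OF nz] .
    then have "((\<lambda>x. \<zeta> x * f (\<zeta> x)) has_integral of_real (S N / 2)) {0..1}"
      by (rule has_integral_eq[rotated]) (rule mult.commute)
    moreover have "((\<lambda>_. 1::complex) has_integral 1) {0..1::real}"
      using has_integral_const_real[of "1::complex" 0 1] by simp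
    ultimately have I: "((\<lambda>x. \<zeta> x * f (\<zeta> x) - 1) has_integral of_real (S N / 2) - 1) {0..1}"
      by (rule has_integral_diff)
    define b where "b = (\<lambda>x. exp (- (2 * (R N * \<bar>sin (pi * x)\<bar>))))"
    have "b integrable_on {0..1}" unfolding b_def
      by (intro integrable_continuous_real continuous_intros)
    then have "(b has_integral J N) {0..1}" unfolding J_def b_def by (rule integrable_integral)
    moreover have "((\<lambda>_. inverse (R N)) has_integral inverse (R N)) {0..1::real}"
      using has_integral_const_real[of "inverse (R N)" 0 1] by simp
    ultimately have "((\<lambda>x. b x + inverse (R N)) has_integral J N + inverse (R N)) {0..1}"
      by (rule has_integral_add)
    then have B: "((\<lambda>x. K * (b x + inverse (R N))) has_integral K * (J N + inverse (R N))) {0..1}"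
      by (rule has_integral_mult_right)
    have le: "norm (\<zeta> x * f (\<zeta> x) - 1) \<le> K * (b x + inverse (R N))" for x
      using K(2)[rule_format, OF N'(2) n\<zeta>[of x]]
        unfolding f\<zeta> env\<zeta> b_def divide_inverse[of 1 "R N"] mult_1_left .
    have "norm (integral {0..1} (\<lambda>x. \<zeta> x * f (\<zeta> x) - 1)) \<le> integral {0..1} (\<lambda>x. K * (b x + inverse (R N)))"
      by (rule Henstock_Kurzweil_Integration.integral_norm_bound_integral[OF has_integral_integrable[OF
        I] has_integral_integrable[OF B] le])
    then have "norm (complex_of_real (S N / 2) - 1) \<le> K * (J N + inverse (R N))"
      unfolding integral_unique[OF I] integral_unique[OF B] .
    moreover have "complex_of_real (S N / 2) - 1 = complex_of_real (S N / 2 - 1)"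
      by (simp only: of_real_diff of_real_1)
    ultimately have "\<bar>S N / 2 - 1\<bar> \<le> K * (J N + inverse (R N))" by (simp only: norm_of_real)
    then show ?thesis unfolding real_norm_def by argo
  qed
  then have "eventually (\<lambda>N. norm (S N - 2) \<le> 2 * (K * (J N + inverse (R N)))) sequentially"
    by (rule eventually_sequentiallyI)
  moreover have "(\<lambda>N. 2 * (K * (J N + inverse (R N)))) \<longlonglongrightarrow> 2 * (K * (0 + 0))"
    unfolding J_def
    by (rule tendsto_mult_left, rule tendsto_mult_left, rule tendsto_add, rule
      integral_exp_sin_tendsto[OF R_tendsto],
        rule tendsto_inverse_0_at_top[OF R_tendsto])
  then have "(\<lambda>N. 2 * (K * (J N + inverse (R N)))) \<longlonglongrightarrow> 0" by simp
  ultimately have "(\<lambda>N. S N - 2) \<longlonglongrightarrow> 0" by (rule Lim_null_comparison)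
  then show ?thesis unfolding S_def by (rule Lim_null[THEN iffD2])
qed

lemma edges_upto_sum: "(\<Sum>e\<in>edges_upto N. case_prod mass e) = mass 0 Plus + (\<Sum>n<N. mass (Suc n) Plus
  + mass (Suc n) Minus)"
proof (induction N)
  case 0
  have "edges_upto 0 = {(0, Plus)}" by (auto simp: edges_upto_def edge_index_iff)
  then show ?case by simp
next
  case (Suc N)
  have "edges_upto (Suc N) = insert (Suc N, Plus) (insert (Suc N, Minus) (edges_upto N))"
    by (rule set_eqI) (use edge_sign_cases in \<open>auto simp: edges_upto_def edge_index_iff le_Suc_eq\<close>)
  moreover have "(Suc N, \<nu>) \<notin> edges_upto N" for \<nu> by (simp add: edges_upto_def)
  ultimately show ?case using Suc by simp
qed

text \<open>The partial sums run over \<open>edges_upto N\<close>, which contains both signs of each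
  positive index up to \<open>N\<close>; hence the series is grouped by index.\<close>

theorem mass_total: "(\<lambda>n. mass (Suc n) Plus + mass (Suc n) Minus) sums (2 - mass 0 Plus)"
proof -
  have "(\<lambda>N. (\<Sum>e\<in>edges_upto N. case_prod mass e) - mass 0 Plus) \<longlonglongrightarrow> 2 - mass 0 Plus"
    by (intro tendsto_diff mass_partial_sums tendsto_const)
  then show ?thesis unfolding sums_def edges_upto_sum by simp
qed

end

section \<open>Effective masses\<close>

lemma zorder_eq_1_iff:
  assumes hol: "g holomorphic_on UNIV" and z: "g z = 0" and w: "g w \<noteq> (0 :: complex)"
  shows "zorder g z = 1 \<longleftrightarrow> deriv g z \<noteq> 0"
proof
  assume "deriv g z \<noteq> 0"
  then show "zorder g z = 1"
    by (intro zorder_zero_eqI[OF hol]) (use z in auto)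
next
  assume one: "zorder g z = 1"
  have "\<exists>r. r > 0 \<and> cball z r \<subseteq> UNIV \<and> zor_poly g z holomorphic_on cball z r
      \<and> (\<forall>v\<in>cball z r. g v = zor_poly g z v * (v - z) ^ nat (zorder g z) \<and> zor_poly g z v \<noteq> 0)"
    by (rule conjunct2, rule zorder_exist_zero[OF hol]) (use w in auto)
  then obtain r where r: "r > 0" and P: "zor_poly g z holomorphic_on cball z r"
    and g: "\<And>v. v \<in> cball z r \<Longrightarrow> g v = zor_poly g z v * (v - z)" "\<And>v. v \<in> cball z r \<Longrightarrow> zor_poly g z v \<noteq> 0"
    unfolding one by auto
  have "(zor_poly g z has_field_derivative deriv (zor_poly g z) z) (at z)"
    by (rule holomorphic_derivI[OF holomorphic_on_subset[OF P ball_subset_cball] open_ball]) (use r in auto)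
  then have "((\<lambda>v. zor_poly g z v * (v - z)) has_field_derivative zor_poly g z z) (at z)"
    by (auto intro!: derivative_eq_intros)
  then have "(g has_field_derivative zor_poly g z z) (at z)"
    by (rule has_field_derivative_transform_within[OF _ r]) (auto simp: g(1) dist_commute)
  then show "deriv g z \<noteq> 0" using g(2)[of z] r by (simp add: DERIV_imp_deriv)
qed

text \<open>As X = (-1)^n at the edge, X' vanishes exactly when the zero of X^2 - 1 is multiple. Its
  order is the number of labels at that point, and coinciding labels have the same index.\<close>

lemma edge_simple_iff:
  assumes hol: "X holomorphic_on UNIV" and lab: "labelling X L" and e: "(n, \<nu>) \<in> edge_index"
  shows "deriv X (of_real (L n \<nu>)) = 0 \<longleftrightarrow> n \<ge> 1 \<and> L n Minus = L n Plus"
proof -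
  define g where "g = (\<lambda>z. (X z)\<^sup>2 - 1)"
  define z where "z = complex_of_real (L n \<nu>)"
  have Xz: "X z = (-1) ^ n" unfolding z_def by (rule labelling_val[OF lab e])
  then have Xz2: "(X z)\<^sup>2 = 1" by (simp flip: power_mult)
  have gh: "g holomorphic_on UNIV" unfolding g_def by (intro holomorphic_intros hol)
  \<comment> \<open>All edges are real, so \<open>\<i>\<close> witnesses that \<open>g\<close> does
    not vanish identically, as the theory of orders of zeros requires.\<close>
  have "g \<i> \<noteq> 0"
  proof
    assume "g \<i> = 0"
    then obtain m \<mu> where "\<i> = complex_of_real (L m \<mu>)" using labelling_zero[OF lab, of \<i>]
      by (auto simp: g_def)
    then have "Im \<i> = Im (complex_of_real (L m \<mu>))" by (rule arg_cong)
    then show False by simp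
  qed
  note iff = zorder_eq_1_iff[OF gh _ this, of z]
  have "(X has_field_derivative deriv X z) (at z)" by (rule holomorphic_derivI[OF hol]) auto
  then have "(g has_field_derivative 2 * X z * deriv X z) (at z)"
    unfolding g_def by (auto intro!: derivative_eq_intros)
  then have dg: "deriv g z = 2 * X z * deriv X z" by (rule DERIV_imp_deriv)
  have "deriv X z = 0 \<longleftrightarrow> deriv g z = 0" using Xz unfolding dg by auto
  also have "\<dots> \<longleftrightarrow> zorder g z \<noteq> 1" using iff Xz2 by (auto simp: g_def)
  also have "\<dots> \<longleftrightarrow> card {e \<in> edge_index. complex_of_real (case_prod L e) = z} \<noteq> 1"
    using labelling_zorder[OF lab Xz2] by (simp add: g_def)
  also have "{e \<in> edge_index. complex_of_real (case_prod L e) = z} = {n} \<times> {\<mu>. (n, \<mu>) \<in> edge_index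
    \<and> L n \<mu> = L n \<nu>}"
  proof -
    have "m = n" if "(m, \<mu>) \<in> edge_index" "L m \<mu> = L n \<nu>" for m \<mu>
      using labelling_le_imp[OF lab, of m \<mu> n \<nu>] labelling_le_imp[OF lab, of n \<nu> m \<mu>] that e by simp
    then show ?thesis by (auto simp: z_def)
  qed
  also have "card \<dots> \<noteq> 1 \<longleftrightarrow> n \<ge> 1 \<and> L n Minus = L n Plus"
  proof (cases "n \<ge> 1 \<and> L n Minus = L n Plus")
    case True
    then have "{\<mu>. (n, \<mu>) \<in> edge_index \<and> L n \<mu> = L n \<nu>} = {Minus, Plus}"
      using edge_sign_cases by (auto simp: edge_index_iff) metis+
    then show ?thesis using True by (simp add: card_cartesian_product)
  next
    case False
    then have "{\<mu>. (n, \<mu>) \<in> edge_index \<and> L n \<mu> = L n \<nu>} = {\<nu>}"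
      using e edge_sign_cases by (auto simp: edge_index_iff) metis+
    then show ?thesis using False by (simp add: card_cartesian_product)
  qed
  finally show ?thesis unfolding z_def .
qed

lemma one_minus_cos_quotient: "((\<lambda>z. (1 - cos z) / z\<^sup>2) \<longlongrightarrow> 1 / 2) (at (0 :: complex))"
proof -
  have "(sin has_field_derivative cos 0) (at (0 :: complex))" by (rule DERIV_sin)
  then have s: "((\<lambda>h :: complex. sin h / h) \<longlongrightarrow> 1) (at 0)" by (simp add: DERIV_def)
  have "filterlim (\<lambda>z :: complex. z / 2) (at 0) (at 0)"
    unfolding filterlim_at by (auto simp: eventually_at_filter intro!: tendsto_eq_intros)
  from filterlim_compose[OF s this] have "((\<lambda>z :: complex. (sin (z / 2) / (z / 2))\<^sup>2 / 2) \<longlongrightarrow> 1\<^sup>2 / 2) (at 0)"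
    by (intro tendsto_intros) simp_all
  moreover have "(sin (z / 2) / (z / 2))\<^sup>2 / 2 = (1 - cos z) / z\<^sup>2" for z :: complex
    using cos_double_sin[of "z / 2"] by (simp add: power_divide)
  ultimately show ?thesis by (simp only: power_one)
qed

lemma cos_minus_npi: "cos (z - complex_of_real (pi * real n)) = (-1) ^ n * cos z"
  unfolding cos_diff cos_of_real sin_of_real by simp

text \<open>\<open>E = exp (ik)\<close> satisfies \<open>(E - 1)\<^sup>2 = 2E (cos k - 1)\<close>.\<close>

lemma exp_near_1:
  fixes k :: complex
  defines "t \<equiv> norm (exp (\<i> * k) - 1)" and "\<delta> \<equiv> 2 * norm (cos k - 1)"
  shows "t \<le> \<delta> + sqrt \<delta>"
proof (rule ccontr)
  assume "\<not> ?thesis"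
  then have t: "t > \<delta> + sqrt \<delta>" by simp
  have \<delta>: "\<delta> \<ge> 0" by (simp add: \<delta>_def)
  define E where "E = exp (\<i> * k)"
  have "(E - 1)\<^sup>2 = 2 * E * (cos k - 1)"
  proof -
    have "E * exp (- (\<i> * k)) = 1" unfolding E_def by (simp flip: exp_add)
    moreover have "2 * cos k = E + exp (- (\<i> * k))" by (simp add: cos_exp_eq E_def)
    ultimately have "E * (2 * cos k) = E * E + 1" by (simp add: distrib_left)
    then show ?thesis by (simp add: power2_eq_square algebra_simps)
  qed
  then have "t\<^sup>2 = norm E * \<delta>" unfolding t_def \<delta>_def E_def[symmetric] norm_power[symmetric]
    by (simp add: norm_mult)
  also have "norm E \<le> norm (E - 1) + norm (1 :: complex)" using norm_triangle_ineq[of "E - 1" 1] by simp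
  then have "norm E * \<delta> \<le> (t + 1) * \<delta>" unfolding t_def E_def[symmetric] using \<delta>
    by (intro mult_right_mono) auto
  finally have 1: "t * (t - \<delta>) \<le> \<delta>" by (simp add: power2_eq_square algebra_simps)
  have "sqrt \<delta> * sqrt \<delta> \<le> t * sqrt \<delta>" using t \<delta> by (intro mult_right_mono) auto
  also have "t * sqrt \<delta> < t * (t - \<delta>)" using t \<delta> real_sqrt_ge_zero[OF \<delta>]
    by (intro mult_strict_left_mono) linarith+
  finally show False using 1 \<delta> by simp
qed

locale simple_edge =
  fixes a :: real and q :: "real \<Rightarrow> real" and n :: nat and e :: real and D :: real
  assumes hol: "xi a q holomorphic_on UNIV"
    and real: "\<And>z. (xi a q z)\<^sup>2 = 1 \<Longrightarrow> Im z = 0"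
    and val: "xi a q (of_real e) = (-1) ^ n"
    and D: "deriv (xi a q) (of_real e) = of_real D" "D \<noteq> 0"
begin

abbreviation e_upper :: "complex filter" where
  "e_upper \<equiv> at (of_real e) within upper_half_plane"

definition Y :: "complex \<Rightarrow> complex" where "Y z = (-1) ^ n * xi a q z"

definition m :: real where "m = (-1) ^ (n + 1) * D"

lemma m_nz: "m \<noteq> 0" using D by (simp add: m_def)

lemma e_upper_nontrivial: "e_upper \<noteq> bot"
proof -
  have "complex_of_real e \<in> closure upper_half_plane"
    using closure_halfspace_gt[of \<i> 0] by simp
  then have "complex_of_real e islimpt upper_half_plane" by (simp add: closure_def)
  then show ?thesis using trivial_limit_within[of "complex_of_real e"] by simp
qed

lemma eventually_upper: "eventually (\<lambda>z. Im z > 0) e_upper"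
  by (simp add: eventually_at_filter)

lemma Y_nz: "Im z > 0 \<Longrightarrow> Y z \<noteq> 1"
proof
  assume z: "Im z > 0" and "Y z = 1"
  have "(xi a q z)\<^sup>2 = (Y z)\<^sup>2" by (simp add: Y_def power_mult_distrib flip: power_mult)
  then show False using real[of z] z \<open>Y z = 1\<close> by simp
qed

lemma Y_deriv: "((\<lambda>z. (1 - Y z) / (z - of_real e)) \<longlongrightarrow> of_real m) e_upper"
proof -
  have "(xi a q has_field_derivative of_real D) (at (of_real e))"
    using holomorphic_derivI[OF hol open_UNIV, of "of_real e"] D(1) by simp
  then have "((\<lambda>z. (xi a q z - (-1) ^ n) / (z - of_real e)) \<longlongrightarrow> of_real D) (at (of_real e))"
    unfolding has_field_derivative_iff val .
  then have "((\<lambda>z. (-1) ^ (n + 1) * ((xi a q z - (-1) ^ n) / (z - of_real e))) \<longlongrightarrow> (-1) ^ (n + 1)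
    * of_real D) e_upper"
    by (intro tendsto_mult_left) (rule tendsto_within_subset, auto)
  moreover have "(-1) ^ (n + 1) * ((xi a q z - (-1) ^ n) / (z - of_real e)) = (1 - Y z) / (z
    - of_real e)" for z
  proof -
    have "(-1) ^ (n + 1) * (xi a q z - (-1) ^ n) = 1 - Y z"
      by (simp add: Y_def right_diff_distrib flip: power_add)
    then show ?thesis by (metis times_divide_eq_right)
  qed
  ultimately show ?thesis by (simp add: m_def)
qed

lemma Y_tendsto: "(Y \<longlongrightarrow> 1) e_upper"
proof -
  have "isCont (xi a q) (of_real e)"
    using hol by (meson holomorphic_on_imp_continuous_on continuous_on_eq_continuous_at open_UNIV UNIV_I)
  then have "(Y \<longlongrightarrow> (-1) ^ n * xi a q (of_real e)) (at (of_real e))"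
    unfolding Y_def isCont_def by (rule tendsto_mult_left)
  then have "(Y \<longlongrightarrow> (-1) ^ n * xi a q (of_real e)) e_upper" by (rule tendsto_within_subset) auto
  then show ?thesis unfolding val by (simp flip: power_add)
qed

context
  fixes k
  assumes k: "quasimomentum a q k" and lim: "(k \<longlongrightarrow> of_real (pi * n)) e_upper"
begin

lemma cos_branch: "Im z > 0 \<Longrightarrow> cos (k z - of_real (pi * n)) = Y z"
  using k unfolding quasimomentum_def Y_def cos_minus_npi by auto

lemma branch_nz: "Im z > 0 \<Longrightarrow> k z - of_real (pi * n) \<noteq> 0"
  using cos_branch[of z] Y_nz[of z] by auto

lemma branch_quotient: "((\<lambda>z. (1 - Y z) / (k z - of_real (pi * n))\<^sup>2) \<longlongrightarrow> 1 / 2) e_upper"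
proof -
  have "((\<lambda>z. k z - of_real (pi * n)) \<longlongrightarrow> of_real (pi * n) - of_real (pi * n)) e_upper"
    using lim by (rule tendsto_diff) (rule tendsto_const)
  then have "filterlim (\<lambda>z. k z - of_real (pi * n)) (at 0) e_upper"
    unfolding filterlim_at using eventually_mono[OF eventually_upper branch_nz] by simp
  from filterlim_compose[OF one_minus_cos_quotient this]
  have "((\<lambda>z. (1 - cos (k z - of_real (pi * n))) / (k z - of_real (pi * n))\<^sup>2) \<longlongrightarrow> 1 / 2) e_upper" .
  then show ?thesis
    by (rule Lim_transform_eventually) (use eventually_mono[OF eventually_upper] cos_branch in auto)
qed

end

text \<open>The quotient (1 - Y) / (z - e) tends to \<open>m\<close> by differentiation. The
  defining expansion, combined with 1 - cos K asymptotic to K^2 / 2 for K = k - \<pi> n, gives it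
  the limit \<open>\<mu>\<close>.\<close>

lemma effective_mass_unique:
  assumes "is_effective_mass a q n e \<mu>"
  shows "\<mu> = m"
proof -
  obtain k r where \<mu>: "\<mu> \<noteq> 0" and k: "quasimomentum a q k" and lim: "(k \<longlongrightarrow> of_real (pi * n)) e_upper"
    and r: "(r \<longlongrightarrow> 0) e_upper"
    and eq: "\<forall>\<^sub>F z in e_upper. z = of_real e + (k z - of_real (pi * n))\<^sup>2 / of_real (2 * \<mu>) * (1 + r z)"
    using assms unfolding is_effective_mass_def by (elim exE conjE) (rule that)
  have "((\<lambda>z. (1 - Y z) / (k z - of_real (pi * n))\<^sup>2 * (of_real (2 * \<mu>) / (1 + r z))) \<longlongrightarrow> 1 / 2
    * (of_real (2 * \<mu>) / (1 + 0))) e_upper"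
    by (intro tendsto_mult tendsto_divide tendsto_add tendsto_const r branch_quotient[OF k lim]) simp
  moreover have "\<forall>\<^sub>F z in e_upper. (1 - Y z) / (k z - of_real (pi * n))\<^sup>2 * (of_real (2 * \<mu>) / (1 + r z))
    = (1 - Y z) / (z - of_real e)"
    using eq eventually_upper
  proof eventually_elim
    case (elim z)
    define K where "K = k z - of_real (pi * n)"
    have diff: "u = v + w \<Longrightarrow> u - v = w" for u v w :: complex by simp
    have z: "z - of_real e = K\<^sup>2 / of_real (2 * \<mu>) * (1 + r z)" unfolding K_def by (rule diff[OF elim(1)])
    show ?case unfolding K_def[symmetric] z by simp
  qed
  ultimately have "((\<lambda>z. (1 - Y z) / (z - of_real e)) \<longlongrightarrow> 1 / 2 * (of_real (2 * \<mu>) / (1 + 0))) e_upper"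
    by (rule Lim_transform_eventually)
  from tendsto_unique[OF e_upper_nontrivial this Y_deriv] have "complex_of_real \<mu> = of_real m" by simp
  then show ?thesis by simp
qed

text \<open>The remainder is defined by solving the expansion for it. It tends to 0 because the
  quotients of 1 - Y by (k - \<pi> n)^2 and by z - e tend to 1/2 and \<open>m\<close>.\<close>

lemma branch_effective_mass:
  assumes k: "quasimomentum a q k" and lim: "(k \<longlongrightarrow> of_real (pi * n)) e_upper"
  shows "is_effective_mass a q n e m"
proof -
  define r where "r = (\<lambda>z. (z - of_real e) * of_real (2 * m) / (k z - of_real (pi * n))\<^sup>2 - 1)"
  have "((\<lambda>z. of_real (2 * m) * ((1 - Y z) / (k z - of_real (pi * n))\<^sup>2) / ((1 - Y z) / (z - of_real e))
    - 1) \<longlongrightarrow>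
      of_real (2 * m) * (1 / 2) / of_real m - 1) e_upper"
    by (intro tendsto_diff tendsto_divide tendsto_mult tendsto_const branch_quotient[OF k lim] Y_deriv)
      (simp add: m_nz)
  then have "((\<lambda>z. of_real (2 * m) * ((1 - Y z) / (k z - of_real (pi * n))\<^sup>2) / ((1 - Y z) / (z
    - of_real e)) - 1) \<longlongrightarrow> 0) e_upper"
    using m_nz by simp
  moreover have "\<forall>\<^sub>F z in e_upper. of_real (2 * m) * ((1 - Y z) / (k z - of_real (pi * n))\<^sup>2) / ((1
    - Y z) / (z - of_real e)) - 1 = r z"
    using eventually_upper
  proof eventually_elim
    case (elim z)
    have "1 - Y z \<noteq> 0" using Y_nz[OF elim] by simp
    then show ?case unfolding r_def by (simp add: mult_ac)
  qed
  ultimately have r: "(r \<longlongrightarrow> 0) e_upper" by (rule Lim_transform_eventually)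
  have "\<forall>\<^sub>F z in e_upper. z = of_real e + (k z - of_real (pi * n))\<^sup>2 / of_real (2 * m) * (1 + r z)"
    using eventually_upper
  proof eventually_elim
    case (elim z)
    define K where "K = k z - of_real (pi * n)"
    have "K \<noteq> 0" unfolding K_def by (rule branch_nz[OF k lim elim])
    moreover have "complex_of_real (2 * m) \<noteq> 0" using m_nz by simp
    ultimately show ?case unfolding r_def K_def[symmetric] by simp
  qed
  with m_nz k lim r show ?thesis unfolding is_effective_mass_def by blast
qed

text \<open>On the half-plane \<open>xi\<close> omits 1 and -1, so a holomorphic arccosine
  \<open>k\<close> exists, but nothing forces it to tend to \<pi> n. Only E = exp (i (k - \<pi> n))
  is known to tend to 1. Near \<open>e\<close>, the number i (k - \<pi> n) differs from the
  principal logarithm of E by a constant multiple of 2 \<pi> i, and subtracting this constant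
  corrects the branch.\<close>

lemma branch_exists: "\<exists>k. quasimomentum a q k \<and> (k \<longlongrightarrow> of_real (pi * n)) e_upper"
proof -
  have "contractible upper_half_plane" by (intro convex_imp_contractible convex_halfspace_Im_gt)
  moreover have "xi a q z \<noteq> 1 \<and> xi a q z \<noteq> - 1" if "z \<in> upper_half_plane" for z
    using real[of z] that by auto
  ultimately obtain k where hk: "k holomorphic_on upper_half_plane" and ck: "\<And>z. z \<in> upper_half_plane
    \<Longrightarrow> xi a q z = cos (k z)"
    by (rule contractible_imp_holomorphic_arccos[OF holomorphic_on_subset[OF hol subset_UNIV]])
      (assumption, rule that)
  define E where "E = (\<lambda>z. exp (\<i> * (k z - of_real (pi * n))))"
  have "(E \<longlongrightarrow> 1) e_upper"
  proof (rule Lim_null[THEN iffD2], rule Lim_null_comparison)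
    show "\<forall>\<^sub>F z in e_upper. norm (E z - 1) \<le> 2 * norm (Y z - 1) + sqrt (2 * norm (Y z - 1))"
      using eventually_upper
    proof eventually_elim
      case (elim z)
      have "cos (k z - of_real (pi * n)) = Y z" using ck[of z] elim unfolding cos_minus_npi Y_def by simp
      then show ?case using exp_near_1[of "k z - of_real (pi * n)"] unfolding E_def by simp
    qed
    have "((\<lambda>z. 2 * norm (Y z - 1) + sqrt (2 * norm (Y z - 1))) \<longlongrightarrow> 2 * norm (1 - 1 :: complex) + sqrt (2
      * norm (1 - 1 :: complex))) e_upper"
      by (intro tendsto_intros Y_tendsto)
    then show "((\<lambda>z. 2 * norm (Y z - 1) + sqrt (2 * norm (Y z - 1))) \<longlongrightarrow> 0) e_upper" by simp
  qed
  then have "\<forall>\<^sub>F z in e_upper. norm (E z - 1) < 1" by (simp add: tendsto_iff dist_norm)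
  then obtain \<rho> where \<rho>: "\<rho> > 0" "\<And>z. Im z > 0 \<Longrightarrow> z \<noteq> of_real e \<Longrightarrow> dist z (of_real e) < \<rho> \<Longrightarrow> norm (E z - 1) < 1"
    unfolding eventually_at by auto
  define V where "V = upper_half_plane \<inter> ball (of_real e) \<rho>"
  have E1: "norm (E z - 1) < 1" if "z \<in> V" for z
  proof (rule \<rho>(2))
    show "z \<noteq> of_real e" using that by (auto simp: V_def)
  qed (use that in \<open>auto simp: V_def dist_commute\<close>)
  have Ebr: "w \<notin> \<real>\<^sub>\<le>\<^sub>0" if "norm (w - 1) < 1" for w :: complex
  proof
    assume "w \<in> \<real>\<^sub>\<le>\<^sub>0"
    then have "Re w \<le> 0" by (auto simp: complex_nonpos_Reals_iff)
    then show False using abs_Re_le_cmod[of "w - 1"] that by simp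
  qed
  \<comment> \<open>The values of \<open>d\<close> are multiples of 2 \<pi> i. On the half-disc
    \<open>V\<close> the principal logarithm is continuous, because \<open>E\<close> stays within
    distance 1 of 1; so \<open>d\<close> is continuous and therefore constant.\<close>
  define d where "d = (\<lambda>z. \<i> * (k z - of_real (pi * n)) - Ln (E z))"
  have exp_d: "exp (d z) = 1" for z
  proof -
    have "E z \<noteq> 0" by (simp add: E_def)
    then have "exp (d z) = E z / E z" unfolding d_def exp_diff by (simp add: E_def)
    then show ?thesis by (simp add: E_def)
  qed
  have "d constant_on V"
  proof (rule continuous_discrete_range_constant)
    show "connected V" unfolding V_def by (intro convex_connected convex_Int convex_halfspace_Im_gt
      convex_ball)
    have ck': "continuous_on V k" using holomorphic_on_imp_continuous_on[OF hk]
      by (rule continuous_on_subset) (simp add: V_def)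
    then have "continuous_on V E" unfolding E_def by (intro continuous_intros)
    then show "continuous_on V d" unfolding d_def using ck' Ebr E1 by (intro continuous_intros) auto
    show "\<exists>\<epsilon>>0. \<forall>y. y \<in> V \<and> d y \<noteq> d z \<longrightarrow> \<epsilon> \<le> norm (d y - d z)" for z
    proof (intro exI[of _ 1] conjI allI impI)
      fix y assume y: "y \<in> V \<and> d y \<noteq> d z"
      obtain i j :: int where ij: "Re (d y) = 0" "Im (d y) = of_int (2 * i) * pi" "Re (d z)
        = 0" "Im (d z) = of_int (2 * j) * pi"
        using exp_d[of y] exp_d[of z] unfolding exp_eq_1 by blast
      then have "i \<noteq> j" using y complex_eq_iff by auto
      then have "1 \<le> \<bar>real_of_int (i - j)\<bar>" by linarith
      then have "2 * pi * 1 \<le> 2 * pi * \<bar>real_of_int (i - j)\<bar>" by (intro mult_left_mono) auto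
      also have "\<dots> = \<bar>Im (d y - d z)\<bar>"
      proof -
        have "Im (d y - d z) = (2 * pi) * real_of_int (i - j)" using ij by (simp add: algebra_simps)
        then show ?thesis by (simp only: abs_mult) simp
      qed
      also have "\<dots> \<le> norm (d y - d z)" by (rule abs_Im_le_cmod)
      finally show "1 \<le> norm (d y - d z)" using pi_ge_two by linarith
    qed simp
  qed
  then obtain c where c: "\<And>z. z \<in> V \<Longrightarrow> d z = c" unfolding constant_on_def by blast
  have V: "\<forall>\<^sub>F z in e_upper. z \<in> V"
    unfolding eventually_at by (intro exI[of _ \<rho>]) (use \<rho>(1) in \<open>auto simp: V_def dist_commute\<close>)
  have "exp c = 1"
  proof -
    obtain z where "z \<in> V" using eventually_happens[OF V] e_upper_nontrivial by blast
    then show ?thesis using exp_d[of z] c by simp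
  qed
  \<comment> \<open>As exp c = 1, the summand is a real multiple of 2 \<pi> and the cosine is
    unchanged.\<close>
  define k' where "k' = (\<lambda>z. k z + \<i> * c)"
  have "quasimomentum a q k'"
  proof -
    have "cos (k' z) = cos (k z)" for z
    proof -
      have "\<i> * k' z = \<i> * k z - c" by (simp add: k'_def distrib_left)
      moreover have "- (\<i> * k z - c) = - (\<i> * k z) + c" by simp
      ultimately show ?thesis unfolding cos_exp_eq by (simp only: exp_diff exp_add \<open>exp c = 1\<close>) simp
    qed
    then show ?thesis using hk ck unfolding quasimomentum_def k'_def by (auto intro!: holomorphic_intros)
  qed
  moreover have "(k' \<longlongrightarrow> of_real (pi * n)) e_upper"
  proof -
    have "((\<lambda>z. of_real (pi * n) - \<i> * Ln (E z)) \<longlongrightarrow> of_real (pi * n) - \<i> * Ln 1) e_upper"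
      using \<open>(E \<longlongrightarrow> 1) e_upper\<close> by (intro tendsto_intros) auto
    then have "((\<lambda>z. of_real (pi * n) - \<i> * Ln (E z)) \<longlongrightarrow> of_real (pi * n)) e_upper" by simp
    moreover have "\<forall>\<^sub>F z in e_upper. of_real (pi * n) - \<i> * Ln (E z) = k' z"
      using V
    proof eventually_elim
      case (elim z)
      have "\<i> * Ln (E z) = \<i> * (\<i> * (k z - of_real (pi * n)) - c)" using c[OF elim] unfolding d_def
        by (simp add: algebra_simps)
      also have "\<dots> = - (k z - of_real (pi * n)) - \<i> * c" by (simp add: right_diff_distrib)
      finally show ?case unfolding k'_def by simp
    qed
    ultimately show ?thesis by (rule Lim_transform_eventually)
  qed
  ultimately show ?thesis by blast
qed

lemma effective_mass_eq: "(THE \<mu>. is_effective_mass a q n e \<mu>) = m"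
proof (rule the_equality)
  show "is_effective_mass a q n e m" using branch_exists branch_effective_mass by blast
qed (rule effective_mass_unique)

end

theorem effective_mass_deriv:
  assumes hol: "xi a q holomorphic_on UNIV" and cnj: "\<And>z. xi a q (cnj z) = cnj (xi a q z)"
    and lab: "labelling (xi a q) L" and e: "(n, \<nu>) \<in> edge_index"
  shows "effective_mass a q L n \<nu> = Re ((-1) ^ (n + 1) * deriv (xi a q) (of_real (L n \<nu>)))"
proof (cases "n \<ge> 1 \<and> L n Minus = L n Plus")
  case True
  then have "deriv (xi a q) (of_real (L n \<nu>)) = 0" using edge_simple_iff[OF hol lab e] by simp
  then show ?thesis using True by (simp add: effective_mass_def)
next
  case False
  define D where "D = Re (deriv (xi a q) (of_real (L n \<nu>)))"
  have D: "deriv (xi a q) (of_real (L n \<nu>)) = of_real D"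
    unfolding D_def by (rule deriv_of_real[OF hol cnj])
  have nz: "D \<noteq> 0" using edge_simple_iff[OF hol lab e] False D by auto
  interpret simple_edge a q n "L n \<nu>" D
  proof
    show "Im z = 0" if "(xi a q z)\<^sup>2 = 1" for z using labelling_zero[OF lab that] by auto
  qed (use hol labelling_val[OF lab e] D nz in auto)
  have "effective_mass a q L n \<nu> = m" using False effective_mass_eq by (auto simp: effective_mass_def)
  also have "m = Re ((-1) ^ (n + 1) * deriv (xi a q) (of_real (L n \<nu>)))"
    unfolding m_def D by (simp flip: of_real_power)
  finally show ?thesis .
qed

corollary of_real_effective_mass:
  assumes hol: "xi a q holomorphic_on UNIV" and cnj: "\<And>z. xi a q (cnj z) = cnj (xi a q z)"
    and lab: "labelling (xi a q) L" and e: "(n, \<nu>) \<in> edge_index"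
  shows "of_real (effective_mass a q L n \<nu>) = (-1) ^ (n + 1) * deriv (xi a q) (of_real (L n \<nu>))"
proof -
  obtain r where r: "deriv (xi a q) (of_real (L n \<nu>)) = of_real r" using deriv_of_real[OF hol cnj] ..
  show ?thesis unfolding effective_mass_deriv[OF assms] r by (cases "even n") auto
qed

section \<open>The modified Lyapunov function\<close>

lemma L2_unit_zero: "L2_unit (\<lambda>_. 0)" by (simp add: L2_unit_def)

lemma xi_holomorphic:
  assumes "L2_unit q" "cos a > 0"
  shows "xi a q holomorphic_on UNIV"
proof -
  have "(\<lambda>z. (F q z + of_real ((sin a)\<^sup>2)) / of_real (cos a)) holomorphic_on UNIV"
    using assms(2) by (intro holomorphic_intros F_properties(1)[OF assms(1)]) simp
  then show ?thesis unfolding xi_def[abs_def] .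
qed

lemma xi_cnj:
  assumes "L2_unit q"
  shows "xi a q (cnj z) = cnj (xi a q z)"
  unfolding xi_def F_properties(2)[OF assms] by simp

lemma xi_zero_potential:
  assumes "cos a > 0"
  shows "xi a (\<lambda>_. 0) z = of_real (9 / (8 * cos a)) * cos (2 * csqrt z) + of_real ((8 * (sin a)\<^sup>2
    - 1) / (8 * cos a))"
proof -
  have "complex_of_real (cos a) \<noteq> 0" using assms by simp
  then show ?thesis unfolding xi_def F0_eq by (simp add: field_simps)
qed

text \<open>The two signs of the absolute value amount to (2 cos a - 1)^2 \<ge> 0 and to cos a \<le>
  1. Equality occurs for cos a = 1/2 and for cos a = 1, where the model gaps of one parity are
  closed.\<close>

lemma xi_model: "cos a > 0 \<Longrightarrow> cosine_model (9 / (8 * cos a)) ((8 * (sin a)\<^sup>2 - 1) / (8 * cos a))"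
proof
  assume c: "cos a > 0"
  define x where "x = (cos a)\<^sup>2"
  have "4 * x - 4 * cos a + 1 \<ge> 0"
    using zero_le_power2[of "2 * cos a - 1"] by (simp add: x_def power2_eq_square algebra_simps)
  moreover have "x \<le> 1" using abs_square_le_1[of "cos a"] by (simp add: x_def)
  moreover have "(sin a)\<^sup>2 = 1 - x" unfolding x_def by (rule sin_squared_eq)
  ultimately have "\<bar>8 * (sin a)\<^sup>2 - 1\<bar> \<le> 9 - 8 * cos a" using cos_le_one[of a] by argo
  then have "\<bar>8 * (sin a)\<^sup>2 - 1\<bar> / (8 * cos a) \<le> (9 - 8 * cos a) / (8 * cos a)"
    using c by (intro divide_right_mono) auto
  moreover have "\<bar>(8 * (sin a)\<^sup>2 - 1) / (8 * cos a)\<bar> = \<bar>8 * (sin a)\<^sup>2 - 1\<bar> / (8 * cos a)" using c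
    by (simp add: abs_divide abs_mult)
  moreover have "(9 - 8 * cos a) / (8 * cos a) = 9 / (8 * cos a) - 1" using c
    by (simp add: diff_divide_distrib)
  ultimately show "1 + \<bar>(8 * (sin a)\<^sup>2 - 1) / (8 * cos a)\<bar> \<le> 9 / (8 * cos a)" by linarith
qed

lemma deriv_shift: "f holomorphic_on UNIV \<Longrightarrow> deriv (\<lambda>z. f (z + c)) z = deriv f (z + (c :: complex))"
  by (rule DERIV_imp_deriv) (auto simp: DERIV_shift[symmetric] intro: holomorphic_derivI)

lemma labelling_shift:
  assumes "labelling f L"
  shows "labelling (\<lambda>z. f (z + of_real b)) (\<lambda>n \<nu>. L n \<nu> - b)"
proof -
  have z: "zorder (\<lambda>w. (f (w + of_real b))\<^sup>2 - 1) z = zorder (\<lambda>w. (f w)\<^sup>2 - 1) (z + of_real b)" for z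
    by (subst (1 2) zorder_shift) (simp only: add.assoc)
  have e: "complex_of_real (l - b) = z \<longleftrightarrow> of_real l = z + of_real b" for l z by (auto simp: diff_eq_eq)
  have e': "z = complex_of_real (l - b) \<longleftrightarrow> z + of_real b = of_real l" for l z by (auto simp: eq_diff_eq)
  have v: "complex_of_real (l - b) + of_real b = of_real l" for l by simp
  show ?thesis using assms unfolding labelling_def z e e' v by simp
qed

lemma xi_close:
  assumes "L2_unit q" "cos a > 0"
  shows "growth 2 (\<lambda>z. xi a q (z + of_real (mean q)) - xi a (\<lambda>_. 0) z)"
proof -
  obtain C r where C: "C \<ge> 0" "r > 0" "\<forall>z. norm z \<ge> r \<longrightarrow>
      norm (F q (z + of_real (mean q)) - F0 z) \<le> C * exp (2 * \<bar>Im (csqrt z)\<bar>) / norm z"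
    using F_properties(3)[OF assms(1)] by (elim exE conjE) (rule that)
  show ?thesis
  proof (rule growthI)
    fix z :: complex assume "r \<le> norm z"
    then have "norm (F q (z + of_real (mean q)) - F0 z) \<le> C * env z / norm z" using C(3)
      unfolding env_def by blast
    then have "norm (F q (z + of_real (mean q)) - F0 z) / cos a \<le> (C * env z / norm z) / cos a"
      using assms(2) by (intro divide_right_mono) auto
    also have "\<dots> = (C / cos a) * env z / sqrt (norm z) ^ 2" by simp
    also have "norm (F q (z + of_real (mean q)) - F0 z) / cos a = norm (xi a q (z + of_real (mean q))
      - xi a (\<lambda>_. 0) z)"
    proof -
      have "xi a q (z + of_real (mean q)) - xi a (\<lambda>_. 0) z = (F q (z + of_real (mean q))
        - F0 z) / of_real (cos a)"
        by (simp add: xi_def flip: diff_divide_distrib)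
      then show ?thesis using assms(2) by (simp add: norm_divide)
    qed
    finally show "norm (xi a q (z + of_real (mean q)) - xi a (\<lambda>_. 0) z) \<le> (C / cos a)
      * env z / sqrt (norm z) ^ 2" .
  qed
qed

theorem theorem1p1:
  fixes a :: real and q :: "real \<Rightarrow> real"
    and lam lam0 \<mu> \<mu>0 \<epsilon> :: "nat \<Rightarrow> edge_sign \<Rightarrow> real"
  assumes c_pos: "cos a > 0"
    and q: "L2_unit q"
    and lam: "edge_labelling a q lam"
    and lam0: "edge_labelling a (\<lambda>_. 0) lam0"
    and \<mu>: "\<mu> = effective_mass a q lam"
    and \<mu>0: "\<mu>0 = effective_mass a (\<lambda>_. 0) lam0"
    and \<epsilon>: "\<And>n \<nu>. lam n \<nu> = lam0 n \<nu> + mean q + \<epsilon> n \<nu>"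
  shows
    "(\<forall>\<nu>. (\<lambda>n. of_real (\<mu> n \<nu>) - of_real (\<mu>0 n \<nu>)
             - (-1) ^ (n + 1) * deriv (deriv F0) (of_real (lam0 n \<nu>)) * of_real (\<epsilon> n \<nu>)
                 / of_real (cos a))
          \<in> O(\<lambda>n. 1 / of_nat n ^ 3 :: complex)) \<and>
     ((\<forall>z. z \<notin> edge_set lam \<longrightarrow>
            (\<lambda>(n, \<nu>). norm (of_real (\<mu> n \<nu>) / (z - of_real (lam n \<nu>)))) summable_on edge_index \<and>
            quasimomentum_deriv_sq a q z =
              1 / 2 * (\<Sum>\<^sub>\<infinity>(n, \<nu>)\<in>edge_index. of_real (\<mu> n \<nu>) / (z - of_real (lam n \<nu>)))) \<and>
         (\<forall>K. compact K \<longrightarrow> K \<inter> edge_set lam = {} \<longrightarrow>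
            uniform_limit K
              (\<lambda>I z. 1 / 2 * (\<Sum>(n, \<nu>)\<in>I. of_real (\<mu> n \<nu>) / (z - of_real (lam n \<nu>))))
              (quasimomentum_deriv_sq a q) (finite_subsets_at_top edge_index))) \<and>
     (summable (\<lambda>n. \<mu> (Suc n) Plus + \<mu> (Suc n) Minus) \<and>
         \<mu> 0 Plus + (\<Sum>n. \<mu> (Suc n) Plus + \<mu> (Suc n) Minus) = 2) \<and>
     ((\<forall>n \<nu>. (2 * n, \<nu>) \<in> edge_index \<longrightarrow>
            (\<lambda>(m, s). 1 / (lam (2 * m - 1) s - lam (2 * n) \<nu>)) summable_on {(m, s). m \<ge> 1} \<and>
            \<mu> (2 * n) \<nu> =
              2 * (\<Sum>\<^sub>\<infinity>(m, s)\<in>{(m, s). m \<ge> 1}. 1 / (lam (2 * m - 1) s - lam (2 * n) \<nu>))) \<and>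
         (\<forall>n \<nu>.
            (\<lambda>(m, s). 1 / (lam (2 * m) s - lam (2 * n + 1) \<nu>))
              summable_on {(m, s). (2 * m, s) \<in> edge_index} \<and>
            \<mu> (2 * n + 1) \<nu> =
              2 * (\<Sum>\<^sub>\<infinity>(m, s)\<in>{(m, s). (2 * m, s) \<in> edge_index}.
                     1 / (lam (2 * m) s - lam (2 * n + 1) \<nu>))))"
proof -
  define b where "b = mean q"
  define X where "X = (\<lambda>z. xi a q (z + of_real b))"
  \<comment> \<open>With this normalisation \<open>\<epsilon> n \<nu>\<close> is exactly
    \<open>L n \<nu> - lam0 n \<nu>\<close>, the shift estimated for the perturbed model.\<close>
  define L where "L = (\<lambda>n \<nu>. lam n \<nu> - b)"
  note h = xi_holomorphic[OF q c_pos] and h0 = xi_holomorphic[OF L2_unit_zero c_pos]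
  note lb = lam[unfolded edge_labelling_iff] and lb0 = lam0[unfolded edge_labelling_iff]
  interpret cosine_model "9 / (8 * cos a)" "(8 * (sin a)\<^sup>2 - 1) / (8 * cos a)" by (rule xi_model[OF c_pos])
  have X0: "X0 = xi a (\<lambda>_. 0)" unfolding X0_def[abs_def] xi_zero_potential[OF c_pos, abs_def] ..
  interpret perturbation "9 / (8 * cos a)" "(8 * (sin a)\<^sup>2 - 1) / (8 * cos a)" X L lam0
  proof
    have "(\<lambda>z. z + complex_of_real b) holomorphic_on UNIV" by (intro holomorphic_intros)
    from holomorphic_on_compose[OF this holomorphic_on_subset[OF h subset_UNIV]]
    show "X holomorphic_on UNIV" unfolding X_def o_def .
    show "X0 holomorphic_on UNIV" unfolding X0 by (rule h0)
    show "X (cnj z) = cnj (X z)" for z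
      using xi_cnj[OF q, of a "z + of_real b"] by (simp add: X_def)
    show "growth 2 (\<lambda>z. X z - X0 z)" unfolding X_def X0 b_def by (rule xi_close[OF q c_pos])
    show "labelling X L" unfolding X_def L_def by (rule labelling_shift[OF lb])
    show "labelling X0 lam0" unfolding X0 by (rule lb0)
  qed
  have dX: "deriv X z = deriv (xi a q) (z + of_real b)" for z unfolding X_def by (rule deriv_shift[OF h])
  have L_back: "complex_of_real (L n \<nu>) + of_real b = of_real (lam n \<nu>)" for n \<nu> by (simp add: L_def)
  \<comment> \<open>The identity is available only for genuine edges; below, sums are therefore
    rewritten by congruence over \<open>edge_index\<close>.\<close>
  have mass: "mass n \<nu> = \<mu> n \<nu>" if "(n, \<nu>) \<in> edge_index" for n \<nu>
  proof -
    have "complex_of_real (mass n \<nu>) = of_real (\<mu> n \<nu>)"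
      unfolding of_real_mass dX L_back \<mu> of_real_effective_mass[OF h xi_cnj[OF q] lb that] ..
    then show ?thesis by simp
  qed
  have dX0: "deriv X0 = (\<lambda>z. deriv F0 z / of_real (cos a))"
  proof
    fix z
    have "(F0 has_field_derivative deriv F0 z) (at z)"
      by (rule holomorphic_derivI[OF F_properties(1)[OF L2_unit_zero]]) auto
    then have "((\<lambda>z. (F0 z + of_real ((sin a)\<^sup>2)) / of_real (cos a)) has_field_derivative (deriv F0 z
      + 0) / of_real (cos a)) (at z)"
      by (intro DERIV_cdivide DERIV_add DERIV_const)
    then show "deriv X0 z = deriv F0 z / of_real (cos a)" unfolding X0 xi_def[abs_def]
      by (simp add: DERIV_imp_deriv)
  qed
  have ddX0: "deriv (deriv X0) z = deriv (deriv F0) z / of_real (cos a)" for z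
  proof -
    have "deriv F0 holomorphic_on UNIV" by (rule holomorphic_deriv[OF F_properties(1)[OF L2_unit_zero]]) auto
    then have "(deriv F0 has_field_derivative deriv (deriv F0) z) (at z)" by (rule holomorphic_derivI) auto
    then have "((\<lambda>z. deriv F0 z / of_real (cos a)) has_field_derivative deriv (deriv F0) z / of_real (cos
      a)) (at z)"
      by (rule DERIV_cdivide)
    then show ?thesis unfolding dX0 by (rule DERIV_imp_deriv)
  qed
  have part1: "(\<lambda>n. of_real (\<mu> n \<nu>) - of_real (\<mu>0 n \<nu>)
             - (-1) ^ (n + 1) * deriv (deriv F0) (of_real (lam0 n \<nu>)) * of_real (\<epsilon> n \<nu>) / of_real (cos a))
          \<in> O(\<lambda>n. 1 / of_nat n ^ 3 :: complex)" (is "?f \<in> _") for \<nu>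
  proof -
    obtain K N0 where K: "\<And>n \<nu>. n \<ge> N0 \<Longrightarrow> norm (deriv X (of_real (L n \<nu>)) - deriv X0 (of_real (lam0 n \<nu>))
        - deriv (deriv X0) (of_real (lam0 n \<nu>)) * of_real (L n \<nu> - lam0 n \<nu>))
          \<le> K / real n ^ 3" "K \<ge> 0" "N0 \<ge> 2"
      by (rule deriv_expansion) (rule that)
    have "norm (?f n) \<le> K * norm (1 / of_nat n ^ 3 :: complex)" if n: "n \<ge> N0" for n
    proof -
      have i: "(n, \<nu>) \<in> edge_index" using n K(3) by (simp add: edge_index_iff)
      have eps: "\<epsilon> n \<nu> = L n \<nu> - lam0 n \<nu>" using \<epsilon>[of n \<nu>] by (simp add: L_def b_def)
      have m: "complex_of_real (\<mu> n \<nu>) = (-1) ^ (n + 1) * deriv X (of_real (L n \<nu>))"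
        unfolding mass[OF i, symmetric] by (rule of_real_mass)
      have m0: "complex_of_real (\<mu>0 n \<nu>) = (-1) ^ (n + 1) * deriv X0 (of_real (lam0 n \<nu>))"
        unfolding \<mu>0 X0 by (rule of_real_effective_mass[OF h0 xi_cnj[OF L2_unit_zero] lb0 i])
      have "?f n = (-1) ^ (n + 1) * (deriv X (of_real (L n \<nu>)) - deriv X0 (of_real (lam0 n \<nu>))
        - deriv (deriv X0) (of_real (lam0 n \<nu>)) * of_real (L n \<nu> - lam0 n \<nu>))"
        unfolding m m0 eps ddX0 by (simp only: right_diff_distrib times_divide_eq_left
          times_divide_eq_right mult.assoc)
      then have "norm (?f n) = norm (deriv X (of_real (L n \<nu>)) - deriv X0 (of_real (lam0 n \<nu>))
        - deriv (deriv X0) (of_real (lam0 n \<nu>)) * of_real (L n \<nu> - lam0 n \<nu>))"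
        by (simp only: norm_mult norm_power norm_minus_cancel norm_one power_one mult_1_left)
      also have "\<dots> \<le> K / real n ^ 3" by (rule K(1)[OF n])
      finally show ?thesis by (simp add: norm_divide norm_power)
    qed
    then show ?thesis by (intro bigoI[where c = K]) (rule eventually_sequentiallyI)
  qed
  have shift: "(z - of_real b) - of_real (L n \<nu>) = z - complex_of_real (lam n \<nu>)" for z n \<nu>
    by (simp add: L_def)
  have off: "z - of_real b \<in> edge_set L \<longleftrightarrow> z \<in> edge_set lam" for z
    unfolding edge_set_def L_def by (auto simp: diff_eq_eq)
  have qm: "(deriv X (z - of_real b))\<^sup>2 / (1 - (X (z - of_real b))\<^sup>2) = quasimomentum_deriv_sq a q z" for z
    unfolding quasimomentum_deriv_sq_def dX by (simp add: X_def)
  have part2a: "(\<lambda>(n, \<nu>). norm (of_real (\<mu> n \<nu>) / (z - of_real (lam n \<nu>)))) summable_on edge_index"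
    "quasimomentum_deriv_sq a q z = 1 / 2 * (\<Sum>\<^sub>\<infinity>(n, \<nu>)\<in>edge_index. of_real (\<mu> n \<nu>) / (z - of_real (lam n \<nu>)))"
    if "z \<notin> edge_set lam" for z
  proof -
    have z: "z - of_real b \<notin> edge_set L" using that off by simp
    have "(\<lambda>(n, \<nu>). norm (of_real (mass n \<nu>) / (z - of_real (lam n \<nu>)))) summable_on edge_index"
      using partial_fractions(1)[OF z] unfolding shift .
    moreover have "(\<lambda>(n, \<nu>). norm (of_real (mass n \<nu>) / (z - of_real (lam n \<nu>)))) summable_on edge_index
       \<longleftrightarrow> (\<lambda>(n, \<nu>). norm (of_real (\<mu> n \<nu>) / (z - of_real (lam n \<nu>)))) summable_on edge_index"
      by (rule summable_on_cong) (auto simp: mass)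
    ultimately show "(\<lambda>(n, \<nu>). norm (of_real (\<mu> n \<nu>) / (z - of_real (lam n \<nu>)))) summable_on edge_index"
      by simp
    have "(\<Sum>\<^sub>\<infinity>(n, \<nu>)\<in>edge_index. of_real (mass n \<nu>) / (z - of_real (lam n \<nu>)))
      = (\<Sum>\<^sub>\<infinity>(n, \<nu>)\<in>edge_index. of_real (\<mu> n \<nu>) / (z - of_real (lam n \<nu>)))"
      by (rule infsum_cong) (auto simp: mass)
    then show "quasimomentum_deriv_sq a q z = 1 / 2 * (\<Sum>\<^sub>\<infinity>(n, \<nu>)\<in>edge_index. of_real (\<mu> n \<nu>) / (z
      - of_real (lam n \<nu>)))"
      using partial_fractions(2)[OF z] unfolding shift qm by (simp only:)
  qed
  have part2b: "uniform_limit K (\<lambda>I z. 1 / 2 * (\<Sum>(n, \<nu>)\<in>I. of_real (\<mu> n \<nu>) / (z - of_real (lam n \<nu>))))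
              (quasimomentum_deriv_sq a q) (finite_subsets_at_top edge_index)"
    if K: "compact K" "K \<inter> edge_set lam = {}" for K
  proof -
    define K' where "K' = (\<lambda>z. z - of_real b) ` K"
    have "compact K'" unfolding K'_def by (intro compact_continuous_image K(1) continuous_intros)
    moreover have "K' \<inter> edge_set L = {}" unfolding K'_def using K(2) off by auto
    ultimately have "uniform_limit K (\<lambda>I z. 1 / 2 * (\<Sum>(n, \<nu>)\<in>I. of_real (mass n \<nu>) / ((z - of_real b)
      - of_real (L n \<nu>))))
        (\<lambda>z. (deriv X (z - of_real b))\<^sup>2 / (1 - (X (z - of_real b))\<^sup>2)) (finite_subsets_at_top edge_index)"
      by (rule uniform_limit_compose'[OF partial_fractions_uniform]) (auto simp: K'_def)
    then have u: "uniform_limit K (\<lambda>I z. 1 / 2 * (\<Sum>(n, \<nu>)\<in>I. of_real (mass n \<nu>) / (z - of_real (lam n \<nu>))))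
        (quasimomentum_deriv_sq a q) (finite_subsets_at_top edge_index)"
      unfolding shift qm .
    have "\<forall>\<^sub>F I in finite_subsets_at_top edge_index. \<forall>z\<in>K. 1 / 2 * (\<Sum>(n, \<nu>)\<in>I. of_real (mass n \<nu>) / (z
      - of_real (lam n \<nu>)))
        = 1 / 2 * (\<Sum>(n, \<nu>)\<in>I. of_real (\<mu> n \<nu>) / (z - of_real (lam n \<nu>)))"
    proof (rule eventually_finite_subsets_at_top_weakI, intro ballI arg_cong[where f = "\<lambda>u. 1 / 2
      * u"] sum.cong refl)
      fix I e and z :: complex assume "I \<subseteq> edge_index" "e \<in> I"
      then show "(case e of (n, \<nu>) \<Rightarrow> of_real (mass n \<nu>) / (z - of_real (lam n \<nu>)))
        = (case e of (n, \<nu>) \<Rightarrow> of_real (\<mu> n \<nu>) / (z - of_real (lam n \<nu>)))"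
        using mass by (cases e) auto
    qed
    from uniform_limit_cong[OF this refl] u show ?thesis by simp
  qed
  have part3: "(\<lambda>n. \<mu> (Suc n) Plus + \<mu> (Suc n) Minus) sums (2 - \<mu> 0 Plus)"
  proof -
    have "mass (Suc n) \<nu> = \<mu> (Suc n) \<nu>" and "mass 0 Plus = \<mu> 0 Plus" for n \<nu>
      by (auto intro!: mass simp: edge_index_iff)
    then show ?thesis using mass_total by simp
  qed
  have diff: "L n \<nu> - L n' \<nu>' = lam n \<nu> - lam n' \<nu>'" for n n' \<nu> \<nu>' by (simp add: L_def)
  show ?thesis
  proof (intro conjI allI impI)
    show "summable (\<lambda>n. \<mu> (Suc n) Plus + \<mu> (Suc n) Minus)" using part3 by (rule sums_summable)
    show "\<mu> 0 Plus + (\<Sum>n. \<mu> (Suc n) Plus + \<mu> (Suc n) Minus) = 2" using sums_unique[OF part3] by simp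
    fix n \<nu>
    show "(\<lambda>(m, s). 1 / (lam (2 * m - 1) s - lam (2 * n) \<nu>)) summable_on {(m, s). m \<ge> 1}"
      "\<mu> (2 * n) \<nu> = 2 * (\<Sum>\<^sub>\<infinity>(m, s)\<in>{(m, s). m \<ge> 1}. 1 / (lam (2 * m - 1) s - lam (2 * n) \<nu>))"
      if i: "(2 * n, \<nu>) \<in> edge_index"
      using mass_even[OF i] unfolding diff mass[OF i] .
    have i: "(2 * n + 1, \<nu>) \<in> edge_index" by (simp add: edge_index_iff)
    show "(\<lambda>(m, s). 1 / (lam (2 * m) s - lam (2 * n + 1) \<nu>)) summable_on {(m, s). (2 * m, s) \<in> edge_index}"
      "\<mu> (2 * n + 1) \<nu> = 2 * (\<Sum>\<^sub>\<infinity>(m, s)\<in>{(m, s). (2 * m, s) \<in> edge_index}. 1 / (lam (2 * m) s - lam (2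
        * n + 1) \<nu>))"
      using mass_odd[of n \<nu>] unfolding diff mass[OF i] .
  qed (fact part1 part2a part2b)+
qed

end
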